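(* Let $A$ be an Artin algebra and let $I$, $J$, $K$ be three ideals of $A$ such that $IJK=0$ and $K\supseteq \mathrm{rad}(A)$. If both $A/I$ and $A/J$ are $A$-syzygy-finite, then the finitistic dimension of $A$ is finite.
   Context: All algebras are Artin $R$-algebras over a commutative Artin ring $R$; all modules are finitely generated left modules; ideals are two-sided; $\mathrm{rad}(A)$ is the Jacobson radical. The finitistic dimension of $A$ is the supremum of the projective dimensions of those $A$-modules that have finite projective dimension. $\Omega_A^i(M)$ is the $i$-th syzygy of $M$ (via projective covers), with $\Omega_A^0(M)=M$, and $\mathrm{add}({}_AN)$ is the class of direct summands of finite direct sums of copies of $N$. For an Artin algebra $C$ and a homomorphism of algebras $A\to C$ preserving identities, every $C$-module is regarded as an $A$-module via this homomorphism. $C$ is called $A$-syzygy-finite if there are an integer $n\ge 0$ and an $A$-module $N$ such that $\Omega_A^n(X)\in\mathrm{add}({}_AN)$ for every $C$-module $X$. For $C=A/I$ or $A/J$ the homomorphism is the canonical projection. *)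

theory Defs
  imports "HOL-Library.Extended_Nat" "HOL-Algebra.Module" "HOL-Algebra.Ideal_Product" "HOL-Algebra.QuotRing"
begin

section \<open>Left modules over a not necessarily commutative ring\<close>

text \<open>
  The locale \<open>module\<close> of HOL-Algebra requires a commutative ring of scalars, so left modules
  over an arbitrary ring are introduced here.  They use the record type and the predicate
  \<open>submodule\<close> of HOL-Algebra; the fields \<open>mult\<close> and \<open>one\<close> of the module record are
  never inspected.
\<close>

locale left_module = A?: ring A + M?: abelian_group M
  for A :: "('a, 'k) ring_scheme" (structure) and M :: "('a, 'x, 'l) module_scheme" (structure) +
  assumes smult_closed [simp, intro]:
      "\<lbrakk>a \<in> carrier A; x \<in> carrier M\<rbrakk> \<Longrightarrow> a \<odot>\<^bsub>M\<^esub> x \<in> carrier M"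
    and smult_l_distr:
      "\<lbrakk>a \<in> carrier A; b \<in> carrier A; x \<in> carrier M\<rbrakk> \<Longrightarrow>
       (a \<oplus>\<^bsub>A\<^esub> b) \<odot>\<^bsub>M\<^esub> x = a \<odot>\<^bsub>M\<^esub> x \<oplus>\<^bsub>M\<^esub> b \<odot>\<^bsub>M\<^esub> x"
    and smult_r_distr:
      "\<lbrakk>a \<in> carrier A; x \<in> carrier M; y \<in> carrier M\<rbrakk> \<Longrightarrow>
       a \<odot>\<^bsub>M\<^esub> (x \<oplus>\<^bsub>M\<^esub> y) = a \<odot>\<^bsub>M\<^esub> x \<oplus>\<^bsub>M\<^esub> a \<odot>\<^bsub>M\<^esub> y"
    and smult_assoc1:
      "\<lbrakk>a \<in> carrier A; b \<in> carrier A; x \<in> carrier M\<rbrakk> \<Longrightarrow>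
       (a \<otimes>\<^bsub>A\<^esub> b) \<odot>\<^bsub>M\<^esub> x = a \<odot>\<^bsub>M\<^esub> (b \<odot>\<^bsub>M\<^esub> x)"
    and smult_one [simp]:
      "x \<in> carrier M \<Longrightarrow> \<one>\<^bsub>A\<^esub> \<odot>\<^bsub>M\<^esub> x = x"

definition finitely_generated :: "('a, 'k) ring_scheme \<Rightarrow> ('a, 'x, 'l) module_scheme \<Rightarrow> bool" where
  "finitely_generated A M \<longleftrightarrow>
     (\<exists>S. finite S \<and> S \<subseteq> carrier M \<and> (\<forall>H. submodule H A M \<and> S \<subseteq> H \<longrightarrow> H = carrier M))"

definition fg_module :: "('a, 'k) ring_scheme \<Rightarrow> ('a, 'x, 'l) module_scheme \<Rightarrow> bool" where
  "fg_module A M \<longleftrightarrow> left_module A M \<and> finitely_generated A M"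

definition mod_hom ::
    "('a, 'k) ring_scheme \<Rightarrow> ('a, 'x, 'l) module_scheme \<Rightarrow> ('a, 'y, 'm) module_scheme \<Rightarrow> ('x \<Rightarrow> 'y) set" where
  "mod_hom A M N = {f \<in> carrier M \<rightarrow> carrier N.
     (\<forall>x\<in>carrier M. \<forall>y\<in>carrier M. f (x \<oplus>\<^bsub>M\<^esub> y) = f x \<oplus>\<^bsub>N\<^esub> f y) \<and>
     (\<forall>a\<in>carrier A. \<forall>x\<in>carrier M. f (a \<odot>\<^bsub>M\<^esub> x) = a \<odot>\<^bsub>N\<^esub> f x)}"

definition mod_epi ::
    "('a, 'k) ring_scheme \<Rightarrow> ('a, 'x, 'l) module_scheme \<Rightarrow> ('a, 'y, 'm) module_scheme \<Rightarrow> ('x \<Rightarrow> 'y) set" where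
  "mod_epi A M N = {f \<in> mod_hom A M N. f ` carrier M = carrier N}"

definition mod_iso ::
    "('a, 'k) ring_scheme \<Rightarrow> ('a, 'x, 'l) module_scheme \<Rightarrow> ('a, 'y, 'm) module_scheme \<Rightarrow> ('x \<Rightarrow> 'y) set" where
  "mod_iso A M N = {f \<in> mod_hom A M N. bij_betw f (carrier M) (carrier N)}"

definition restrict_scalars ::
    "('a \<Rightarrow> 'c) \<Rightarrow> ('c, 'x, 'l) module_scheme \<Rightarrow> ('a, 'x) module" where
  "restrict_scalars f X =
     \<lparr>carrier = carrier X, mult = mult X, one = one X, zero = zero X, add = add X,
      smult = (\<lambda>a x. f a \<odot>\<^bsub>X\<^esub> x)\<rparr>"

text \<open>
  HOL cannot quantify over carrier types inside a formula.  All quantification over finitely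
  generated \<open>A\<close>-modules therefore ranges over modules whose carrier lies in the following
  type.  It is large enough for a copy of every quotient of every \<open>A\<^sup>n\<close>, hence of every
  finitely generated module; see \<open>fg_module_representable\<close> below, and
  \<open>fg_module_representable_surj\<close> for modules over quotient rings of \<open>A\<close>.
\<close>

type_synonym 'a fgcar = "(nat \<Rightarrow> 'a) set"


section \<open>Artin algebras and the Jacobson radical\<close>

definition artinian_cring :: "('r, 'k) ring_scheme \<Rightarrow> bool" where
  "artinian_cring R \<longleftrightarrow> cring R \<and>
     (\<forall>F :: nat \<Rightarrow> 'r set. (\<forall>n. ideal (F n) R \<and> F (Suc n) \<subseteq> F n) \<longrightarrow> (\<exists>n. \<forall>m\<ge>n. F m = F n))"

text \<open>
  The record of an \<open>R\<close>-algebra carries both the ring structure and the \<open>R\<close>-module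
  structure, as in the (commutative) locale \<open>algebra\<close> of HOL-Algebra.
\<close>

locale artin_algebra = Module.module R A + ring A
  for R :: "('r, 'k) ring_scheme" (structure) and A :: "('r, 'a, 'l) module_scheme" (structure) +
  assumes artinian: "artinian_cring R"
    and smult_mult_left:
      "\<lbrakk>r \<in> carrier R; x \<in> carrier A; y \<in> carrier A\<rbrakk> \<Longrightarrow>
       (r \<odot>\<^bsub>A\<^esub> x) \<otimes>\<^bsub>A\<^esub> y = r \<odot>\<^bsub>A\<^esub> (x \<otimes>\<^bsub>A\<^esub> y)"
    and smult_mult_right:
      "\<lbrakk>r \<in> carrier R; x \<in> carrier A; y \<in> carrier A\<rbrakk> \<Longrightarrow>
       x \<otimes>\<^bsub>A\<^esub> (r \<odot>\<^bsub>A\<^esub> y) = r \<odot>\<^bsub>A\<^esub> (x \<otimes>\<^bsub>A\<^esub> y)"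
    and fin_gen: "finitely_generated R A"

definition regular_module :: "('a, 'k) ring_scheme \<Rightarrow> ('a, 'a) module" where
  "regular_module A =
     \<lparr>carrier = carrier A, mult = mult A, one = one A, zero = zero A, add = add A, smult = mult A\<rparr>"

definition left_ideal :: "'a set \<Rightarrow> ('a, 'k) ring_scheme \<Rightarrow> bool" where
  "left_ideal L A \<longleftrightarrow> submodule L A (regular_module A)"

definition maximal_left_ideal :: "'a set \<Rightarrow> ('a, 'k) ring_scheme \<Rightarrow> bool" where
  "maximal_left_ideal L A \<longleftrightarrow> left_ideal L A \<and> L \<noteq> carrier A \<and>
     (\<forall>L'. left_ideal L' A \<and> L \<subseteq> L' \<longrightarrow> L' = L \<or> L' = carrier A)"

definition jacobson_radical :: "('a, 'k) ring_scheme \<Rightarrow> 'a set" where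
  "jacobson_radical A = carrier A \<inter> \<Inter> {L. maximal_left_ideal L A}"


section \<open>Projective modules, resolutions and dimensions\<close>

text \<open>Projectivity in the category of finitely generated left modules.\<close>

definition projective_module :: "('a, 'k) ring_scheme \<Rightarrow> ('a, 'x, 'l) module_scheme \<Rightarrow> bool" where
  "projective_module A P \<longleftrightarrow> fg_module A P \<and>
     (\<forall>(M :: ('a, 'a fgcar) module) (N :: ('a, 'a fgcar) module).
        fg_module A M \<and> fg_module A N \<longrightarrow>
        (\<forall>g \<in> mod_epi A M N. \<forall>h \<in> mod_hom A P N.
           \<exists>k \<in> mod_hom A P M. \<forall>x\<in>carrier P. g (k x) = h x))"

text \<open>
  A resolution \<open>\<dots> \<rightarrow> P 1 \<rightarrow> P 0 \<rightarrow> M \<rightarrow> 0\<close> with differentials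
  \<open>d i : P (i + 1) \<rightarrow> P i\<close> and augmentation \<open>e : P 0 \<rightarrow> M\<close>.
\<close>

definition projective_resolution ::
    "('a, 'k) ring_scheme \<Rightarrow> ('a, 'x, 'l) module_scheme \<Rightarrow> (nat \<Rightarrow> ('a, 'a fgcar) module) \<Rightarrow>
     (nat \<Rightarrow> 'a fgcar \<Rightarrow> 'a fgcar) \<Rightarrow> ('a fgcar \<Rightarrow> 'x) \<Rightarrow> bool" where
  "projective_resolution A M P d e \<longleftrightarrow>
     (\<forall>i. projective_module A (P i)) \<and>
     e \<in> mod_epi A (P 0) M \<and>
     (\<forall>i. d i \<in> mod_hom A (P (Suc i)) (P i)) \<and>
     d 0 ` carrier (P 1) = a_kernel (P 0) M e \<and>
     (\<forall>i. d (Suc i) ` carrier (P (Suc (Suc i))) = a_kernel (P (Suc i)) (P i) (d i))"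

text \<open>The dimension is \<open>\<infinity>\<close> if there is no finite resolution; the zero module gets dimension \<open>0\<close>.\<close>

definition projective_dimension :: "('a, 'k) ring_scheme \<Rightarrow> ('a, 'x, 'l) module_scheme \<Rightarrow> enat" where
  "projective_dimension A M =
     Inf {enat n | n. \<exists>P d e. projective_resolution A M P d e \<and> (\<forall>i>n. carrier (P i) = {\<zero>\<^bsub>P i\<^esub>})}"

definition finitistic_dimension :: "('a, 'k) ring_scheme \<Rightarrow> enat" where
  "finitistic_dimension A =
     Sup {projective_dimension A M | M :: ('a, 'a fgcar) module.
            fg_module A M \<and> projective_dimension A M < \<infinity>}"


section \<open>Syzygies and syzygy-finiteness\<close>

definition projective_cover ::
    "('a, 'k) ring_scheme \<Rightarrow> ('a, 'x, 'l) module_scheme \<Rightarrow> ('a, 'y, 'm) module_scheme \<Rightarrow> ('y \<Rightarrow> 'x) \<Rightarrow> bool" where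
  "projective_cover A M P p \<longleftrightarrow> projective_module A P \<and> p \<in> mod_epi A P M \<and>
     (\<forall>U. submodule U A P \<and> U <+>\<^bsub>P\<^esub> a_kernel P M p = carrier P \<longrightarrow> U = carrier P)"

text \<open>
  Projective covers, hence syzygies, are unique only up to isomorphism; one of them is chosen.
\<close>

definition syzygy :: "('a, 'k) ring_scheme \<Rightarrow> ('a, 'a fgcar) module \<Rightarrow> ('a, 'a fgcar) module" where
  "syzygy A M =
     (let (P, p) = (SOME (P, p). projective_cover A M P p) in P\<lparr>carrier := a_kernel P M p\<rparr>)"

text \<open>The direct sum of \<open>m\<close> copies of \<open>N\<close>.\<close>

definition mod_power :: "('a, 'x, 'l) module_scheme \<Rightarrow> nat \<Rightarrow> ('a, nat \<Rightarrow> 'x) module" where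
  "mod_power N m =
     \<lparr>carrier = (\<Pi>\<^sub>E i\<in>{..<m}. carrier N),
      mult = (\<lambda>f g. \<lambda>i\<in>{..<m}. f i \<otimes>\<^bsub>N\<^esub> g i), one = (\<lambda>i\<in>{..<m}. \<one>\<^bsub>N\<^esub>),
      zero = (\<lambda>i\<in>{..<m}. \<zero>\<^bsub>N\<^esub>), add = (\<lambda>f g. \<lambda>i\<in>{..<m}. f i \<oplus>\<^bsub>N\<^esub> g i),
      smult = (\<lambda>a f. \<lambda>i\<in>{..<m}. a \<odot>\<^bsub>N\<^esub> f i)\<rparr>"

definition direct_summand :: "('a, 'k) ring_scheme \<Rightarrow> 'x set \<Rightarrow> ('a, 'x, 'l) module_scheme \<Rightarrow> bool" where
  "direct_summand A U M \<longleftrightarrow> submodule U A M \<and>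
     (\<exists>V. submodule V A M \<and> U <+>\<^bsub>M\<^esub> V = carrier M \<and> U \<inter> V = {\<zero>\<^bsub>M\<^esub>})"

definition add_closure :: "('a, 'k) ring_scheme \<Rightarrow> ('a, 'y, 'm) module_scheme \<Rightarrow> ('a, 'x) module set" where
  "add_closure A N = {X. fg_module A X \<and>
     (\<exists>m U. direct_summand A U (mod_power N m) \<and> mod_iso A X ((mod_power N m)\<lparr>carrier := U\<rparr>) \<noteq> {})}"

text \<open>
  \<open>C\<close> is \<open>A\<close>-syzygy-finite via the identity-preserving homomorphism \<open>f\<close> from
  \<open>A\<close> to \<open>C\<close>.  Carriers in \<open>'a fgcar\<close> also suffice for the
  \<open>C\<close>-modules because \<open>C\<close> is finitely generated over \<open>A\<close>, both being Artin algebras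
  over the same \<open>R\<close> (and, in particular, for quotients of \<open>A\<close>).
\<close>

definition syzygy_finite ::
    "('a, 'k) ring_scheme \<Rightarrow> ('c, 'l) ring_scheme \<Rightarrow> ('a \<Rightarrow> 'c) \<Rightarrow> bool" where
  "syzygy_finite A C f \<longleftrightarrow>
     (\<exists>(n::nat) (N :: ('a, 'a fgcar) module). fg_module A N \<and>
        (\<forall>X :: ('c, 'a fgcar) module. fg_module C X \<longrightarrow>
           (syzygy A ^^ n) (restrict_scalars f X) \<in> add_closure A N))"


section \<open>Every finitely generated module has a copy with carrier in the chosen type\<close>

definition transport_module :: "('x \<Rightarrow> 'y) \<Rightarrow> ('a, 'x, 'l) module_scheme \<Rightarrow> ('a, 'y) module" where
  "transport_module g M = (let h = inv_into (carrier M) g in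
     \<lparr>carrier = g ` carrier M, mult = (\<lambda>u v. g (h u \<otimes>\<^bsub>M\<^esub> h v)), one = g \<one>\<^bsub>M\<^esub>,
      zero = g \<zero>\<^bsub>M\<^esub>, add = (\<lambda>u v. g (h u \<oplus>\<^bsub>M\<^esub> h v)), smult = (\<lambda>a u. g (a \<odot>\<^bsub>M\<^esub> h u))\<rparr>)"

lemma transport_module_simps:
  assumes "inj_on g (carrier M)"
  shows "carrier (transport_module g M) = g ` carrier M"
    and "zero (transport_module g M) = g \<zero>\<^bsub>M\<^esub>"
    and "\<lbrakk>x \<in> carrier M; y \<in> carrier M\<rbrakk> \<Longrightarrow> g x \<oplus>\<^bsub>transport_module g M\<^esub> g y = g (x \<oplus>\<^bsub>M\<^esub> y)"
    and "x \<in> carrier M \<Longrightarrow> a \<odot>\<^bsub>transport_module g M\<^esub> g x = g (a \<odot>\<^bsub>M\<^esub> x)"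
  using assms by (simp_all add: transport_module_def Let_def)

lemma transport_module_left_module:
  assumes M: "left_module A M" and g: "inj_on g (carrier M)"
  shows "left_module A (transport_module g M)"
proof -
  interpret left_module A M by fact
  note s = transport_module_simps[OF g]
  have "abelian_group (transport_module g M)"
  proof (rule abelian_groupI)
    fix x assume "x \<in> carrier (transport_module g M)"
    then obtain x' where x': "x = g x'" "x' \<in> carrier M" by (auto simp: s)
    then show "\<exists>y\<in>carrier (transport_module g M).
        y \<oplus>\<^bsub>transport_module g M\<^esub> x = \<zero>\<^bsub>transport_module g M\<^esub>"
      by (intro bexI[of _ "g (\<ominus>\<^bsub>M\<^esub> x')"]) (auto simp: s M.l_neg)
  qed (auto simp: s M.a_ac)
  then show ?thesis
    by (intro left_module.intro left_module_axioms.intro)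
      (auto simp: s A.ring_axioms smult_l_distr smult_r_distr smult_assoc1)
qed

lemma transport_module_iso:
  assumes M: "left_module A M" and g: "inj_on g (carrier M)"
  shows "g \<in> mod_iso A M (transport_module g M)"
  using g by (auto simp: mod_iso_def mod_hom_def transport_module_simps bij_betw_def)

lemma finitely_generatedE:
  assumes "finitely_generated A M"
  obtains S where "finite S" "S \<subseteq> carrier M"
    "\<And>H. submodule H A M \<Longrightarrow> S \<subseteq> H \<Longrightarrow> H = carrier M"
  using assms unfolding finitely_generated_def by (elim exE conjE) simp

lemma (in left_module) smult_minus_one:
  assumes x: "x \<in> carrier M"
  shows "(\<ominus>\<^bsub>A\<^esub> \<one>\<^bsub>A\<^esub>) \<odot>\<^bsub>M\<^esub> x = \<ominus>\<^bsub>M\<^esub> x"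
proof -
  have z: "\<zero>\<^bsub>A\<^esub> \<odot>\<^bsub>M\<^esub> x = \<zero>\<^bsub>M\<^esub>"
  proof -
    have "\<zero>\<^bsub>A\<^esub> \<odot>\<^bsub>M\<^esub> x \<oplus>\<^bsub>M\<^esub> \<zero>\<^bsub>A\<^esub> \<odot>\<^bsub>M\<^esub> x = \<zero>\<^bsub>A\<^esub> \<odot>\<^bsub>M\<^esub> x"
      using x smult_l_distr[of "\<zero>\<^bsub>A\<^esub>" "\<zero>\<^bsub>A\<^esub>" x] by simp
    then show ?thesis using x by (metis A.zero_closed M.add.l_cancel_one smult_closed)
  qed
  have "(\<ominus>\<^bsub>A\<^esub> \<one>\<^bsub>A\<^esub>) \<odot>\<^bsub>M\<^esub> x \<oplus>\<^bsub>M\<^esub> x = (\<ominus>\<^bsub>A\<^esub> \<one>\<^bsub>A\<^esub> \<oplus>\<^bsub>A\<^esub> \<one>\<^bsub>A\<^esub>) \<odot>\<^bsub>M\<^esub> x"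
    using x by (subst smult_l_distr) auto
  also have "\<dots> = \<zero>\<^bsub>M\<^esub>" by (simp add: A.l_neg z)
  finally show ?thesis using x by (simp add: M.minus_equality)
qed

lemma (in left_module) left_submoduleI:
  assumes "H \<subseteq> carrier M" "H \<noteq> {}"
    and "\<And>x y. \<lbrakk>x \<in> H; y \<in> H\<rbrakk> \<Longrightarrow> x \<oplus>\<^bsub>M\<^esub> y \<in> H"
    and "\<And>a x. \<lbrakk>a \<in> carrier A; x \<in> H\<rbrakk> \<Longrightarrow> a \<odot>\<^bsub>M\<^esub> x \<in> H"
  shows "submodule H A M"
proof -
  have inv: "\<ominus>\<^bsub>M\<^esub> x \<in> H" if "x \<in> H" for x
    using that assms(1) assms(4)[of "\<ominus>\<^bsub>A\<^esub> \<one>\<^bsub>A\<^esub>" x] smult_minus_one[of x] by auto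
  have "subgroup H (add_monoid M)"
    by (rule M.add.subgroupI) (use assms inv in \<open>auto simp: a_inv_def\<close>)
  then show ?thesis
    by (intro submodule.intro submodule_axioms.intro) (use assms in auto)
qed

lemma (in left_module) finsum_smult:
  assumes "finite I" "a \<in> carrier A" "v \<in> I \<rightarrow> carrier M"
  shows "a \<odot>\<^bsub>M\<^esub> finsum M v I = finsum M (\<lambda>i. a \<odot>\<^bsub>M\<^esub> v i) I"
  using assms
proof (induction I rule: finite_induct)
  case empty
  have "a \<odot>\<^bsub>M\<^esub> \<zero>\<^bsub>M\<^esub> \<oplus>\<^bsub>M\<^esub> a \<odot>\<^bsub>M\<^esub> \<zero>\<^bsub>M\<^esub> = a \<odot>\<^bsub>M\<^esub> \<zero>\<^bsub>M\<^esub>"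
    using empty smult_r_distr[of a "\<zero>\<^bsub>M\<^esub>" "\<zero>\<^bsub>M\<^esub>"] by simp
  then have "a \<odot>\<^bsub>M\<^esub> \<zero>\<^bsub>M\<^esub> = \<zero>\<^bsub>M\<^esub>"
    using empty by (metis M.add.l_cancel_one M.zero_closed smult_closed)
  then show ?case by simp
next
  case (insert j I)
  then have "v j \<in> carrier M" "v \<in> I \<rightarrow> carrier M" by auto
  with insert show ?case
    by (simp add: smult_r_distr M.finsum_closed Pi_def)
qed

lemma (in left_module) spanning_family:
  assumes "finitely_generated A M"
  obtains k :: nat and v where "v \<in> {..<k} \<rightarrow> carrier M"
    and "carrier M = (\<lambda>c. finsum M (\<lambda>i. c i \<odot>\<^bsub>M\<^esub> v i) {..<k}) ` (UNIV \<rightarrow> carrier A)"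
proof -
  obtain S where S: "finite S" "S \<subseteq> carrier M"
    "\<And>H. submodule H A M \<Longrightarrow> S \<subseteq> H \<Longrightarrow> H = carrier M"
    by (rule finitely_generatedE[OF assms]) auto
  obtain v and k :: nat where v: "S = v ` {..<k}"
    using S(1) finite_imp_nat_seg_image_inj_on[OF S(1)] unfolding lessThan_def by metis
  have vc: "v i \<in> carrier M" if "i < k" for i using that v S(2) by auto
  define t where "t = (\<lambda>c. finsum M (\<lambda>i. c i \<odot>\<^bsub>M\<^esub> v i) {..<k})"
  have "submodule (t ` (UNIV \<rightarrow> carrier A)) A M"
  proof (rule left_submoduleI)
    show "t ` (UNIV \<rightarrow> carrier A) \<subseteq> carrier M"
      unfolding t_def using vc by (auto intro!: M.finsum_closed)
    show "t ` (UNIV \<rightarrow> carrier A) \<noteq> {}" using A.zero_closed by (auto intro!: exI[of _ "\<lambda>_. \<zero>\<^bsub>A\<^esub>"] simp: Pi_eq_empty)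
  next
    fix x y assume "x \<in> t ` (UNIV \<rightarrow> carrier A)" "y \<in> t ` (UNIV \<rightarrow> carrier A)"
    then obtain c c' where c: "c \<in> UNIV \<rightarrow> carrier A" "x = t c" "c' \<in> UNIV \<rightarrow> carrier A" "y = t c'"
      by blast
    have "x \<oplus>\<^bsub>M\<^esub> y = finsum M (\<lambda>i. c i \<odot>\<^bsub>M\<^esub> v i \<oplus>\<^bsub>M\<^esub> c' i \<odot>\<^bsub>M\<^esub> v i) {..<k}"
      unfolding c t_def by (rule M.finsum_addf[symmetric]) (use c vc in auto)
    also have "\<dots> = t (\<lambda>i. c i \<oplus>\<^bsub>A\<^esub> c' i)"
      unfolding t_def by (rule M.finsum_cong') (use c vc in \<open>auto simp: smult_l_distr Pi_def\<close>)
    finally show "x \<oplus>\<^bsub>M\<^esub> y \<in> t ` (UNIV \<rightarrow> carrier A)"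
      using c by (intro image_eqI[of _ _ "\<lambda>i. c i \<oplus>\<^bsub>A\<^esub> c' i"]) auto
  next
    fix a x assume a: "a \<in> carrier A" and "x \<in> t ` (UNIV \<rightarrow> carrier A)"
    then obtain c where c: "c \<in> UNIV \<rightarrow> carrier A" "x = t c" by blast
    have "a \<odot>\<^bsub>M\<^esub> x = finsum M (\<lambda>i. a \<odot>\<^bsub>M\<^esub> (c i \<odot>\<^bsub>M\<^esub> v i)) {..<k}"
      unfolding c t_def by (rule finsum_smult) (use a c vc in auto)
    also have "\<dots> = t (\<lambda>i. a \<otimes>\<^bsub>A\<^esub> c i)"
      unfolding t_def by (rule M.finsum_cong') (use a c vc in \<open>auto simp: smult_assoc1 Pi_def\<close>)
    finally show "a \<odot>\<^bsub>M\<^esub> x \<in> t ` (UNIV \<rightarrow> carrier A)"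
      using a c by (intro image_eqI[of _ _ "\<lambda>i. a \<otimes>\<^bsub>A\<^esub> c i"]) auto
  qed
  moreover have "S \<subseteq> t ` (UNIV \<rightarrow> carrier A)"
  proof
    fix x assume "x \<in> S"
    then obtain j where j: "j < k" "x = v j" using v by auto
    have z: "\<zero>\<^bsub>A\<^esub> \<odot>\<^bsub>M\<^esub> y = \<zero>\<^bsub>M\<^esub>" if "y \<in> carrier M" for y
      using that smult_l_distr[of "\<zero>\<^bsub>A\<^esub>" "\<zero>\<^bsub>A\<^esub>" y]
      by (metis A.l_zero A.zero_closed M.add.l_cancel_one smult_closed)
    have "t (\<lambda>i. if i = j then \<one>\<^bsub>A\<^esub> else \<zero>\<^bsub>A\<^esub>)
        = finsum M (\<lambda>i. if j = i then v i else \<zero>\<^bsub>M\<^esub>) {..<k}"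
      unfolding t_def by (rule M.finsum_cong') (use vc z in auto)
    also have "\<dots> = v j"
      by (rule M.finsum_singleton) (use j vc in auto)
    finally show "x \<in> t ` (UNIV \<rightarrow> carrier A)"
      using j by (intro image_eqI[of _ _ "\<lambda>i. if i = j then \<one>\<^bsub>A\<^esub> else \<zero>\<^bsub>A\<^esub>"]) auto
  qed
  ultimately have "carrier M = t ` (UNIV \<rightarrow> carrier A)" using S(3) by metis
  moreover have "v \<in> {..<k} \<rightarrow> carrier M" using vc by simp
  ultimately show thesis using that unfolding t_def by blast
qed

lemma fg_carrier_embedding:
  fixes A :: "('a, 'k) ring_scheme" and M :: "('a, 'x, 'l) module_scheme"
  assumes "fg_module A M"
  obtains g :: "'x \<Rightarrow> 'a fgcar" where "inj_on g (carrier M)"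
proof -
  interpret left_module A M using assms by (simp add: fg_module_def)
  obtain t :: "(nat \<Rightarrow> 'a) \<Rightarrow> 'x" where t: "carrier M = t ` (UNIV \<rightarrow> carrier A)"
  proof -
    have "finitely_generated A M" using assms by (simp add: fg_module_def)
    then show thesis
    proof (rule spanning_family)
      fix k and v :: "nat \<Rightarrow> 'x"
      assume "carrier M = (\<lambda>c. finsum M (\<lambda>i. c i \<odot>\<^bsub>M\<^esub> v i) {..<k}) ` (UNIV \<rightarrow> carrier A)"
      then show thesis by (rule that)
    qed
  qed
  have "inj_on (\<lambda>x. {c \<in> UNIV \<rightarrow> carrier A. t c = x}) (carrier M)"
  proof (rule inj_onI)
    fix x y
    assume "x \<in> carrier M"
      and eq: "{c \<in> UNIV \<rightarrow> carrier A. t c = x} = {c \<in> UNIV \<rightarrow> carrier A. t c = y}"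
    then obtain c where "c \<in> UNIV \<rightarrow> carrier A" "t c = x" using t by auto
    then have "c \<in> {c \<in> UNIV \<rightarrow> carrier A. t c = x}" by simp
    then have "t c = y" unfolding eq by simp
    with \<open>t c = x\<close> show "x = y" by simp
  qed
  then show thesis by (rule that)
qed

lemma finitely_generated_transport:
  assumes M: "fg_module A M" and g: "inj_on g (carrier M)"
  shows "finitely_generated A (transport_module g M)"
proof -
  interpret left_module A M using M by (simp add: fg_module_def)
  interpret T: left_module A "transport_module g M"
    by (rule transport_module_left_module[OF left_module_axioms g])
  note s = transport_module_simps[OF g]
  obtain S where S: "finite S" "S \<subseteq> carrier M"
    "\<And>H. submodule H A M \<Longrightarrow> S \<subseteq> H \<Longrightarrow> H = carrier M"
    by (rule finitely_generatedE[of A M]) (use M in \<open>auto simp: fg_module_def\<close>)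
  have "H = carrier (transport_module g M)"
    if H: "submodule H A (transport_module g M)" and SH: "g ` S \<subseteq> H" for H
  proof -
    interpret H: submodule H A "transport_module g M" by fact
    have Hsub: "H \<subseteq> g ` carrier M" using H.subset by (simp add: s)
    have Hadd: "u \<oplus>\<^bsub>transport_module g M\<^esub> w \<in> H" if "u \<in> H" "w \<in> H" for u w
      using H.m_closed that by simp
    have Hz: "g \<zero>\<^bsub>M\<^esub> \<in> H" using H.one_closed by (simp add: s)
    have "submodule {x \<in> carrier M. g x \<in> H} A M"
    proof (rule left_submoduleI)
      show "{x \<in> carrier M. g x \<in> H} \<noteq> {}" using Hz by auto
    next
      fix x y assume "x \<in> {x \<in> carrier M. g x \<in> H}" "y \<in> {x \<in> carrier M. g x \<in> H}"
      then show "x \<oplus>\<^bsub>M\<^esub> y \<in> {x \<in> carrier M. g x \<in> H}"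
        using Hadd[of "g x" "g y"] by (simp add: s)
    next
      fix a x assume "a \<in> carrier A" "x \<in> {x \<in> carrier M. g x \<in> H}"
      then show "a \<odot>\<^bsub>M\<^esub> x \<in> {x \<in> carrier M. g x \<in> H}"
        using H.smult_closed[of a "g x"] by (simp add: s)
    qed auto
    then have "{x \<in> carrier M. g x \<in> H} = carrier M" using S(2,3) SH by blast
    then show ?thesis using Hsub by (auto simp: s)
  qed
  then show ?thesis
    unfolding finitely_generated_def using S
    by (intro exI[of _ "g ` S"]) (auto simp: s)
qed

lemma fg_module_representable:
  fixes A :: "('a, 'k) ring_scheme" and M :: "('a, 'x, 'l) module_scheme"
  assumes "fg_module A M"
  shows "\<exists>N :: ('a, 'a fgcar) module. fg_module A N \<and> mod_iso A M N \<noteq> {}"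
proof -
  obtain g :: "'x \<Rightarrow> 'a fgcar" where g: "inj_on g (carrier M)"
    by (rule fg_carrier_embedding[OF assms])
  have "left_module A M" using assms by (simp add: fg_module_def)
  then have "fg_module A (transport_module g M)" "g \<in> mod_iso A M (transport_module g M)"
    using finitely_generated_transport[OF assms g] transport_module_left_module[OF _ g]
      transport_module_iso[OF _ g] by (simp_all add: fg_module_def)
  then show ?thesis by (intro exI[of _ "transport_module g M"] conjI) auto
qed

lemma restrict_scalars_left_module:
  assumes A: "ring A" and f: "f \<in> ring_hom A C" and X: "left_module C X"
  shows "left_module A (restrict_scalars f X)"
proof -
  interpret A: ring A by fact
  interpret X: left_module C X by fact
  have "abelian_group (restrict_scalars f X)"
  proof (rule abelian_groupI)
    fix x assume "x \<in> carrier (restrict_scalars f X)"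
    then show "\<exists>y\<in>carrier (restrict_scalars f X).
        y \<oplus>\<^bsub>restrict_scalars f X\<^esub> x = \<zero>\<^bsub>restrict_scalars f X\<^esub>"
      by (intro bexI[of _ "\<ominus>\<^bsub>X\<^esub> x"]) (simp_all add: restrict_scalars_def X.M.l_neg)
  qed (simp_all add: restrict_scalars_def X.M.a_ac)
  then show ?thesis
    using f A by (intro left_module.intro left_module_axioms.intro)
      (auto simp: restrict_scalars_def ring_hom_closed ring_hom_add ring_hom_mult ring_hom_one
        X.smult_l_distr X.smult_r_distr X.smult_assoc1)
qed

lemma fg_module_representable_surj:
  fixes A :: "('a, 'k) ring_scheme" and C :: "('c, 'm) ring_scheme" and X :: "('c, 'x, 'l) module_scheme"
  assumes A: "ring A" and f: "f \<in> ring_hom A C" "f ` carrier A = carrier C" and X: "fg_module C X"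
  shows "\<exists>Y :: ('c, 'a fgcar) module. fg_module C Y \<and> mod_iso C X Y \<noteq> {}"
proof -
  interpret X: left_module C X using X by (simp add: fg_module_def)
  have L: "left_module A (restrict_scalars f X)"
    by (rule restrict_scalars_left_module[OF A f(1) X.left_module_axioms])
  have sub: "submodule H C X" if "submodule H A (restrict_scalars f X)" for H
  proof -
    interpret H: submodule H A "restrict_scalars f X" by fact
    show ?thesis
    proof (rule X.left_submoduleI)
      show "H \<subseteq> carrier X" using H.subset by (simp add: restrict_scalars_def)
      show "H \<noteq> {}" using H.one_closed by auto
      show "x \<oplus>\<^bsub>X\<^esub> y \<in> H" if "x \<in> H" "y \<in> H" for x y
        using H.m_closed[OF that] by (simp add: restrict_scalars_def)
    next
      fix c x assume c: "c \<in> carrier C" and x: "x \<in> H"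
      obtain a where "a \<in> carrier A" "c = f a" using c unfolding f(2)[symmetric] by blast
      then show "c \<odot>\<^bsub>X\<^esub> x \<in> H"
        using H.smult_closed[of a x] x by (simp add: restrict_scalars_def)
    qed
  qed
  have "finitely_generated A (restrict_scalars f X)"
  proof -
    obtain S where "finite S" "S \<subseteq> carrier X"
      "\<And>H. submodule H C X \<Longrightarrow> S \<subseteq> H \<Longrightarrow> H = carrier X"
      by (rule finitely_generatedE[of C X]) (use X in \<open>auto simp: fg_module_def\<close>)
    with sub show ?thesis
      unfolding finitely_generated_def
      by (intro exI[of _ S]) (simp add: restrict_scalars_def[of f X])
  qed
  then have "fg_module A (restrict_scalars f X)" using L by (simp add: fg_module_def)
  then obtain g :: "'x \<Rightarrow> 'a fgcar" where "inj_on g (carrier (restrict_scalars f X))"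
    by (rule fg_carrier_embedding)
  then have g: "inj_on g (carrier X)" by (simp add: restrict_scalars_def)
  have "left_module C X" using X by (simp add: fg_module_def)
  then have "fg_module C (transport_module g X)" "g \<in> mod_iso C X (transport_module g X)"
    using finitely_generated_transport[OF X g] transport_module_left_module[OF _ g]
      transport_module_iso[OF _ g] by (simp_all add: fg_module_def)
  then show ?thesis by (intro exI[of _ "transport_module g X"] conjI) auto
qed

end

theory Submission
  imports Defs
begin

text \<open>
  Write \<open>\<Omega>\<close> for the syzygy functor on modules modulo homomorphisms that factor through projectives.
  If \<open>M\<close> has finite projective dimension, then \<open>W = \<Omega>M\<close> lies in \<open>rad(A) P \<subseteq> K P\<close> for the projective cover
  \<open>P\<close>, so \<open>I J W = 0\<close> and \<open>W\<close> is an extension of an \<open>A/J\<close>-module \<open>Z\<close> by an \<open>A/I\<close>-module \<open>X\<close>.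
  Rotating the extension gives a stable map \<open>u : \<Omega>\<^sup>2 Z \<rightarrow> \<Omega>X\<close> with cokernel \<open>\<Omega>W\<close>; as the latter has finite
  projective dimension, some \<open>\<Omega>\<^sup>m u\<close> is a stable isomorphism, and a bound for the least such \<open>m\<close> bounds the
  projective dimension of \<open>M\<close>.

  After finitely many syzygies, both ends of \<open>u\<close> lie in the additive closure of finitely many fixed modules.
  That \<open>m\<close> is then bounded is a theorem of Igusa and Todorov, for which lengths replace their use of
  the Grothendieck group.  Let \<open>T\<^sub>k(X)\<close> be \<open>Hom(\<Omega>\<^sup>k N, \<Omega>\<^sup>k X)\<close> modulo the maps killed by some further syzygy.
  Every \<open>T\<^sub>k(u)\<close> is injective, and bijective for large \<open>k\<close>.  The length of \<open>T\<^sub>k(X)\<close> is linear in the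
  multiplicities of the indecomposable summands of \<open>X\<close>, so by linear algebra the lengths of the two sides already
  agree from some \<open>k\<close> on that depends on \<open>N\<close> only.  There \<open>T\<^sub>k(u)\<close> is bijective, and with \<open>N\<close> running
  through the given modules \<open>\<Omega>\<^sup>k u\<close> becomes invertible up to maps that are killed at a uniform stage.
\<close>

section \<open>Submodules, homomorphisms and relative length\<close>

text \<open>Short exact sequences are rotated by passing to kernels of maps from projective covers,
  which moves the terms by two places at once: (X, Y, Z) becomes (\<Omega>Y, \<Omega>Z, X) up to
  stable isomorphism. Three such moves restore the order and cost two syzygies, so a map is found
  again in first position of an exact sequence at its even syzygies. This is the source of the
  factor 2 in the final bound \<open>Suc (2 * (b + n)) + 2\<close>: \<open>n\<close> syzygies bring
  both ends of \<open>u\<close> into the fixed additive closure, \<open>b\<close> is the bound of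
  Igusa and Todorov, and the last 2 appears because the cokernel \<Omega>W is a second syzygy of M.
  Hom(L, X) is a module over \<open>R\<close>, not over \<open>A\<close>. Lengths of Hom modules are
  therefore lengths over \<open>R\<close>, and their finiteness rests on the fact that a commutative
  Artinian ring has finite length over itself. Lengths are taken relative to a pair of submodules,
  and additive closures are described by identity maps, so that quotients and direct sums rarely
  have to be formed and \<open>A\<close>-modules mostly stay within one carrier type.\<close>

context abelian_group
begin

lemma add_diff_cancel_left: "\<lbrakk>a \<in> carrier G; b \<in> carrier G\<rbrakk> \<Longrightarrow> (a \<oplus> b) \<ominus> a = b"
proof -
  assume ab: "a \<in> carrier G" "b \<in> carrier G"
  then have "(a \<oplus> b) \<ominus> a = b \<oplus> (a \<oplus> \<ominus> a)" by (simp add: minus_eq a_ac)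
  then show ?thesis using ab by (simp add: r_neg)
qed

lemma add_diff_cancel_right: "\<lbrakk>a \<in> carrier G; b \<in> carrier G\<rbrakk> \<Longrightarrow> (a \<oplus> b) \<ominus> b = a"
  by (simp add: minus_eq a_assoc r_neg)

lemma diff_add_cancel: "\<lbrakk>a \<in> carrier G; b \<in> carrier G\<rbrakk> \<Longrightarrow> (a \<ominus> b) \<oplus> b = a"
  by (simp add: minus_eq a_assoc l_neg)

lemma diff_eq_zero_iff: "\<lbrakk>a \<in> carrier G; b \<in> carrier G\<rbrakk> \<Longrightarrow> a \<ominus> b = \<zero> \<longleftrightarrow> a = b"
  by (metis diff_add_cancel l_zero minus_eq r_neg)

end

context left_module
begin

lemma smult_l_null [simp]: "x \<in> carrier M \<Longrightarrow> \<zero>\<^bsub>A\<^esub> \<odot>\<^bsub>M\<^esub> x = \<zero>\<^bsub>M\<^esub>"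
  using smult_l_distr[of "\<zero>\<^bsub>A\<^esub>" "\<zero>\<^bsub>A\<^esub>" x]
  by (metis A.l_zero A.zero_closed M.add.l_cancel_one smult_closed)

lemma smult_r_null [simp]: "a \<in> carrier A \<Longrightarrow> a \<odot>\<^bsub>M\<^esub> \<zero>\<^bsub>M\<^esub> = \<zero>\<^bsub>M\<^esub>"
  using smult_r_distr[of a "\<zero>\<^bsub>M\<^esub>" "\<zero>\<^bsub>M\<^esub>"]
  by (metis M.l_zero M.zero_closed M.add.l_cancel_one smult_closed)

lemma smult_r_minus: "\<lbrakk>a \<in> carrier A; x \<in> carrier M\<rbrakk> \<Longrightarrow> a \<odot>\<^bsub>M\<^esub> (\<ominus>\<^bsub>M\<^esub> x) = \<ominus>\<^bsub>M\<^esub> (a \<odot>\<^bsub>M\<^esub> x)"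
  using smult_r_distr[of a "\<ominus>\<^bsub>M\<^esub> x" x]
  by (metis M.add.inv_closed M.l_neg M.minus_equality smult_closed smult_r_null)

text \<open>Closure under negation comes for free, since negation is multiplication by the negative
  of the unit.\<close>

lemma submodule_iff:
  "submodule H A M \<longleftrightarrow> H \<subseteq> carrier M \<and> \<zero>\<^bsub>M\<^esub> \<in> H \<and> (\<forall>x\<in>H. \<forall>y\<in>H. x \<oplus>\<^bsub>M\<^esub> y \<in> H) \<and>
     (\<forall>a\<in>carrier A. \<forall>x\<in>H. a \<odot>\<^bsub>M\<^esub> x \<in> H)" (is "?l \<longleftrightarrow> ?r")
proof
  assume ?l
  then interpret H: submodule H A M .
  show ?r using H.subset H.one_closed H.m_closed H.smult_closed by auto
next
  assume ?r then show ?l by (intro left_submoduleI) auto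
qed

lemma submoduleD:
  assumes "submodule H A M"
  shows "x \<in> H \<Longrightarrow> x \<in> carrier M" and "\<zero>\<^bsub>M\<^esub> \<in> H"
    and "\<lbrakk>x \<in> H; y \<in> H\<rbrakk> \<Longrightarrow> x \<oplus>\<^bsub>M\<^esub> y \<in> H"
    and "\<lbrakk>a \<in> carrier A; x \<in> H\<rbrakk> \<Longrightarrow> a \<odot>\<^bsub>M\<^esub> x \<in> H"
  using assms by (auto simp: submodule_iff)

lemma submodule_minus:
  assumes "submodule H A M" "x \<in> H" shows "\<ominus>\<^bsub>M\<^esub> x \<in> H"
  using assms smult_minus_one[of x] unfolding submodule_iff
  by (metis A.add.inv_closed A.one_closed subsetD)

lemma submodule_diff:
  assumes "submodule H A M" "x \<in> H" "y \<in> H" shows "x \<ominus>\<^bsub>M\<^esub> y \<in> H"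
  using assms submodule_minus[OF assms(1,3)] unfolding submodule_iff by (simp add: a_minus_def)

lemma submodule_zero: "submodule {\<zero>\<^bsub>M\<^esub>} A M"
  by (simp add: submodule_iff)

lemma submodule_carrier: "submodule (carrier M) A M"
  by (simp add: submodule_iff)

lemma submodule_Int:
  "\<lbrakk>submodule H A M; submodule H' A M\<rbrakk> \<Longrightarrow> submodule (H \<inter> H') A M"
  by (auto simp: submodule_iff)

lemma set_add_iff: "x \<in> H <+>\<^bsub>M\<^esub> H' \<longleftrightarrow> (\<exists>h\<in>H. \<exists>k\<in>H'. x = h \<oplus>\<^bsub>M\<^esub> k)"
  by (auto simp: set_add_def set_mult_def)

lemma submodule_set_add:
  assumes H: "submodule H A M" and H': "submodule H' A M"
  shows "submodule (H <+>\<^bsub>M\<^esub> H') A M"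
proof -
  have sub: "H \<subseteq> carrier M" "H' \<subseteq> carrier M" using H H' by (auto simp: submodule_iff)
  show ?thesis
  proof (rule left_submoduleI)
    show "H <+>\<^bsub>M\<^esub> H' \<subseteq> carrier M" using sub by (auto simp: set_add_iff subset_iff)
    have "\<zero>\<^bsub>M\<^esub> \<oplus>\<^bsub>M\<^esub> \<zero>\<^bsub>M\<^esub> \<in> H <+>\<^bsub>M\<^esub> H'"
      unfolding set_add_iff by (intro bexI[OF _ submoduleD(2)[OF H]] bexI[OF _ submoduleD(2)[OF H']]) simp
    then show "H <+>\<^bsub>M\<^esub> H' \<noteq> {}" by blast
  next
    fix x y assume "x \<in> H <+>\<^bsub>M\<^esub> H'" "y \<in> H <+>\<^bsub>M\<^esub> H'"
    then obtain h k h' k' where e: "h \<in> H" "k \<in> H'" "h' \<in> H" "k' \<in> H'" "x = h \<oplus>\<^bsub>M\<^esub> k" "y = h' \<oplus>\<^bsub>M\<^esub> k'"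
      by (auto simp: set_add_iff)
    have "x \<oplus>\<^bsub>M\<^esub> y = (h \<oplus>\<^bsub>M\<^esub> h') \<oplus>\<^bsub>M\<^esub> (k \<oplus>\<^bsub>M\<^esub> k')"
      using e sub by (auto simp: M.a_ac subset_iff)
    moreover have "h \<oplus>\<^bsub>M\<^esub> h' \<in> H" "k \<oplus>\<^bsub>M\<^esub> k' \<in> H'" using e H H' by (auto simp: submodule_iff)
    ultimately show "x \<oplus>\<^bsub>M\<^esub> y \<in> H <+>\<^bsub>M\<^esub> H'" by (auto simp: set_add_iff)
  next
    fix a x assume a: "a \<in> carrier A" and "x \<in> H <+>\<^bsub>M\<^esub> H'"
    then obtain h k where e: "h \<in> H" "k \<in> H'" "x = h \<oplus>\<^bsub>M\<^esub> k" by (auto simp: set_add_iff)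
    have "a \<odot>\<^bsub>M\<^esub> x = a \<odot>\<^bsub>M\<^esub> h \<oplus>\<^bsub>M\<^esub> a \<odot>\<^bsub>M\<^esub> k" using e sub a by (auto simp: smult_r_distr subset_iff)
    moreover have "a \<odot>\<^bsub>M\<^esub> h \<in> H" "a \<odot>\<^bsub>M\<^esub> k \<in> H'" using e a H H' by (auto simp: submodule_iff)
    ultimately show "a \<odot>\<^bsub>M\<^esub> x \<in> H <+>\<^bsub>M\<^esub> H'" by (auto simp: set_add_iff)
  qed
qed

lemma set_add_upper1: "\<lbrakk>submodule H A M; submodule H' A M\<rbrakk> \<Longrightarrow> H \<subseteq> H <+>\<^bsub>M\<^esub> H'"
  unfolding submodule_iff set_add_iff subset_iff by (metis M.r_zero)

lemma set_add_upper2: "\<lbrakk>submodule H A M; submodule H' A M\<rbrakk> \<Longrightarrow> H' \<subseteq> H <+>\<^bsub>M\<^esub> H'"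
  unfolding submodule_iff set_add_iff subset_iff by (metis M.l_zero)

lemma set_add_least:
  "\<lbrakk>submodule L A M; H \<subseteq> L; H' \<subseteq> L\<rbrakk> \<Longrightarrow> H <+>\<^bsub>M\<^esub> H' \<subseteq> L"
  unfolding submodule_iff by (auto simp: set_add_iff subset_iff)

lemma left_module_submodule:
  assumes "submodule H A M"
  shows "left_module A (M\<lparr>carrier := H\<rparr>)"
proof -
  have sub: "H \<subseteq> carrier M" using assms by (auto simp: submodule_iff)
  have "abelian_group (M\<lparr>carrier := H\<rparr>)"
  proof (rule abelian_groupI)
    fix x assume "x \<in> carrier (M\<lparr>carrier := H\<rparr>)"
    then show "\<exists>y\<in>carrier (M\<lparr>carrier := H\<rparr>). y \<oplus>\<^bsub>M\<lparr>carrier := H\<rparr>\<^esub> x = \<zero>\<^bsub>M\<lparr>carrier := H\<rparr>\<^esub>"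
      using sub submodule_minus[OF assms, of x] by (intro bexI[of _ "\<ominus>\<^bsub>M\<^esub> x"]) (auto simp: M.l_neg)
  qed (use assms sub in \<open>auto simp: submodule_iff M.a_ac subset_iff\<close>)
  then show ?thesis
    using assms sub
    by (intro left_module.intro left_module_axioms.intro)
      (auto simp: submodule_iff A.ring_axioms smult_l_distr smult_r_distr smult_assoc1 subset_iff)
qed

lemma submodule_of_submodule:
  assumes "submodule H A M"
  shows "submodule L A (M\<lparr>carrier := H\<rparr>) \<longleftrightarrow> submodule L A M \<and> L \<subseteq> H"
proof -
  interpret H: left_module A "M\<lparr>carrier := H\<rparr>" by (rule left_module_submodule[OF assms])
  show ?thesis
    using assms by (auto simp: H.submodule_iff submodule_iff)
qed

end

section \<open>Homomorphisms of left modules\<close>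

lemma mod_homD:
  assumes "f \<in> mod_hom A M N"
  shows "x \<in> carrier M \<Longrightarrow> f x \<in> carrier N"
    and "\<lbrakk>x \<in> carrier M; y \<in> carrier M\<rbrakk> \<Longrightarrow> f (x \<oplus>\<^bsub>M\<^esub> y) = f x \<oplus>\<^bsub>N\<^esub> f y"
    and "\<lbrakk>a \<in> carrier A; x \<in> carrier M\<rbrakk> \<Longrightarrow> f (a \<odot>\<^bsub>M\<^esub> x) = a \<odot>\<^bsub>N\<^esub> f x"
  using assms by (auto simp: mod_hom_def)

lemma mod_homI:
  assumes "\<And>x. x \<in> carrier M \<Longrightarrow> f x \<in> carrier N"
    and "\<And>x y. \<lbrakk>x \<in> carrier M; y \<in> carrier M\<rbrakk> \<Longrightarrow> f (x \<oplus>\<^bsub>M\<^esub> y) = f x \<oplus>\<^bsub>N\<^esub> f y"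
    and "\<And>a x. \<lbrakk>a \<in> carrier A; x \<in> carrier M\<rbrakk> \<Longrightarrow> f (a \<odot>\<^bsub>M\<^esub> x) = a \<odot>\<^bsub>N\<^esub> f x"
  shows "f \<in> mod_hom A M N"
  using assms by (auto simp: mod_hom_def)

lemma mod_hom_zero:
  assumes "left_module A M" "left_module A N" "f \<in> mod_hom A M N"
  shows "f \<zero>\<^bsub>M\<^esub> = \<zero>\<^bsub>N\<^esub>"
proof -
  interpret M: left_module A M by fact
  interpret N: left_module A N by fact
  show ?thesis
    using mod_homD(2)[OF assms(3), of "\<zero>\<^bsub>M\<^esub>" "\<zero>\<^bsub>M\<^esub>"] mod_homD(1)[OF assms(3), of "\<zero>\<^bsub>M\<^esub>"]
    by (metis M.M.l_zero M.M.zero_closed N.M.add.l_cancel_one)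
qed

lemma mod_hom_minus:
  assumes "left_module A M" "left_module A N" "f \<in> mod_hom A M N" "x \<in> carrier M"
  shows "f (\<ominus>\<^bsub>M\<^esub> x) = \<ominus>\<^bsub>N\<^esub> f x"
proof -
  interpret M: left_module A M by fact
  interpret N: left_module A N by fact
  show ?thesis
    using mod_homD(3)[OF assms(3), of "\<ominus>\<^bsub>A\<^esub> \<one>\<^bsub>A\<^esub>" x] assms(4) mod_homD(1)[OF assms(3)]
      M.smult_minus_one[of x] N.smult_minus_one[of "f x"] by auto
qed

lemma mod_hom_diff:
  assumes "left_module A M" "left_module A N" "f \<in> mod_hom A M N" "x \<in> carrier M" "y \<in> carrier M"
  shows "f (x \<ominus>\<^bsub>M\<^esub> y) = f x \<ominus>\<^bsub>N\<^esub> f y"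
proof -
  interpret M: left_module A M by fact
  show ?thesis
    using mod_hom_minus[OF assms(1-3,5)] assms mod_homD(2)[OF assms(3), of x "\<ominus>\<^bsub>M\<^esub> y"]
    by (simp add: a_minus_def)
qed

lemma mod_hom_image_submodule:
  assumes M: "left_module A M" and N: "left_module A N" and f: "f \<in> mod_hom A M N" and H: "submodule H A M"
  shows "submodule (f ` H) A N"
proof -
  interpret M: left_module A M by fact
  interpret N: left_module A N by fact
  have sub: "H \<subseteq> carrier M" using H by (auto simp: M.submodule_iff)
  note fD = mod_homD[OF f]
  show ?thesis
  proof (rule N.left_submoduleI)
    show "f ` H \<subseteq> carrier N" using sub fD(1) by auto
    show "f ` H \<noteq> {}" using H by (auto simp: M.submodule_iff)
  next
    fix x y assume "x \<in> f ` H" "y \<in> f ` H"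
    then obtain x' y' where "x' \<in> H" "y' \<in> H" "x = f x'" "y = f y'" by blast
    then show "x \<oplus>\<^bsub>N\<^esub> y \<in> f ` H"
      using H sub fD(2)[of x' y'] by (intro image_eqI[of _ _ "x' \<oplus>\<^bsub>M\<^esub> y'"]) (auto simp: M.submodule_iff subset_iff)
  next
    fix a x assume "a \<in> carrier A" "x \<in> f ` H"
    then obtain x' where "x' \<in> H" "x = f x'" by blast
    then show "a \<odot>\<^bsub>N\<^esub> x \<in> f ` H"
      using H sub fD(3)[of a x'] \<open>a \<in> carrier A\<close>
      by (intro image_eqI[of _ _ "a \<odot>\<^bsub>M\<^esub> x'"]) (auto simp: M.submodule_iff)
  qed
qed

lemma mod_hom_vimage_submodule:
  assumes M: "left_module A M" and N: "left_module A N" and f: "f \<in> mod_hom A M N" and H: "submodule H A N"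
  shows "submodule {x \<in> carrier M. f x \<in> H} A M"
proof -
  interpret M: left_module A M by fact
  interpret N: left_module A N by fact
  show ?thesis
    using H mod_homD[OF f] mod_hom_zero[OF M N f]
    by (auto simp: M.submodule_iff N.submodule_iff)
qed

lemma mod_hom_comp:
  "\<lbrakk>f \<in> mod_hom A M N; g \<in> mod_hom A N L\<rbrakk> \<Longrightarrow> (\<lambda>x. g (f x)) \<in> mod_hom A M L"
  by (auto simp: mod_hom_def Pi_iff)

lemma mod_hom_id: "(\<lambda>x. x) \<in> mod_hom A M M"
  by (auto simp: mod_hom_def)

text \<open>Lengths are measured by weakly increasing sequences of submodules, counting the strict steps:
  such sequences are preserved by images and preimages.\<close>

definition flag :: "('a, 'k) ring_scheme \<Rightarrow> ('a, 'x, 'l) module_scheme \<Rightarrow> 'x set \<Rightarrow> 'x set \<Rightarrow> (nat \<Rightarrow> 'x set) \<Rightarrow> bool" where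
  "flag A M E F C \<longleftrightarrow> (\<forall>i. submodule (C i) A M \<and> E \<subseteq> C i \<and> C i \<subseteq> F \<and> C i \<subseteq> C (Suc i))"

definition steps :: "(nat \<Rightarrow> 'x set) \<Rightarrow> nat \<Rightarrow> nat" where
  "steps C k = card {i. i < k \<and> C i \<noteq> C (Suc i)}"

definition length_le :: "('a, 'k) ring_scheme \<Rightarrow> ('a, 'x, 'l) module_scheme \<Rightarrow> 'x set \<Rightarrow> 'x set \<Rightarrow> nat \<Rightarrow> bool" where
  "length_le A M E F b \<longleftrightarrow> (\<forall>C k. flag A M E F C \<longrightarrow> steps C k \<le> b)"

definition finite_length :: "('a, 'k) ring_scheme \<Rightarrow> ('a, 'x, 'l) module_scheme \<Rightarrow> 'x set \<Rightarrow> 'x set \<Rightarrow> bool" where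
  "finite_length A M E F \<longleftrightarrow> (\<exists>b. length_le A M E F b)"

definition rel_length :: "('a, 'k) ring_scheme \<Rightarrow> ('a, 'x, 'l) module_scheme \<Rightarrow> 'x set \<Rightarrow> 'x set \<Rightarrow> nat" where
  "rel_length A M E F = (LEAST b. length_le A M E F b)"

lemma length_le_rel_length: "finite_length A M E F \<Longrightarrow> length_le A M E F (rel_length A M E F)"
  unfolding finite_length_def rel_length_def by (rule LeastI_ex)

lemma rel_length_le: "length_le A M E F b \<Longrightarrow> rel_length A M E F \<le> b"
  unfolding rel_length_def by (rule Least_le)

lemma rel_length_ge:
  "\<lbrakk>finite_length A M E F; flag A M E F C\<rbrakk> \<Longrightarrow> steps C k \<le> rel_length A M E F"
  using length_le_rel_length unfolding length_le_def by blast

text \<open>The predecessor of a positive length is not a bound, which yields a flag. For length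
  zero there may be no flag at all, for instance if \<open>E\<close> is not contained in
  \<open>F\<close>.\<close>

lemma rel_length_attained:
  assumes fin: "finite_length A M E F" and pos: "0 < rel_length A M E F"
  obtains C k where "flag A M E F C" "rel_length A M E F \<le> steps C k"
proof -
  have "\<not> length_le A M E F (rel_length A M E F - 1)"
    using rel_length_le[of A M E F "rel_length A M E F - 1"] pos by linarith
  then obtain C k where "flag A M E F C" "\<not> steps C k \<le> rel_length A M E F - 1"
    unfolding length_le_def by blast
  then show thesis by (intro that[of C k]) auto
qed

lemma flag_mono: "flag A M E F C \<Longrightarrow> i \<le> j \<Longrightarrow> C i \<subseteq> C j"
  by (metis flag_def lift_Suc_mono_le)

lemma steps_all: "(\<And>i. i < k \<Longrightarrow> C i \<noteq> C (Suc i)) \<Longrightarrow> steps C k = k"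
proof -
  assume "\<And>i. i < k \<Longrightarrow> C i \<noteq> C (Suc i)"
  then have "{i. i < k \<and> C i \<noteq> C (Suc i)} = {..<k}" by auto
  then show ?thesis by (simp add: steps_def)
qed

lemma steps_le:
  assumes "\<And>i. i < k \<Longrightarrow> C i \<noteq> C (Suc i) \<Longrightarrow> D i \<noteq> D (Suc i)"
  shows "steps C k \<le> steps D k"
  unfolding steps_def using assms by (intro card_mono) auto

lemma steps_le_add:
  assumes "\<And>i. i < k \<Longrightarrow> C i \<noteq> C (Suc i) \<Longrightarrow> D i \<noteq> D (Suc i) \<or> D' i \<noteq> D' (Suc i)"
  shows "steps C k \<le> steps D k + steps D' k"
proof -
  have "steps C k \<le> card ({i. i < k \<and> D i \<noteq> D (Suc i)} \<union> {i. i < k \<and> D' i \<noteq> D' (Suc i)})"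
    unfolding steps_def using assms by (intro card_mono) auto
  also have "\<dots> \<le> steps D k + steps D' k"
    unfolding steps_def by (rule card_Un_le)
  finally show ?thesis .
qed

lemma length_le_mono:
  "\<lbrakk>length_le A M E F b; E \<subseteq> E'; F' \<subseteq> F; b \<le> b'\<rbrakk> \<Longrightarrow> length_le A M E' F' b'"
  unfolding length_le_def flag_def by (meson order_trans)

lemma finite_length_mono:
  "\<lbrakk>finite_length A M E F; E \<subseteq> E'; F' \<subseteq> F\<rbrakk> \<Longrightarrow> finite_length A M E' F'"
  unfolding finite_length_def using length_le_mono by blast

lemma finite_length_inc_stable:
  assumes "finite_length A M E F" "\<And>i. submodule (C i) A M \<and> E \<subseteq> C i \<and> C i \<subseteq> F \<and> C i \<subseteq> C (Suc i)"
  shows "\<exists>n. C n = C (Suc n)"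
proof (rule ccontr)
  assume "\<nexists>n. C n = C (Suc n)"
  then have "steps C k = k" for k by (intro steps_all) auto
  moreover have "flag A M E F C" using assms(2) by (simp add: flag_def)
  ultimately show False
    using rel_length_ge[OF assms(1), of C "Suc (rel_length A M E F)"] by simp
qed

lemma finite_length_dec_stable:
  assumes "finite_length A M E F" "\<And>i. submodule (C i) A M \<and> E \<subseteq> C i \<and> C i \<subseteq> F \<and> C (Suc i) \<subseteq> C i"
  shows "\<exists>n. C n = C (Suc n)"
proof (rule ccontr)
  assume n: "\<nexists>n. C n = C (Suc n)"
  define k where "k = Suc (rel_length A M E F)"
  \<comment> \<open>Reversal turns the descending sequence into a flag; from index \<open>k\<close>
    on, truncated subtraction keeps it constant at \<open>C 0\<close>.\<close>
  define D where "D i = C (k - i)" for i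
  have "D i \<subseteq> D (Suc i)" for i
    using assms(2)[of "k - Suc i"] unfolding D_def
    by (cases "i < k") (auto simp: Suc_diff_Suc)
  then have "flag A M E F D" using assms(2) by (auto simp: flag_def D_def)
  moreover have "steps D k = k"
  proof (rule steps_all)
    fix i assume "i < k"
    then show "D i \<noteq> D (Suc i)" using n unfolding D_def by (metis Suc_diff_Suc)
  qed
  ultimately show False
    using rel_length_ge[OF assms(1), of D k] k_def by simp
qed

section \<open>Additivity and positivity of length\<close>

context left_module
begin

text \<open>A flag is compared with its intersections with \<open>F\<close> and its sums with
  \<open>F\<close>. By the modular law, a strict step stays strict in at least one of the
  two.\<close>

lemma length_le_add:
  assumes F: "submodule F A M"
    and EF: "length_le A M E F a" and FG: "length_le A M F G b"
    and EsF: "E \<subseteq> F" and FsG: "F \<subseteq> G" and G: "submodule G A M"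
  shows "length_le A M E G (a + b)"
  unfolding length_le_def
proof (intro allI impI)
  fix C k assume C: "flag A M E G C"
  define D where "D i = C i \<inter> F" for i
  define D' where "D' i = C i <+>\<^bsub>M\<^esub> F" for i
  have Cs: "submodule (C i) A M" for i using C by (simp add: flag_def)
  have 1: "flag A M E F D"
    using C EsF submodule_Int[OF Cs F] unfolding flag_def D_def by blast
  have 2: "flag A M F G D'"
    unfolding flag_def D'_def
  proof (intro allI conjI)
    fix i
    show "submodule (C i <+>\<^bsub>M\<^esub> F) A M" by (rule submodule_set_add[OF Cs F])
    show "F \<subseteq> C i <+>\<^bsub>M\<^esub> F" by (rule set_add_upper2[OF Cs F])
    show "C i <+>\<^bsub>M\<^esub> F \<subseteq> G" using C FsG by (intro set_add_least[OF G]) (auto simp: flag_def)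
    have "C i \<subseteq> C (Suc i)" using C by (simp add: flag_def)
    then show "C i <+>\<^bsub>M\<^esub> F \<subseteq> C (Suc i) <+>\<^bsub>M\<^esub> F"
      unfolding set_add_def set_mult_def by blast
  qed
  have "steps C k \<le> steps D k + steps D' k"
  proof (rule steps_le_add, rule ccontr)
    fix i assume ne: "C i \<noteq> C (Suc i)" and "\<not> (D i \<noteq> D (Suc i) \<or> D' i \<noteq> D' (Suc i))"
    then have eq: "D i = D (Suc i)" "D' i = D' (Suc i)" by auto
    have inc: "C i \<subseteq> C (Suc i)" using C by (simp add: flag_def)
    have "x \<in> C i" if x: "x \<in> C (Suc i)" for x
    proof -
      have "x \<in> D' i" unfolding eq(2) using x set_add_upper1[OF Cs F] by (auto simp: D'_def)
      then obtain c f where cf: "c \<in> C i" "f \<in> F" "x = c \<oplus>\<^bsub>M\<^esub> f" by (auto simp: D'_def set_add_iff)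
      have car: "c \<in> carrier M" "f \<in> carrier M" using cf submoduleD(1)[OF Cs] submoduleD(1)[OF F] by blast+
      have "f = x \<ominus>\<^bsub>M\<^esub> c" using cf car by (simp add: M.add_diff_cancel_left)
      moreover have "x \<ominus>\<^bsub>M\<^esub> c \<in> C (Suc i)" using x cf inc by (intro submodule_diff[OF Cs]) auto
      ultimately have "f \<in> D (Suc i)" using cf by (simp add: D_def)
      then have "f \<in> C i" using eq(1) by (auto simp: D_def)
      then show "x \<in> C i" using cf Cs[of i] by (auto simp: submodule_iff)
    qed
    then show False using inc ne by blast
  qed
  also have "\<dots> \<le> a + b" using EF FG 1 2 unfolding length_le_def by (meson add_mono)
  finally show "steps C k \<le> a + b" .
qed

lemma finite_length_add:
  assumes "submodule F A M" "submodule G A M" "E \<subseteq> F" "F \<subseteq> G"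
    and "finite_length A M E F" "finite_length A M F G"
  shows "finite_length A M E G"
  using length_le_add[OF assms(1) _ _ assms(3,4,2)] assms(5,6) unfolding finite_length_def by blast

text \<open>The upper bound is \<open>length_le_add\<close>; for the lower one, longest flags of the
  two pieces are concatenated.\<close>

lemma rel_length_add:
  assumes F: "submodule F A M" and G: "submodule G A M" and EF: "E \<subseteq> F" and FG: "F \<subseteq> G"
    and E: "submodule E A M" and fin: "finite_length A M E G"
  shows "rel_length A M E G = rel_length A M E F + rel_length A M F G"
proof (rule antisym)
  have f1: "finite_length A M E F" and f2: "finite_length A M F G"
    using finite_length_mono[OF fin] EF FG by auto
  show "rel_length A M E G \<le> rel_length A M E F + rel_length A M F G"
    by (intro rel_length_le length_le_add[OF F _ _ EF FG G] length_le_rel_length f1 f2)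
  \<comment> \<open>A piece of length zero still needs a flag to concatenate, and the constant
    sequence serves.\<close>
  have at: "\<exists>C k. flag A M E' F' C \<and> rel_length A M E' F' \<le> steps C k"
    if "finite_length A M E' F'" "submodule E' A M" "E' \<subseteq> F'" for E' F'
  proof (cases "rel_length A M E' F' = 0")
    case True
    then show ?thesis using that by (intro exI[of _ "\<lambda>_. E'"] exI[of _ 0]) (auto simp: flag_def)
  next
    case False then show ?thesis using rel_length_attained[OF that(1)] by (metis gr0I)
  qed
  obtain C k where C: "flag A M E F C" "rel_length A M E F \<le> steps C k"
    using at[OF f1 E EF] by blast
  obtain D m where D: "flag A M F G D" "rel_length A M F G \<le> steps D m"
    using at[OF f2 F FG] by blast
  \<comment> \<open>The second flag starts at index \<open>Suc k\<close>. The joint between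
    \<open>C k\<close> and \<open>D 0\<close> may or may not be strict; it is not counted, which is
    enough for a lower bound.\<close>
  define H where "H i = (if i \<le> k then C i else D (i - Suc k))" for i
  have "flag A M E G H"
    unfolding flag_def
  proof (intro allI conjI)
    fix i
    show "submodule (H i) A M" "E \<subseteq> H i" "H i \<subseteq> G"
      using C(1) D(1) EF FG unfolding H_def flag_def by (cases "i \<le> k"; simp; blast)+
    show "H i \<subseteq> H (Suc i)"
    proof (cases "i = k")
      case True
      have "C k \<subseteq> F" "F \<subseteq> D 0" using C(1) D(1) by (auto simp: flag_def)
      then show ?thesis using True by (auto simp: H_def)
    next
      case False
      then have "\<not> i \<le> k \<Longrightarrow> Suc i - Suc k = Suc (i - Suc k)" by simp
      then show ?thesis using False C(1) D(1) by (auto simp: H_def flag_def)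
    qed
  qed
  then have "steps H (Suc k + m) \<le> rel_length A M E G" by (rule rel_length_ge[OF fin])
  moreover have "steps C k + steps D m \<le> steps H (Suc k + m)"
  proof -
    let ?S = "{i. i < k \<and> C i \<noteq> C (Suc i)}" and ?T = "{i. i < m \<and> D i \<noteq> D (Suc i)}"
    have "steps C k + steps D m = card ?S + card ((\<lambda>i. Suc k + i) ` ?T)"
      unfolding steps_def by (subst card_image) (auto simp: inj_on_def)
    also have "\<dots> = card (?S \<union> (\<lambda>i. Suc k + i) ` ?T)"
      by (rule card_Un_disjoint[symmetric]) auto
    also have "\<dots> \<le> steps H (Suc k + m)"
      unfolding steps_def by (intro card_mono) (auto simp: H_def)
    finally show ?thesis .
  qed
  ultimately show "rel_length A M E F + rel_length A M F G \<le> rel_length A M E G"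
    using C(2) D(2) by linarith
qed

lemma rel_length_pos:
  assumes E: "submodule E A M" and F: "submodule F A M" and "E \<subset> F" and fin: "finite_length A M E F"
  shows "0 < rel_length A M E F"
proof -
  define C where "C i = (if i = 0 then E else F)" for i :: nat
  have "flag A M E F C" using assms by (auto simp: flag_def C_def)
  moreover have "steps C 1 = 1" using assms by (intro steps_all) (auto simp: C_def)
  ultimately show ?thesis using rel_length_ge[OF fin, of C 1] by simp
qed

end

text \<open>The hypothesis \<open>inj\<close> takes the place of an injective map from F/E to F'/E'.
  The images of a flag, enlarged by \<open>E'\<close>, form a flag: if \<open>f x = f c + e\<close>
  with \<open>e\<close> in \<open>E'\<close>, then \<open>x - c\<close> lies in \<open>E\<close>, so
  a strict step cannot collapse.\<close>

lemma length_le_inj: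
  assumes M: "left_module A M" and N: "left_module A N" and f: "f \<in> mod_hom A M N"
    and F: "submodule F A M" and E': "submodule E' A N" and F': "submodule F' A N" and E'F': "E' \<subseteq> F'"
    and FF: "f ` F \<subseteq> F'" and inj: "\<And>x. x \<in> F \<Longrightarrow> f x \<in> E' \<Longrightarrow> x \<in> E" and len: "length_le A N E' F' b"
  shows "length_le A M E F b"
  unfolding length_le_def
proof (intro allI impI)
  interpret M: left_module A M by fact
  interpret N: left_module A N by fact
  fix C k assume C: "flag A M E F C"
  have Cs: "submodule (C i) A M" for i using C by (simp add: flag_def)
  have fs: "submodule (f ` C i) A N" for i by (rule mod_hom_image_submodule[OF M N f Cs])
  define D where "D i = f ` C i <+>\<^bsub>N\<^esub> E'" for i
  have "flag A N E' F' D"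
    unfolding flag_def D_def
  proof (intro allI conjI)
    fix i
    show "submodule (f ` C i <+>\<^bsub>N\<^esub> E') A N" by (rule N.submodule_set_add[OF fs E'])
    show "E' \<subseteq> f ` C i <+>\<^bsub>N\<^esub> E'" by (rule N.set_add_upper2[OF fs E'])
    show "f ` C i <+>\<^bsub>N\<^esub> E' \<subseteq> F'"
    proof (rule N.set_add_least[OF F' _ E'F'])
      have "C i \<subseteq> F" using C by (simp add: flag_def)
      then show "f ` C i \<subseteq> F'" using FF by blast
    qed
    have "C i \<subseteq> C (Suc i)" using C by (simp add: flag_def)
    then show "f ` C i <+>\<^bsub>N\<^esub> E' \<subseteq> f ` C (Suc i) <+>\<^bsub>N\<^esub> E'"
      unfolding set_add_def set_mult_def by blast
  qed
  moreover have "steps C k \<le> steps D k"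
  proof (rule steps_le, rule notI)
    fix i assume ne: "C i \<noteq> C (Suc i)" and eq: "D i = D (Suc i)"
    have inc: "C i \<subseteq> C (Suc i)" using C by (simp add: flag_def)
    have "x \<in> C i" if x: "x \<in> C (Suc i)" for x
    proof -
      have "f x \<in> D i" unfolding eq using x N.set_add_upper1[OF fs E'] by (auto simp: D_def)
      then obtain c e where ce: "c \<in> C i" "e \<in> E'" "f x = f c \<oplus>\<^bsub>N\<^esub> e" by (auto simp: D_def N.set_add_iff)
      have car: "c \<in> carrier M" "x \<in> carrier M" "e \<in> carrier N"
        using ce x M.submoduleD(1)[OF Cs] N.submoduleD(1)[OF E'] by blast+
      have fc: "f c \<in> carrier N" using car mod_homD(1)[OF f] by simp
      have "f (x \<ominus>\<^bsub>M\<^esub> c) = f x \<ominus>\<^bsub>N\<^esub> f c" by (rule mod_hom_diff[OF M N f car(2,1)])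
      also have "\<dots> = e" using ce(3) car fc by (simp add: N.M.add_diff_cancel_left)
      finally have "f (x \<ominus>\<^bsub>M\<^esub> c) \<in> E'" using ce by simp
      moreover have "x \<ominus>\<^bsub>M\<^esub> c \<in> C (Suc i)" using x ce inc by (intro M.submodule_diff[OF Cs]) auto
      ultimately have "x \<ominus>\<^bsub>M\<^esub> c \<in> C i" using inj[of "x \<ominus>\<^bsub>M\<^esub> c"] C unfolding flag_def by blast
      then have "(x \<ominus>\<^bsub>M\<^esub> c) \<oplus>\<^bsub>M\<^esub> c \<in> C i" using ce Cs[of i] by (auto simp: M.submodule_iff)
      moreover have "(x \<ominus>\<^bsub>M\<^esub> c) \<oplus>\<^bsub>M\<^esub> c = x"
        using car by (simp add: M.M.minus_eq M.M.a_assoc M.M.l_neg)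
      ultimately show "x \<in> C i" by simp
    qed
    then show False using inc ne by blast
  qed
  ultimately show "steps C k \<le> b" using len unfolding length_le_def by (meson order_trans)
qed

text \<open>Dually, the preimages in \<open>F\<close> of a flag between \<open>E'\<close> and
  \<open>F'\<close> form a flag above \<open>E\<close>. Strict steps survive because every element
  of \<open>F'\<close> comes from \<open>F\<close> modulo \<open>E'\<close>.\<close>

lemma length_le_surj:
  assumes M: "left_module A M" and N: "left_module A N" and f: "f \<in> mod_hom A M N"
    and F: "submodule F A M" and E: "E \<subseteq> F"
    and EE: "f ` E \<subseteq> E'" and surj: "F' \<subseteq> f ` F <+>\<^bsub>N\<^esub> E'" and len: "length_le A M E F b"
  shows "length_le A N E' F' b"
  unfolding length_le_def
proof (intro allI impI)
  interpret M: left_module A M by fact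
  interpret N: left_module A N by fact
  fix C k assume C: "flag A N E' F' C"
  have Cs: "submodule (C i) A N" for i using C by (simp add: flag_def)
  define D where "D i = {x \<in> carrier M. f x \<in> C i} \<inter> F" for i
  have Fc: "F \<subseteq> carrier M" using F by (simp add: M.submodule_iff)
  have "flag A M E F D"
    unfolding flag_def D_def
  proof (intro allI conjI)
    fix i
    show "submodule ({x \<in> carrier M. f x \<in> C i} \<inter> F) A M"
      by (intro M.submodule_Int mod_hom_vimage_submodule[OF M N f Cs] F)
    show "E \<subseteq> {x \<in> carrier M. f x \<in> C i} \<inter> F"
      proof -
      have "E' \<subseteq> C i" using C by (simp add: flag_def)
      then show ?thesis using E EE Fc by blast
    qed
    show "{x \<in> carrier M. f x \<in> C i} \<inter> F \<subseteq> {x \<in> carrier M. f x \<in> C (Suc i)} \<inter> F"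
      using C by (auto simp: flag_def)
  qed auto
  moreover have "steps C k \<le> steps D k"
  proof (rule steps_le, rule notI)
    fix i assume ne: "C i \<noteq> C (Suc i)" and eq: "D i = D (Suc i)"
    have inc: "C i \<subseteq> C (Suc i)" using C by (simp add: flag_def)
    have "y \<in> C i" if y: "y \<in> C (Suc i)" for y
    proof -
      have "y \<in> F'" using y C by (auto simp: flag_def)
      then obtain x e where xe: "x \<in> F" "e \<in> E'" "y = f x \<oplus>\<^bsub>N\<^esub> e"
        using surj unfolding set_add_def set_mult_def by auto
      have e: "e \<in> C i" "e \<in> C (Suc i)" using xe C by (auto simp: flag_def)
      have car: "f x \<in> carrier N" "e \<in> carrier N" using xe Fc mod_homD(1)[OF f] e(1) Cs[of i] by (auto simp: N.submodule_iff)
      have "f x = y \<ominus>\<^bsub>N\<^esub> e" using xe car by (simp add: N.M.minus_eq N.M.a_assoc N.M.r_neg)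
      then have "f x \<in> C (Suc i)" using N.submodule_diff[OF Cs y e(2)] by simp
      then have "x \<in> D (Suc i)" using xe Fc by (auto simp: D_def)
      then have "f x \<in> C i" using eq by (auto simp: D_def)
      then show "y \<in> C i" using xe e(1) Cs[of i] by (auto simp: N.submodule_iff)
    qed
    then show False using inc ne by blast
  qed
  ultimately show "steps C k \<le> b" using len unfolding length_le_def by (meson order_trans)
qed

section \<open>Finite length of finitely generated modules\<close>

lemma regular_module_simps [simp]:
  "carrier (regular_module A) = carrier A" "zero (regular_module A) = zero A"
  "add (regular_module A) = add A" "smult (regular_module A) = mult A"
  by (simp_all add: regular_module_def)

lemma regular_module_minus [simp]: "a_inv (regular_module A) = a_inv A"
  by (simp add: a_inv_def m_inv_def fun_eq_iff)

lemma restrict_scalars_simps [simp]: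
  "carrier (restrict_scalars f X) = carrier X" "zero (restrict_scalars f X) = zero X"
  "add (restrict_scalars f X) = add X" "smult (restrict_scalars f X) a x = f a \<odot>\<^bsub>X\<^esub> x"
  by (simp_all add: restrict_scalars_def)

lemma regular_left_module:
  assumes "ring A" shows "left_module A (regular_module A)"
proof -
  interpret ring A by fact
  have "abelian_group (regular_module A)"
  proof (rule abelian_groupI)
    fix x assume "x \<in> carrier (regular_module A)"
    then show "\<exists>y\<in>carrier (regular_module A). y \<oplus>\<^bsub>regular_module A\<^esub> x = \<zero>\<^bsub>regular_module A\<^esub>"
      by (intro bexI[of _ "\<ominus>\<^bsub>A\<^esub> x"]) (auto simp: l_neg)
  qed (auto simp: a_ac)
  then show ?thesis
    by (intro left_module.intro left_module_axioms.intro) (auto simp: ring_axioms l_distr r_distr m_assoc)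
qed

lemma regular_mod_hom:
  assumes "left_module A M" "v \<in> carrier M"
  shows "(\<lambda>a. a \<odot>\<^bsub>M\<^esub> v) \<in> mod_hom A (regular_module A) M"
proof -
  interpret left_module A M by fact
  show ?thesis using assms(2) by (intro mod_homI) (auto simp: smult_l_distr smult_assoc1)
qed

text \<open>A structure with fewer submodules has fewer flags. This carries finite length from the
  ground ring up to the algebra.\<close>

lemma finite_length_weaken:
  "finite_length A M E F \<Longrightarrow> (\<And>H. submodule H B N \<Longrightarrow> submodule H A M) \<Longrightarrow> finite_length B N E F"
  unfolding finite_length_def length_le_def flag_def by meson

lemma rel_length_inj:
  assumes "left_module A M" "left_module A N" "f \<in> mod_hom A M N"
    "submodule F A M" "submodule E' A N" "submodule F' A N" "E' \<subseteq> F'"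
    "f ` F \<subseteq> F'" "\<And>x. x \<in> F \<Longrightarrow> f x \<in> E' \<Longrightarrow> x \<in> E" "finite_length A N E' F'"
  shows "finite_length A M E F" and "rel_length A M E F \<le> rel_length A N E' F'"
proof -
  have "length_le A M E F (rel_length A N E' F')"
    by (rule length_le_inj[OF assms(1-9) length_le_rel_length[OF assms(10)]])
  then show "finite_length A M E F" "rel_length A M E F \<le> rel_length A N E' F'"
    by (auto simp: finite_length_def intro: rel_length_le)
qed

lemma rel_length_surj:
  assumes "left_module A M" "left_module A N" "f \<in> mod_hom A M N"
    "submodule F A M" "E \<subseteq> F" "f ` E \<subseteq> E'" "F' \<subseteq> f ` F <+>\<^bsub>N\<^esub> E'" "finite_length A M E F"
  shows "finite_length A N E' F'" and "rel_length A N E' F' \<le> rel_length A M E F"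
proof -
  have "length_le A N E' F' (rel_length A M E F)"
    by (rule length_le_surj[OF assms(1-7) length_le_rel_length[OF assms(8)]])
  then show "finite_length A N E' F'" "rel_length A N E' F' \<le> rel_length A M E F"
    by (auto simp: finite_length_def intro: rel_length_le)
qed

lemma finite_length_trivial: "finite_length A M E E"
proof -
  have "steps C k = 0" if "flag A M E E C" for C k
    proof -
    have "C i = E" for i using that unfolding flag_def by blast
    then show ?thesis by (simp add: steps_def)
  qed
  then show ?thesis unfolding finite_length_def length_le_def by (intro exI[of _ 0]) simp
qed

lemma submodule_restrict_scalars:
  assumes "\<rho> \<in> ring_hom B A" "ring B" "left_module A M" "submodule H A M"
  shows "submodule H B (restrict_scalars \<rho> M)"
proof -
  interpret M: left_module A M by fact
  interpret N: left_module B "restrict_scalars \<rho> M" by (rule restrict_scalars_left_module[OF assms(2,1,3)])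
  show ?thesis using assms(4) ring_hom_closed[OF assms(1)] by (auto simp: M.submodule_iff N.submodule_iff)
qed

text \<open>Otherwise dependent choice produces a strictly descending sequence of ideals.\<close>

lemma artinian_minimal_ideal:
  assumes R: "artinian_cring R" and S: "a \<in> S" and ideals: "\<And>a. a \<in> S \<Longrightarrow> ideal a R"
  obtains m where "m \<in> S" "\<And>b. b \<in> S \<Longrightarrow> \<not> b \<subset> m"
proof -
  have "\<exists>m\<in>S. \<forall>b\<in>S. \<not> b \<subset> m"
  proof (rule ccontr)
    assume *: "\<not> (\<exists>m\<in>S. \<forall>b\<in>S. \<not> b \<subset> m)"
    have "\<exists>F. \<forall>n::nat. F n \<in> S \<and> F (Suc n) \<subset> F n"
      by (rule dependent_nat_choice) (use S * in auto)
    then obtain F where F: "\<And>n::nat. F n \<in> S" "\<And>n. F (Suc n) \<subset> F n" by blast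
    then have "\<exists>n. \<forall>m\<ge>n. F m = F n"
      using R ideals unfolding artinian_cring_def by (metis psubset_imp_subset)
    then obtain n where n: "\<And>m. m \<ge> n \<Longrightarrow> F m = F n" by blast
    then show False using F(2)[of n] n[OF le_SucI[OF order_refl]] by (metis psubset_eq)
  qed
  then show thesis using that by blast
qed

text \<open>The ideals generated by the powers of \<open>x\<close> stabilise, so x^n = y x^(n+1) for
  some \<open>n\<close> and \<open>y\<close>. As \<open>x\<close> maps \<open>a\<close> onto itself,
  every \<open>z\<close> in \<open>a\<close> has the form x^n z', whence y (x z) = y x^(n+1) z' =
  x^n z' = z.\<close>

lemma artinian_invertible_on:
  assumes R: "artinian_cring R" and x: "x \<in> carrier R" and a: "a \<subseteq> carrier R"
    and xa: "(\<lambda>z. x \<otimes>\<^bsub>R\<^esub> z) ` a = a"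
  obtains y where "y \<in> carrier R" "\<And>z. z \<in> a \<Longrightarrow> y \<otimes>\<^bsub>R\<^esub> (x \<otimes>\<^bsub>R\<^esub> z) = z"
proof -
  interpret cring R using R by (simp add: artinian_cring_def)
  define F where "F n = PIdl\<^bsub>R\<^esub> (x [^]\<^bsub>R\<^esub> n)" for n :: nat
  have "ideal (F n) R" for n unfolding F_def using x by (simp add: cgenideal_ideal)
  moreover have "F (Suc n) \<subseteq> F n" for n
  proof
    fix z assume "z \<in> F (Suc n)"
    then obtain r where r: "r \<in> carrier R" "z = r \<otimes>\<^bsub>R\<^esub> (x [^]\<^bsub>R\<^esub> Suc n)"
      unfolding F_def cgenideal_def by blast
    then have "z = (r \<otimes>\<^bsub>R\<^esub> x) \<otimes>\<^bsub>R\<^esub> x [^]\<^bsub>R\<^esub> n" using x by (simp add: m_ac)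
    then show "z \<in> F n" unfolding F_def cgenideal_def using r x by blast
  qed
  ultimately obtain n where n: "\<And>m. m \<ge> n \<Longrightarrow> F m = F n"
    using R unfolding artinian_cring_def by metis
  have "F (Suc n) = F n" by (rule n) simp
  moreover have "x [^]\<^bsub>R\<^esub> n \<in> F n" unfolding F_def using x by (simp add: cgenideal_self)
  ultimately obtain y where y: "y \<in> carrier R" "x [^]\<^bsub>R\<^esub> n = y \<otimes>\<^bsub>R\<^esub> (x [^]\<^bsub>R\<^esub> Suc n)"
    unfolding F_def cgenideal_def by blast
  have surj: "\<exists>z'\<in>a. z = x [^]\<^bsub>R\<^esub> k \<otimes>\<^bsub>R\<^esub> z'" if "z \<in> a" for z and k :: nat
    using that
  proof (induction k arbitrary: z)
    case 0 then show ?case using a by (auto intro!: bexI[of _ z])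
  next
    case (Suc k)
    then obtain z' where z': "z' \<in> a" "z = x [^]\<^bsub>R\<^esub> k \<otimes>\<^bsub>R\<^esub> z'" by blast
    then obtain z'' where "z'' \<in> a" "z' = x \<otimes>\<^bsub>R\<^esub> z''" using xa by (metis imageE)
    then show ?case using z' x a by (intro bexI[of _ z'']) (auto simp: m_assoc subset_iff)
  qed
  show thesis
  proof (rule that[OF y(1)])
    fix z assume "z \<in> a"
    then obtain z' where z': "z' \<in> a" "z = x [^]\<^bsub>R\<^esub> n \<otimes>\<^bsub>R\<^esub> z'" using surj by blast
    have c: "z' \<in> carrier R" using z' a by auto
    have "y \<otimes>\<^bsub>R\<^esub> (x \<otimes>\<^bsub>R\<^esub> z) = (y \<otimes>\<^bsub>R\<^esub> (x [^]\<^bsub>R\<^esub> Suc n)) \<otimes>\<^bsub>R\<^esub> z'" using z' c x y(1) by (simp add: m_ac)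
    then show "y \<otimes>\<^bsub>R\<^esub> (x \<otimes>\<^bsub>R\<^esub> z) = z" unfolding y(2)[symmetric] z'(2)[symmetric] .
  qed
qed

text \<open>Akizuki's theorem in the form needed here.  An ideal \<open>a\<close> minimal among those of infinite
  length is a vector space over the field \<open>R / ann a\<close>, because every scalar acts on it by zero or
  invertibly, while all its proper subspaces have finite length; a hyperplane then gives a contradiction.\<close>

lemma artinian_finite_length:
  assumes R: "artinian_cring R"
  shows "finite_length R (regular_module R) {\<zero>\<^bsub>R\<^esub>} (carrier R)"
proof (rule ccontr)
  interpret cring R using R by (simp add: artinian_cring_def)
  let ?M = "regular_module R"
  interpret L: left_module R ?M by (rule regular_left_module) (rule ring_axioms)
  have LM: "left_module R ?M" by (rule L.left_module_axioms)
  let ?fin = "finite_length R ?M"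
  assume "\<not> ?fin {\<zero>\<^bsub>R\<^esub>} (carrier R)"
  then have S: "carrier R \<in> {a. submodule a R ?M \<and> \<not> ?fin {\<zero>\<^bsub>R\<^esub>} a}"
    using L.submodule_carrier by simp
  have id: "ideal a R" if a: "submodule a R ?M" for a
  proof (rule idealI)
    show "subgroup a (add_monoid R)"
      using L.submoduleD[OF a] L.submodule_minus[OF a]
      by (intro add.subgroupI) (auto simp: a_inv_def[symmetric])
    fix z x assume "z \<in> a" "x \<in> carrier R"
    then show "x \<otimes>\<^bsub>R\<^esub> z \<in> a" using L.submoduleD(4)[OF a, of x z] by simp
    then show "z \<otimes>\<^bsub>R\<^esub> x \<in> a" using \<open>z \<in> a\<close> \<open>x \<in> carrier R\<close> L.submoduleD(1)[OF a, of z] by (simp add: m_comm)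
  qed (rule ring_axioms)
  obtain a where a: "submodule a R ?M" "\<not> ?fin {\<zero>\<^bsub>R\<^esub>} a"
    and min: "\<And>b. submodule b R ?M \<Longrightarrow> \<not> ?fin {\<zero>\<^bsub>R\<^esub>} b \<Longrightarrow> \<not> b \<subset> a"
  proof (rule artinian_minimal_ideal[OF R S])
    fix a assume "a \<in> {a. submodule a R ?M \<and> \<not> ?fin {\<zero>\<^bsub>R\<^esub>} a}"
    then show "ideal a R" using id by simp
  next
    fix m assume "m \<in> {a. submodule a R ?M \<and> \<not> ?fin {\<zero>\<^bsub>R\<^esub>} a}"
      and "\<And>b. b \<in> {a. submodule a R ?M \<and> \<not> ?fin {\<zero>\<^bsub>R\<^esub>} a} \<Longrightarrow> \<not> b \<subset> m"
    then show thesis by (intro that[of m]) simp_all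
  qed
  have ac: "a \<subseteq> carrier R" using a by (auto simp: L.submodule_iff)
  have proper: "?fin {\<zero>\<^bsub>R\<^esub>} b" if "submodule b R ?M" "b \<subseteq> a" "b \<noteq> a" for b
    using min that by blast
  have mu: "(\<lambda>z. x \<otimes>\<^bsub>R\<^esub> z) \<in> mod_hom R ?M ?M" if "x \<in> carrier R" for x
    using that by (intro mod_homI) (auto simp: r_distr m_ac)
  \<comment> \<open>If the image and the kernel of multiplication by \<open>x\<close> on
    \<open>a\<close> were both proper, both would have finite length by minimality of
    \<open>a\<close>, and then so would \<open>a\<close>.\<close>
  have act: "(\<lambda>z. x \<otimes>\<^bsub>R\<^esub> z) ` a = a \<or> (\<forall>z\<in>a. x \<otimes>\<^bsub>R\<^esub> z = \<zero>\<^bsub>R\<^esub>)" if x: "x \<in> carrier R" for x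
  proof (rule ccontr)
    let ?f = "\<lambda>z. x \<otimes>\<^bsub>R\<^esub> z"
    assume *: "\<not> (?f ` a = a \<or> (\<forall>z\<in>a. x \<otimes>\<^bsub>R\<^esub> z = \<zero>\<^bsub>R\<^esub>))"
    have im: "submodule (?f ` a) R ?M" by (rule mod_hom_image_submodule[OF LM LM mu[OF x] a(1)])
    have "?f ` a \<subseteq> a" using x L.submoduleD(4)[OF a(1), of x] by auto
    then have f1: "?fin {\<zero>\<^bsub>R\<^esub>} (?f ` a)" using proper[OF im] * by blast
    define K where "K = {z \<in> carrier R. x \<otimes>\<^bsub>R\<^esub> z \<in> {\<zero>\<^bsub>R\<^esub>}} \<inter> a"
    have "submodule {z \<in> carrier ?M. x \<otimes>\<^bsub>R\<^esub> z \<in> {\<zero>\<^bsub>R\<^esub>}} R ?M"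
      by (rule mod_hom_vimage_submodule[OF LM LM mu[OF x]]) (use L.submodule_zero in simp)
    then have K: "submodule K R ?M" unfolding K_def using L.submodule_Int[OF _ a(1)] by simp
    have "?fin K a"
    proof (rule rel_length_inj(1)[OF LM LM mu[OF x] a(1) _ im _ order_refl _ f1])
      show "submodule {\<zero>\<^bsub>R\<^esub>} R ?M" using L.submodule_zero by simp
      show "{\<zero>\<^bsub>R\<^esub>} \<subseteq> ?f ` a" using L.submoduleD(2)[OF im] by simp
    qed (use ac in \<open>auto simp: K_def\<close>)
    moreover have "?fin {\<zero>\<^bsub>R\<^esub>} K" by (rule proper[OF K]) (use * ac in \<open>auto simp: K_def\<close>)
    ultimately have "?fin {\<zero>\<^bsub>R\<^esub>} a"
      using L.finite_length_add[OF K a(1), of "{\<zero>\<^bsub>R\<^esub>}"] L.submoduleD(2)[OF K] by (auto simp: K_def)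
    then show False using a by simp
  qed
  have "a \<noteq> {\<zero>\<^bsub>R\<^esub>}" using a finite_length_trivial by metis
  then obtain a0 where a0: "a0 \<in> a" "a0 \<noteq> \<zero>\<^bsub>R\<^esub>" using L.submoduleD(2)[OF a(1)] by auto
  \<comment> \<open>A member of \<open>Z\<close> maximal by Zorn's lemma, a submodule of
    \<open>a\<close> that just avoids \<open>a0\<close>, is the hyperplane.\<close>
  define Z where "Z = {b. submodule b R ?M \<and> b \<subseteq> a \<and> a0 \<notin> b}"
  have "\<exists>b\<in>Z. \<forall>c\<in>Z. b \<subseteq> c \<longrightarrow> c = b"
  proof (rule subset_Zorn_nonempty)
    have "{\<zero>\<^bsub>R\<^esub>} \<in> Z" using L.submodule_zero L.submoduleD(2)[OF a(1)] a0 by (auto simp: Z_def)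
    then show "Z \<noteq> {}" by blast
  next
    fix C assume C: "C \<noteq> {}" "subset.chain Z C"
    have CZ: "submodule b R ?M" "b \<subseteq> a" "a0 \<notin> b" if "b \<in> C" for b
      using C(2) that by (auto simp: subset.chain_def Z_def)
    have "submodule (\<Union>C) R ?M"
    proof (rule L.left_submoduleI)
      show "\<Union>C \<subseteq> carrier ?M" using CZ(2) ac by auto
      show "\<Union>C \<noteq> {}" using C(1) CZ(1) L.submoduleD(2) by blast
    next
      fix x y assume "x \<in> \<Union>C" "y \<in> \<Union>C"
      then obtain b c where bc: "b \<in> C" "c \<in> C" "x \<in> b" "y \<in> c" by blast
      then have "b \<subseteq> c \<or> c \<subseteq> b" using C(2) by (auto simp: subset.chain_def)
      then show "x \<oplus>\<^bsub>?M\<^esub> y \<in> \<Union>C" using bc CZ(1) L.submoduleD(3) by blast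
    next
      fix r x assume "r \<in> carrier R" "x \<in> \<Union>C"
      then show "r \<odot>\<^bsub>?M\<^esub> x \<in> \<Union>C" using CZ(1) L.submoduleD(4) by blast
    qed
    then show "\<Union>C \<in> Z" using CZ by (auto simp: Z_def)
  qed
  then obtain b where b: "submodule b R ?M" "b \<subseteq> a" "a0 \<notin> b"
    and max: "\<And>c. submodule c R ?M \<Longrightarrow> c \<subseteq> a \<Longrightarrow> a0 \<notin> c \<Longrightarrow> b \<subseteq> c \<Longrightarrow> c = b"
    by (auto simp: Z_def)
  \<comment> \<open>For \<open>c\<close> outside \<open>b\<close>, maximality of \<open>b\<close>
    gives \<open>a0 = b' + r c\<close>. Here \<open>r\<close> does not annihilate \<open>c\<close>,
    so it acts invertibly, and \<open>c\<close> is a multiple of \<open>a0 - b'\<close>; hence every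
    \<open>D\<close> that contains \<open>b\<close> and \<open>a0\<close> contains
    \<open>c\<close>.\<close>
  have simple: "D = b \<or> D = a" if D: "submodule D R ?M" "b \<subseteq> D" "D \<subseteq> a" for D
  proof (cases "a0 \<in> D")
    case False then show ?thesis using max D by blast
  next
    case a0D: True
    have "c \<in> D" if c: "c \<in> a" for c
    proof (cases "c \<in> b")
      case True then show ?thesis using D by auto
    next
      case False
      have cc: "c \<in> carrier R" using c ac by auto
      have hom: "(\<lambda>r. r \<otimes>\<^bsub>R\<^esub> c) \<in> mod_hom R ?M ?M" using regular_mod_hom[OF LM, of c] cc by simp
      have im: "submodule ((\<lambda>r. r \<otimes>\<^bsub>R\<^esub> c) ` carrier R) R ?M"
        using mod_hom_image_submodule[OF LM LM hom L.submodule_carrier] by simp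
      let ?E = "b <+>\<^bsub>?M\<^esub> (\<lambda>r. r \<otimes>\<^bsub>R\<^esub> c) ` carrier R"
      have E: "submodule ?E R ?M" by (rule L.submodule_set_add[OF b(1) im])
      have "c \<in> (\<lambda>r. r \<otimes>\<^bsub>R\<^esub> c) ` carrier R" using cc by (intro image_eqI[of _ _ "\<one>\<^bsub>R\<^esub>"]) auto
      then have "c \<in> ?E" using L.set_add_upper2[OF b(1) im] by blast
      then have ne: "?E \<noteq> b" using False by blast
      have "(\<lambda>r. r \<otimes>\<^bsub>R\<^esub> c) ` carrier R \<subseteq> a" using L.submoduleD(4)[OF a(1)] c by auto
      then have "?E \<subseteq> a" by (intro L.set_add_least[OF a(1) b(2)])
      then have "a0 \<in> ?E" using max[OF E] ne L.set_add_upper1[OF b(1) im] by blast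
      then obtain b' r where br: "b' \<in> b" "r \<in> carrier R" "a0 = b' \<oplus>\<^bsub>R\<^esub> r \<otimes>\<^bsub>R\<^esub> c"
        by (auto simp: L.set_add_iff)
      have bc: "b' \<in> carrier R" "a0 \<in> carrier R" using br b(2) ac a0 by auto
      have "r \<otimes>\<^bsub>R\<^esub> c \<noteq> \<zero>\<^bsub>R\<^esub>" using br bc b(3) by auto
      then have "(\<lambda>z. r \<otimes>\<^bsub>R\<^esub> z) ` a = a" using act[OF br(2)] c by blast
      then obtain y where y: "y \<in> carrier R" "\<And>z. z \<in> a \<Longrightarrow> y \<otimes>\<^bsub>R\<^esub> (r \<otimes>\<^bsub>R\<^esub> z) = z"
        using artinian_invertible_on[OF R br(2) ac] by blast
      have "r \<otimes>\<^bsub>R\<^esub> c = a0 \<ominus>\<^bsub>R\<^esub> b'" using br bc cc by (simp add: add_diff_cancel_left)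
      also have "\<dots> \<in> D"
        using L.submodule_diff[OF D(1) a0D, of b'] br D(2) by (auto simp: a_minus_def)
      finally have "y \<otimes>\<^bsub>R\<^esub> (r \<otimes>\<^bsub>R\<^esub> c) \<in> D" using L.submoduleD(4)[OF D(1) y(1), of "r \<otimes>\<^bsub>R\<^esub> c"] by simp
      then show "c \<in> D" using y(2)[OF c] by simp
    qed
    then show ?thesis using D by blast
  qed
  \<comment> \<open>A strict step of such a flag leads from \<open>b\<close> to \<open>a\<close> and
    hence occurs at most once.\<close>
  have "length_le R ?M b a 1"
    unfolding length_le_def
  proof (intro allI impI)
    fix C k assume C: "flag R ?M b a C"
    have step: "C i = b" "C (Suc i) = a" if "C i \<noteq> C (Suc i)" for i
      using that C simple[of "C i"] simple[of "C (Suc i)"] unfolding flag_def by blast+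
    have uniq: "i = j" if "C i \<noteq> C (Suc i)" "C j \<noteq> C (Suc j)" "i \<le> j" for i j
    proof (rule ccontr)
      assume "i \<noteq> j"
      then have "C (Suc i) \<subseteq> C j" using that by (intro flag_mono[OF C]) auto
      then show False using step[OF that(1)] step[OF that(2)] that(2) C unfolding flag_def by blast
    qed
    have "\<forall>i\<in>{i. i < k \<and> C i \<noteq> C (Suc i)}. \<forall>j\<in>{i. i < k \<and> C i \<noteq> C (Suc i)}. i = j"
    proof (intro ballI)
      fix i j assume "i \<in> {i. i < k \<and> C i \<noteq> C (Suc i)}" "j \<in> {i. i < k \<and> C i \<noteq> C (Suc i)}"
      then show "i = j" using uniq[of i j] uniq[of j i] by (cases "i \<le> j") auto
    qed
    then show "steps C k \<le> 1" unfolding steps_def by (subst One_nat_def, subst card_le_Suc0_iff_eq) auto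
  qed
  then have "?fin b a" unfolding finite_length_def by blast
  moreover have "?fin {\<zero>\<^bsub>R\<^esub>} b" using proper[OF b(1,2)] a0 b(3) by blast
  ultimately have "?fin {\<zero>\<^bsub>R\<^esub>} a"
    using L.finite_length_add[OF b(1) a(1), of "{\<zero>\<^bsub>R\<^esub>}"] L.submoduleD(2)[OF b(1)] b(2) by auto
  then show False using a by simp
qed

text \<open>Generators are adjoined one at a time; each enlarges the submodule by a cyclic one, an
  image of \<open>A\<close>, which has finite length over \<open>B\<close>.\<close>

lemma finite_length_fg:
  assumes B: "ring B" and \<rho>: "\<rho> \<in> ring_hom B A" and M: "fg_module A M"
    and fin: "finite_length B (restrict_scalars \<rho> (regular_module A)) {\<zero>\<^bsub>A\<^esub>} (carrier A)"
  shows "finite_length B (restrict_scalars \<rho> M) {\<zero>\<^bsub>M\<^esub>} (carrier M)"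
proof -
  interpret M: left_module A M using M by (simp add: fg_module_def)
  note LM = M.left_module_axioms
  have LA: "left_module A (regular_module A)" by (rule regular_left_module) (rule M.A.ring_axioms)
  let ?N = "restrict_scalars \<rho> M" and ?A = "restrict_scalars \<rho> (regular_module A)"
  have LN: "left_module B ?N" and LA': "left_module B ?A"
    by (rule restrict_scalars_left_module[OF B \<rho> LM], rule restrict_scalars_left_module[OF B \<rho> LA])
  interpret N: left_module B ?N by (rule LN)
  interpret RA: left_module B ?A by (rule LA')
  obtain S where S: "finite S" "S \<subseteq> carrier M"
    "\<And>H. submodule H A M \<Longrightarrow> S \<subseteq> H \<Longrightarrow> H = carrier M"
    by (rule finitely_generatedE[of A M]) (use M in \<open>auto simp: fg_module_def\<close>)
  have "\<exists>U. submodule U A M \<and> S \<subseteq> U \<and> finite_length B ?N {\<zero>\<^bsub>M\<^esub>} U"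
    using S(1,2)
  proof (induction S rule: finite_induct)
    case empty
    show ?case using M.submodule_zero finite_length_trivial by (intro exI[of _ "{\<zero>\<^bsub>M\<^esub>}"]) auto
  next
    case (insert v S)
    then obtain U where U: "submodule U A M" "S \<subseteq> U" "finite_length B ?N {\<zero>\<^bsub>M\<^esub>} U" by auto
    let ?f = "\<lambda>a. a \<odot>\<^bsub>M\<^esub> v"
    have v: "v \<in> carrier M" using insert by simp
    have f: "?f \<in> mod_hom A (regular_module A) M" by (rule regular_mod_hom[OF LM v])
    have im: "submodule (?f ` carrier A) A M"
      using mod_hom_image_submodule[OF LA LM f, of "carrier A"] left_module.submodule_carrier[OF LA] by simp
    have fB: "?f \<in> mod_hom B ?A ?N"
      using mod_homD[OF f] ring_hom_closed[OF \<rho>] by (intro mod_homI) auto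
    let ?V = "U <+>\<^bsub>M\<^esub> ?f ` carrier A"
    have V: "submodule ?V A M" by (rule M.submodule_set_add[OF U(1) im])
    have UB: "submodule U B ?N" "submodule ?V B ?N"
      by (rule submodule_restrict_scalars[OF \<rho> B LM U(1)], rule submodule_restrict_scalars[OF \<rho> B LM V])
    have "finite_length B ?N U ?V"
    proof (rule rel_length_surj(1)[OF LA' LN fB _ _ _ _ fin])
        show "submodule (carrier A) B ?A" using RA.submodule_carrier by simp
        show "?f ` {\<zero>\<^bsub>A\<^esub>} \<subseteq> U" using v M.submoduleD(2)[OF U(1)] by simp
        show "?V \<subseteq> ?f ` carrier A <+>\<^bsub>?N\<^esub> U"
        proof
          fix x assume "x \<in> ?V"
          then obtain u a where "u \<in> U" "a \<in> carrier A" "x = u \<oplus>\<^bsub>M\<^esub> ?f a" by (auto simp: M.set_add_iff)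
          moreover have "u \<oplus>\<^bsub>M\<^esub> ?f a = ?f a \<oplus>\<^bsub>M\<^esub> u"
            using calculation v M.submoduleD(1)[OF U(1)] by (simp add: M.a_comm)
          ultimately show "x \<in> ?f ` carrier A <+>\<^bsub>?N\<^esub> U" by (auto simp: N.set_add_iff)
        qed
    qed simp
    then have "finite_length B ?N {\<zero>\<^bsub>M\<^esub>} ?V"
      using N.finite_length_add[OF UB _ _ U(3)] M.submoduleD(2)[OF U(1)] M.set_add_upper1[OF U(1) im] by simp
    moreover have "v \<in> ?f ` carrier A" using v by (intro image_eqI[of _ _ "\<one>\<^bsub>A\<^esub>"]) auto
    then have "insert v S \<subseteq> ?V" using M.set_add_upper1[OF U(1) im] M.set_add_upper2[OF U(1) im] U(2) by blast
    ultimately show ?case using V by blast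
  qed
  then show ?thesis using S(3) by auto
qed

text \<open>If no finite set generated \<open>U\<close>, adjoining elements outside the span reached
  so far would give an infinite strictly increasing sequence of submodules.\<close>

lemma fg_submodule:
  assumes M: "left_module A M" and fin: "finite_length A M {\<zero>\<^bsub>M\<^esub>} (carrier M)" and U: "submodule U A M"
  shows "fg_module A (M\<lparr>carrier := U\<rparr>)"
proof -
  interpret M: left_module A M by fact
  interpret U: left_module A "M\<lparr>carrier := U\<rparr>" by (rule M.left_module_submodule[OF U])
  have "finitely_generated A (M\<lparr>carrier := U\<rparr>)"
  proof (rule ccontr)
    assume nfg: "\<not> finitely_generated A (M\<lparr>carrier := U\<rparr>)"
    \<comment> \<open>The span of \<open>T\<close>, provided that \<open>T\<close> is contained in
      \<open>U\<close>; otherwise the intersection runs over the empty family and is the whole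
      type.\<close>
    define sp where "sp T = \<Inter>{H. submodule H A M \<and> T \<subseteq> H \<and> H \<subseteq> U}" for T
    have sp_D: "x \<in> H" if "submodule H A M" "T \<subseteq> H" "H \<subseteq> U" "x \<in> sp T" for x H T
      using that by (simp add: sp_def)
    have sp_I: "x \<in> sp T" if "\<And>H. submodule H A M \<Longrightarrow> T \<subseteq> H \<Longrightarrow> H \<subseteq> U \<Longrightarrow> x \<in> H" for x T
      using that by (simp add: sp_def)
    have sp: "submodule (sp T) A M" "sp T \<subseteq> U" "T \<subseteq> sp T" if "T \<subseteq> U" for T
    proof -
      show "submodule (sp T) A M"
      proof (rule M.left_submoduleI)
        show "sp T \<subseteq> carrier M" using that M.submoduleD(1)[OF U] sp_D[OF U that order_refl] by blast
        have "\<zero>\<^bsub>M\<^esub> \<in> sp T" by (rule sp_I) (rule M.submoduleD(2))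
        then show "sp T \<noteq> {}" by blast
      next
        fix x y assume xy: "x \<in> sp T" "y \<in> sp T"
        show "x \<oplus>\<^bsub>M\<^esub> y \<in> sp T"
        proof (rule sp_I)
          fix H assume H: "submodule H A M" "T \<subseteq> H" "H \<subseteq> U"
          show "x \<oplus>\<^bsub>M\<^esub> y \<in> H" by (rule M.submoduleD(3)[OF H(1) sp_D[OF H xy(1)] sp_D[OF H xy(2)]])
        qed
      next
        fix a x assume ax: "a \<in> carrier A" "x \<in> sp T"
        show "a \<odot>\<^bsub>M\<^esub> x \<in> sp T"
        proof (rule sp_I)
          fix H assume H: "submodule H A M" "T \<subseteq> H" "H \<subseteq> U"
          show "a \<odot>\<^bsub>M\<^esub> x \<in> H" by (rule M.submoduleD(4)[OF H(1) ax(1) sp_D[OF H ax(2)]])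
        qed
      qed
      show "sp T \<subseteq> U" using sp_D[OF U that order_refl] by blast
      show "T \<subseteq> sp T" by (intro subsetI sp_I) (rule subsetD)
    qed
    have "\<exists>T. \<forall>n::nat. (finite (T n) \<and> T n \<subseteq> U) \<and> (T n \<subseteq> T (Suc n) \<and> \<not> T (Suc n) \<subseteq> sp (T n))"
    proof (rule dependent_nat_choice)
      fix T n assume T: "finite T \<and> T \<subseteq> U"
      have "\<exists>H. submodule H A (M\<lparr>carrier := U\<rparr>) \<and> T \<subseteq> H \<and> H \<noteq> U"
      proof (rule ccontr)
        assume "\<not> ?thesis"
        then have "\<forall>H. submodule H A (M\<lparr>carrier := U\<rparr>) \<and> T \<subseteq> H \<longrightarrow> H = carrier (M\<lparr>carrier := U\<rparr>)"
          by simp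
        then have "finitely_generated A (M\<lparr>carrier := U\<rparr>)"
          unfolding finitely_generated_def using T by (intro exI[of _ T]) simp
        then show False using nfg by contradiction
      qed
      then obtain H where H: "submodule H A M" "H \<subseteq> U" "T \<subseteq> H" "H \<noteq> U"
        unfolding M.submodule_of_submodule[OF U] by (elim exE conjE)
      then obtain x where "x \<in> U" "x \<notin> H" by blast
      then show "\<exists>T'. (finite T' \<and> T' \<subseteq> U) \<and> T \<subseteq> T' \<and> \<not> T' \<subseteq> sp T"
        using T H by (intro exI[of _ "insert x T"]) (auto simp: sp_def)
    qed auto
    then obtain T where T: "\<And>n::nat. T n \<subseteq> U" "\<And>n. T n \<subseteq> T (Suc n)" "\<And>n. \<not> T (Suc n) \<subseteq> sp (T n)" by auto
    have "\<exists>n. sp (T n) = sp (T (Suc n))"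
    proof (rule finite_length_inc_stable[OF fin], intro conjI)
      fix i
      show "submodule (sp (T i)) A M" by (rule sp[OF T(1)])
      then show "{\<zero>\<^bsub>M\<^esub>} \<subseteq> sp (T i)" "sp (T i) \<subseteq> carrier M" by (auto simp: M.submodule_iff)
      show "sp (T i) \<subseteq> sp (T (Suc i))" using T(2)[of i] by (auto simp: sp_def)
    qed
    then show False using T(3) sp(3)[OF T(1)] by metis
  qed
  then show ?thesis using U.left_module_axioms by (simp add: fg_module_def)
qed

section \<open>Finite length of modules over an Artin algebra\<close>

context artin_algebra
begin

text \<open>The structural homomorphism from \<open>R\<close> to the centre of \<open>A\<close>.
  Restriction of scalars along it makes \<open>A\<close>-modules into
  \<open>R\<close>-modules.\<close>

definition rho :: "'r \<Rightarrow> 'a" where "rho r = r \<odot>\<^bsub>A\<^esub> \<one>\<^bsub>A\<^esub>"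

lemma rho_closed [simp]: "r \<in> carrier R \<Longrightarrow> rho r \<in> carrier A"
  by (simp add: rho_def)

lemma rho_hom: "rho \<in> ring_hom R A"
proof (rule ring_hom_memI)
  fix r s assume rs: "r \<in> carrier R" "s \<in> carrier R"
  show "rho (r \<otimes>\<^bsub>R\<^esub> s) = rho r \<otimes>\<^bsub>A\<^esub> rho s"
    using rs smult_mult_left[of r "\<one>\<^bsub>A\<^esub>" "rho s"] by (simp add: rho_def smult_assoc1)
  show "rho (r \<oplus>\<^bsub>R\<^esub> s) = rho r \<oplus>\<^bsub>A\<^esub> rho s"
    using rs by (simp add: rho_def smult_l_distr)
qed (simp_all add: rho_def)

lemma rho_mult: "\<lbrakk>r \<in> carrier R; x \<in> carrier A\<rbrakk> \<Longrightarrow> rho r \<otimes>\<^bsub>A\<^esub> x = r \<odot>\<^bsub>A\<^esub> x"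
  using smult_mult_left[of r "\<one>\<^bsub>A\<^esub>" x] by (simp add: rho_def)

lemma rho_central: "\<lbrakk>r \<in> carrier R; x \<in> carrier A\<rbrakk> \<Longrightarrow> x \<otimes>\<^bsub>A\<^esub> rho r = rho r \<otimes>\<^bsub>A\<^esub> x"
  using smult_mult_right[of r x "\<one>\<^bsub>A\<^esub>"] rho_mult by (simp add: rho_def)

lemma ring_A: "ring A" by (rule ring_axioms)

lemma ring_R: "ring R" by (rule R.ring_axioms)

text \<open>Finiteness climbs in two steps: from \<open>R\<close> to the finitely generated
  \<open>R\<close>-module \<open>A\<close>, then from \<open>A\<close> to the finitely generated
  \<open>A\<close>-module \<open>M\<close>, with lengths always taken over \<open>R\<close>.\<close>

lemma finite_length_R:
  assumes M: "fg_module A M"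
  shows "finite_length R (restrict_scalars rho M) {\<zero>\<^bsub>M\<^esub>} (carrier M)"
proof (rule finite_length_fg[OF ring_R rho_hom M])
  have LA: "left_module R A"
    using R.ring_axioms M.abelian_group_axioms
    by (intro left_module.intro left_module_axioms.intro)
      (auto simp: smult_l_distr smult_r_distr smult_assoc1)
  then have fgA: "fg_module R A" using fin_gen by (simp add: fg_module_def)
  have id: "(\<lambda>x. x) \<in> ring_hom R R" by (rule ring_hom_memI) auto
  have LR: "left_module R (regular_module R)" by (rule regular_left_module) (rule ring_R)
  interpret LA: left_module R A by (rule LA)
  interpret LR: left_module R "regular_module R" by (rule LR)
  interpret LR': left_module R "restrict_scalars (\<lambda>x. x) (regular_module R)"
    by (rule restrict_scalars_left_module[OF ring_R id LR])
  interpret LA': left_module R "restrict_scalars (\<lambda>x. x) A"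
    by (rule restrict_scalars_left_module[OF ring_R id LA])
  interpret LA'': left_module R "restrict_scalars rho (regular_module A)"
    by (rule restrict_scalars_left_module[OF ring_R rho_hom regular_left_module[OF ring_A]])
  \<comment> \<open>\<open>finite_length_fg\<close> speaks of restricted modules, so its use over
    \<open>R\<close> itself restricts along the identity; the submodules are the same as
    before.\<close>
  have "finite_length R (restrict_scalars (\<lambda>x. x) (regular_module R)) {\<zero>\<^bsub>R\<^esub>} (carrier R)"
    by (rule finite_length_weaken[OF artinian_finite_length[OF artinian]])
      (simp add: LR.submodule_iff LR'.submodule_iff)
  from finite_length_fg[OF ring_R id fgA this]
  have "finite_length R (restrict_scalars (\<lambda>x. x) A) {\<zero>\<^bsub>A\<^esub>} (carrier A)" .
  then show "finite_length R (restrict_scalars rho (regular_module A)) {\<zero>\<^bsub>A\<^esub>} (carrier A)"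
    by (rule finite_length_weaken) (auto simp: LA'.submodule_iff LA''.submodule_iff rho_mult subset_iff)
qed

lemma finite_length_A:
  assumes M: "fg_module A M"
  shows "finite_length A M {\<zero>\<^bsub>M\<^esub>} (carrier M)"
  by (rule finite_length_weaken[OF finite_length_R[OF M]])
    (rule submodule_restrict_scalars[OF rho_hom ring_R], use M in \<open>auto simp: fg_module_def\<close>)

lemma fg_sub:
  assumes M: "fg_module A M" and U: "submodule U A M"
  shows "fg_module A (M\<lparr>carrier := U\<rparr>)"
  by (rule fg_submodule[OF _ finite_length_A[OF M] U]) (use M in \<open>simp add: fg_module_def\<close>)

end

section \<open>Fitting's lemma and projective covers\<close>

lemma (in abelian_group) diff_zero: "a \<in> carrier G \<Longrightarrow> a \<ominus> \<zero> = a"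
  by (metis add_diff_cancel_right r_zero zero_closed)

lemma fg_left_module: "fg_module A M \<Longrightarrow> left_module A M"
  by (simp add: fg_module_def)

lemma mod_hom_add:
  assumes "left_module A N" "f \<in> mod_hom A M N" "g \<in> mod_hom A M N"
  shows "(\<lambda>x. f x \<oplus>\<^bsub>N\<^esub> g x) \<in> mod_hom A M N"
proof -
  interpret N: left_module A N by fact
  show ?thesis
    using mod_homD[OF assms(2)] mod_homD[OF assms(3)]
    by (intro mod_homI) (simp_all add: N.smult_r_distr N.M.a_ac)
qed

lemma mod_hom_neg:
  assumes "left_module A N" "f \<in> mod_hom A M N"
  shows "(\<lambda>x. \<ominus>\<^bsub>N\<^esub> f x) \<in> mod_hom A M N"
proof -
  interpret N: left_module A N by fact
  show ?thesis
    using mod_homD[OF assms(2)]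
    by (intro mod_homI) (simp_all add: N.smult_r_minus N.M.minus_add)
qed

lemma mod_hom_sub:
  assumes "left_module A N" "f \<in> mod_hom A M N" "g \<in> mod_hom A M N"
  shows "(\<lambda>x. f x \<ominus>\<^bsub>N\<^esub> g x) \<in> mod_hom A M N"
  using mod_hom_add[OF assms(1,2) mod_hom_neg[OF assms(1,3)]] by (simp add: a_minus_def)

lemma mod_hom_const_zero: "left_module A N \<Longrightarrow> (\<lambda>x. \<zero>\<^bsub>N\<^esub>) \<in> mod_hom A M N"
proof -
  assume "left_module A N"
  then interpret N: left_module A N .
  show ?thesis by (intro mod_homI) simp_all
qed

lemma mod_hom_cong:
  assumes "left_module A M" "f \<in> mod_hom A M N" "\<And>x. x \<in> carrier M \<Longrightarrow> g x = f x"
  shows "g \<in> mod_hom A M N"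
proof -
  interpret M: left_module A M by fact
  show ?thesis using mod_homD[OF assms(2)] assms(3) by (intro mod_homI) simp_all
qed

lemma mod_hom_inv:
  assumes M: "left_module A M" and f: "f \<in> mod_hom A M N" and b: "bij_betw f (carrier M) (carrier N)"
  shows "inv_into (carrier M) f \<in> mod_hom A N M"
proof -
  interpret M: left_module A M by fact
  let ?g = "inv_into (carrier M) f"
  have inj: "inj_on f (carrier M)" and im: "f ` carrier M = carrier N" using b by (auto simp: bij_betw_def)
  have g: "?g y \<in> carrier M" "f (?g y) = y" if "y \<in> carrier N" for y
    using that im by (metis inv_into_into, metis f_inv_into_f)
  have eq: "?g (f x) = x" if "x \<in> carrier M" for x using inj that by simp
  note fD = mod_homD[OF f]
  show ?thesis
  proof (rule mod_homI)
    fix x y assume xy: "x \<in> carrier N" "y \<in> carrier N"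
    have "f (?g x \<oplus>\<^bsub>M\<^esub> ?g y) = x \<oplus>\<^bsub>N\<^esub> y" using g xy fD(2) by simp
    then show "?g (x \<oplus>\<^bsub>N\<^esub> y) = ?g x \<oplus>\<^bsub>M\<^esub> ?g y" using eq g xy by (metis M.M.add.m_closed)
  next
    fix a x assume ax: "a \<in> carrier A" "x \<in> carrier N"
    have "f (a \<odot>\<^bsub>M\<^esub> ?g x) = a \<odot>\<^bsub>N\<^esub> x" using g ax fD(3) by simp
    then show "?g (a \<odot>\<^bsub>N\<^esub> x) = a \<odot>\<^bsub>M\<^esub> ?g x" using eq g ax by (metis M.smult_closed)
  qed (rule g)
qed

lemma mod_hom_funpow: "f \<in> mod_hom A M M \<Longrightarrow> (f ^^ n) \<in> mod_hom A M M"
proof (induction n)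
  case 0 show ?case using mod_hom_id[of A M] by (simp add: id_def)
next
  case (Suc n)
  then show ?case using mod_hom_comp[of "f ^^ n" A M M f M] by (simp add: comp_def)
qed

lemma mod_hom_sub_incl:
  assumes "left_module A M" "submodule U A M" "f \<in> mod_hom A M N"
  shows "f \<in> mod_hom A (M\<lparr>carrier := U\<rparr>) N"
proof -
  interpret M: left_module A M by fact
  show ?thesis using mod_homD[OF assms(3)] M.submoduleD(1)[OF assms(2)] by (intro mod_homI) auto
qed

lemma mod_hom_into_sub:
  assumes "f \<in> mod_hom A N M" "\<And>x. x \<in> carrier N \<Longrightarrow> f x \<in> U"
  shows "f \<in> mod_hom A N (M\<lparr>carrier := U\<rparr>)"
  using mod_homD[OF assms(1)] assms(2) by (intro mod_homI) auto

lemma mod_hom_out_of_sub: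
  assumes "left_module A M" "submodule U A M" "f \<in> mod_hom A N (M\<lparr>carrier := U\<rparr>)"
  shows "f \<in> mod_hom A N M"
proof -
  interpret M: left_module A M by fact
  show ?thesis using mod_homD[OF assms(3)] M.submoduleD(1)[OF assms(2)] by (intro mod_homI) auto
qed

lemma mod_hom_kernel:
  assumes "left_module A M" "left_module A N" "f \<in> mod_hom A M N"
  shows "submodule (a_kernel M N f) A M"
proof -
  interpret N: left_module A N by fact
  show ?thesis
    using mod_hom_vimage_submodule[OF assms N.submodule_zero] by (simp add: a_kernel_def kernel_def)
qed

lemma a_kernel_iff: "x \<in> a_kernel M N f \<longleftrightarrow> x \<in> carrier M \<and> f x = \<zero>\<^bsub>N\<^esub>"
  by (simp add: a_kernel_def kernel_def)

section \<open>Direct decompositions and Fitting's lemma\<close>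

definition direct_decomposition :: "('a, 'k) ring_scheme \<Rightarrow> ('a, 'x, 'l) module_scheme \<Rightarrow> 'x set \<Rightarrow> 'x set \<Rightarrow> bool" where
  "direct_decomposition A M U V \<longleftrightarrow> submodule U A M \<and> submodule V A M \<and>
     U <+>\<^bsub>M\<^esub> V = carrier M \<and> U \<inter> V = {\<zero>\<^bsub>M\<^esub>}"

text \<open>The component in \<open>U\<close> is picked by \<open>SOME\<close>. Since
  \<open>U\<close> and \<open>V\<close> meet in zero it is unique, and uniqueness gives linearity
  and the values on both summands.\<close>

lemma direct_decomposition_projection:
  assumes M: "left_module A M" and d: "direct_decomposition A M U V"
  obtains p where "p \<in> mod_hom A M M" "\<And>x. x \<in> carrier M \<Longrightarrow> p x \<in> U"
    "\<And>x. x \<in> carrier M \<Longrightarrow> x \<ominus>\<^bsub>M\<^esub> p x \<in> V" "\<And>u. u \<in> U \<Longrightarrow> p u = u" "\<And>v. v \<in> V \<Longrightarrow> p v = \<zero>\<^bsub>M\<^esub>"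
proof -
  interpret M: left_module A M by fact
  have U: "submodule U A M" and V: "submodule V A M" and UV: "U \<inter> V = {\<zero>\<^bsub>M\<^esub>}" and sum: "U <+>\<^bsub>M\<^esub> V = carrier M"
    using d by (auto simp: direct_decomposition_def)
  note Uc = M.submoduleD(1)[OF U] and Vc = M.submoduleD(1)[OF V]
  define p where "p x = (SOME u. u \<in> U \<and> x \<ominus>\<^bsub>M\<^esub> u \<in> V)" for x
  have ex: "\<exists>u. u \<in> U \<and> x \<ominus>\<^bsub>M\<^esub> u \<in> V" if x: "x \<in> carrier M" for x
  proof -
    have "x \<in> U <+>\<^bsub>M\<^esub> V" using x sum by simp
    then obtain u v where "u \<in> U" "v \<in> V" "x = u \<oplus>\<^bsub>M\<^esub> v" by (auto simp: M.set_add_iff)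
    then show ?thesis using Uc Vc by (intro exI[of _ u]) (simp add: M.M.add_diff_cancel_left)
  qed
  have p: "p x \<in> U" "x \<ominus>\<^bsub>M\<^esub> p x \<in> V" if "x \<in> carrier M" for x
    using someI_ex[OF ex[OF that]] by (auto simp: p_def)
  have uniq: "p x = u" if x: "x \<in> carrier M" and u: "u \<in> U" "x \<ominus>\<^bsub>M\<^esub> u \<in> V" for x u
  proof -
    have c: "u \<in> carrier M" "p x \<in> carrier M" using u p x Uc by auto
    have "(x \<ominus>\<^bsub>M\<^esub> u) \<ominus>\<^bsub>M\<^esub> (x \<ominus>\<^bsub>M\<^esub> p x) \<in> V" by (rule M.submodule_diff[OF V u(2) p(2)[OF x]])
    moreover have "(x \<ominus>\<^bsub>M\<^esub> u) \<ominus>\<^bsub>M\<^esub> (x \<ominus>\<^bsub>M\<^esub> p x) = p x \<ominus>\<^bsub>M\<^esub> u"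
    proof -
      have "(x \<ominus>\<^bsub>M\<^esub> u) \<ominus>\<^bsub>M\<^esub> (x \<ominus>\<^bsub>M\<^esub> p x) = (x \<oplus>\<^bsub>M\<^esub> \<ominus>\<^bsub>M\<^esub> x) \<oplus>\<^bsub>M\<^esub> (p x \<oplus>\<^bsub>M\<^esub> \<ominus>\<^bsub>M\<^esub> u)"
        using x c by (simp add: M.M.minus_eq M.M.minus_add M.M.a_ac)
      then show ?thesis using x c by (simp add: M.M.r_neg M.M.minus_eq)
    qed
    moreover have "p x \<ominus>\<^bsub>M\<^esub> u \<in> U" by (rule M.submodule_diff[OF U p(1)[OF x] u(1)])
    ultimately have "p x \<ominus>\<^bsub>M\<^esub> u = \<zero>\<^bsub>M\<^esub>" using UV by auto
    then show ?thesis using c by (simp add: M.M.diff_eq_zero_iff)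
  qed
  show thesis
  proof (rule that)
    show "p \<in> mod_hom A M M"
    proof (rule mod_homI)
      fix x assume "x \<in> carrier M" then show "p x \<in> carrier M" using p Uc by blast
    next
      fix x y assume xy: "x \<in> carrier M" "y \<in> carrier M"
      have c: "p x \<in> carrier M" "p y \<in> carrier M" using xy p Uc by auto
      have "(x \<oplus>\<^bsub>M\<^esub> y) \<ominus>\<^bsub>M\<^esub> (p x \<oplus>\<^bsub>M\<^esub> p y) = (x \<ominus>\<^bsub>M\<^esub> p x) \<oplus>\<^bsub>M\<^esub> (y \<ominus>\<^bsub>M\<^esub> p y)"
        using xy c by (simp add: M.M.minus_eq M.M.minus_add M.M.a_ac)
      then show "p (x \<oplus>\<^bsub>M\<^esub> y) = p x \<oplus>\<^bsub>M\<^esub> p y"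
        using xy c p M.submoduleD(3)[OF U] M.submoduleD(3)[OF V] by (intro uniq) auto
    next
      fix a x assume ax: "a \<in> carrier A" "x \<in> carrier M"
      have c: "p x \<in> carrier M" using ax p Uc by auto
      have "a \<odot>\<^bsub>M\<^esub> x \<ominus>\<^bsub>M\<^esub> a \<odot>\<^bsub>M\<^esub> p x = a \<odot>\<^bsub>M\<^esub> (x \<ominus>\<^bsub>M\<^esub> p x)"
        using ax c by (simp add: M.M.minus_eq M.smult_r_distr M.smult_r_minus)
      then show "p (a \<odot>\<^bsub>M\<^esub> x) = a \<odot>\<^bsub>M\<^esub> p x"
        using ax p M.submoduleD(4)[OF U] M.submoduleD(4)[OF V] by (intro uniq) auto
    qed
    show "p u = u" if "u \<in> U" for u
      using that Uc M.submoduleD(2)[OF V] by (intro uniq) (auto simp: M.M.minus_eq M.M.r_neg)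
    show "p v = \<zero>\<^bsub>M\<^esub>" if "v \<in> V" for v
      using that Vc M.submoduleD(2)[OF U] by (intro uniq) (auto simp: M.M.diff_zero)
  qed (use p in auto)
qed

text \<open>Images of powers of \<open>f\<close> descend and kernels ascend. At an exponent where
  both are constant, image and kernel are complementary, and \<open>f\<close> is injective on the
  image.\<close>

lemma fitting:
  assumes M: "left_module A M" and fin: "finite_length A M {\<zero>\<^bsub>M\<^esub>} (carrier M)" and f: "f \<in> mod_hom A M M"
  obtains n where "0 < n" "direct_decomposition A M ((f ^^ n) ` carrier M) (a_kernel M M (f ^^ n))"
    "inj_on f ((f ^^ n) ` carrier M)"
proof -
  interpret M: left_module A M by fact
  define I where "I n = (f ^^ n) ` carrier M" for n
  define K where "K n = a_kernel M M (f ^^ n)" for n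
  note fn = mod_hom_funpow[OF f]
  note fnc = mod_homD(1)[OF fn]
  note fn0 = mod_hom_zero[OF M M fn]
  have I: "submodule (I n) A M" for n
    unfolding I_def by (rule mod_hom_image_submodule[OF M M fn M.submodule_carrier])
  have K: "submodule (K n) A M" for n
    unfolding K_def by (rule mod_hom_kernel[OF M M fn])
  have Idec: "I (Suc n) \<subseteq> I n" for n
    unfolding I_def funpow_Suc_right using mod_homD(1)[OF f] by auto
  have Kinc: "K n \<subseteq> K (Suc n)" for n
    using mod_hom_zero[OF M M f] by (auto simp: K_def a_kernel_iff)
  have "\<exists>n. I n = I (Suc n)"
    by (rule finite_length_dec_stable[OF fin]) (use I Idec M.submoduleD[OF I] in auto)
  then obtain i where i: "I i = I (Suc i)" by blast
  have "\<exists>n. K n = K (Suc n)"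
    by (rule finite_length_inc_stable[OF fin]) (use K Kinc M.submoduleD[OF K] in auto)
  then obtain k where k: "K k = K (Suc k)" by blast
  have Ii: "I m = I i" if "i \<le> m" for m
    using that
  proof (induction m rule: dec_induct)
    case (step m)
    have IS: "I (Suc n) = f ` I n" for n by (auto simp: I_def)
    have "I (Suc m) = f ` I i" unfolding IS step(3) ..
    also have "\<dots> = I i" using i IS by simp
    finally show ?case .
  qed simp
  have Kk: "K m = K k" if "k \<le> m" for m
    using that
  proof (induction m rule: dec_induct)
    case (step m)
    have KS: "K (Suc n) = {x \<in> carrier M. f x \<in> K n}" for n
      using mod_homD(1)[OF f] by (simp only: K_def set_eq_iff a_kernel_iff mem_Collect_eq funpow_Suc_right comp_def) blast
    have "K (Suc m) = {x \<in> carrier M. f x \<in> K k}" unfolding KS step(3) ..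
    also have "\<dots> = K k" using k KS by simp
    finally show ?case .
  qed simp
  \<comment> \<open>Large enough for both sequences to be constant from \<open>n\<close> on; the
    successor makes the exponent positive.\<close>
  define n where "n = Suc (i + k)"
  have II: "I n = I (n + n)" and KK: "K n = K (n + n)" using Ii[of n] Ii[of "n + n"] Kk[of n] Kk[of "n + n"]
    by (auto simp: n_def)
  have add: "(f ^^ (n + n)) x = (f ^^ n) ((f ^^ n) x)" for x by (simp add: funpow_add)
  have "direct_decomposition A M (I n) (K n)"
    unfolding direct_decomposition_def
  proof (intro conjI)
    have "x \<in> I n <+>\<^bsub>M\<^esub> K n" if x: "x \<in> carrier M" for x
    proof -
      have "(f ^^ n) x \<in> I (n + n)" using x II by (auto simp: I_def)
      then obtain y where y: "y \<in> carrier M" "(f ^^ n) x = (f ^^ n) ((f ^^ n) y)" by (auto simp: I_def add)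
      let ?z = "x \<ominus>\<^bsub>M\<^esub> (f ^^ n) y"
      have yc: "(f ^^ n) y \<in> carrier M" using fnc y by simp
      have "(f ^^ n) ?z = \<zero>\<^bsub>M\<^esub>"
        using mod_hom_diff[OF M M fn x yc, of n] y(2) fnc[OF yc] by (simp add: M.M.r_neg M.M.minus_eq)
      then have "?z \<in> K n" using x yc by (auto simp: K_def a_kernel_iff)
      moreover have "(f ^^ n) y \<in> I n" using y by (auto simp: I_def)
      moreover have "x = (f ^^ n) y \<oplus>\<^bsub>M\<^esub> ?z" using M.M.diff_add_cancel[OF x yc] x yc by (simp add: M.M.a_comm)
      ultimately show ?thesis unfolding M.set_add_iff by blast
    qed
    then show "I n <+>\<^bsub>M\<^esub> K n = carrier M"
      using M.set_add_least[OF M.submodule_carrier, of "I n" "K n"] M.submoduleD(1)[OF I] M.submoduleD(1)[OF K]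
      by (meson subsetI subset_antisym)
    have "z = \<zero>\<^bsub>M\<^esub>" if z: "z \<in> I n" "z \<in> K n" for z
    proof -
      obtain x where x: "x \<in> carrier M" "z = (f ^^ n) x" using z by (auto simp: I_def)
      then have "x \<in> K (n + n)" using z by (auto simp: K_def a_kernel_iff add)
      then show ?thesis using KK x by (auto simp: K_def a_kernel_iff)
    qed
    then show "I n \<inter> K n = {\<zero>\<^bsub>M\<^esub>}" using M.submoduleD(2)[OF I] M.submoduleD(2)[OF K] by blast
  qed (rule I, rule K)
  moreover have "inj_on f (I n)"
  proof (rule inj_onI)
    fix x y assume xy: "x \<in> I n" "y \<in> I n" "f x = f y"
    have c: "x \<in> carrier M" "y \<in> carrier M" using xy M.submoduleD(1)[OF I] by auto
    obtain z where z: "z \<in> carrier M" "x \<ominus>\<^bsub>M\<^esub> y = (f ^^ n) z"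
      using M.submodule_diff[OF I xy(1,2)] by (auto simp: I_def)
    have "f (x \<ominus>\<^bsub>M\<^esub> y) = \<zero>\<^bsub>M\<^esub>"
      using mod_hom_diff[OF M M f c] xy(3) mod_homD(1)[OF f c(2)] by (simp add: M.M.r_neg M.M.minus_eq)
    then have "z \<in> K (Suc n)" using z by (auto simp: K_def a_kernel_iff)
    then have "z \<in> K n" using Kk[of n] Kk[of "Suc n"] by (simp add: n_def)
    then have "x \<ominus>\<^bsub>M\<^esub> y = \<zero>\<^bsub>M\<^esub>" using z by (auto simp: K_def a_kernel_iff)
    then show "x = y" using c by (simp add: M.M.diff_eq_zero_iff)
  qed
  ultimately show thesis using that[of n] by (simp add: I_def K_def n_def)
qed

subsection \<open>Powers of a module\<close>

lemma mod_power_simps [simp]: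
  "carrier (mod_power N m) = (\<Pi>\<^sub>E i\<in>{..<m}. carrier N)"
  "zero (mod_power N m) = (\<lambda>i\<in>{..<m}. \<zero>\<^bsub>N\<^esub>)"
  "f \<oplus>\<^bsub>mod_power N m\<^esub> g = (\<lambda>i\<in>{..<m}. f i \<oplus>\<^bsub>N\<^esub> g i)"
  "a \<odot>\<^bsub>mod_power N m\<^esub> f = (\<lambda>i\<in>{..<m}. a \<odot>\<^bsub>N\<^esub> f i)"
  by (simp_all add: mod_power_def)

lemma mod_power_left_module:
  assumes "left_module A N" shows "left_module A (mod_power N m)"
proof -
  interpret N: left_module A N by fact
  have "abelian_group (mod_power N m)"
  proof (rule abelian_groupI)
    fix x assume x: "x \<in> carrier (mod_power N m)"
    then show "\<exists>y\<in>carrier (mod_power N m). y \<oplus>\<^bsub>mod_power N m\<^esub> x = \<zero>\<^bsub>mod_power N m\<^esub>"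
      by (intro bexI[of _ "\<lambda>i\<in>{..<m}. \<ominus>\<^bsub>N\<^esub> x i"]) (auto simp: N.M.l_neg PiE_iff fun_eq_iff)
  qed (auto simp: N.M.a_ac PiE_iff fun_eq_iff extensional_def)
  then show ?thesis
    by (intro left_module.intro left_module_axioms.intro)
      (auto simp: N.A.ring_axioms N.smult_l_distr N.smult_r_distr N.smult_assoc1 PiE_iff fun_eq_iff extensional_def)
qed

definition power_ins :: "('a, 'x, 'l) module_scheme \<Rightarrow> nat \<Rightarrow> nat \<Rightarrow> 'x \<Rightarrow> nat \<Rightarrow> 'x" where
  "power_ins N m i x = (\<lambda>j\<in>{..<m}. if j = i then x else \<zero>\<^bsub>N\<^esub>)"

text \<open>Raising \<open>j\<close> by one adds a single inserted coordinate, so induction on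
  \<open>j\<close> replaces the decomposition of an element into a finite sum of its
  coordinates.\<close>

definition power_trunc :: "('a, 'x, 'l) module_scheme \<Rightarrow> nat \<Rightarrow> nat \<Rightarrow> (nat \<Rightarrow> 'x) \<Rightarrow> nat \<Rightarrow> 'x" where
  "power_trunc N m j f = (\<lambda>i\<in>{..<m}. if i < j then f i else \<zero>\<^bsub>N\<^esub>)"

lemma power_ins_hom:
  assumes "left_module A N" shows "power_ins N m i \<in> mod_hom A N (mod_power N m)"
proof -
  interpret N: left_module A N by fact
  show ?thesis by (intro mod_homI) (auto simp: power_ins_def PiE_iff)
qed

lemma power_proj_hom:
  assumes "i < m" shows "(\<lambda>f. f i) \<in> mod_hom A (mod_power N m) N"
  using assms by (intro mod_homI) auto

lemma power_trunc_hom: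
  assumes "left_module A N" shows "power_trunc N m j \<in> mod_hom A (mod_power N m) (mod_power N m)"
proof -
  interpret N: left_module A N by fact
  show ?thesis by (intro mod_homI) (auto simp: power_trunc_def PiE_iff)
qed

lemma power_trunc_0: "power_trunc N m 0 f = \<zero>\<^bsub>mod_power N m\<^esub>"
  by (simp add: power_trunc_def)

lemma power_trunc_Suc:
  assumes "left_module A N" "f \<in> carrier (mod_power N m)" "j < m"
  shows "power_trunc N m (Suc j) f = power_trunc N m j f \<oplus>\<^bsub>mod_power N m\<^esub> power_ins N m j (f j)"
proof -
  interpret N: left_module A N by fact
  have "f i \<in> carrier N" if "i < m" for i using assms(2) that by (auto simp: PiE_iff)
  then show ?thesis using assms(3) by (auto simp: power_trunc_def power_ins_def fun_eq_iff less_Suc_eq)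
qed

lemma power_trunc_full: "f \<in> carrier (mod_power N m) \<Longrightarrow> power_trunc N m m f = f"
  by (auto simp: power_trunc_def fun_eq_iff PiE_iff extensional_def)

lemma mod_power_fg:
  assumes "fg_module A N" shows "fg_module A (mod_power N m)"
proof -
  have LN: "left_module A N" using assms by (rule fg_left_module)
  interpret N: left_module A N by (rule LN)
  have LP: "left_module A (mod_power N m)" by (rule mod_power_left_module[OF LN])
  interpret P: left_module A "mod_power N m" by (rule LP)
  obtain S where S: "finite S" "S \<subseteq> carrier N"
    "\<And>H. submodule H A N \<Longrightarrow> S \<subseteq> H \<Longrightarrow> H = carrier N"
    by (rule finitely_generatedE[of A N]) (use assms in \<open>auto simp: fg_module_def\<close>)
  define T where "T = (\<Union>i<m. power_ins N m i ` S)"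
  have "T \<subseteq> carrier (mod_power N m)"
    unfolding T_def
  proof (intro UN_least image_subsetI)
    fix i x assume "x \<in> S"
    then show "power_ins N m i x \<in> carrier (mod_power N m)"
      using S(2) mod_homD(1)[OF power_ins_hom[OF LN]] by blast
  qed
  moreover have "H = carrier (mod_power N m)" if H: "submodule H A (mod_power N m)" "T \<subseteq> H" for H
  proof -
    have ins: "power_ins N m i x \<in> H" if i: "i < m" and x: "x \<in> carrier N" for i x
    proof -
      have "{x \<in> carrier N. power_ins N m i x \<in> H} = carrier N"
        by (rule S(3)[OF mod_hom_vimage_submodule[OF LN LP power_ins_hom[OF LN] H(1)]])
          (use H(2) i S(2) in \<open>auto simp: T_def\<close>)
      then show ?thesis using x by blast
    qed
    have "f \<in> H" if f: "f \<in> carrier (mod_power N m)" for f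
    proof -
      have "power_trunc N m j f \<in> H" if "j \<le> m" for j
        using that
      proof (induction j)
        case 0 show ?case unfolding power_trunc_0 by (rule P.submoduleD(2)[OF H(1)])
      next
        case (Suc j)
        have "f j \<in> carrier N" using f Suc.prems by (auto simp: PiE_iff)
        then show ?case
          using Suc ins[of j "f j"] f P.submoduleD(3)[OF H(1)] power_trunc_Suc[OF LN f, of j]
            by (simp del: mod_power_simps)
      qed
      from this[of m] show ?thesis using power_trunc_full[OF f] by simp
    qed
    then show ?thesis using P.submoduleD(1)[OF H(1)] by blast
  qed
  moreover have "finite T" using S(1) by (simp add: T_def)
  ultimately show ?thesis using LP unfolding fg_module_def finitely_generated_def by blast
qed

subsection \<open>Projective modules\<close>

lemma projective_lift:
  fixes M N :: "('a, 'a fgcar) module"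
  assumes "projective_module A P" "fg_module A M" "fg_module A N" "g \<in> mod_epi A M N" "h \<in> mod_hom A P N"
  obtains k where "k \<in> mod_hom A P M" "\<And>x. x \<in> carrier P \<Longrightarrow> g (k x) = h x"
  using assms unfolding projective_module_def by meson

lemma projective_fg: "projective_module A P \<Longrightarrow> fg_module A P"
  by (simp add: projective_module_def)

lemma projective_retract:
  assumes P: "projective_module A P" and Q: "fg_module A Q"
    and s: "s \<in> mod_hom A Q P" and r: "r \<in> mod_hom A P Q" and rs: "\<And>x. x \<in> carrier Q \<Longrightarrow> r (s x) = x"
  shows "projective_module A Q"
  unfolding projective_module_def
proof (intro conjI Q allI impI ballI)
  fix M N :: "('a, 'a fgcar) module" and g h
  assume MN: "fg_module A M \<and> fg_module A N" and g: "g \<in> mod_epi A M N" and h: "h \<in> mod_hom A Q N"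
  obtain k where k: "k \<in> mod_hom A P M" "\<And>x. x \<in> carrier P \<Longrightarrow> g (k x) = h (r x)"
    using projective_lift[OF P _ _ g mod_hom_comp[OF r h]] MN by blast
  then show "\<exists>k\<in>mod_hom A Q M. \<forall>x\<in>carrier Q. g (k x) = h x"
    using mod_hom_comp[OF s k(1)] mod_homD(1)[OF s] rs by (intro bexI[of _ "\<lambda>x. k (s x)"]) auto
qed

text \<open>The regular module moved into the carrier type over which projectivity and syzygies
  quantify; a ring element is coded by the singleton of a constant sequence.\<close>

definition free_one :: "('a, 'k) ring_scheme \<Rightarrow> ('a, 'a fgcar) module" where
  "free_one A = transport_module (\<lambda>a. {\<lambda>_. a}) (regular_module A)"

lemma free_one_inj: "inj_on (\<lambda>a. {\<lambda>_. a}) S"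
  by (auto simp: inj_on_def fun_eq_iff)

context ring
begin

lemma regular_fg: "fg_module R (regular_module R)"
proof -
  have L: "left_module R (regular_module R)" by (rule regular_left_module) (rule ring_axioms)
  interpret L: left_module R "regular_module R" by (rule L)
  have "H = carrier R" if "submodule H R (regular_module R)" "\<one> \<in> H" for H
    using L.submoduleD(1)[OF that(1)] L.submoduleD(4)[OF that(1) _ that(2)] by auto
  then show ?thesis
    using L unfolding fg_module_def finitely_generated_def by (auto intro!: exI[of _ "{\<one>}"])
qed

lemma free_one_fg: "fg_module R (free_one R)"
  unfolding free_one_def fg_module_def
  using finitely_generated_transport[OF regular_fg free_one_inj]
    transport_module_left_module[OF fg_left_module[OF regular_fg] free_one_inj] by blast

lemma free_one_simps [simp]: "carrier (free_one R) = (\<lambda>a. {\<lambda>_. a}) ` carrier R"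
  "b \<in> carrier R \<Longrightarrow> a \<odot>\<^bsub>free_one R\<^esub> {\<lambda>_. b} = {\<lambda>_. a \<otimes> b}"
  unfolding free_one_def
  using transport_module_simps(1)[OF free_one_inj, of "regular_module R"]
    transport_module_simps(4)[OF free_one_inj, of b "regular_module R"] by simp_all

lemma free_one_iso: "(\<lambda>a. {\<lambda>_. a}) \<in> mod_iso R (regular_module R) (free_one R)"
  unfolding free_one_def
  by (rule transport_module_iso[OF fg_left_module[OF regular_fg] free_one_inj])

lemma free_one_hom:
  assumes M: "left_module R M" and v: "v \<in> carrier M"
  obtains f where "f \<in> mod_hom R (free_one R) M" "\<And>a. a \<in> carrier R \<Longrightarrow> f {\<lambda>_. a} = a \<odot>\<^bsub>M\<^esub> v"
proof -
  have L: "left_module R (regular_module R)" by (rule fg_left_module[OF regular_fg])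
  let ?g = "\<lambda>a. {\<lambda>_. a} :: (nat \<Rightarrow> 'a) set"
  have g: "?g \<in> mod_hom R (regular_module R) (free_one R)"
    and b: "bij_betw ?g (carrier (regular_module R)) (carrier (free_one R))"
    using free_one_iso by (auto simp: mod_iso_def)
  have "(\<lambda>x. inv_into (carrier (regular_module R)) ?g x \<odot>\<^bsub>M\<^esub> v) \<in> mod_hom R (free_one R) M"
    by (rule mod_hom_comp[OF mod_hom_inv[OF L g b] regular_mod_hom[OF M v]])
  then show thesis
    by (rule that) (simp add: inv_into_f_f[OF free_one_inj])
qed

lemma free_one_hom_eq:
  assumes f: "f \<in> mod_hom R (free_one R) M" and a: "a \<in> carrier R"
  shows "f {\<lambda>_. a} = a \<odot>\<^bsub>M\<^esub> f {\<lambda>_. \<one>}"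
  using mod_homD(3)[OF f a, of "{\<lambda>_. \<one>}"] a by simp

lemma free_one_projective: "projective_module R (free_one R)"
  unfolding projective_module_def
proof (intro conjI free_one_fg allI impI ballI)
  fix M N :: "('a, 'a fgcar) module" and g h
  assume MN: "fg_module R M \<and> fg_module R N" and g: "g \<in> mod_epi R M N" and h: "h \<in> mod_hom R (free_one R) N"
  have gh: "g \<in> mod_hom R M N" "g ` carrier M = carrier N" using g by (auto simp: mod_epi_def)
  have "h {\<lambda>_. \<one>} \<in> carrier N" using mod_homD(1)[OF h, of "{\<lambda>_. \<one>}"] by simp
  then have "h {\<lambda>_. \<one>} \<in> g ` carrier M" using gh(2) by simp
  then obtain v where v: "v \<in> carrier M" "g v = h {\<lambda>_. \<one>}" by (metis imageE)
  obtain k where k: "k \<in> mod_hom R (free_one R) M" "\<And>a. a \<in> carrier R \<Longrightarrow> k {\<lambda>_. a} = a \<odot>\<^bsub>M\<^esub> v"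
    using free_one_hom[OF fg_left_module v(1)] MN by blast
  have "g (k {\<lambda>_. a}) = h {\<lambda>_. a}" if "a \<in> carrier R" for a
    using k(2)[OF that] mod_homD(3)[OF gh(1) that v(1)] v(2) free_one_hom_eq[OF h that] by simp
  then show "\<exists>k\<in>mod_hom R (free_one R) M. \<forall>x\<in>carrier (free_one R). g (k x) = h x"
    using k(1) by (intro bexI[of _ k]) auto
qed

text \<open>A lift is built coordinate by coordinate: a lift of the truncation to \<open>j\<close>
  coordinates plus a lift on the next coordinate.\<close>

lemma mod_power_projective:
  assumes Q: "projective_module R Q" shows "projective_module R (mod_power Q m)"
  unfolding projective_module_def
proof (intro conjI mod_power_fg projective_fg[OF Q] allI impI ballI)
  let ?F = "mod_power Q m"
  fix M N :: "('a, 'a fgcar) module" and g h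
  assume MN: "fg_module R M \<and> fg_module R N" and g: "g \<in> mod_epi R M N" and h: "h \<in> mod_hom R ?F N"
  have gh: "g \<in> mod_hom R M N" using g by (auto simp: mod_epi_def)
  have LQ: "left_module R Q" and LM: "left_module R M" and LN: "left_module R N"
    using fg_left_module projective_fg[OF Q] MN by blast+
  have LF: "left_module R ?F" by (rule mod_power_left_module[OF LQ])
  have "\<exists>k\<in>mod_hom R ?F M. \<forall>x\<in>carrier ?F. g (k x) = h (power_trunc Q m j x)" if "j \<le> m" for j
    using that
  proof (induction j)
    case 0
    show ?case
      using mod_hom_const_zero[OF LM, of ?F] mod_hom_zero[OF LM LN gh] mod_hom_zero[OF LF LN h]
      by (intro bexI[of _ "\<lambda>_. \<zero>\<^bsub>M\<^esub>"]) (auto simp: power_trunc_0 simp del: mod_power_simps)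
  next
    case (Suc j)
    then obtain k where k: "k \<in> mod_hom R ?F M" "\<forall>x\<in>carrier ?F. g (k x) = h (power_trunc Q m j x)" by auto
    have "(\<lambda>x. h (power_ins Q m j x)) \<in> mod_hom R Q N" by (rule mod_hom_comp[OF power_ins_hom[OF LQ] h])
    then obtain l where l: "l \<in> mod_hom R Q M" "\<And>x. x \<in> carrier Q \<Longrightarrow> g (l x) = h (power_ins Q m j x)"
      using projective_lift[OF Q _ _ g] MN by blast
    have j: "j < m" using Suc.prems by simp
    have l': "(\<lambda>x. l (x j)) \<in> mod_hom R ?F M" by (rule mod_hom_comp[OF power_proj_hom[OF j] l(1)])
    show ?case
    proof (intro bexI[of _ "\<lambda>x. k x \<oplus>\<^bsub>M\<^esub> l (x j)"] ballI)
      show "(\<lambda>x. k x \<oplus>\<^bsub>M\<^esub> l (x j)) \<in> mod_hom R ?F M" by (rule mod_hom_add[OF LM k(1) l'])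
      fix x assume x: "x \<in> carrier ?F"
      have xj: "x j \<in> carrier Q" by (rule mod_homD(1)[OF power_proj_hom[OF j] x])
      have "g (k x \<oplus>\<^bsub>M\<^esub> l (x j)) = g (k x) \<oplus>\<^bsub>N\<^esub> g (l (x j))"
        by (rule mod_homD(2)[OF gh mod_homD(1)[OF k(1) x] mod_homD(1)[OF l' x]])
      also have "\<dots> = h (power_trunc Q m j x) \<oplus>\<^bsub>N\<^esub> h (power_ins Q m j (x j))" using k(2) l(2) x xj by simp
      also have "\<dots> = h (power_trunc Q m (Suc j) x)"
        unfolding power_trunc_Suc[OF LQ x j]
        by (rule mod_homD(2)[OF h mod_homD(1)[OF power_trunc_hom[OF LQ] x] mod_homD(1)[OF power_ins_hom[OF LQ] xj], symmetric])
      finally show "g (k x \<oplus>\<^bsub>M\<^esub> l (x j)) = h (power_trunc Q m (Suc j) x)" .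
    qed
  qed
  from this[of m] show "\<exists>k\<in>mod_hom R ?F M. \<forall>x\<in>carrier ?F. g (k x) = h x"
    using power_trunc_full by (metis order_refl)
qed

text \<open>The map sending the basis vectors to the generators is built by induction on the number
  \<open>j\<close> of generators already reached; the remaining basis vectors go to zero until
  then.\<close>

lemma free_power_epi:
  assumes M: "fg_module R M"
  obtains m e where "e \<in> mod_epi R (mod_power (free_one R) m) M"
proof -
  have LM: "left_module R M" by (rule fg_left_module[OF M])
  interpret M: left_module R M by (rule LM)
  have LQ: "left_module R (free_one R)" by (rule fg_left_module[OF free_one_fg])
  obtain S where S: "finite S" "S \<subseteq> carrier M" "\<And>H. submodule H R M \<Longrightarrow> S \<subseteq> H \<Longrightarrow> H = carrier M"
    by (rule finitely_generatedE[of R M]) (use M in \<open>auto simp: fg_module_def\<close>)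
  obtain v and m :: nat where v: "S = v ` {..<m}"
    using S(1) finite_imp_nat_seg_image_inj_on[OF S(1)] unfolding lessThan_def by metis
  let ?F = "mod_power (free_one R) m" and ?i = "\<lambda>i. power_ins (free_one R) m i {\<lambda>_. \<one>}"
  have LF: "left_module R ?F" by (rule mod_power_left_module[OF LQ])
  have one: "{\<lambda>_. \<one>} \<in> carrier (free_one R)" by simp
  have ic: "?i i \<in> carrier ?F" for i by (rule mod_homD(1)[OF power_ins_hom[OF LQ] one])
  have zero_hom: "f \<zero>\<^bsub>free_one R\<^esub> = \<zero>\<^bsub>M\<^esub>" if "f \<in> mod_hom R (free_one R) M" for f
    by (rule mod_hom_zero[OF LQ LM that])
  have "\<exists>e\<in>mod_hom R ?F M. \<forall>i<m. e (?i i) = (if i < j then v i else \<zero>\<^bsub>M\<^esub>)" if "j \<le> m" for j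
    using that
  proof (induction j)
    case 0
    show ?case using mod_hom_const_zero[OF LM, of ?F] by (intro bexI[of _ "\<lambda>_. \<zero>\<^bsub>M\<^esub>"]) auto
  next
    case (Suc j)
    then obtain e where e: "e \<in> mod_hom R ?F M" "\<forall>i<m. e (?i i) = (if i < j then v i else \<zero>\<^bsub>M\<^esub>)" by auto
    have j: "j < m" and vj: "v j \<in> carrier M" using Suc.prems S(2) v by auto
    obtain f where f: "f \<in> mod_hom R (free_one R) M" "\<And>a. a \<in> carrier R \<Longrightarrow> f {\<lambda>_. a} = a \<odot>\<^bsub>M\<^esub> v j"
      using free_one_hom[OF LM vj] by blast
    have f1: "f {\<lambda>_. \<one>} = v j" using f(2)[of \<one>] vj by simp
    have f': "(\<lambda>x. f (x j)) \<in> mod_hom R ?F M" by (rule mod_hom_comp[OF power_proj_hom[OF j] f(1)])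
    show ?case
    proof (intro bexI[of _ "\<lambda>x. e x \<oplus>\<^bsub>M\<^esub> f (x j)"] allI impI)
      show "(\<lambda>x. e x \<oplus>\<^bsub>M\<^esub> f (x j)) \<in> mod_hom R ?F M" by (rule mod_hom_add[OF LM e(1) f'])
      fix i assume i: "i < m"
      have "?i i j = (if j = i then {\<lambda>_. \<one>} else \<zero>\<^bsub>free_one R\<^esub>)" using j by (simp add: power_ins_def)
      moreover have "v i \<in> carrier M" using i v S(2) by auto
      ultimately show "e (?i i) \<oplus>\<^bsub>M\<^esub> f (?i i j) = (if i < Suc j then v i else \<zero>\<^bsub>M\<^esub>)"
        using e(2) i f1 zero_hom[OF f(1)] by (auto simp: less_Suc_eq)
    qed
  qed
  from this[of m] obtain e where e: "e \<in> mod_hom R ?F M" "\<And>i. i < m \<Longrightarrow> e (?i i) = v i" by auto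
  have "e ` carrier ?F = carrier M"
  proof (rule S(3))
    show "submodule (e ` carrier ?F) R M"
      by (rule mod_hom_image_submodule[OF LF LM e(1) left_module.submodule_carrier[OF LF]])
    have "v i \<in> e ` carrier ?F" if "i < m" for i
      by (rule image_eqI[of _ _ "?i i"]) (use e(2)[OF that] ic in simp_all)
    then show "S \<subseteq> e ` carrier ?F" using v by auto
  qed
  then have "e \<in> mod_epi R ?F M" using e(1) by (simp add: mod_epi_def)
  then show thesis by (rule that)
qed

text \<open>A power of \<open>free_one R\<close> has tuples as elements and is copied into the
  common carrier type. The maps \<open>h\<close> and \<open>g\<close> remember that the copy is a
  retract of the power, which later lets projective modules be expanded through
  \<open>free_one\<close>.\<close>

lemma projective_epi_ex:
  fixes M :: "('a, 'x, 'l) module_scheme"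
  assumes M: "fg_module R M"
  obtains P :: "('a, 'a fgcar) module" and e m g h where "projective_module R P" "e \<in> mod_epi R P M"
    "h \<in> mod_hom R P (mod_power (free_one R) m)" "g \<in> mod_hom R (mod_power (free_one R) m) P"
    "\<And>x. x \<in> carrier P \<Longrightarrow> g (h x) = x"
proof -
  obtain m e where e: "e \<in> mod_epi R (mod_power (free_one R) m) M" by (rule free_power_epi[OF M])
  let ?F = "mod_power (free_one R) m"
  have F: "fg_module R ?F" by (rule mod_power_fg[OF free_one_fg])
  obtain P :: "('a, 'a fgcar) module" and g where P: "fg_module R P" and g: "g \<in> mod_iso R ?F P"
    using fg_module_representable[OF F] by blast
  have gh: "g \<in> mod_hom R ?F P" and b: "bij_betw g (carrier ?F) (carrier P)" using g by (auto simp: mod_iso_def)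
  let ?h = "inv_into (carrier ?F) g"
  have h: "?h \<in> mod_hom R P ?F" by (rule mod_hom_inv[OF fg_left_module[OF F] gh b])
  have "projective_module R P"
    by (rule projective_retract[OF mod_power_projective[OF free_one_projective] P h gh])
      (use bij_betw_inv_into_right[OF b] in blast)
  moreover have "(\<lambda>x. e (?h x)) \<in> mod_epi R P M"
  proof -
    have "bij_betw ?h (carrier P) (carrier ?F)" by (rule bij_betw_inv_into[OF b])
    then have "?h ` carrier P = carrier ?F" by (simp add: bij_betw_def)
    moreover have "e \<in> mod_hom R ?F M" "e ` carrier ?F = carrier M" using e by (auto simp: mod_epi_def)
    ultimately show ?thesis
      using mod_hom_comp[OF h, of e M] by (simp add: mod_epi_def image_image[of e ?h, symmetric] del: mod_power_simps)
  qed
  ultimately show thesis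
    using h gh by (rule that) (use bij_betw_inv_into_right[OF b] in blast)
qed

end

section \<open>Existence of projective covers\<close>

context artin_algebra
begin

abbreviation mlen :: "('a, 'a fgcar) module \<Rightarrow> nat" where
  "mlen X \<equiv> rel_length A X {\<zero>\<^bsub>X\<^esub>} (carrier X)"

lemma mlen_sub_less:
  assumes X: "fg_module A X" and U: "submodule U A X" and ne: "U \<noteq> carrier X"
  shows "mlen (X\<lparr>carrier := U\<rparr>) < mlen X"
proof -
  have LX: "left_module A X" by (rule fg_left_module[OF X])
  interpret X: left_module A X by (rule LX)
  have fin: "finite_length A X {\<zero>\<^bsub>X\<^esub>} (carrier X)" by (rule finite_length_A[OF X])
  have "rel_length A (X\<lparr>carrier := U\<rparr>) {\<zero>\<^bsub>X\<^esub>} U \<le> rel_length A X {\<zero>\<^bsub>X\<^esub>} U"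
  proof (rule rel_length_inj(2)[OF X.left_module_submodule[OF U] LX])
    show "(\<lambda>x. x) \<in> mod_hom A (X\<lparr>carrier := U\<rparr>) X" by (rule mod_hom_sub_incl[OF LX U mod_hom_id])
    show "submodule U A (X\<lparr>carrier := U\<rparr>)" unfolding X.submodule_of_submodule[OF U] using U by simp
    show "finite_length A X {\<zero>\<^bsub>X\<^esub>} U" by (rule finite_length_mono[OF fin]) (use X.submoduleD(1)[OF U] in auto)
  qed (use X.submodule_zero U X.submoduleD(2)[OF U] in auto)
  moreover have "0 < rel_length A X U (carrier X)"
  proof (rule X.rel_length_pos[OF U X.submodule_carrier])
    show "U \<subset> carrier X" using ne X.submoduleD(1)[OF U] by blast
    show "finite_length A X U (carrier X)"
      by (rule finite_length_mono[OF fin]) (use X.submoduleD(2)[OF U] in auto)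
  qed
  moreover have "mlen X = rel_length A X {\<zero>\<^bsub>X\<^esub>} U + rel_length A X U (carrier X)"
    by (rule X.rel_length_add[OF U X.submodule_carrier _ _ X.submodule_zero fin])
      (use X.submoduleD[OF U] in auto)
  ultimately show ?thesis by simp
qed

text \<open>A projective module of least length that maps onto \<open>M\<close> is a cover. If a
  proper submodule \<open>U\<close> supplemented the kernel, \<open>p\<close> would lift to an
  endomorphism \<open>k\<close> with image in \<open>U\<close> and \<open>p k = p\<close>; by
  Fitting, the image of some power of \<open>k\<close> would be a direct summand, thus projective,
  inside \<open>U\<close>, and it would still map onto \<open>M\<close>.\<close>

lemma projective_cover_ex:
  fixes M :: "('a, 'a fgcar) module"
  assumes M: "fg_module A M"
  shows "\<exists>(P :: ('a, 'a fgcar) module) p. projective_cover A M P p"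
proof -
  define Q where "Q = (\<lambda>Pp :: ('a, 'a fgcar) module \<times> ('a fgcar \<Rightarrow> 'a fgcar).
    projective_module A (fst Pp) \<and> snd Pp \<in> mod_epi A (fst Pp) M)"
  obtain P0 :: "('a, 'a fgcar) module" and e0 where "projective_module A P0" "e0 \<in> mod_epi A P0 M"
    by (rule projective_epi_ex[OF M], rule that)
  then have "Q (P0, e0)" by (simp add: Q_def)
  then obtain Pp where Pp: "Q Pp" "\<And>Pp'. Q Pp' \<Longrightarrow> mlen (fst Pp) \<le> mlen (fst Pp')"
    using ex_has_least_nat[of Q _ "\<lambda>Pp. mlen (fst Pp)"] by blast
  define P p where "P = fst Pp" and "p = snd Pp"
  have P: "projective_module A P" and pe: "p \<in> mod_epi A P M" using Pp by (auto simp: Q_def P_def p_def)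
  have p: "p \<in> mod_hom A P M" "p ` carrier P = carrier M" using pe by (auto simp: mod_epi_def)
  have fgP: "fg_module A P" by (rule projective_fg[OF P])
  have LP: "left_module A P" and LM: "left_module A M" using fgP M by (auto intro: fg_left_module)
  interpret P: left_module A P by (rule LP)
  interpret LM: left_module A M by (rule LM)
  have fin: "finite_length A P {\<zero>\<^bsub>P\<^esub>} (carrier P)" by (rule finite_length_A[OF fgP])
  have "U = carrier P" if U: "submodule U A P" and UK: "U <+>\<^bsub>P\<^esub> a_kernel P M p = carrier P" for U
  proof (rule ccontr)
    assume ne: "U \<noteq> carrier P"
    let ?U = "P\<lparr>carrier := U\<rparr>"
    have Uc: "x \<in> carrier P" if "x \<in> U" for x using P.submoduleD(1)[OF U that] .
    have fgU: "fg_module A ?U" by (rule fg_sub[OF fgP U])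
    have "p \<in> mod_hom A ?U M" using mod_homD[OF p(1)] Uc by (intro mod_homI) auto
    moreover have "p ` U = carrier M"
    proof
      show "p ` U \<subseteq> carrier M" using p(2) Uc by blast
      show "carrier M \<subseteq> p ` U"
      proof
        fix y assume "y \<in> carrier M"
        then obtain x where x: "x \<in> carrier P" "y = p x" using p(2) by blast
        then have "x \<in> U <+>\<^bsub>P\<^esub> a_kernel P M p" using UK by simp
        then obtain u k where uk: "u \<in> U" "k \<in> carrier P" "p k = \<zero>\<^bsub>M\<^esub>" "x = u \<oplus>\<^bsub>P\<^esub> k"
          by (auto simp: P.set_add_iff a_kernel_iff)
        then have "y = p u" using x mod_homD(1,2)[OF p(1)] Uc[of u] by simp
        then show "y \<in> p ` U" using uk by blast
      qed
    qed
    ultimately have "p \<in> mod_epi A ?U M" by (simp add: mod_epi_def)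
    \<comment> \<open>Lifting is possible because \<open>U\<close> supplements the kernel and so
      already maps onto \<open>M\<close>. As \<open>p k = p\<close>, all powers of \<open>k\<close>
      have images that map onto \<open>M\<close>.\<close>
    then obtain k where k: "k \<in> mod_hom A P ?U" "\<And>x. x \<in> carrier P \<Longrightarrow> p (k x) = p x"
      using projective_lift[OF P fgU M _ p(1)] by blast
    have kU: "k x \<in> U" if "x \<in> carrier P" for x using mod_homD(1)[OF k(1) that] by simp
    have kP: "k \<in> mod_hom A P P" using mod_homD[OF k(1)] Uc by (intro mod_homI) auto
    obtain n where n: "0 < n" "direct_decomposition A P ((k ^^ n) ` carrier P) (a_kernel P P (k ^^ n))"
      by (rule fitting[OF LP fin kP])
    let ?I = "(k ^^ n) ` carrier P"
    have knc: "(k ^^ i) x \<in> carrier P" if "x \<in> carrier P" for i x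
      by (rule mod_homD(1)[OF mod_hom_funpow[OF kP] that])
    have pk: "p ((k ^^ i) x) = p x" if "x \<in> carrier P" for i x
      using that by (induction i) (auto simp: k(2) knc)
    have IU: "?I \<subseteq> U"
    proof
      fix y assume "y \<in> ?I"
      then obtain x where "x \<in> carrier P" "y = (k ^^ n) x" by blast
      moreover obtain i where "n = Suc i" using n(1) by (metis gr0_implies_Suc)
      ultimately show "y \<in> U" using kU[OF knc, of x i] by simp
    qed
    have I: "submodule ?I A P" using n(2) by (simp add: direct_decomposition_def)
    obtain q where q: "q \<in> mod_hom A P P" "\<And>x. x \<in> carrier P \<Longrightarrow> q x \<in> ?I" "\<And>x. x \<in> carrier P \<Longrightarrow> x \<ominus>\<^bsub>P\<^esub> q x \<in> a_kernel P P (k ^^ n)"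
      "\<And>u. u \<in> ?I \<Longrightarrow> q u = u" "\<And>v. v \<in> a_kernel P P (k ^^ n) \<Longrightarrow> q v = \<zero>\<^bsub>P\<^esub>"
      by (rule direct_decomposition_projection[OF LP n(2)], rule that)
    let ?J = "P\<lparr>carrier := ?I\<rparr>"
    have "projective_module A ?J"
    proof (rule projective_retract[OF P fg_sub[OF fgP I]])
      show "(\<lambda>x. x) \<in> mod_hom A ?J P" using P.submoduleD(1)[OF I] by (intro mod_homI) auto
      show "q \<in> mod_hom A P ?J" using mod_homD[OF q(1)] q(2) by (intro mod_homI) auto
    qed (use q(4) in auto)
    moreover have "p \<in> mod_epi A ?J M"
    proof -
      have "p ` ?I = carrier M" unfolding image_image using pk p(2) by (metis (no_types, lifting) image_cong)
      moreover have "p \<in> mod_hom A ?J M" using mod_homD[OF p(1)] P.submoduleD(1)[OF I] by (intro mod_homI) auto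
      ultimately show ?thesis by (simp add: mod_epi_def)
    qed
    ultimately have "mlen P \<le> mlen ?J" using Pp(2)[of "(?J, p)"] by (simp add: Q_def P_def)
    moreover have "mlen ?J < mlen P"
      by (rule mlen_sub_less[OF fgP I]) (use IU ne P.submoduleD(1)[OF U] in blast)
    ultimately show False by simp
  qed
  then show ?thesis using P pe unfolding projective_cover_def by blast
qed

end

section \<open>The stable category\<close>

text \<open>A homomorphism is null if it factors through a projective module; it suffices to test the
  projective cover of the target.  Homomorphisms are compared modulo null ones, and the syzygy becomes
  a functor on the quotient category.\<close>

lemma mod_epi_hom: "f \<in> mod_epi A M N \<Longrightarrow> f \<in> mod_hom A M N"
  by (simp add: mod_epi_def)

lemma mod_epi_surj: "f \<in> mod_epi A M N \<Longrightarrow> y \<in> carrier N \<Longrightarrow> \<exists>x\<in>carrier M. f x = y"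
proof -
  assume "f \<in> mod_epi A M N" "y \<in> carrier N"
  then have "y \<in> f ` carrier M" by (simp add: mod_epi_def)
  then show ?thesis by blast
qed

lemma sub_minus:
  assumes "left_module A M" "submodule U A M" "x \<in> U" "y \<in> U"
  shows "x \<ominus>\<^bsub>M\<lparr>carrier := U\<rparr>\<^esub> y = x \<ominus>\<^bsub>M\<^esub> y"
proof -
  interpret M: left_module A M by fact
  have "(\<lambda>x. x) \<in> mod_hom A (M\<lparr>carrier := U\<rparr>) M"
    by (rule mod_hom_sub_incl[OF assms(1,2) mod_hom_id])
  from mod_hom_diff[OF M.left_module_submodule[OF assms(2)] assms(1) this, of x y] assms(3,4)
  show ?thesis by simp
qed

section \<open>Chosen covers and null maps\<close>

context artin_algebra
begin

definition proj_cover :: "('a, 'a fgcar) module \<Rightarrow> ('a, 'a fgcar) module" where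
  "proj_cover M = fst (SOME (P, p). projective_cover A M P p)"

definition cover_map :: "('a, 'a fgcar) module \<Rightarrow> 'a fgcar \<Rightarrow> 'a fgcar" where
  "cover_map M = snd (SOME (P :: ('a, 'a fgcar) module, p). projective_cover A M P p)"

lemma syzygy_eq: "syzygy A M = (proj_cover M)\<lparr>carrier := a_kernel (proj_cover M) M (cover_map M)\<rparr>"
  by (simp add: syzygy_def proj_cover_def cover_map_def Let_def case_prod_beta)

lemma cover: "fg_module A M \<Longrightarrow> projective_cover A M (proj_cover M) (cover_map M)"
proof -
  assume "fg_module A M"
  then have "\<exists>Pp. (case Pp of (P :: ('a, 'a fgcar) module, p) \<Rightarrow> projective_cover A M P p)"
    using projective_cover_ex by (auto simp: split_paired_Ex)
  from someI_ex[OF this] show ?thesis by (simp add: proj_cover_def cover_map_def case_prod_unfold)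
qed

lemma proj_cover_projective: "fg_module A M \<Longrightarrow> projective_module A (proj_cover M)"
  and cover_map_epi: "fg_module A M \<Longrightarrow> cover_map M \<in> mod_epi A (proj_cover M) M"
  using cover unfolding projective_cover_def by blast+

lemma proj_cover_fg: "fg_module A M \<Longrightarrow> fg_module A (proj_cover M)"
  using proj_cover_projective projective_fg by blast

lemma cover_map_hom: "fg_module A M \<Longrightarrow> cover_map M \<in> mod_hom A (proj_cover M) M"
  using cover_map_epi mod_epi_hom by blast

definition null :: "('a, 'a fgcar) module \<Rightarrow> ('a, 'a fgcar) module \<Rightarrow> ('a fgcar \<Rightarrow> 'a fgcar) \<Rightarrow> bool" where
  "null X Y f \<longleftrightarrow> f \<in> mod_hom A X Y \<and> (\<exists>h\<in>mod_hom A X (proj_cover Y). \<forall>x\<in>carrier X. cover_map Y (h x) = f x)"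

lemma null_hom: "null X Y f \<Longrightarrow> f \<in> mod_hom A X Y"
  by (simp add: null_def)

text \<open>Lifting \<open>b\<close> to the projective cover of \<open>Y\<close> turns a
  factorisation through any projective into one through that cover.\<close>

lemma null_factor:
  assumes Y: "fg_module A Y" and P: "projective_module A P"
    and a: "a \<in> mod_hom A X P" and b: "b \<in> mod_hom A P Y"
  shows "null X Y (\<lambda>x. b (a x))"
proof -
  obtain k where k: "k \<in> mod_hom A P (proj_cover Y)" "\<And>x. x \<in> carrier P \<Longrightarrow> cover_map Y (k x) = b x"
    using projective_lift[OF P proj_cover_fg[OF Y] Y cover_map_epi[OF Y] b] by blast
  show ?thesis
    unfolding null_def
    using mod_hom_comp[OF a b] mod_hom_comp[OF a k(1)] k(2) mod_homD(1)[OF a]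
    by (intro conjI bexI[of _ "\<lambda>x. k (a x)"]) auto
qed

text \<open>The cover of \<open>Y\<close> lifts along every epimorphism onto \<open>Y\<close>, and
  with it every map that factors through the cover.\<close>

lemma null_lift:
  fixes Q :: "('a, 'a fgcar) module"
  assumes Y: "fg_module A Y" and f: "null X Y f" and Q: "fg_module A Q" and e: "e \<in> mod_epi A Q Y"
  obtains h where "h \<in> mod_hom A X Q" "\<And>x. x \<in> carrier X \<Longrightarrow> e (h x) = f x"
proof -
  obtain h where h: "h \<in> mod_hom A X (proj_cover Y)" "\<And>x. x \<in> carrier X \<Longrightarrow> cover_map Y (h x) = f x"
    using f by (auto simp: null_def)
  obtain k where k: "k \<in> mod_hom A (proj_cover Y) Q" "\<And>x. x \<in> carrier (proj_cover Y) \<Longrightarrow> e (k x) = cover_map Y x"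
    using projective_lift[OF proj_cover_projective[OF Y] Q Y e cover_map_hom[OF Y]] by blast
  show thesis
    by (rule that[OF mod_hom_comp[OF h(1) k(1)]]) (use h k mod_homD(1)[OF h(1)] in auto)
qed

lemma null_cong:
  assumes "fg_module A X" "null X Y f" "\<And>x. x \<in> carrier X \<Longrightarrow> g x = f x"
  shows "null X Y g"
  using assms(2,3) mod_hom_cong[OF fg_left_module[OF assms(1)] _ assms(3)] unfolding null_def by auto

lemma null_comp_left:
  assumes X: "fg_module A X" and Y: "fg_module A Y" and Z: "fg_module A Z"
    and f: "null X Y f" and g: "g \<in> mod_hom A Y Z"
  shows "null X Z (\<lambda>x. g (f x))"
proof -
  obtain h where h: "h \<in> mod_hom A X (proj_cover Y)" "\<And>x. x \<in> carrier X \<Longrightarrow> cover_map Y (h x) = f x"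
    using f by (auto simp: null_def)
  have "null X Z (\<lambda>x. g (cover_map Y (h x)))"
    by (rule null_factor[OF Z proj_cover_projective[OF Y] h(1) mod_hom_comp[OF cover_map_hom[OF Y] g]])
  then show ?thesis by (rule null_cong[OF X]) (use h in auto)
qed

lemma null_comp_right:
  assumes "null X Y f" and g: "g \<in> mod_hom A W X"
  shows "null W Y (\<lambda>x. f (g x))"
  using assms(1) mod_hom_comp[OF g] mod_homD(1)[OF g] unfolding null_def by fast

lemma null_zero: "fg_module A Y \<Longrightarrow> null X Y (\<lambda>_. \<zero>\<^bsub>Y\<^esub>)"
  using mod_hom_const_zero[OF fg_left_module, of A Y X] mod_hom_const_zero[OF fg_left_module[OF proj_cover_fg], of Y X]
    mod_hom_zero[OF fg_left_module[OF proj_cover_fg] fg_left_module cover_map_hom, of Y]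
  unfolding null_def by auto

lemma null_add:
  assumes Y: "fg_module A Y" and f: "null X Y f" and g: "null X Y g"
  shows "null X Y (\<lambda>x. f x \<oplus>\<^bsub>Y\<^esub> g x)"
proof -
  obtain h k where h: "h \<in> mod_hom A X (proj_cover Y)" "\<And>x. x \<in> carrier X \<Longrightarrow> cover_map Y (h x) = f x"
    and k: "k \<in> mod_hom A X (proj_cover Y)" "\<And>x. x \<in> carrier X \<Longrightarrow> cover_map Y (k x) = g x"
    using f g by (auto simp: null_def)
  show ?thesis
    unfolding null_def
  proof (intro conjI bexI[of _ "\<lambda>x. h x \<oplus>\<^bsub>proj_cover Y\<^esub> k x"] ballI)
    show "(\<lambda>x. f x \<oplus>\<^bsub>Y\<^esub> g x) \<in> mod_hom A X Y"
      by (rule mod_hom_add[OF fg_left_module[OF Y] null_hom[OF f] null_hom[OF g]])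
    show "(\<lambda>x. h x \<oplus>\<^bsub>proj_cover Y\<^esub> k x) \<in> mod_hom A X (proj_cover Y)"
      by (rule mod_hom_add[OF fg_left_module[OF proj_cover_fg[OF Y]] h(1) k(1)])
    fix x assume x: "x \<in> carrier X"
    show "cover_map Y (h x \<oplus>\<^bsub>proj_cover Y\<^esub> k x) = f x \<oplus>\<^bsub>Y\<^esub> g x"
      using mod_homD(2)[OF cover_map_hom[OF Y] mod_homD(1)[OF h(1) x] mod_homD(1)[OF k(1) x]] h(2) k(2) x by simp
  qed
qed

lemma mod_hom_neg_id: "left_module A Y \<Longrightarrow> (\<lambda>x. \<ominus>\<^bsub>Y\<^esub> x) \<in> mod_hom A Y Y"
  using mod_hom_neg[OF _ mod_hom_id] by blast

lemma null_neg:
  assumes "fg_module A X" "fg_module A Y" "null X Y f"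
  shows "null X Y (\<lambda>x. \<ominus>\<^bsub>Y\<^esub> f x)"
  by (rule null_comp_left[OF assms(1,2,2,3) mod_hom_neg_id[OF fg_left_module[OF assms(2)]]])

section \<open>Homomorphisms modulo null maps\<close>

definition stable_eq :: "('a, 'a fgcar) module \<Rightarrow> ('a, 'a fgcar) module \<Rightarrow> ('a fgcar \<Rightarrow> 'a fgcar) \<Rightarrow> ('a fgcar \<Rightarrow> 'a fgcar) \<Rightarrow> bool" where
  "stable_eq X Y f g \<longleftrightarrow> f \<in> mod_hom A X Y \<and> g \<in> mod_hom A X Y \<and> null X Y (\<lambda>x. f x \<ominus>\<^bsub>Y\<^esub> g x)"

lemma stable_eq_hom: "stable_eq X Y f g \<Longrightarrow> f \<in> mod_hom A X Y" "stable_eq X Y f g \<Longrightarrow> g \<in> mod_hom A X Y"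
  by (auto simp: stable_eq_def)

text \<open>Homomorphisms are total functions with arbitrary values off the carrier; this lemma lets
  functions that agree on the carrier be exchanged.\<close>

lemma stable_eq_cong:
  assumes X: "fg_module A X" and Y: "fg_module A Y" and f: "f \<in> mod_hom A X Y"
    and eq: "\<And>x. x \<in> carrier X \<Longrightarrow> g x = f x"
  shows "stable_eq X Y f g"
proof -
  interpret Y: left_module A Y using Y by (rule fg_left_module)
  have "null X Y (\<lambda>x. f x \<ominus>\<^bsub>Y\<^esub> g x)"
    by (rule null_cong[OF X null_zero[OF Y]])
      (use eq mod_homD(1)[OF f] in \<open>auto simp: Y.M.minus_eq Y.M.r_neg\<close>)
  then show ?thesis using f mod_hom_cong[OF fg_left_module[OF X] f eq] by (simp add: stable_eq_def)
qed

lemma stable_eq_refl: "\<lbrakk>fg_module A X; fg_module A Y; f \<in> mod_hom A X Y\<rbrakk> \<Longrightarrow> stable_eq X Y f f"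
  by (rule stable_eq_cong) auto

lemma stable_eq_sym:
  assumes X: "fg_module A X" and Y: "fg_module A Y" and s: "stable_eq X Y f g"
  shows "stable_eq X Y g f"
proof -
  interpret Y: left_module A Y using Y by (rule fg_left_module)
  have "null X Y (\<lambda>x. \<ominus>\<^bsub>Y\<^esub> (f x \<ominus>\<^bsub>Y\<^esub> g x))" by (rule null_neg[OF X Y]) (use s in \<open>simp add: stable_eq_def\<close>)
  then have "null X Y (\<lambda>x. g x \<ominus>\<^bsub>Y\<^esub> f x)"
    by (rule null_cong[OF X])
      (use mod_homD(1)[OF stable_eq_hom(1)[OF s]] mod_homD(1)[OF stable_eq_hom(2)[OF s]] in
        \<open>auto simp: Y.M.minus_eq Y.M.minus_add Y.M.a_comm\<close>)
  then show ?thesis using s by (simp add: stable_eq_def)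
qed

lemma stable_eq_trans:
  assumes X: "fg_module A X" and Y: "fg_module A Y" and s: "stable_eq X Y f g" "stable_eq X Y g h"
  shows "stable_eq X Y f h"
proof -
  interpret Y: left_module A Y using Y by (rule fg_left_module)
  note c = mod_homD(1)[OF stable_eq_hom(1)[OF s(1)]] mod_homD(1)[OF stable_eq_hom(2)[OF s(1)]] mod_homD(1)[OF stable_eq_hom(2)[OF s(2)]]
  have "null X Y (\<lambda>x. (f x \<ominus>\<^bsub>Y\<^esub> g x) \<oplus>\<^bsub>Y\<^esub> (g x \<ominus>\<^bsub>Y\<^esub> h x))"
    by (rule null_add[OF Y]) (use s in \<open>auto simp: stable_eq_def\<close>)
  then have "null X Y (\<lambda>x. f x \<ominus>\<^bsub>Y\<^esub> h x)"
  proof (rule null_cong[OF X])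
    fix x assume x: "x \<in> carrier X"
    have "(f x \<ominus>\<^bsub>Y\<^esub> g x) \<oplus>\<^bsub>Y\<^esub> (g x \<ominus>\<^bsub>Y\<^esub> h x) = ((f x \<ominus>\<^bsub>Y\<^esub> g x) \<oplus>\<^bsub>Y\<^esub> g x) \<ominus>\<^bsub>Y\<^esub> h x"
      using c[OF x] by (simp add: Y.M.minus_eq Y.M.a_assoc)
    also have "\<dots> = f x \<ominus>\<^bsub>Y\<^esub> h x" using c[OF x] by (simp add: Y.M.diff_add_cancel)
    finally show "f x \<ominus>\<^bsub>Y\<^esub> h x = (f x \<ominus>\<^bsub>Y\<^esub> g x) \<oplus>\<^bsub>Y\<^esub> (g x \<ominus>\<^bsub>Y\<^esub> h x)" ..
  qed
  then show ?thesis using s by (simp add: stable_eq_def)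
qed

lemma stable_eq_comp:
  assumes X: "fg_module A X" and Y: "fg_module A Y" and Z: "fg_module A Z"
    and f: "stable_eq X Y f f'" and g: "stable_eq Y Z g g'"
  shows "stable_eq X Z (\<lambda>x. g (f x)) (\<lambda>x. g' (f' x))"
proof (rule stable_eq_trans[OF X Z])
  note fh = stable_eq_hom[OF f] and gh = stable_eq_hom[OF g]
  show "stable_eq X Z (\<lambda>x. g (f x)) (\<lambda>x. g (f' x))"
  proof -
    have "null X Z (\<lambda>x. g (f x \<ominus>\<^bsub>Y\<^esub> f' x))"
      by (rule null_comp_left[OF X Y Z _ gh(1)]) (use f in \<open>simp add: stable_eq_def\<close>)
    then have "null X Z (\<lambda>x. g (f x) \<ominus>\<^bsub>Z\<^esub> g (f' x))"
      by (rule null_cong[OF X])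
        (use mod_hom_diff[OF fg_left_module[OF Y] fg_left_module[OF Z] gh(1)] mod_homD(1)[OF fh(1)] mod_homD(1)[OF fh(2)] in auto)
    then show ?thesis using mod_hom_comp[OF fh(1) gh(1)] mod_hom_comp[OF fh(2) gh(1)] by (simp add: stable_eq_def)
  qed
  show "stable_eq X Z (\<lambda>x. g (f' x)) (\<lambda>x. g' (f' x))"
  proof -
    have "null X Z (\<lambda>x. g (f' x) \<ominus>\<^bsub>Z\<^esub> g' (f' x))"
      by (rule null_comp_right[of Y Z "\<lambda>y. g y \<ominus>\<^bsub>Z\<^esub> g' y", OF _ fh(2)]) (use g in \<open>simp add: stable_eq_def\<close>)
    then show ?thesis using mod_hom_comp[OF fh(2) gh(1)] mod_hom_comp[OF fh(2) gh(2)] by (simp add: stable_eq_def)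
  qed
qed

lemma stable_eq_add:
  assumes X: "fg_module A X" and Y: "fg_module A Y" and f: "stable_eq X Y f f'" and g: "stable_eq X Y g g'"
  shows "stable_eq X Y (\<lambda>x. f x \<oplus>\<^bsub>Y\<^esub> g x) (\<lambda>x. f' x \<oplus>\<^bsub>Y\<^esub> g' x)"
proof -
  interpret Y: left_module A Y using Y by (rule fg_left_module)
  note fh = stable_eq_hom[OF f] and gh = stable_eq_hom[OF g]
  note c = mod_homD(1)[OF fh(1)] mod_homD(1)[OF fh(2)] mod_homD(1)[OF gh(1)] mod_homD(1)[OF gh(2)]
  have "null X Y (\<lambda>x. (f x \<ominus>\<^bsub>Y\<^esub> f' x) \<oplus>\<^bsub>Y\<^esub> (g x \<ominus>\<^bsub>Y\<^esub> g' x))"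
    by (rule null_add[OF Y]) (use f g in \<open>auto simp: stable_eq_def\<close>)
  then have "null X Y (\<lambda>x. (f x \<oplus>\<^bsub>Y\<^esub> g x) \<ominus>\<^bsub>Y\<^esub> (f' x \<oplus>\<^bsub>Y\<^esub> g' x))"
    by (rule null_cong[OF X]) (use c in \<open>auto simp: Y.M.minus_eq Y.M.minus_add Y.M.a_ac\<close>)
  then show ?thesis
    using mod_hom_add[OF Y.left_module_axioms fh(1) gh(1)] mod_hom_add[OF Y.left_module_axioms fh(2) gh(2)]
    by (simp add: stable_eq_def)
qed

lemma stable_eq_zero_iff:
  assumes X: "fg_module A X" and Y: "fg_module A Y"
  shows "stable_eq X Y f (\<lambda>_. \<zero>\<^bsub>Y\<^esub>) \<longleftrightarrow> null X Y f"
proof -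
  interpret Y: left_module A Y using Y by (rule fg_left_module)
  have eq: "f x \<ominus>\<^bsub>Y\<^esub> \<zero>\<^bsub>Y\<^esub> = f x" if "f \<in> mod_hom A X Y" "x \<in> carrier X" for x
    using mod_homD(1)[OF that] by (simp add: Y.M.diff_zero)
  have "null X Y (\<lambda>x. f x \<ominus>\<^bsub>Y\<^esub> \<zero>\<^bsub>Y\<^esub>)" if "null X Y f"
    by (rule null_cong[OF X that eq[OF null_hom[OF that]]])
  moreover have "null X Y f" if "null X Y (\<lambda>x. f x \<ominus>\<^bsub>Y\<^esub> \<zero>\<^bsub>Y\<^esub>)" "f \<in> mod_hom A X Y"
    by (rule null_cong[OF X that(1)]) (simp add: eq[OF that(2)])
  ultimately show ?thesis
    using mod_hom_const_zero[OF Y.left_module_axioms, of X] null_hom[of X Y f] unfolding stable_eq_def by blast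
qed

lemma null_stable_eq:
  assumes X: "fg_module A X" and Y: "fg_module A Y" and s: "stable_eq X Y f g" and n: "null X Y g"
  shows "null X Y f"
  using stable_eq_trans[OF X Y s] n unfolding stable_eq_zero_iff[OF X Y, symmetric] by blast

lemma stable_eq_sub_null: "stable_eq X Y f g \<Longrightarrow> null X Y (\<lambda>x. f x \<ominus>\<^bsub>Y\<^esub> g x)"
  by (simp add: stable_eq_def)

subsection \<open>Syzygies as functors\<close>

text \<open>\<open>K\<close> is a first syzygy of \<open>M\<close> formed with any projective
  presentation, not necessarily a projective cover. Such kernels arise when sequences are
  rotated.\<close>

definition pres :: "('a, 'a fgcar) module \<Rightarrow> ('a, 'a fgcar) module \<Rightarrow> ('a, 'a fgcar) module \<Rightarrow> ('a fgcar \<Rightarrow> 'a fgcar) \<Rightarrow> bool" where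
  "pres K M P p \<longleftrightarrow> projective_module A P \<and> fg_module A M \<and> p \<in> mod_epi A P M \<and>
     K = P\<lparr>carrier := a_kernel P M p\<rparr>"

lemma presD:
  assumes "pres K M P p"
  shows "projective_module A P" "fg_module A P" "fg_module A M" "p \<in> mod_epi A P M" "p \<in> mod_hom A P M"
    "K = P\<lparr>carrier := a_kernel P M p\<rparr>" "submodule (a_kernel P M p) A P" "fg_module A K"
    "x \<in> carrier K \<longleftrightarrow> x \<in> carrier P \<and> p x = \<zero>\<^bsub>M\<^esub>"
proof -
  show 1: "projective_module A P" "fg_module A M" "p \<in> mod_epi A P M" "K = P\<lparr>carrier := a_kernel P M p\<rparr>"
    using assms by (auto simp: pres_def)
  show 2: "fg_module A P" "p \<in> mod_hom A P M" using 1 projective_fg mod_epi_hom by auto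
  show 3: "submodule (a_kernel P M p) A P"
    by (rule mod_hom_kernel[OF fg_left_module[OF 2(1)] fg_left_module[OF 1(2)] 2(2)])
  show "fg_module A K" unfolding 1(4) by (rule fg_sub[OF 2(1) 3])
  show "x \<in> carrier K \<longleftrightarrow> x \<in> carrier P \<and> p x = \<zero>\<^bsub>M\<^esub>" by (simp add: 1(4) a_kernel_iff)
qed

lemma pres_incl: "pres K M P p \<Longrightarrow> (\<lambda>x. x) \<in> mod_hom A K P"
  using presD(6,7)[of K M P p] mod_hom_sub_incl[OF fg_left_module[OF presD(2)] _ mod_hom_id, of K M P p] by simp

lemma pres_into:
  assumes "pres K M P p" "f \<in> mod_hom A X P" "\<And>x. x \<in> carrier X \<Longrightarrow> p (f x) = \<zero>\<^bsub>M\<^esub>"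
  shows "f \<in> mod_hom A X K"
  unfolding presD(6)[OF assms(1)]
  by (rule mod_hom_into_sub[OF assms(2)]) (use assms(3) mod_homD(1)[OF assms(2)] in \<open>simp add: a_kernel_iff\<close>)

lemma pres_out:
  assumes "pres K M P p" "f \<in> mod_hom A X K" shows "f \<in> mod_hom A X P"
  using mod_hom_comp[OF assms(2) pres_incl[OF assms(1)]] .

lemma syzygy_pres: "fg_module A M \<Longrightarrow> pres (syzygy A M) M (proj_cover M) (cover_map M)"
  using proj_cover_projective cover_map_epi by (simp add: pres_def syzygy_eq)

lemma syzygy_fg: "fg_module A M \<Longrightarrow> fg_module A (syzygy A M)"
  using presD(8)[OF syzygy_pres] .

definition is_lift :: "('a, 'a fgcar) module \<Rightarrow> ('a fgcar \<Rightarrow> 'a fgcar) \<Rightarrow> ('a, 'a fgcar) module \<Rightarrow> ('a fgcar \<Rightarrow> 'a fgcar) \<Rightarrow>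
    ('a fgcar \<Rightarrow> 'a fgcar) \<Rightarrow> ('a fgcar \<Rightarrow> 'a fgcar) \<Rightarrow> bool" where
  "is_lift P p Q q f F \<longleftrightarrow> F \<in> mod_hom A P Q \<and> (\<forall>x\<in>carrier P. q (F x) = f (p x))"

lemma lift_ex:
  assumes K: "pres K M P p" and L: "pres L N Q q" and f: "f \<in> mod_hom A M N"
  shows "\<exists>F. is_lift P p Q q f F"
proof -
  obtain F where "F \<in> mod_hom A P Q" "\<And>x. x \<in> carrier P \<Longrightarrow> q (F x) = f (p x)"
    by (rule projective_lift[OF presD(1)[OF K] presD(2,3,4)[OF L] mod_hom_comp[OF presD(5)[OF K] f]], rule that)
  then show ?thesis unfolding is_lift_def by blast
qed

lemma lift_restrict:
  assumes K: "pres K M P p" and L: "pres L N Q q" and f: "f \<in> mod_hom A M N" and F: "is_lift P p Q q f F"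
  shows "F \<in> mod_hom A K L"
proof (rule pres_into[OF L])
  have "F \<in> mod_hom A P Q" using F by (simp add: is_lift_def)
  then show "F \<in> mod_hom A K Q" using mod_hom_comp[OF pres_incl[OF K], of F Q] by simp
  fix x assume "x \<in> carrier K"
  then show "q (F x) = \<zero>\<^bsub>N\<^esub>"
    using F mod_hom_zero[OF fg_left_module[OF presD(3)[OF K]] fg_left_module[OF presD(3)[OF L]] f]
    by (simp add: is_lift_def presD(9)[OF K])
qed

text \<open>The null map \<open>f - g\<close> lifts along \<open>q\<close> to some \<open>h\<close>.
  Then \<open>F - G - h p\<close> lands in the kernel \<open>L\<close> and is defined on all of the
  projective \<open>P\<close>; on \<open>K\<close>, where \<open>p\<close> vanishes, it agrees with
  \<open>F - G\<close>, which is therefore null.\<close>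

lemma lift_unique:
  assumes K: "pres K M P p" and L: "pres L N Q q" and f: "stable_eq M N f g"
    and F: "is_lift P p Q q f F" and G: "is_lift P p Q q g G"
  shows "stable_eq K L F G"
proof -
  note kP = presD[OF K] and lQ = presD[OF L]
  have LK: "left_module A K" and LL: "left_module A L" and LP: "left_module A P" and LQ: "left_module A Q"
    and LM: "left_module A M" and LN: "left_module A N"
    using kP lQ by (auto intro: fg_left_module)
  interpret Q: left_module A Q by (rule LQ)
  interpret N: left_module A N by (rule LN)
  have fh: "f \<in> mod_hom A M N" "g \<in> mod_hom A M N" using stable_eq_hom[OF f] .
  have FG: "F \<in> mod_hom A K L" "G \<in> mod_hom A K L" using lift_restrict[OF K L fh(1) F] lift_restrict[OF K L fh(2) G] .
  have FP: "F \<in> mod_hom A P Q" "G \<in> mod_hom A P Q" "\<And>x. x \<in> carrier P \<Longrightarrow> q (F x) = f (p x)"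
    "\<And>x. x \<in> carrier P \<Longrightarrow> q (G x) = g (p x)"
    using F G by (auto simp: is_lift_def)
  obtain h where h: "h \<in> mod_hom A M Q" "\<And>x. x \<in> carrier M \<Longrightarrow> q (h x) = f x \<ominus>\<^bsub>N\<^esub> g x"
    using null_lift[OF lQ(3) stable_eq_sub_null[OF f] lQ(2) lQ(4)] by blast
  let ?D = "\<lambda>x. (F x \<ominus>\<^bsub>Q\<^esub> G x) \<ominus>\<^bsub>Q\<^esub> h (p x)"
  have pc: "p x \<in> carrier M" if "x \<in> carrier P" for x using mod_homD(1)[OF kP(5) that] .
  note cF = mod_homD(1)[OF FP(1)] and cG = mod_homD(1)[OF FP(2)] and ch = mod_homD(1)[OF h(1) pc]
  have D: "?D \<in> mod_hom A P Q"
    by (rule mod_hom_sub[OF LQ mod_hom_sub[OF LQ FP(1,2)] mod_hom_comp[OF kP(5) h(1)]])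
  have "?D \<in> mod_hom A P L"
  proof (rule pres_into[OF L D])
    fix x assume x: "x \<in> carrier P"
    have "q (?D x) = (q (F x) \<ominus>\<^bsub>N\<^esub> q (G x)) \<ominus>\<^bsub>N\<^esub> q (h (p x))"
      using x cF cG ch by (simp add: mod_hom_diff[OF LQ LN lQ(5)] Q.M.minus_closed)
    also have "\<dots> = \<zero>\<^bsub>N\<^esub>"
      using x pc FP(3,4) h(2) mod_homD(1)[OF fh(1)] mod_homD(1)[OF fh(2)]
      by (simp add: N.M.diff_eq_zero_iff N.M.minus_closed)
    finally show "q (?D x) = \<zero>\<^bsub>N\<^esub>" .
  qed
  then have "null K L ?D" by (rule null_factor[OF lQ(8) kP(1) pres_incl[OF K]])
  then have "null K L (\<lambda>x. F x \<ominus>\<^bsub>L\<^esub> G x)"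
  proof (rule null_cong[OF kP(8)])
    fix x assume x: "x \<in> carrier K"
    then have xP: "x \<in> carrier P" "p x = \<zero>\<^bsub>M\<^esub>" by (auto simp: kP(9))
    have e: "F x \<ominus>\<^bsub>L\<^esub> G x = F x \<ominus>\<^bsub>Q\<^esub> G x"
      unfolding lQ(6)
      by (rule sub_minus[OF LQ lQ(7)]) (use mod_homD(1)[OF FG(1) x] mod_homD(1)[OF FG(2) x] lQ(6) in auto)
    show "F x \<ominus>\<^bsub>L\<^esub> G x = ?D x"
      unfolding e xP(2) mod_hom_zero[OF LM LQ h(1)]
      using cF[OF xP(1)] cG[OF xP(1)] by (simp add: Q.M.diff_zero Q.M.minus_closed)
  qed
  then show ?thesis using FG by (simp add: stable_eq_def)
qed

lemma lift_id: "is_lift P p P p (\<lambda>x. x) (\<lambda>x. x)"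
  by (simp add: is_lift_def mod_hom_id)

lemma lift_comp:
  assumes "is_lift P p Q q f F" "is_lift Q q S s g G"
  shows "is_lift P p S s (\<lambda>x. g (f x)) (\<lambda>x. G (F x))"
  using assms mod_hom_comp[of F A P Q G S] mod_homD(1)[of F A P Q] by (auto simp: is_lift_def)

lemma lift_add:
  assumes K: "pres K M P p" and L: "pres L N Q q" and F: "is_lift P p Q q f F" and G: "is_lift P p Q q g G"
  shows "is_lift P p Q q (\<lambda>x. f x \<oplus>\<^bsub>N\<^esub> g x) (\<lambda>x. F x \<oplus>\<^bsub>Q\<^esub> G x)"
  using F G mod_hom_add[OF fg_left_module[OF presD(2)[OF L]], of F P G] mod_homD(2)[OF presD(5)[OF L]]
    mod_homD(1)[of F A P Q] mod_homD(1)[of G A P Q] by (auto simp: is_lift_def)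

lemma lift_zero:
  assumes L: "pres L N Q q"
  shows "is_lift P p Q q (\<lambda>_. \<zero>\<^bsub>N\<^esub>) (\<lambda>_. \<zero>\<^bsub>Q\<^esub>)"
  using mod_hom_const_zero[OF fg_left_module[OF presD(2)[OF L]]]
    mod_hom_zero[OF fg_left_module[OF presD(2)[OF L]] fg_left_module[OF presD(3)[OF L]] presD(5)[OF L]]
  by (simp add: is_lift_def)

text \<open>A lift between the covers, read on their kernels; by \<open>lift_unique\<close> the
  choice does not matter modulo null maps.\<close>

definition syzygy_map :: "('a, 'a fgcar) module \<Rightarrow> ('a, 'a fgcar) module \<Rightarrow> ('a fgcar \<Rightarrow> 'a fgcar) \<Rightarrow> 'a fgcar \<Rightarrow> 'a fgcar" where
  "syzygy_map X Y f = (SOME F. is_lift (proj_cover X) (cover_map X) (proj_cover Y) (cover_map Y) f F)"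

lemma syzygy_map_lift:
  assumes "fg_module A X" "fg_module A Y" "f \<in> mod_hom A X Y"
  shows "is_lift (proj_cover X) (cover_map X) (proj_cover Y) (cover_map Y) f (syzygy_map X Y f)"
  unfolding syzygy_map_def by (rule someI_ex[OF lift_ex[OF syzygy_pres[OF assms(1)] syzygy_pres[OF assms(2)] assms(3)]])

lemma syzygy_map_hom:
  assumes "fg_module A X" "fg_module A Y" "f \<in> mod_hom A X Y"
  shows "syzygy_map X Y f \<in> mod_hom A (syzygy A X) (syzygy A Y)"
  by (rule lift_restrict[OF syzygy_pres syzygy_pres assms(3) syzygy_map_lift]) (use assms in auto)

text \<open>The functor laws below reduce to this: it suffices to exhibit one lift that has the
  desired form.\<close>

lemma syzygy_map_unique:
  assumes "fg_module A X" "fg_module A Y" "stable_eq X Y f g" "is_lift (proj_cover X) (cover_map X) (proj_cover Y) (cover_map Y) g G"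
  shows "stable_eq (syzygy A X) (syzygy A Y) (syzygy_map X Y f) G"
  by (rule lift_unique[OF syzygy_pres syzygy_pres assms(3) syzygy_map_lift assms(4)]) (use assms stable_eq_hom[OF assms(3)] in auto)

lemma syzygy_map_stable_eq:
  assumes "fg_module A X" "fg_module A Y" "stable_eq X Y f g"
  shows "stable_eq (syzygy A X) (syzygy A Y) (syzygy_map X Y f) (syzygy_map X Y g)"
  by (rule syzygy_map_unique[OF assms syzygy_map_lift]) (use assms stable_eq_hom[OF assms(3)] in auto)

lemma syzygy_map_id:
  assumes "fg_module A X"
  shows "stable_eq (syzygy A X) (syzygy A X) (syzygy_map X X (\<lambda>x. x)) (\<lambda>x. x)"
  by (rule syzygy_map_unique[OF assms assms stable_eq_refl[OF assms assms mod_hom_id] lift_id])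

lemma syzygy_map_comp:
  assumes X: "fg_module A X" and Y: "fg_module A Y" and Z: "fg_module A Z"
    and f: "f \<in> mod_hom A X Y" and g: "g \<in> mod_hom A Y Z"
  shows "stable_eq (syzygy A X) (syzygy A Z) (syzygy_map X Z (\<lambda>x. g (f x))) (\<lambda>x. syzygy_map Y Z g (syzygy_map X Y f x))"
  by (rule syzygy_map_unique[OF X Z stable_eq_refl[OF X Z mod_hom_comp[OF f g]] lift_comp[OF syzygy_map_lift[OF X Y f] syzygy_map_lift[OF Y Z g]]])

lemma syzygy_map_add:
  assumes X: "fg_module A X" and Y: "fg_module A Y" and f: "f \<in> mod_hom A X Y" and g: "g \<in> mod_hom A X Y"
  shows "stable_eq (syzygy A X) (syzygy A Y) (syzygy_map X Y (\<lambda>x. f x \<oplus>\<^bsub>Y\<^esub> g x))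
    (\<lambda>x. syzygy_map X Y f x \<oplus>\<^bsub>syzygy A Y\<^esub> syzygy_map X Y g x)"
  using syzygy_map_unique[OF X Y stable_eq_refl[OF X Y mod_hom_add[OF fg_left_module[OF Y] f g]]
      lift_add[OF syzygy_pres[OF X] syzygy_pres[OF Y] syzygy_map_lift[OF X Y f] syzygy_map_lift[OF X Y g]]]
  by (simp add: syzygy_eq)

lemma syzygy_map_null:
  assumes X: "fg_module A X" and Y: "fg_module A Y" and f: "null X Y f"
  shows "null (syzygy A X) (syzygy A Y) (syzygy_map X Y f)"
  using syzygy_map_unique[OF X Y _ lift_zero[OF syzygy_pres[OF Y]], of f] f
    stable_eq_zero_iff[OF X Y] stable_eq_zero_iff[OF syzygy_fg[OF X] syzygy_fg[OF Y]]
  by (simp add: syzygy_eq)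

abbreviation syz :: "nat \<Rightarrow> ('a, 'a fgcar) module \<Rightarrow> ('a, 'a fgcar) module" where
  "syz k \<equiv> syzygy A ^^ k"

primrec syz_map :: "nat \<Rightarrow> ('a, 'a fgcar) module \<Rightarrow> ('a, 'a fgcar) module \<Rightarrow> ('a fgcar \<Rightarrow> 'a fgcar) \<Rightarrow> 'a fgcar \<Rightarrow> 'a fgcar" where
  "syz_map 0 X Y f = f"
| "syz_map (Suc k) X Y f = syzygy_map (syz k X) (syz k Y) (syz_map k X Y f)"

lemma syz_fg: "fg_module A X \<Longrightarrow> fg_module A (syz k X)"
  by (induction k) (auto intro: syzygy_fg)

lemma syz_map_hom: "\<lbrakk>fg_module A X; fg_module A Y; f \<in> mod_hom A X Y\<rbrakk> \<Longrightarrow> syz_map k X Y f \<in> mod_hom A (syz k X) (syz k Y)"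
  by (induction k) (auto intro: syzygy_map_hom syz_fg)

lemma syz_map_stable_eq: "\<lbrakk>fg_module A X; fg_module A Y; stable_eq X Y f g\<rbrakk> \<Longrightarrow> stable_eq (syz k X) (syz k Y) (syz_map k X Y f) (syz_map k X Y g)"
  by (induction k) (auto intro: syzygy_map_stable_eq syz_fg)

lemma syz_map_null: "\<lbrakk>fg_module A X; fg_module A Y; null X Y f\<rbrakk> \<Longrightarrow> null (syz k X) (syz k Y) (syz_map k X Y f)"
  by (induction k) (auto intro: syzygy_map_null syz_fg)

lemma syz_map_id:
  assumes X: "fg_module A X" shows "stable_eq (syz k X) (syz k X) (syz_map k X X (\<lambda>x. x)) (\<lambda>x. x)"
proof (induction k)
  case 0 show ?case using stable_eq_refl[OF X X mod_hom_id] by simp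
next
  case (Suc k)
  then show ?case
    using stable_eq_trans[OF _ _ syzygy_map_stable_eq[OF _ _ Suc] syzygy_map_id] syz_fg[OF X] syzygy_fg[OF syz_fg[OF X]] by simp
qed

lemma syz_map_comp:
  assumes X: "fg_module A X" and Y: "fg_module A Y" and Z: "fg_module A Z"
    and f: "f \<in> mod_hom A X Y" and g: "g \<in> mod_hom A Y Z"
  shows "stable_eq (syz k X) (syz k Z) (syz_map k X Z (\<lambda>x. g (f x))) (\<lambda>x. syz_map k Y Z g (syz_map k X Y f x))"
proof (induction k)
  case 0 show ?case using stable_eq_refl[OF X Z mod_hom_comp[OF f g]] by simp
next
  case (Suc k)
  note s = syz_fg[OF X, of k] syz_fg[OF Y, of k] syz_fg[OF Z, of k]
  show ?case
    using stable_eq_trans[OF syzygy_fg[OF s(1)] syzygy_fg[OF s(3)] syzygy_map_stable_eq[OF s(1,3) Suc]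
        syzygy_map_comp[OF s syz_map_hom[OF X Y f] syz_map_hom[OF Y Z g]]]
    by simp
qed

lemma syz_map_add:
  assumes X: "fg_module A X" and Y: "fg_module A Y" and f: "f \<in> mod_hom A X Y" and g: "g \<in> mod_hom A X Y"
  shows "stable_eq (syz k X) (syz k Y) (syz_map k X Y (\<lambda>x. f x \<oplus>\<^bsub>Y\<^esub> g x)) (\<lambda>x. syz_map k X Y f x \<oplus>\<^bsub>syz k Y\<^esub> syz_map k X Y g x)"
proof (induction k)
  case 0 show ?case using stable_eq_refl[OF X Y mod_hom_add[OF fg_left_module[OF Y] f g]] by simp
next
  case (Suc k)
  note s = syz_fg[OF X, of k] syz_fg[OF Y, of k]
  show ?case
    using stable_eq_trans[OF syzygy_fg[OF s(1)] syzygy_fg[OF s(2)] syzygy_map_stable_eq[OF s Suc]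
        syzygy_map_add[OF s syz_map_hom[OF X Y f] syz_map_hom[OF X Y g]]]
    by simp
qed

lemma syz_map_syz_map: "syz_map j (syz k X) (syz k Y) (syz_map k X Y f) = syz_map (j + k) X Y f"
  by (induction j) (simp_all add: funpow_add)

lemma syz_syz: "syz j (syz k X) = syz (j + k) X"
  by (simp add: funpow_add)

lemma stable_eq_of_add_zero:
  assumes X: "fg_module A X" and Y: "fg_module A Y" and f: "f \<in> mod_hom A X Y" and g: "g \<in> mod_hom A X Y"
    and h: "h \<in> mod_hom A X Y" and s: "stable_eq X Y f (\<lambda>x. g x \<oplus>\<^bsub>Y\<^esub> h x)"
  shows "stable_eq X Y (\<lambda>x. f x \<ominus>\<^bsub>Y\<^esub> h x) g"
proof -
  interpret Y: left_module A Y using Y by (rule fg_left_module)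
  have "null X Y (\<lambda>x. f x \<ominus>\<^bsub>Y\<^esub> (g x \<oplus>\<^bsub>Y\<^esub> h x))" by (rule stable_eq_sub_null[OF s])
  then have "null X Y (\<lambda>x. (f x \<ominus>\<^bsub>Y\<^esub> h x) \<ominus>\<^bsub>Y\<^esub> g x)"
    by (rule null_cong[OF X])
      (use mod_homD(1)[OF f] mod_homD(1)[OF g] mod_homD(1)[OF h] in \<open>auto simp: Y.M.minus_eq Y.M.minus_add Y.M.a_ac\<close>)
  then show ?thesis using mod_hom_sub[OF Y.left_module_axioms f h] g by (simp add: stable_eq_def)
qed

text \<open>Additivity applied to \<open>f = (f - g) + g\<close>.\<close>

lemma syz_map_sub:
  assumes X: "fg_module A X" and Y: "fg_module A Y" and f: "f \<in> mod_hom A X Y" and g: "g \<in> mod_hom A X Y"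
  shows "stable_eq (syz k X) (syz k Y) (syz_map k X Y (\<lambda>x. f x \<ominus>\<^bsub>Y\<^esub> g x)) (\<lambda>x. syz_map k X Y f x \<ominus>\<^bsub>syz k Y\<^esub> syz_map k X Y g x)"
proof -
  interpret Y: left_module A Y using Y by (rule fg_left_module)
  let ?d = "\<lambda>x. f x \<ominus>\<^bsub>Y\<^esub> g x"
  note s = syz_fg[OF X, of k] syz_fg[OF Y, of k]
  have d: "?d \<in> mod_hom A X Y" by (rule mod_hom_sub[OF Y.left_module_axioms f g])
  have "stable_eq X Y f (\<lambda>x. ?d x \<oplus>\<^bsub>Y\<^esub> g x)"
    by (rule stable_eq_cong[OF X Y f]) (use mod_homD(1)[OF f] mod_homD(1)[OF g] in \<open>simp add: Y.M.diff_add_cancel\<close>)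
  from stable_eq_trans[OF s syz_map_stable_eq[OF X Y this] syz_map_add[OF X Y d g]]
  have "stable_eq (syz k X) (syz k Y) (syz_map k X Y f) (\<lambda>x. syz_map k X Y ?d x \<oplus>\<^bsub>syz k Y\<^esub> syz_map k X Y g x)" .
  from stable_eq_of_add_zero[OF s syz_map_hom[OF X Y f] syz_map_hom[OF X Y d] syz_map_hom[OF X Y g] this]
  show ?thesis by (rule stable_eq_sym[OF s])
qed

subsection \<open>Stable isomorphisms\<close>

definition stable_iso :: "('a, 'a fgcar) module \<Rightarrow> ('a, 'a fgcar) module \<Rightarrow> ('a fgcar \<Rightarrow> 'a fgcar) \<Rightarrow> bool" where
  "stable_iso X Y f \<longleftrightarrow> f \<in> mod_hom A X Y \<and>
     (\<exists>g\<in>mod_hom A Y X. stable_eq X X (\<lambda>x. g (f x)) (\<lambda>x. x) \<and> stable_eq Y Y (\<lambda>x. f (g x)) (\<lambda>x. x))"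

lemma sisoE:
  assumes "stable_iso X Y f"
  obtains g where "f \<in> mod_hom A X Y" "g \<in> mod_hom A Y X" "stable_eq X X (\<lambda>x. g (f x)) (\<lambda>x. x)"
    "stable_eq Y Y (\<lambda>x. f (g x)) (\<lambda>x. x)" "stable_iso Y X g"
  using assms unfolding stable_iso_def by blast

lemma sisoI:
  assumes "f \<in> mod_hom A X Y" "g \<in> mod_hom A Y X" "stable_eq X X (\<lambda>x. g (f x)) (\<lambda>x. x)" "stable_eq Y Y (\<lambda>x. f (g x)) (\<lambda>x. x)"
  shows "stable_iso X Y f"
  using assms unfolding stable_iso_def by blast

lemma stable_iso_hom: "stable_iso X Y f \<Longrightarrow> f \<in> mod_hom A X Y"
  by (simp add: stable_iso_def)

lemma stable_iso_id: "fg_module A X \<Longrightarrow> stable_iso X X (\<lambda>x. x)"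
  by (rule sisoI[OF mod_hom_id mod_hom_id]) (simp_all add: stable_eq_refl mod_hom_id)

lemma stable_iso_stable_eq:
  assumes X: "fg_module A X" and Y: "fg_module A Y" and f: "stable_iso X Y f" and s: "stable_eq X Y f f'"
  shows "stable_iso X Y f'"
proof -
  obtain g where g: "f \<in> mod_hom A X Y" "g \<in> mod_hom A Y X" "stable_eq X X (\<lambda>x. g (f x)) (\<lambda>x. x)"
    "stable_eq Y Y (\<lambda>x. f (g x)) (\<lambda>x. x)"
    using f by (rule sisoE)
  have s': "stable_eq X Y f' f" by (rule stable_eq_sym[OF X Y s])
  have gg: "stable_eq Y X g g" by (rule stable_eq_refl[OF Y X g(2)])
  show ?thesis
    by (rule sisoI[OF stable_eq_hom(2)[OF s] g(2)
          stable_eq_trans[OF X X stable_eq_comp[OF X Y X s' gg] g(3)] stable_eq_trans[OF Y Y stable_eq_comp[OF Y X Y gg s'] g(4)]])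
qed

lemma stable_iso_comp:
  assumes X: "fg_module A X" and Y: "fg_module A Y" and Z: "fg_module A Z"
    and f: "stable_iso X Y f" and g: "stable_iso Y Z g"
  shows "stable_iso X Z (\<lambda>x. g (f x))"
proof -
  obtain f' where f': "f \<in> mod_hom A X Y" "f' \<in> mod_hom A Y X" "stable_eq X X (\<lambda>x. f' (f x)) (\<lambda>x. x)"
    "stable_eq Y Y (\<lambda>x. f (f' x)) (\<lambda>x. x)"
    using f by (rule sisoE)
  obtain g' where g': "g \<in> mod_hom A Y Z" "g' \<in> mod_hom A Z Y" "stable_eq Y Y (\<lambda>x. g' (g x)) (\<lambda>x. x)"
    "stable_eq Z Z (\<lambda>x. g (g' x)) (\<lambda>x. x)"
    using g by (rule sisoE)
  note rf = stable_eq_refl[OF X Y f'(1)] and rf' = stable_eq_refl[OF Y X f'(2)]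
  note rg = stable_eq_refl[OF Y Z g'(1)] and rg' = stable_eq_refl[OF Z Y g'(2)]
  have 1: "stable_eq X X (\<lambda>x. f' (g' (g (f x)))) (\<lambda>x. f' (f x))"
    by (rule stable_eq_comp[OF X Y X stable_eq_comp[OF X Y Y rf g'(3)] rf'])
  have 2: "stable_eq Z Z (\<lambda>x. g (f (f' (g' x)))) (\<lambda>x. g (g' x))"
    by (rule stable_eq_comp[OF Z Y Z stable_eq_comp[OF Z Y Y rg' f'(4)] rg])
  show ?thesis
    by (rule sisoI[OF mod_hom_comp[OF f'(1) g'(1)] mod_hom_comp[OF g'(2) f'(2)]
          stable_eq_trans[OF X X 1 f'(3)] stable_eq_trans[OF Z Z 2 g'(4)]])
qed

lemma syz_map_stable_iso:
  assumes X: "fg_module A X" and Y: "fg_module A Y" and f: "stable_iso X Y f"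
  shows "stable_iso (syz k X) (syz k Y) (syz_map k X Y f)"
proof -
  obtain g where g: "f \<in> mod_hom A X Y" "g \<in> mod_hom A Y X" "stable_eq X X (\<lambda>x. g (f x)) (\<lambda>x. x)"
    "stable_eq Y Y (\<lambda>x. f (g x)) (\<lambda>x. x)"
    using f by (rule sisoE)
  note s = syz_fg[OF X, of k] syz_fg[OF Y, of k]
  have 1: "stable_eq (syz k X) (syz k X) (\<lambda>x. syz_map k Y X g (syz_map k X Y f x)) (\<lambda>x. x)"
    by (rule stable_eq_trans[OF s(1) s(1) stable_eq_sym[OF s(1) s(1) syz_map_comp[OF X Y X g(1,2)]]
          stable_eq_trans[OF s(1) s(1) syz_map_stable_eq[OF X X g(3)] syz_map_id[OF X]]])
  have 2: "stable_eq (syz k Y) (syz k Y) (\<lambda>x. syz_map k X Y f (syz_map k Y X g x)) (\<lambda>x. x)"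
    by (rule stable_eq_trans[OF s(2) s(2) stable_eq_sym[OF s(2) s(2) syz_map_comp[OF Y X Y g(2,1)]]
          stable_eq_trans[OF s(2) s(2) syz_map_stable_eq[OF Y Y g(4)] syz_map_id[OF Y]]])
  show ?thesis by (rule sisoI[OF syz_map_hom[OF X Y g(1)] syz_map_hom[OF Y X g(2)] 1 2])
qed

text \<open>Lifts of \<open>f\<close> and of a stable inverse compose to lifts of maps stably equal
  to identities, and the identities lift these too; uniqueness of lifts does the rest.\<close>

lemma lift_stable_iso:
  assumes K: "pres K M P p" and L: "pres L N Q q" and f: "stable_iso M N f" and F: "is_lift P p Q q f F"
  shows "stable_iso K L F"
proof -
  note k = presD[OF K] and l = presD[OF L]
  obtain g where g: "f \<in> mod_hom A M N" "g \<in> mod_hom A N M" "stable_eq M M (\<lambda>x. g (f x)) (\<lambda>x. x)"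
    "stable_eq N N (\<lambda>x. f (g x)) (\<lambda>x. x)"
    using f by (rule sisoE)
  obtain G where G: "is_lift Q q P p g G" using lift_ex[OF L K g(2)] by blast
  show ?thesis
    by (rule sisoI[OF lift_restrict[OF K L g(1) F] lift_restrict[OF L K g(2) G]
          lift_unique[OF K K g(3) lift_comp[OF F G] lift_id] lift_unique[OF L L g(4) lift_comp[OF G F] lift_id]])
qed

lemma iso_stable_iso:
  assumes X: "fg_module A X" and Y: "fg_module A Y" and f: "f \<in> mod_iso A X Y"
  shows "stable_iso X Y f"
proof -
  have fh: "f \<in> mod_hom A X Y" and b: "bij_betw f (carrier X) (carrier Y)" using f by (auto simp: mod_iso_def)
  let ?g = "inv_into (carrier X) f"
  have g: "?g \<in> mod_hom A Y X" by (rule mod_hom_inv[OF fg_left_module[OF X] fh b])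
  show ?thesis
    by (rule sisoI[OF fh g stable_eq_sym[OF X X stable_eq_cong[OF X X mod_hom_id]] stable_eq_sym[OF Y Y stable_eq_cong[OF Y Y mod_hom_id]]])
      (use bij_betw_inv_into_left[OF b] bij_betw_inv_into_right[OF b] in blast)+
qed

text \<open>Isomorphism of arrows in the stable category. Rotated sequences determine their maps
  only up to this relation.\<close>

definition arrow_eq :: "('a, 'a fgcar) module \<Rightarrow> ('a, 'a fgcar) module \<Rightarrow> ('a fgcar \<Rightarrow> 'a fgcar) \<Rightarrow>
    ('a, 'a fgcar) module \<Rightarrow> ('a, 'a fgcar) module \<Rightarrow> ('a fgcar \<Rightarrow> 'a fgcar) \<Rightarrow> bool" where
  "arrow_eq X Y f X' Y' f' \<longleftrightarrow> f \<in> mod_hom A X Y \<and> f' \<in> mod_hom A X' Y' \<and>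
     (\<exists>\<alpha> \<beta>. stable_iso X X' \<alpha> \<and> stable_iso Y Y' \<beta> \<and> stable_eq X Y' (\<lambda>x. \<beta> (f x)) (\<lambda>x. f' (\<alpha> x)))"

lemma arrow_eqI:
  assumes "f \<in> mod_hom A X Y" "f' \<in> mod_hom A X' Y'" "stable_iso X X' \<alpha>" "stable_iso Y Y' \<beta>"
    "stable_eq X Y' (\<lambda>x. \<beta> (f x)) (\<lambda>x. f' (\<alpha> x))"
  shows "arrow_eq X Y f X' Y' f'"
  using assms unfolding arrow_eq_def by blast

lemma arrow_eq_sym:
  assumes fg: "fg_module A X" "fg_module A Y" "fg_module A X'" "fg_module A Y'"
    and e: "arrow_eq X Y f X' Y' f'"
  shows "arrow_eq X' Y' f' X Y f"
proof -
  obtain \<alpha> \<beta> where ab: "f \<in> mod_hom A X Y" "f' \<in> mod_hom A X' Y'" "stable_iso X X' \<alpha>" "stable_iso Y Y' \<beta>"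
    "stable_eq X Y' (\<lambda>x. \<beta> (f x)) (\<lambda>x. f' (\<alpha> x))"
    using e unfolding arrow_eq_def by blast
  obtain \<alpha>' where a: "\<alpha> \<in> mod_hom A X X'" "\<alpha>' \<in> mod_hom A X' X" "stable_eq X' X' (\<lambda>x. \<alpha> (\<alpha>' x)) (\<lambda>x. x)" "stable_iso X' X \<alpha>'"
    using ab(3) by (rule sisoE)
  obtain \<beta>' where b: "\<beta> \<in> mod_hom A Y Y'" "\<beta>' \<in> mod_hom A Y' Y" "stable_eq Y Y (\<lambda>x. \<beta>' (\<beta> x)) (\<lambda>x. x)" "stable_iso Y' Y \<beta>'"
    using ab(4) by (rule sisoE)
  note ra = stable_eq_refl[OF fg(3,1) a(2)] and rb = stable_eq_refl[OF fg(4,2) b(2)]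
  have 1: "stable_eq X' Y' (\<lambda>x. f' (\<alpha> (\<alpha>' x))) (\<lambda>x. f' x)"
    by (rule stable_eq_comp[OF fg(3,3,4) a(3) stable_eq_refl[OF fg(3,4) ab(2)]])
  have 2: "stable_eq X' Y' (\<lambda>x. \<beta> (f (\<alpha>' x))) (\<lambda>x. f' (\<alpha> (\<alpha>' x)))"
    by (rule stable_eq_comp[OF fg(3,1,4) ra ab(5)])
  have 3: "stable_eq X' Y (\<lambda>x. \<beta>' (\<beta> (f (\<alpha>' x)))) (\<lambda>x. \<beta>' (f' x))"
    by (rule stable_eq_comp[OF fg(3,4,2) stable_eq_trans[OF fg(3,4) 2 1] rb])
  have 4: "stable_eq X' Y (\<lambda>x. \<beta>' (\<beta> (f (\<alpha>' x)))) (\<lambda>x. f (\<alpha>' x))"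
    by (rule stable_eq_comp[OF fg(3,2,2) stable_eq_comp[OF fg(3,1,2) ra stable_eq_refl[OF fg(1,2) ab(1)]] b(3)])
  show ?thesis
    by (rule arrow_eqI[OF ab(2,1) a(4) b(4) stable_eq_trans[OF fg(3,2) stable_eq_sym[OF fg(3,2) 3] 4]])
qed

lemma arrow_eq_trans:
  assumes fg: "fg_module A X" "fg_module A Y" "fg_module A X'" "fg_module A Y'" "fg_module A X''" "fg_module A Y''"
    and e: "arrow_eq X Y f X' Y' f'" and e': "arrow_eq X' Y' f' X'' Y'' f''"
  shows "arrow_eq X Y f X'' Y'' f''"
proof -
  obtain \<alpha> \<beta> where ab: "f \<in> mod_hom A X Y" "f' \<in> mod_hom A X' Y'" "stable_iso X X' \<alpha>" "stable_iso Y Y' \<beta>"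
    "stable_eq X Y' (\<lambda>x. \<beta> (f x)) (\<lambda>x. f' (\<alpha> x))"
    using e unfolding arrow_eq_def by blast
  obtain \<gamma> \<delta> where cd: "f'' \<in> mod_hom A X'' Y''" "stable_iso X' X'' \<gamma>" "stable_iso Y' Y'' \<delta>"
    "stable_eq X' Y'' (\<lambda>x. \<delta> (f' x)) (\<lambda>x. f'' (\<gamma> x))"
    using e' unfolding arrow_eq_def by blast
  have 1: "stable_eq X Y'' (\<lambda>x. \<delta> (\<beta> (f x))) (\<lambda>x. \<delta> (f' (\<alpha> x)))"
    by (rule stable_eq_comp[OF fg(1,4,6) ab(5) stable_eq_refl[OF fg(4,6) stable_iso_hom[OF cd(3)]]])
  have 2: "stable_eq X Y'' (\<lambda>x. \<delta> (f' (\<alpha> x))) (\<lambda>x. f'' (\<gamma> (\<alpha> x)))"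
    by (rule stable_eq_comp[OF fg(1,3,6) stable_eq_refl[OF fg(1,3) stable_iso_hom[OF ab(3)]] cd(4)])
  show ?thesis
    by (rule arrow_eqI[OF ab(1) cd(1) stable_iso_comp[OF fg(1,3,5) ab(3) cd(2)] stable_iso_comp[OF fg(2,4,6) ab(4) cd(3)]
          stable_eq_trans[OF fg(1,6) 1 2]])
qed

lemma arrow_eq_syz_map:
  assumes fg: "fg_module A X" "fg_module A Y" "fg_module A X'" "fg_module A Y'"
    and e: "arrow_eq X Y f X' Y' f'"
  shows "arrow_eq (syz k X) (syz k Y) (syz_map k X Y f) (syz k X') (syz k Y') (syz_map k X' Y' f')"
proof -
  obtain \<alpha> \<beta> where ab: "f \<in> mod_hom A X Y" "f' \<in> mod_hom A X' Y'" "stable_iso X X' \<alpha>" "stable_iso Y Y' \<beta>"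
    "stable_eq X Y' (\<lambda>x. \<beta> (f x)) (\<lambda>x. f' (\<alpha> x))"
    using e unfolding arrow_eq_def by blast
  note s = syz_fg[OF fg(1), of k] syz_fg[OF fg(4), of k]
  have "stable_eq (syz k X) (syz k Y') (\<lambda>x. syz_map k Y Y' \<beta> (syz_map k X Y f x)) (\<lambda>x. syz_map k X' Y' f' (syz_map k X X' \<alpha> x))"
    by (rule stable_eq_trans[OF s stable_eq_sym[OF s syz_map_comp[OF fg(1,2,4) ab(1) stable_iso_hom[OF ab(4)]]]
          stable_eq_trans[OF s syz_map_stable_eq[OF fg(1,4) ab(5)] syz_map_comp[OF fg(1,3,4) stable_iso_hom[OF ab(3)] ab(2)]]])
  then show ?thesis
    by (rule arrow_eqI[OF syz_map_hom[OF fg(1,2) ab(1)] syz_map_hom[OF fg(3,4) ab(2)]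
          syz_map_stable_iso[OF fg(1,3) ab(3)] syz_map_stable_iso[OF fg(2,4) ab(4)]])
qed

lemma arrow_eq_stable_iso:
  assumes fg: "fg_module A X" "fg_module A Y" "fg_module A X'" "fg_module A Y'"
    and e: "arrow_eq X Y f X' Y' f'" and f: "stable_iso X Y f"
  shows "stable_iso X' Y' f'"
proof -
  obtain \<alpha> \<beta> where ab: "f \<in> mod_hom A X Y" "f' \<in> mod_hom A X' Y'" "stable_iso X X' \<alpha>" "stable_iso Y Y' \<beta>"
    "stable_eq X Y' (\<lambda>x. \<beta> (f x)) (\<lambda>x. f' (\<alpha> x))"
    using e unfolding arrow_eq_def by blast
  obtain \<alpha>' where a: "\<alpha> \<in> mod_hom A X X'" "\<alpha>' \<in> mod_hom A X' X" "stable_eq X' X' (\<lambda>x. \<alpha> (\<alpha>' x)) (\<lambda>x. x)" "stable_iso X' X \<alpha>'"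
    using ab(3) by (rule sisoE)
  have 1: "stable_eq X' Y' (\<lambda>x. f' (\<alpha> (\<alpha>' x))) (\<lambda>x. f' x)"
    by (rule stable_eq_comp[OF fg(3,3,4) a(3) stable_eq_refl[OF fg(3,4) ab(2)]])
  have 2: "stable_eq X' Y' (\<lambda>x. \<beta> (f (\<alpha>' x))) (\<lambda>x. f' (\<alpha> (\<alpha>' x)))"
    by (rule stable_eq_comp[OF fg(3,1,4) stable_eq_refl[OF fg(3,1) a(2)] ab(5)])
  show ?thesis
    by (rule stable_iso_stable_eq[OF fg(3,4) stable_iso_comp[OF fg(3,2,4) stable_iso_comp[OF fg(3,1,2) a(4) f] ab(4)]
          stable_eq_trans[OF fg(3,4) 2 1]])
qed

lemma null_id_stable_iso:
  assumes X: "fg_module A X" and Y: "fg_module A Y" and f: "stable_iso X Y f" and n: "null X X (\<lambda>x. x)"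
  shows "null Y Y (\<lambda>x. x)"
proof -
  obtain g where g: "f \<in> mod_hom A X Y" "g \<in> mod_hom A Y X" "stable_eq Y Y (\<lambda>x. f (g x)) (\<lambda>x. x)"
    using f by (rule sisoE)
  show ?thesis
    by (rule null_stable_eq[OF Y Y stable_eq_sym[OF Y Y g(3)]
          null_comp_left[OF Y X Y null_comp_right[OF n g(2)] g(1)]])
qed

text \<open>Null identities mark the zero objects of the stable category: a factorisation of the
  identity through the projective cover exhibits \<open>X\<close> as a retract of it.\<close>

lemma null_id_iff_projective:
  assumes X: "fg_module A X"
  shows "null X X (\<lambda>x. x) \<longleftrightarrow> projective_module A X"
proof
  assume "null X X (\<lambda>x. x)"
  then show "projective_module A X"
    unfolding null_def using projective_retract[OF proj_cover_projective[OF X] X _ cover_map_hom[OF X]] by blast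
next
  assume "projective_module A X"
  then show "null X X (\<lambda>x. x)" using null_factor[OF X _ mod_hom_id mod_hom_id] by blast
qed

end

section \<open>Additive closures and indecomposable summands\<close>

lemma (in ring) direct_decomposition_maps:
  assumes X: "left_module R X" and d: "direct_decomposition R X U V"
  obtains p q where "p \<in> mod_hom R X (X\<lparr>carrier := U\<rparr>)" "q \<in> mod_hom R X (X\<lparr>carrier := V\<rparr>)"
    "\<And>x. x \<in> carrier X \<Longrightarrow> x = p x \<oplus>\<^bsub>X\<^esub> q x" "\<And>u. u \<in> U \<Longrightarrow> p u = u" "\<And>v. v \<in> V \<Longrightarrow> q v = v"
    "\<And>v. v \<in> V \<Longrightarrow> p v = \<zero>\<^bsub>X\<^esub>" "\<And>u. u \<in> U \<Longrightarrow> q u = \<zero>\<^bsub>X\<^esub>"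
proof -
  interpret X: left_module R X by fact
  have U: "submodule U R X" and V: "submodule V R X" using d by (auto simp: direct_decomposition_def)
  obtain p where p: "p \<in> mod_hom R X X" "\<And>x. x \<in> carrier X \<Longrightarrow> p x \<in> U"
    "\<And>x. x \<in> carrier X \<Longrightarrow> x \<ominus>\<^bsub>X\<^esub> p x \<in> V" "\<And>u. u \<in> U \<Longrightarrow> p u = u" "\<And>v. v \<in> V \<Longrightarrow> p v = \<zero>\<^bsub>X\<^esub>"
    by (rule direct_decomposition_projection[OF X d], rule that)
  show thesis
  proof (rule that)
    show "p \<in> mod_hom R X (X\<lparr>carrier := U\<rparr>)" by (rule mod_hom_into_sub[OF p(1,2)])
    show "(\<lambda>x. x \<ominus>\<^bsub>X\<^esub> p x) \<in> mod_hom R X (X\<lparr>carrier := V\<rparr>)"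
      by (rule mod_hom_into_sub[OF mod_hom_sub[OF X mod_hom_id p(1)] p(3)])
    show "x = p x \<oplus>\<^bsub>X\<^esub> (x \<ominus>\<^bsub>X\<^esub> p x)" if "x \<in> carrier X" for x
      using X.M.diff_add_cancel[OF that mod_homD(1)[OF p(1) that]] that mod_homD(1)[OF p(1) that]
      by (simp add: X.M.a_comm X.M.minus_closed)
    show "v \<ominus>\<^bsub>X\<^esub> p v = v" if "v \<in> V" for v
      using p(5)[OF that] X.submoduleD(1)[OF V that] by (simp add: X.M.diff_zero)
    show "u \<ominus>\<^bsub>X\<^esub> p u = \<zero>\<^bsub>X\<^esub>" if "u \<in> U" for u
      using p(4)[OF that] X.submoduleD(1)[OF U that] by (simp add: X.M.minus_eq X.M.r_neg)
  qed (use p in auto)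
qed

context artin_algebra
begin

text \<open>Sums of homomorphisms factoring through members of \<open>Ns\<close>.  A module belongs to the additive closure
  of \<open>Ns\<close> iff its identity is such a sum, so no direct sums of modules have to be formed.\<close>

inductive thru :: "('a, 'a fgcar) module set \<Rightarrow> ('a, 'a fgcar) module \<Rightarrow> ('a, 'a fgcar) module \<Rightarrow>
    ('a fgcar \<Rightarrow> 'a fgcar) \<Rightarrow> bool" for Ns X Y where
  thru_zero: "\<forall>x\<in>carrier X. h x = \<zero>\<^bsub>Y\<^esub> \<Longrightarrow> thru Ns X Y h"
| thru_step: "\<lbrakk>thru Ns X Y f; N \<in> Ns; a \<in> mod_hom A X N; b \<in> mod_hom A N Y;
    \<forall>x\<in>carrier X. h x = f x \<oplus>\<^bsub>Y\<^esub> b (a x)\<rbrakk> \<Longrightarrow> thru Ns X Y h"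

lemma thru_hom:
  assumes "thru Ns X Y h" and X: "fg_module A X" and Y: "fg_module A Y"
  shows "h \<in> mod_hom A X Y"
  using assms(1)
proof induction
  case (thru_zero h)
  then show ?case
    using mod_hom_cong[OF fg_left_module[OF X] mod_hom_const_zero[OF fg_left_module[OF Y]]] by simp
next
  case (thru_step f N a b h)
  show ?case
    by (rule mod_hom_cong[OF fg_left_module[OF X]
          mod_hom_add[OF fg_left_module[OF Y] thru_step.IH mod_hom_comp[OF thru_step(3,4)]]])
      (use thru_step in simp)
qed

lemma thru_cong: "thru Ns X Y h \<Longrightarrow> \<forall>x\<in>carrier X. g x = h x \<Longrightarrow> thru Ns X Y g"
  by (erule thru.cases) (auto intro: thru.intros)

lemma thru_comp:
  assumes Y: "fg_module A Y" and N: "N \<in> Ns" and a: "a \<in> mod_hom A X N" and b: "b \<in> mod_hom A N Y"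
  shows "thru Ns X Y (\<lambda>x. b (a x))"
proof -
  interpret Y: left_module A Y using Y by (rule fg_left_module)
  have "thru Ns X Y (\<lambda>_. \<zero>\<^bsub>Y\<^esub>)" by (rule thru_zero) simp
  then show ?thesis by (rule thru_step[OF _ N a b]) (use mod_homD(1)[OF mod_hom_comp[OF a b]] in simp)
qed

lemma thru_add:
  assumes X: "fg_module A X" and Y: "fg_module A Y" and f: "thru Ns X Y f" and g: "thru Ns X Y g"
  shows "thru Ns X Y (\<lambda>x. f x \<oplus>\<^bsub>Y\<^esub> g x)"
proof -
  interpret Y: left_module A Y using Y by (rule fg_left_module)
  note fc = mod_homD(1)[OF thru_hom[OF f X Y]]
  show ?thesis using g
  proof induction
    case (thru_zero h)
    show ?case by (rule thru_cong[OF f]) (use thru_zero fc in simp)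
  next
    case (thru_step g N a b h)
    show ?case
      by (rule thru.thru_step[OF thru_step.IH thru_step(2,3,4)])
        (use thru_step fc mod_homD(1)[OF thru_hom[OF thru_step(1) X Y]] mod_homD(1)[OF mod_hom_comp[OF thru_step(3,4)]] in
          \<open>simp add: Y.M.a_assoc\<close>)
  qed
qed

lemma thru_post:
  assumes X: "fg_module A X" and Y: "fg_module A Y" and Z: "fg_module A Z"
    and f: "thru Ns X Y f" and g: "g \<in> mod_hom A Y Z"
  shows "thru Ns X Z (\<lambda>x. g (f x))"
  using f
proof induction
  case (thru_zero h)
  show ?case
    by (rule thru.thru_zero)
      (use thru_zero mod_hom_zero[OF fg_left_module[OF Y] fg_left_module[OF Z] g] in simp)
next
  case (thru_step f N a b h)
  show ?case
    by (rule thru.thru_step[OF thru_step.IH thru_step(2,3) mod_hom_comp[OF thru_step(4) g]])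
      (use thru_step mod_homD(2)[OF g] mod_homD(1)[OF thru_hom[OF thru_step(1) X Y]]
          mod_homD(1)[OF mod_hom_comp[OF thru_step(3,4)]] in simp)
qed

lemma thru_pre:
  assumes f: "thru Ns X Y f" and g: "g \<in> mod_hom A W X"
  shows "thru Ns W Y (\<lambda>x. f (g x))"
  using f
proof induction
  case (thru_zero h)
  show ?case by (rule thru.thru_zero) (use thru_zero mod_homD(1)[OF g] in simp)
next
  case (thru_step f N a b h)
  show ?case
    by (rule thru.thru_step[OF thru_step.IH thru_step(2) mod_hom_comp[OF g thru_step(3)] thru_step(4)])
      (use thru_step mod_homD(1)[OF g] in simp)
qed

lemma thru_mono: "thru Ns X Y f \<Longrightarrow> Ns \<subseteq> Ms \<Longrightarrow> thru Ms X Y f"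
  by (induction rule: thru.induct) (auto intro: thru.intros)

text \<open>Transitivity of additive closures: inside each summand, the identity of the intermediate
  module is expanded through \<open>Bs\<close>.\<close>

lemma thru_subst:
  assumes X: "fg_module A X" and Y: "fg_module A Y" and Ns: "\<And>N. N \<in> Ns \<Longrightarrow> fg_module A N \<and> thru Bs N N (\<lambda>x. x)"
    and f: "thru Ns X Y f"
  shows "thru Bs X Y f"
  using f
proof induction
  case (thru_zero h) then show ?case by (rule thru.thru_zero)
next
  case (thru_step f N a b h)
  have N: "fg_module A N" "thru Bs N N (\<lambda>x. x)" using Ns[OF thru_step(2)] by auto
  have "thru Bs X Y (\<lambda>x. b (a x))"
    by (rule thru_post[OF X N(1) Y thru_pre[OF N(2) thru_step(3)] thru_step(4)])
  then show ?case by (rule thru_cong[OF thru_add[OF X Y thru_step.IH] thru_step(5)])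
qed

text \<open>A map through a power is the sum of its parts through the single coordinates, collected
  by induction on the truncation.\<close>

lemma thru_power:
  assumes X: "fg_module A X" and Y: "fg_module A Y" and N: "fg_module A N"
    and a: "a \<in> mod_hom A X (mod_power N m)" and b: "b \<in> mod_hom A (mod_power N m) Y"
  shows "thru {N} X Y (\<lambda>x. b (a x))"
proof -
  have LN: "left_module A N" and LP: "left_module A (mod_power N m)" and LY: "left_module A Y"
    using fg_left_module[OF N] mod_power_left_module fg_left_module[OF Y] by auto
  interpret LN: left_module A N by (rule LN)
  have "thru {N} X Y (\<lambda>x. b (power_trunc N m j (a x)))" if "j \<le> m" for j
    using that
  proof (induction j)
    case 0
    show ?case
      by (rule thru_zero) (simp only: power_trunc_0 mod_hom_zero[OF LP LY b] ball_triv, simp)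
  next
    case (Suc j)
    then have j: "j < m" and IH: "thru {N} X Y (\<lambda>x. b (power_trunc N m j (a x)))" by auto
    have a': "(\<lambda>x. a x j) \<in> mod_hom A X N" by (rule mod_hom_comp[OF a power_proj_hom[OF j]])
    have b': "(\<lambda>x. b (power_ins N m j x)) \<in> mod_hom A N Y" by (rule mod_hom_comp[OF power_ins_hom[OF LN] b])
    show ?case
    proof (rule thru_step[OF IH _ a' b'], simp, rule ballI)
      fix x assume x: "x \<in> carrier X"
      have ax: "a x \<in> carrier (mod_power N m)" by (rule mod_homD(1)[OF a x])
      show "b (power_trunc N m (Suc j) (a x)) = b (power_trunc N m j (a x)) \<oplus>\<^bsub>Y\<^esub> b (power_ins N m j (a x j))"
        unfolding power_trunc_Suc[OF LN ax j]
        by (rule mod_homD(2)[OF b mod_homD(1)[OF power_trunc_hom[OF LN] ax]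
              mod_homD(1)[OF power_ins_hom[OF LN] mod_homD(1)[OF a' x]]])
    qed
  qed
  from this[OF order_refl] show ?thesis
    by (rule thru_cong) (use power_trunc_full[OF mod_homD(1)[OF a]] in simp)
qed

text \<open>A finitely generated projective is a retract of a power of the free module of rank
  one.\<close>

lemma projective_thru:
  fixes P :: "('a, 'a fgcar) module"
  assumes P: "projective_module A P"
  shows "thru {free_one A} P P (\<lambda>x. x)"
proof -
  have fgP: "fg_module A P" by (rule projective_fg[OF P])
  obtain F :: "('a, 'a fgcar) module" and e m g h where F: "projective_module A F" "e \<in> mod_epi A F P"
    "h \<in> mod_hom A F (mod_power (free_one A) m)" "g \<in> mod_hom A (mod_power (free_one A) m) F"
    "\<And>x. x \<in> carrier F \<Longrightarrow> g (h x) = x"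
    by (rule projective_epi_ex[OF fgP], rule that)
  obtain k where k: "k \<in> mod_hom A P F" "\<And>x. x \<in> carrier P \<Longrightarrow> e (k x) = x"
    by (rule projective_lift[OF P projective_fg[OF F(1)] fgP F(2) mod_hom_id], rule that)
  have "thru {free_one A} P P (\<lambda>x. e (g (h (k x))))"
    by (rule thru_power[OF fgP fgP free_one_fg mod_hom_comp[OF k(1) F(3)] mod_hom_comp[OF F(4) mod_epi_hom[OF F(2)]]])
  then show ?thesis by (rule thru_cong) (use F(5) k mod_homD(1)[OF k(1)] in auto)
qed

lemma null_thru:
  assumes X: "fg_module A X" and Y: "fg_module A Y" and f: "null X Y f"
  shows "thru {free_one A} X Y f"
proof -
  obtain h where h: "h \<in> mod_hom A X (proj_cover Y)" "\<forall>x\<in>carrier X. cover_map Y (h x) = f x"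
    using f by (auto simp: null_def)
  have "thru {free_one A} X Y (\<lambda>x. cover_map Y (h x))"
    by (rule thru_post[OF X proj_cover_fg[OF Y] Y thru_pre[OF projective_thru[OF proj_cover_projective[OF Y]] h(1)] cover_map_hom[OF Y]])
  then show ?thesis by (rule thru_cong) (use h in simp)
qed

text \<open>Null maps are themselves sums of maps through \<open>free_one A\<close>. Once this
  module is among the generators, stable equality suffices where equality was required.\<close>

lemma thru_stable_eq:
  assumes X: "fg_module A X" and Y: "fg_module A Y" and f: "thru Ns X Y f" and s: "stable_eq X Y f g"
    and free: "free_one A \<in> Ns"
  shows "thru Ns X Y g"
proof -
  interpret Y: left_module A Y using Y by (rule fg_left_module)
  have "thru {free_one A} X Y (\<lambda>x. g x \<ominus>\<^bsub>Y\<^esub> f x)"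
    by (rule null_thru[OF X Y stable_eq_sub_null[OF stable_eq_sym[OF X Y s]]])
  then have "thru Ns X Y (\<lambda>x. g x \<ominus>\<^bsub>Y\<^esub> f x)" by (rule thru_mono) (use free in simp)
  then have "thru Ns X Y (\<lambda>x. (g x \<ominus>\<^bsub>Y\<^esub> f x) \<oplus>\<^bsub>Y\<^esub> f x)" by (rule thru_add[OF X Y _ f])
  then show ?thesis
    by (rule thru_cong) (use mod_homD(1)[OF stable_eq_hom(1)[OF s]] mod_homD(1)[OF stable_eq_hom(2)[OF s]] in
        \<open>simp add: Y.M.diff_add_cancel\<close>)
qed

text \<open>The syzygy preserves sums and composites only modulo null maps; the inserted
  \<open>free_one A\<close> absorbs the difference.\<close>

lemma thru_syz_map:
  assumes X: "fg_module A X" and Y: "fg_module A Y" and Ns: "\<And>N. N \<in> Ns \<Longrightarrow> fg_module A N"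
    and f: "thru Ns X Y f"
  shows "thru (insert (free_one A) (syz k ` Ns)) (syz k X) (syz k Y) (syz_map k X Y f)"
  using f
proof induction
  case (thru_zero h)
  have "null X Y h" by (rule null_cong[OF X null_zero[OF Y]]) (use thru_zero in simp)
  then have "thru {free_one A} (syz k X) (syz k Y) (syz_map k X Y h)"
    by (intro null_thru syz_fg X Y syz_map_null)
  then show ?case by (rule thru_mono) simp
next
  case (thru_step f N a b h)
  note s = syz_fg[OF X, of k] syz_fg[OF Y, of k]
  have N: "fg_module A N" by (rule Ns[OF thru_step(2)])
  have fh: "f \<in> mod_hom A X Y" by (rule thru_hom[OF thru_step(1) X Y])
  have ba: "(\<lambda>x. b (a x)) \<in> mod_hom A X Y" by (rule mod_hom_comp[OF thru_step(3,4)])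
  have 1: "stable_eq X Y (\<lambda>x. f x \<oplus>\<^bsub>Y\<^esub> b (a x)) h"
    by (rule stable_eq_cong[OF X Y mod_hom_add[OF fg_left_module[OF Y] fh ba]]) (use thru_step(5) in simp)
  have 2: "stable_eq (syz k X) (syz k Y) (syz_map k X Y h) (\<lambda>x. syz_map k X Y f x \<oplus>\<^bsub>syz k Y\<^esub> syz_map k X Y (\<lambda>x. b (a x)) x)"
    by (rule stable_eq_trans[OF s stable_eq_sym[OF s syz_map_stable_eq[OF X Y 1]] syz_map_add[OF X Y fh ba]])
  have 3: "stable_eq (syz k X) (syz k Y) (syz_map k X Y h) (\<lambda>x. syz_map k X Y f x \<oplus>\<^bsub>syz k Y\<^esub> syz_map k N Y b (syz_map k X N a x))"
    by (rule stable_eq_trans[OF s 2 stable_eq_add[OF s stable_eq_refl[OF s syz_map_hom[OF X Y fh]] syz_map_comp[OF X N Y thru_step(3,4)]]])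
  show ?case
    by (rule thru_stable_eq[OF s thru.thru_step[OF thru_step.IH _ syz_map_hom[OF X N thru_step(3)] syz_map_hom[OF N Y thru_step(4)]] stable_eq_sym[OF s 3]])
      (use thru_step(2) in auto)
qed

subsection \<open>Indecomposable modules\<close>

definition indec :: "('a, 'a fgcar) module \<Rightarrow> bool" where
  "indec X \<longleftrightarrow> carrier X \<noteq> {\<zero>\<^bsub>X\<^esub>} \<and>
     (\<forall>U V. direct_decomposition A X U V \<longrightarrow> U = {\<zero>\<^bsub>X\<^esub>} \<or> V = {\<zero>\<^bsub>X\<^esub>})"

text \<open>One summand of the Fitting decomposition is zero. If it is the image, \<open>h\<close>
  is nilpotent; if it is the kernel, a positive power of \<open>h\<close> is onto, so
  \<open>h\<close> is onto, and \<open>h\<close> is injective on the image of that power.\<close>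

lemma indec_endo:
  assumes X: "fg_module A X" and ind: "indec X" and h: "h \<in> mod_hom A X X"
  shows "bij_betw h (carrier X) (carrier X) \<or> (\<exists>n. \<forall>x\<in>carrier X. (h ^^ n) x = \<zero>\<^bsub>X\<^esub>)"
proof -
  have LX: "left_module A X" by (rule fg_left_module[OF X])
  interpret X: left_module A X by (rule LX)
  obtain n where n: "0 < n" "direct_decomposition A X ((h ^^ n) ` carrier X) (a_kernel X X (h ^^ n))"
    "inj_on h ((h ^^ n) ` carrier X)"
    by (rule fitting[OF LX finite_length_A[OF X] h], rule that)
  have c: "(h ^^ i) x \<in> carrier X" if "x \<in> carrier X" for i x
    by (rule mod_homD(1)[OF mod_hom_funpow[OF h] that])
  consider "(h ^^ n) ` carrier X = {\<zero>\<^bsub>X\<^esub>}" | "a_kernel X X (h ^^ n) = {\<zero>\<^bsub>X\<^esub>}"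
    using ind n(2) unfolding indec_def by blast
  then show ?thesis
  proof cases
    case 1 then show ?thesis by blast
  next
    case 2
    have "(h ^^ n) ` carrier X <+>\<^bsub>X\<^esub> {\<zero>\<^bsub>X\<^esub>} = carrier X" using n(2) 2 by (simp add: direct_decomposition_def)
    moreover have "(h ^^ n) ` carrier X <+>\<^bsub>X\<^esub> {\<zero>\<^bsub>X\<^esub>} \<subseteq> (h ^^ n) ` carrier X"
      using c by (auto simp: X.set_add_iff)
    ultimately have im: "(h ^^ n) ` carrier X = carrier X" using c by blast
    obtain i where i: "n = Suc i" using n(1) by (metis gr0_implies_Suc)
    have "carrier X \<subseteq> h ` carrier X"
    proof
      fix y assume "y \<in> carrier X"
      then obtain x where "x \<in> carrier X" "y = h ((h ^^ i) x)" using im unfolding i by auto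
      then show "y \<in> h ` carrier X" using c by blast
    qed
    then have "h ` carrier X = carrier X" using mod_homD(1)[OF h] by blast
    then show ?thesis using n(3) im by (simp add: bij_betw_def)
  qed
qed

text \<open>The endomorphism ring is local. After composing with the inverse of \<open>f + g\<close>
  one has \<open>F + G = id\<close>. If neither were bijective, both would be nilpotent; but
  \<open>F\<close> then kills some nonzero \<open>x\<close>, and \<open>G\<close> fixes it.\<close>

lemma indec_local:
  assumes X: "fg_module A X" and ind: "indec X" and f: "f \<in> mod_hom A X X" and g: "g \<in> mod_hom A X X"
    and bij: "bij_betw (\<lambda>x. f x \<oplus>\<^bsub>X\<^esub> g x) (carrier X) (carrier X)"
  shows "bij_betw f (carrier X) (carrier X) \<or> bij_betw g (carrier X) (carrier X)"
proof -
  have LX: "left_module A X" by (rule fg_left_module[OF X])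
  interpret X: left_module A X by (rule LX)
  let ?u = "\<lambda>x. f x \<oplus>\<^bsub>X\<^esub> g x"
  let ?v = "inv_into (carrier X) ?u"
  have u: "?u \<in> mod_hom A X X" by (rule mod_hom_add[OF LX f g])
  have v: "?v \<in> mod_hom A X X" by (rule mod_hom_inv[OF LX u bij])
  have vb: "bij_betw ?v (carrier X) (carrier X)" by (rule bij_betw_inv_into[OF bij])
  define F where "F = (\<lambda>x. ?v (f x))"
  define G where "G = (\<lambda>x. ?v (g x))"
  have F: "F \<in> mod_hom A X X" and G: "G \<in> mod_hom A X X" unfolding F_def G_def by (rule mod_hom_comp[OF f v], rule mod_hom_comp[OF g v])
  note fc = mod_homD(1)[OF f] and gc = mod_homD(1)[OF g] and Fc = mod_homD(1)[OF F] and Gc = mod_homD(1)[OF G]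
  have FG: "F x \<oplus>\<^bsub>X\<^esub> G x = x" if x: "x \<in> carrier X" for x
    unfolding F_def G_def
    using mod_homD(2)[OF v fc[OF x] gc[OF x]] bij_betw_inv_into_left[OF bij x] by simp
  have transfer: "bij_betw k (carrier X) (carrier X)"
    if k: "k \<in> mod_hom A X X" and b: "bij_betw (\<lambda>x. ?v (k x)) (carrier X) (carrier X)" for k
  proof -
    have "bij_betw (\<lambda>x. ?u (?v (k x))) (carrier X) (carrier X)"
      using bij_betw_trans[OF b bij] by (simp add: comp_def)
    then show ?thesis
      using bij_betw_inv_into_right[OF bij] mod_homD(1)[OF k] by (subst bij_betw_cong[of _ _ "\<lambda>x. ?u (?v (k x))"]) auto
  qed
  show ?thesis
  proof (rule ccontr)
    assume "\<not> ?thesis"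
    then have "\<not> bij_betw F (carrier X) (carrier X)" "\<not> bij_betw G (carrier X) (carrier X)"
      using transfer[OF f] transfer[OF g] unfolding F_def G_def by auto
    then obtain n m where n: "\<forall>x\<in>carrier X. (F ^^ n) x = \<zero>\<^bsub>X\<^esub>" and m: "\<forall>x\<in>carrier X. (G ^^ m) x = \<zero>\<^bsub>X\<^esub>"
      using indec_endo[OF X ind F] indec_endo[OF X ind G] by blast
    obtain x0 where x0: "x0 \<in> carrier X" "x0 \<noteq> \<zero>\<^bsub>X\<^esub>" using ind X.M.zero_closed unfolding indec_def by blast
    \<comment> \<open>The element just before the \<open>F\<close>-orbit of \<open>x0\<close>
      reaches zero is nonzero and is killed by \<open>F\<close>.\<close>
    define k where "k = (LEAST k. (F ^^ k) x0 = \<zero>\<^bsub>X\<^esub>)"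
    have k0: "(F ^^ k) x0 = \<zero>\<^bsub>X\<^esub>" unfolding k_def by (rule LeastI[of _ n]) (use n x0 in simp)
    have "k \<noteq> 0" using k0 x0 by (intro notI) simp
    then obtain j where j: "k = Suc j" using not0_implies_Suc by blast
    define x where "x = (F ^^ j) x0"
    have x: "x \<in> carrier X" unfolding x_def by (rule mod_homD(1)[OF mod_hom_funpow[OF F] x0(1)])
    have "x \<noteq> \<zero>\<^bsub>X\<^esub>" using not_less_Least[of j "\<lambda>k. (F ^^ k) x0 = \<zero>\<^bsub>X\<^esub>"] j unfolding k_def x_def by auto
    have "F x = \<zero>\<^bsub>X\<^esub>" using k0 by (simp add: j x_def)
    then have Gx: "G x = x" using FG[OF x] Gc[OF x] by simp
    have "(G ^^ i) x = x" for i by (induction i) (simp_all add: Gx)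
    then show False using m x \<open>x \<noteq> \<zero>\<^bsub>X\<^esub>\<close> by metis
  qed
qed

text \<open>The Krull-Schmidt step: by locality, a bijective sum of maps has a summand that is
  already bijective.\<close>

lemma indec_thru_bij:
  assumes X: "fg_module A X" and ind: "indec X" and h: "thru Ns X X h" and bij: "bij_betw h (carrier X) (carrier X)"
  shows "\<exists>N\<in>Ns. \<exists>a\<in>mod_hom A X N. \<exists>b\<in>mod_hom A N X. bij_betw (\<lambda>x. b (a x)) (carrier X) (carrier X)"
  using h bij
proof induction
  case (thru_zero h)
  interpret X: left_module A X using X by (rule fg_left_module)
  have "carrier X = h ` carrier X" using thru_zero(2) by (simp add: bij_betw_def)
  also have "\<dots> \<subseteq> {\<zero>\<^bsub>X\<^esub>}" using thru_zero by auto
  finally have "carrier X = {\<zero>\<^bsub>X\<^esub>}" using X.M.zero_closed by blast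
  then show ?case using ind by (simp add: indec_def)
next
  case (thru_step f N a b h)
  have "bij_betw (\<lambda>x. f x \<oplus>\<^bsub>X\<^esub> b (a x)) (carrier X) (carrier X)"
    using thru_step(5,7) by (subst bij_betw_cong[of _ _ h]) auto
  from indec_local[OF X ind thru_hom[OF thru_step(1) X X] mod_hom_comp[OF thru_step(3,4)] this]
  show ?case using thru_step by blast
qed

text \<open>Bijectivity of the composite makes \<open>N\<close> the direct sum of the image of
  \<open>a\<close> and the kernel of \<open>b\<close>. Since \<open>N\<close> is indecomposable and
  \<open>X\<close> is nonzero, the kernel vanishes.\<close>

lemma indec_summand_iso:
  assumes X: "fg_module A X" and N: "fg_module A N" and iX: "indec X" and iN: "indec N"
    and a: "a \<in> mod_hom A X N" and b: "b \<in> mod_hom A N X"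
    and bij: "bij_betw (\<lambda>x. b (a x)) (carrier X) (carrier X)"
  shows "b \<in> mod_iso A N X"
proof -
  have LX: "left_module A X" and LN: "left_module A N" using X N by (auto intro: fg_left_module)
  interpret X: left_module A X by (rule LX)
  interpret N: left_module A N by (rule LN)
  have inj: "inj_on (\<lambda>x. b (a x)) (carrier X)" and surj: "(\<lambda>x. b (a x)) ` carrier X = carrier X"
    using bij by (auto simp: bij_betw_def)
  have im: "submodule (a ` carrier X) A N" by (rule mod_hom_image_submodule[OF LX LN a X.submodule_carrier])
  have ker: "submodule (a_kernel N X b) A N" by (rule mod_hom_kernel[OF LN LX b])
  have a0: "a \<zero>\<^bsub>X\<^esub> = \<zero>\<^bsub>N\<^esub>" and b0: "b \<zero>\<^bsub>N\<^esub> = \<zero>\<^bsub>X\<^esub>" by (rule mod_hom_zero[OF LX LN a], rule mod_hom_zero[OF LN LX b])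
  have "direct_decomposition A N (a ` carrier X) (a_kernel N X b)"
    unfolding direct_decomposition_def
  proof (intro conjI im ker)
    have "y \<in> a ` carrier X <+>\<^bsub>N\<^esub> a_kernel N X b" if y: "y \<in> carrier N" for y
    proof -
      have by': "b y \<in> carrier X" by (rule mod_homD(1)[OF b y])
      then have "b y \<in> (\<lambda>x. b (a x)) ` carrier X" using surj by simp
      then obtain x where x: "x \<in> carrier X" "b y = b (a x)" by blast
      have ax: "a x \<in> carrier N" by (rule mod_homD(1)[OF a x(1)])
      have "b (y \<ominus>\<^bsub>N\<^esub> a x) = \<zero>\<^bsub>X\<^esub>"
        using mod_hom_diff[OF LN LX b y ax] x(2) by' by (simp add: X.M.minus_eq X.M.r_neg)
      then have "y \<ominus>\<^bsub>N\<^esub> a x \<in> a_kernel N X b" using y ax by (simp add: a_kernel_iff N.M.minus_closed)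
      moreover have "y = a x \<oplus>\<^bsub>N\<^esub> (y \<ominus>\<^bsub>N\<^esub> a x)"
        using N.M.diff_add_cancel[OF y ax] y ax by (simp add: N.M.a_comm N.M.minus_closed)
      ultimately show ?thesis using x unfolding N.set_add_iff by blast
    qed
    moreover have "a ` carrier X <+>\<^bsub>N\<^esub> a_kernel N X b \<subseteq> carrier N"
      by (rule N.set_add_least[OF N.submodule_carrier])
        (use N.submoduleD(1)[OF im] N.submoduleD(1)[OF ker] in auto)
    ultimately show "a ` carrier X <+>\<^bsub>N\<^esub> a_kernel N X b = carrier N" by blast
    have "y = \<zero>\<^bsub>N\<^esub>" if y: "y \<in> a ` carrier X" "y \<in> a_kernel N X b" for y
    proof -
      obtain x where x: "x \<in> carrier X" "y = a x" using y(1) by blast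
      have "b (a x) = b (a \<zero>\<^bsub>X\<^esub>)" using y(2) x(2) a0 b0 by (simp add: a_kernel_iff)
      then have "x = \<zero>\<^bsub>X\<^esub>" using inj_onD[OF inj _ x(1) X.M.zero_closed] by simp
      then show ?thesis using x(2) a0 by simp
    qed
    then show "a ` carrier X \<inter> a_kernel N X b = {\<zero>\<^bsub>N\<^esub>}"
      using N.submoduleD(2)[OF im] N.submoduleD(2)[OF ker] by blast
  qed
  then consider "a ` carrier X = {\<zero>\<^bsub>N\<^esub>}" | "a_kernel N X b = {\<zero>\<^bsub>N\<^esub>}" using iN unfolding indec_def by blast
  then show ?thesis
  proof cases
    case 1
    have "x = \<zero>\<^bsub>X\<^esub>" if x: "x \<in> carrier X" for x
    proof -
      have "a x \<in> {\<zero>\<^bsub>N\<^esub>}" unfolding 1[symmetric] using x by (rule imageI)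
      then have "b (a x) = b (a \<zero>\<^bsub>X\<^esub>)" using a0 by simp
      then show ?thesis using inj_onD[OF inj _ x X.M.zero_closed] by simp
    qed
    then have "carrier X = {\<zero>\<^bsub>X\<^esub>}" using X.M.zero_closed by blast
    then show ?thesis using iX by (simp add: indec_def)
  next
    case 2
    have "inj_on b (carrier N)"
    proof (rule inj_onI)
      fix x y assume xy: "x \<in> carrier N" "y \<in> carrier N" "b x = b y"
      have "b (x \<ominus>\<^bsub>N\<^esub> y) = \<zero>\<^bsub>X\<^esub>"
        using mod_hom_diff[OF LN LX b xy(1,2)] xy mod_homD(1)[OF b] by (simp add: X.M.minus_eq X.M.r_neg)
      then have "x \<ominus>\<^bsub>N\<^esub> y \<in> a_kernel N X b" using xy by (simp add: a_kernel_iff N.M.minus_closed)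
      then show "x = y" using 2 N.M.diff_eq_zero_iff[OF xy(1,2)] by simp
    qed
    moreover have "b ` carrier N = carrier X"
    proof
      show "b ` carrier N \<subseteq> carrier X" using mod_homD(1)[OF b] by blast
      have "(\<lambda>x. b (a x)) ` carrier X \<subseteq> b ` carrier N" using mod_homD(1)[OF a] by blast
      then show "carrier X \<subseteq> b ` carrier N" using surj by simp
    qed
    ultimately show ?thesis using b by (simp add: mod_iso_def bij_betw_def)
  qed
qed

lemma decompose:
  assumes X: "fg_module A X" and nz: "carrier X \<noteq> {\<zero>\<^bsub>X\<^esub>}" and nind: "\<not> indec X"
  obtains U V where "direct_decomposition A X U V"
    "fg_module A (X\<lparr>carrier := U\<rparr>)" "fg_module A (X\<lparr>carrier := V\<rparr>)"
    "mlen (X\<lparr>carrier := U\<rparr>) < mlen X" "mlen (X\<lparr>carrier := V\<rparr>) < mlen X"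
proof -
  interpret X: left_module A X by (rule fg_left_module[OF X])
  obtain U V where d: "direct_decomposition A X U V" "U \<noteq> {\<zero>\<^bsub>X\<^esub>}" "V \<noteq> {\<zero>\<^bsub>X\<^esub>}"
    using nz nind unfolding indec_def by blast
  have U: "submodule U A X" and V: "submodule V A X" and UV: "U \<inter> V = {\<zero>\<^bsub>X\<^esub>}"
    using d(1) by (auto simp: direct_decomposition_def)
  have "U \<noteq> carrier X" "V \<noteq> carrier X"
    using d(2,3) UV X.submoduleD(1)[OF U] X.submoduleD(1)[OF V] by blast+
  then show thesis
    using that[OF d(1) fg_sub[OF X U] fg_sub[OF X V]] mlen_sub_less[OF X U] mlen_sub_less[OF X V] by blast
qed

lemma indec_summands_ex:
  "fg_module A X \<Longrightarrow> \<exists>Bs. finite Bs \<and> (\<forall>B\<in>Bs. fg_module A B \<and> indec B) \<and> thru Bs X X (\<lambda>x. x)"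
proof (induction "mlen X" arbitrary: X rule: less_induct)
  case less
  note X = less.prems
  consider "carrier X = {\<zero>\<^bsub>X\<^esub>}" | "indec X" | "carrier X \<noteq> {\<zero>\<^bsub>X\<^esub>}" "\<not> indec X" by blast
  then show ?case
  proof cases
    case 1
    then show ?thesis by (intro exI[of _ "{}"]) (auto intro: thru_zero)
  next
    case 2
    then show ?thesis
      using X thru_comp[OF X, of X "{X}", OF _ mod_hom_id mod_hom_id] by (intro exI[of _ "{X}"]) auto
  next
    case 3
    obtain U V where d: "direct_decomposition A X U V"
      and fg: "fg_module A (X\<lparr>carrier := U\<rparr>)" "fg_module A (X\<lparr>carrier := V\<rparr>)"
      and len: "mlen (X\<lparr>carrier := U\<rparr>) < mlen X" "mlen (X\<lparr>carrier := V\<rparr>) < mlen X"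
      by (rule decompose[OF X 3], rule that)
    have LX: "left_module A X" by (rule fg_left_module[OF X])
    have sub: "submodule U A X" "submodule V A X" using d by (auto simp: direct_decomposition_def)
    obtain Bs where Bs: "finite Bs" "\<forall>B\<in>Bs. fg_module A B \<and> indec B" "thru Bs (X\<lparr>carrier := U\<rparr>) (X\<lparr>carrier := U\<rparr>) (\<lambda>x. x)"
      using less.hyps[OF len(1) fg(1)] by blast
    obtain Cs where Cs: "finite Cs" "\<forall>B\<in>Cs. fg_module A B \<and> indec B" "thru Cs (X\<lparr>carrier := V\<rparr>) (X\<lparr>carrier := V\<rparr>) (\<lambda>x. x)"
      using less.hyps[OF len(2) fg(2)] by blast
    obtain p q where pq: "p \<in> mod_hom A X (X\<lparr>carrier := U\<rparr>)" "q \<in> mod_hom A X (X\<lparr>carrier := V\<rparr>)"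
      "\<And>x. x \<in> carrier X \<Longrightarrow> x = p x \<oplus>\<^bsub>X\<^esub> q x" "\<And>u. u \<in> U \<Longrightarrow> p u = u" "\<And>v. v \<in> V \<Longrightarrow> q v = v"
      "\<And>v. v \<in> V \<Longrightarrow> p v = \<zero>\<^bsub>X\<^esub>" "\<And>u. u \<in> U \<Longrightarrow> q u = \<zero>\<^bsub>X\<^esub>"
      by (rule direct_decomposition_maps[OF LX d], rule that)
    have "thru (Bs \<union> Cs) X X p"
      by (rule thru_mono[OF thru_post[OF X fg(1) X thru_pre[OF Bs(3) pq(1)] mod_hom_sub_incl[OF LX sub(1) mod_hom_id]]]) simp
    moreover have "thru (Bs \<union> Cs) X X q"
      by (rule thru_mono[OF thru_post[OF X fg(2) X thru_pre[OF Cs(3) pq(2)] mod_hom_sub_incl[OF LX sub(2) mod_hom_id]]]) simp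
    ultimately have "thru (Bs \<union> Cs) X X (\<lambda>x. p x \<oplus>\<^bsub>X\<^esub> q x)" by (rule thru_add[OF X X])
    then have "thru (Bs \<union> Cs) X X (\<lambda>x. x)" by (rule thru_cong) (use pq(3) in blast)
    then show ?thesis using Bs Cs by (intro exI[of _ "Bs \<union> Cs"]) auto
  qed
qed

section \<open>Krull-Schmidt multiplicities, tested by additive functions\<close>

definition additive :: "(('a, 'a fgcar) module \<Rightarrow> nat) \<Rightarrow> bool" where
  "additive \<phi> \<longleftrightarrow> (\<forall>X Y f. fg_module A X \<and> fg_module A Y \<and> f \<in> mod_iso A X Y \<longrightarrow> \<phi> X = \<phi> Y) \<and>
     (\<forall>X U V. fg_module A X \<and> direct_decomposition A X U V \<longrightarrow> \<phi> X = \<phi> (X\<lparr>carrier := U\<rparr>) + \<phi> (X\<lparr>carrier := V\<rparr>))"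

text \<open>A zero module is the direct sum of itself with itself, so its value equals twice that
  value.\<close>

lemma additive_zero:
  assumes phi: "additive \<phi>" and X: "fg_module A X" and z: "carrier X = {\<zero>\<^bsub>X\<^esub>}"
  shows "\<phi> X = 0"
proof -
  interpret X: left_module A X by (rule fg_left_module[OF X])
  have "direct_decomposition A X (carrier X) (carrier X)"
    unfolding direct_decomposition_def using X.submodule_carrier
    by (auto simp: z set_eq_iff X.set_add_iff)
  then have "\<phi> X = \<phi> (X\<lparr>carrier := carrier X\<rparr>) + \<phi> (X\<lparr>carrier := carrier X\<rparr>)"
    using phi X unfolding additive_def by blast
  then show ?thesis by simp
qed

text \<open>The coefficients are the multiplicities of the members of \<open>Bs\<close> in
  \<open>X\<close>. The order of quantifiers matters: one vector \<open>c\<close> serves all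
  additive functions, in particular the Hom lengths at all syzygy stages.\<close>

lemma additive_combination:
  assumes Bs: "finite Bs" "\<And>B. B \<in> Bs \<Longrightarrow> fg_module A B \<and> indec B"
  shows "fg_module A X \<Longrightarrow> thru Bs X X (\<lambda>x. x) \<Longrightarrow> \<exists>c. \<forall>\<phi>. additive \<phi> \<longrightarrow> \<phi> X = (\<Sum>B\<in>Bs. c B * \<phi> B)"
proof (induction "mlen X" arbitrary: X rule: less_induct)
  case less
  note X = less.prems(1) and th = less.prems(2)
  have LX: "left_module A X" by (rule fg_left_module[OF X])
  consider "carrier X = {\<zero>\<^bsub>X\<^esub>}" | "indec X" | "carrier X \<noteq> {\<zero>\<^bsub>X\<^esub>}" "\<not> indec X" by blast
  then show ?case
  proof cases
    case 1
    then show ?thesis using additive_zero[OF _ X 1] by (intro exI[of _ "\<lambda>_. 0"]) auto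
  next
    case 2
    \<comment> \<open>The identity is a bijective sum of maps through \<open>Bs\<close>, so an
      indecomposable \<open>X\<close> is isomorphic to a single member of \<open>Bs\<close>.\<close>
    have "bij_betw (\<lambda>x. x) (carrier X) (carrier X)" by (simp add: bij_betw_def)
    from indec_thru_bij[OF X 2 th this] obtain B a b where B: "B \<in> Bs" "a \<in> mod_hom A X B" "b \<in> mod_hom A B X"
      "bij_betw (\<lambda>x. b (a x)) (carrier X) (carrier X)" by blast
    have iso: "b \<in> mod_iso A B X"
      by (rule indec_summand_iso[OF X _ 2 _ B(2,3,4)]) (use Bs(2)[OF B(1)] in auto)
    have "\<phi> X = (\<Sum>C\<in>Bs. (if C = B then 1 else 0) * \<phi> C)" if phi: "additive \<phi>" for \<phi>
    proof -
      have "\<phi> B = \<phi> X" using phi iso X Bs(2)[OF B(1)] unfolding additive_def by blast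
      moreover have "(\<Sum>C\<in>Bs. (if C = B then 1 else 0) * \<phi> C) = (\<Sum>C\<in>Bs. if C = B then \<phi> C else 0)"
        by (rule sum.cong) auto
      ultimately show ?thesis using B(1) Bs(1) by simp
    qed
    then show ?thesis by (intro exI[of _ "\<lambda>C. if C = B then 1 else 0"]) blast
  next
    case 3
    obtain U V where d: "direct_decomposition A X U V"
      and fg: "fg_module A (X\<lparr>carrier := U\<rparr>)" "fg_module A (X\<lparr>carrier := V\<rparr>)"
      and len: "mlen (X\<lparr>carrier := U\<rparr>) < mlen X" "mlen (X\<lparr>carrier := V\<rparr>) < mlen X"
      by (rule decompose[OF X 3], rule that)
    have sub: "submodule U A X" "submodule V A X" using d by (auto simp: direct_decomposition_def)
    obtain p q where pq: "p \<in> mod_hom A X (X\<lparr>carrier := U\<rparr>)" "q \<in> mod_hom A X (X\<lparr>carrier := V\<rparr>)"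
      "\<And>x. x \<in> carrier X \<Longrightarrow> x = p x \<oplus>\<^bsub>X\<^esub> q x" "\<And>u. u \<in> U \<Longrightarrow> p u = u" "\<And>v. v \<in> V \<Longrightarrow> q v = v"
      "\<And>v. v \<in> V \<Longrightarrow> p v = \<zero>\<^bsub>X\<^esub>" "\<And>u. u \<in> U \<Longrightarrow> q u = \<zero>\<^bsub>X\<^esub>"
      by (rule direct_decomposition_maps[OF LX d], rule that)
    \<comment> \<open>The identity of a summand is the identity of \<open>X\<close> compressed by
      inclusion and projection, so the summands stay in the additive closure and the induction
      applies.\<close>
    have "thru Bs (X\<lparr>carrier := U\<rparr>) (X\<lparr>carrier := U\<rparr>) (\<lambda>x. p x)"
      by (rule thru_post[OF fg(1) X fg(1) thru_pre[OF th mod_hom_sub_incl[OF LX sub(1) mod_hom_id]] pq(1)])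
    then have U: "thru Bs (X\<lparr>carrier := U\<rparr>) (X\<lparr>carrier := U\<rparr>) (\<lambda>x. x)" by (rule thru_cong) (simp add: pq(4))
    have "thru Bs (X\<lparr>carrier := V\<rparr>) (X\<lparr>carrier := V\<rparr>) (\<lambda>x. q x)"
      by (rule thru_post[OF fg(2) X fg(2) thru_pre[OF th mod_hom_sub_incl[OF LX sub(2) mod_hom_id]] pq(2)])
    then have V: "thru Bs (X\<lparr>carrier := V\<rparr>) (X\<lparr>carrier := V\<rparr>) (\<lambda>x. x)" by (rule thru_cong) (simp add: pq(5))
    obtain c where c: "\<And>\<phi>. additive \<phi> \<Longrightarrow> \<phi> (X\<lparr>carrier := U\<rparr>) = (\<Sum>B\<in>Bs. c B * \<phi> B)"
      using less.hyps[OF len(1) fg(1) U] by blast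
    obtain c' where c': "\<And>\<phi>. additive \<phi> \<Longrightarrow> \<phi> (X\<lparr>carrier := V\<rparr>) = (\<Sum>B\<in>Bs. c' B * \<phi> B)"
      using less.hyps[OF len(2) fg(2) V] by blast
    have "\<phi> X = (\<Sum>B\<in>Bs. (c B + c' B) * \<phi> B)" if phi: "additive \<phi>" for \<phi>
    proof -
      have "\<phi> X = \<phi> (X\<lparr>carrier := U\<rparr>) + \<phi> (X\<lparr>carrier := V\<rparr>)"
        using phi X d unfolding additive_def by blast
      then show ?thesis by (simp add: c[OF phi] c'[OF phi] sum.distrib algebra_simps)
    qed
    then show ?thesis by (intro exI[of _ "\<lambda>B. c B + c' B"]) blast
  qed
qed

end

section \<open>Homomorphism modules modulo eventually null maps\<close>

text \<open>\<open>finite_length_inc_stable\<close> provides only one repetition. It is applied to a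
  subsequence whose value changes at every step, which exists if the sequence never becomes
  constant.\<close>

lemma finite_length_inc_eventually:
  assumes fin: "finite_length A M E F"
    and C: "\<And>i. submodule (C i) A M \<and> E \<subseteq> C i \<and> C i \<subseteq> F \<and> C i \<subseteq> C (Suc i)"
  shows "\<exists>n. \<forall>m\<ge>n. C m = C n"
proof (rule ccontr)
  assume "\<not> ?thesis"
  then have ex: "\<exists>m\<ge>n. C m \<noteq> C n" for n by blast
  have "\<exists>f. \<forall>n::nat. True \<and> ((f n :: nat) \<le> f (Suc n) \<and> C (f (Suc n)) \<noteq> C (f n))"
    by (rule dependent_nat_choice) (use ex in auto)
  then obtain f :: "nat \<Rightarrow> nat" where f: "\<And>n. f n \<le> f (Suc n)" "\<And>n. C (f (Suc n)) \<noteq> C (f n)" by blast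
  have mono: "C i \<subseteq> C j" if "i \<le> j" for i j
    using that C by (metis lift_Suc_mono_le)
  have "\<exists>n. C (f n) = C (f (Suc n))"
    by (rule finite_length_inc_stable[OF fin]) (use C mono[OF f(1)] in blast)
  then show False using f(2) by metis
qed

text \<open>Gaussian elimination: the vectors eventually orthogonal to the sequence form a finitely
  generated module.\<close>

lemma eventually_orthogonal_uniform:
  fixes w :: "nat \<Rightarrow> 'b \<Rightarrow> int"
  assumes "finite B"
  shows "\<exists>n. \<forall>v. (\<exists>m. \<forall>k\<ge>m. (\<Sum>b\<in>B. v b * w k b) = 0) \<longrightarrow> (\<forall>k\<ge>n. (\<Sum>b\<in>B. v b * w k b) = 0)"
  using assms
proof (induction B rule: finite_induct)
  case empty show ?case by simp
next
  case (insert x B)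
  then obtain n where n: "\<And>v m. (\<forall>k\<ge>m. (\<Sum>b\<in>B. v b * w k b) = 0) \<Longrightarrow> (\<forall>k\<ge>n. (\<Sum>b\<in>B. v b * w k b) = 0)"
    by blast
  have sum: "(\<Sum>b\<in>insert x B. v b * w k b) = v x * w k x + (\<Sum>b\<in>B. v b * w k b)" for v k
    using insert by simp
  show ?case
  proof (cases "\<exists>v m. v x \<noteq> 0 \<and> (\<forall>k\<ge>m. (\<Sum>b\<in>insert x B. v b * w k b) = 0)")
    case False
    have "\<forall>k\<ge>n. (\<Sum>b\<in>insert x B. v b * w k b) = 0" if "\<forall>k\<ge>m. (\<Sum>b\<in>insert x B. v b * w k b) = 0" for v m
    proof -
      have "v x = 0" using False that by blast
      then show ?thesis using that n[of m v] by (simp add: sum)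
    qed
    then show ?thesis by blast
  next
    case True
    then obtain u l where u: "u x \<noteq> 0" "\<And>k. k \<ge> l \<Longrightarrow> (\<Sum>b\<in>insert x B. u b * w k b) = 0" by blast
    have "\<forall>k\<ge>max n l. (\<Sum>b\<in>insert x B. v b * w k b) = 0" if v: "\<forall>k\<ge>m. (\<Sum>b\<in>insert x B. v b * w k b) = 0" for v m
    proof (intro allI impI)
      fix k assume k: "k \<ge> max n l"
      \<comment> \<open>The pivot \<open>u\<close> clears the \<open>x\<close>-coordinate of
        \<open>v\<close>, so the induction hypothesis applies to \<open>v'\<close> over
        \<open>B\<close>. Cross-multiplication keeps the entries integral, and \<open>l\<close>
        depends on the pivot only, so the bound is uniform in \<open>v\<close>.\<close>
      define v' where "v' b = u x * v b - v x * u b" for b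
      have e: "(\<Sum>b\<in>B. v' b * w i b) = u x * (\<Sum>b\<in>insert x B. v b * w i b) - v x * (\<Sum>b\<in>insert x B. u b * w i b)" for i
      proof -
        have "(\<Sum>b\<in>B. v' b * w i b) = u x * (\<Sum>b\<in>B. v b * w i b) - v x * (\<Sum>b\<in>B. u b * w i b)"
          unfolding v'_def by (simp add: sum_distrib_left sum_subtractf[symmetric] left_diff_distrib mult.assoc)
        then show ?thesis unfolding sum by (simp add: algebra_simps)
      qed
      have "\<forall>i\<ge>max m l. (\<Sum>b\<in>B. v' b * w i b) = 0" using v u(2) by (auto simp: e)
      then have "(\<Sum>b\<in>B. v' b * w k b) = 0" using n[of "max m l" v'] k by auto
      then have "u x * (\<Sum>b\<in>insert x B. v b * w k b) = 0" using e[of k] u(2)[of k] k by simp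
      then show "(\<Sum>b\<in>insert x B. v b * w k b) = 0" using u(1) by simp
    qed
    then show ?thesis by blast
  qed
qed

context artin_algebra
begin

text \<open>Functions are taken extensional so that equality of elements is equality on the carrier,
  as the module laws demand. The values of \<open>mult\<close> and \<open>one\<close> are fillers
  for the record.\<close>

definition hom_module :: "('a, 'a fgcar) module \<Rightarrow> ('a, 'a fgcar) module \<Rightarrow> ('r, 'a fgcar \<Rightarrow> 'a fgcar) module" where
  "hom_module L X = \<lparr>carrier = mod_hom A L X \<inter> extensional (carrier L), mult = (\<lambda>f g. f), one = undefined,
     zero = (\<lambda>x\<in>carrier L. \<zero>\<^bsub>X\<^esub>), add = (\<lambda>f g. \<lambda>x\<in>carrier L. f x \<oplus>\<^bsub>X\<^esub> g x),
     smult = (\<lambda>r f. \<lambda>x\<in>carrier L. rho r \<odot>\<^bsub>X\<^esub> f x)\<rparr>"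

lemma hom_module_simps:
  "carrier (hom_module L X) = mod_hom A L X \<inter> extensional (carrier L)"
  "\<zero>\<^bsub>hom_module L X\<^esub> = (\<lambda>x\<in>carrier L. \<zero>\<^bsub>X\<^esub>)"
  "f \<oplus>\<^bsub>hom_module L X\<^esub> g = (\<lambda>x\<in>carrier L. f x \<oplus>\<^bsub>X\<^esub> g x)"
  "r \<odot>\<^bsub>hom_module L X\<^esub> f = (\<lambda>x\<in>carrier L. rho r \<odot>\<^bsub>X\<^esub> f x)"
  by (simp_all add: hom_module_def)

text \<open>Linearity over \<open>A\<close> comes from the centrality of
  \<open>rho r\<close>.\<close>

lemma rho_scale_hom:
  assumes X: "left_module A X" and r: "r \<in> carrier R"
  shows "(\<lambda>x. rho r \<odot>\<^bsub>X\<^esub> x) \<in> mod_hom A X X"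
proof -
  interpret X: left_module A X by fact
  show ?thesis
  proof (rule mod_homI)
    fix a x assume "a \<in> carrier A" "x \<in> carrier X"
    then show "rho r \<odot>\<^bsub>X\<^esub> (a \<odot>\<^bsub>X\<^esub> x) = a \<odot>\<^bsub>X\<^esub> (rho r \<odot>\<^bsub>X\<^esub> x)"
      using r rho_central[OF r, of a] by (simp add: X.smult_assoc1[symmetric])
  qed (use r in \<open>auto simp: X.smult_r_distr\<close>)
qed

lemma restrict_hom:
  assumes L: "fg_module A L" and f: "f \<in> mod_hom A L X"
  shows "restrict f (carrier L) \<in> carrier (hom_module L X)"
  using mod_hom_cong[OF fg_left_module[OF L] f, of "restrict f (carrier L)"] by (simp add: hom_module_simps)

lemma hom_module_left_module:
  assumes L: "fg_module A L" and X: "fg_module A X"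
  shows "left_module R (hom_module L X)"
proof -
  interpret L: left_module A L using L by (rule fg_left_module)
  interpret X: left_module A X using X by (rule fg_left_module)
  note LX = X.left_module_axioms
  have hc: "f x \<in> carrier X" if "f \<in> carrier (hom_module L X)" "x \<in> carrier L" for f x
    using that mod_homD(1) by (auto simp: hom_module_simps)
  have ext: "(\<lambda>x\<in>carrier L. f x) = f" if "f \<in> carrier (hom_module L X)" for f
    using that by (auto simp: hom_module_simps extensional_restrict)
  have grp: "abelian_group (hom_module L X)"
  proof (rule abelian_groupI)
    fix f g assume "f \<in> carrier (hom_module L X)" "g \<in> carrier (hom_module L X)"
    then show "f \<oplus>\<^bsub>hom_module L X\<^esub> g \<in> carrier (hom_module L X)"
      using restrict_hom[OF L mod_hom_add[OF LX, of f L g]] by (simp add: hom_module_simps)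
    show "f \<oplus>\<^bsub>hom_module L X\<^esub> g = g \<oplus>\<^bsub>hom_module L X\<^esub> f"
      using hc[OF \<open>f \<in> _\<close>] hc[OF \<open>g \<in> _\<close>] by (auto simp: hom_module_simps fun_eq_iff X.M.a_comm restrict_def)
  next
    show "\<zero>\<^bsub>hom_module L X\<^esub> \<in> carrier (hom_module L X)"
      using restrict_hom[OF L mod_hom_const_zero[OF LX]] by (simp add: hom_module_simps)
  next
    fix f g h assume fgh: "f \<in> carrier (hom_module L X)" "g \<in> carrier (hom_module L X)" "h \<in> carrier (hom_module L X)"
    show "f \<oplus>\<^bsub>hom_module L X\<^esub> g \<oplus>\<^bsub>hom_module L X\<^esub> h = f \<oplus>\<^bsub>hom_module L X\<^esub> (g \<oplus>\<^bsub>hom_module L X\<^esub> h)"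
      using hc[OF fgh(1)] hc[OF fgh(2)] hc[OF fgh(3)] by (auto simp: hom_module_simps fun_eq_iff X.M.a_assoc restrict_def)
  next
    fix f assume f: "f \<in> carrier (hom_module L X)"
    have "\<zero>\<^bsub>hom_module L X\<^esub> \<oplus>\<^bsub>hom_module L X\<^esub> f = (\<lambda>x\<in>carrier L. f x)"
      using hc[OF f] by (auto simp: hom_module_simps fun_eq_iff restrict_def)
    then show "\<zero>\<^bsub>hom_module L X\<^esub> \<oplus>\<^bsub>hom_module L X\<^esub> f = f" unfolding ext[OF f] .
    have "(\<lambda>x\<in>carrier L. \<ominus>\<^bsub>X\<^esub> f x) \<in> carrier (hom_module L X)"
      using restrict_hom[OF L mod_hom_neg[OF LX, of f L]] f by (simp add: hom_module_simps)
    moreover have "(\<lambda>x\<in>carrier L. \<ominus>\<^bsub>X\<^esub> f x) \<oplus>\<^bsub>hom_module L X\<^esub> f = \<zero>\<^bsub>hom_module L X\<^esub>"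
      using hc[OF f] by (auto simp: hom_module_simps fun_eq_iff X.M.l_neg restrict_def)
    ultimately show "\<exists>g\<in>carrier (hom_module L X). g \<oplus>\<^bsub>hom_module L X\<^esub> f = \<zero>\<^bsub>hom_module L X\<^esub>" by blast
  qed
  show ?thesis
  proof (intro left_module.intro left_module_axioms.intro ring_R grp)
    fix r f assume r: "r \<in> carrier R" and f: "f \<in> carrier (hom_module L X)"
    show "r \<odot>\<^bsub>hom_module L X\<^esub> f \<in> carrier (hom_module L X)"
      using restrict_hom[OF L mod_hom_comp[OF _ rho_scale_hom[OF LX r], of f L]] f by (simp add: hom_module_simps)
  next
    fix r s f assume rs: "r \<in> carrier R" "s \<in> carrier R" and f: "f \<in> carrier (hom_module L X)"
    show "(r \<oplus>\<^bsub>R\<^esub> s) \<odot>\<^bsub>hom_module L X\<^esub> f = r \<odot>\<^bsub>hom_module L X\<^esub> f \<oplus>\<^bsub>hom_module L X\<^esub> s \<odot>\<^bsub>hom_module L X\<^esub> f"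
      using hc[OF f] rs ring_hom_add[OF rho_hom] by (auto simp: hom_module_simps fun_eq_iff X.smult_l_distr restrict_def)
    show "(r \<otimes>\<^bsub>R\<^esub> s) \<odot>\<^bsub>hom_module L X\<^esub> f = r \<odot>\<^bsub>hom_module L X\<^esub> (s \<odot>\<^bsub>hom_module L X\<^esub> f)"
      using hc[OF f] rs ring_hom_mult[OF rho_hom] by (auto simp: hom_module_simps fun_eq_iff X.smult_assoc1 restrict_def)
  next
    fix r f g assume r: "r \<in> carrier R" and fg: "f \<in> carrier (hom_module L X)" "g \<in> carrier (hom_module L X)"
    show "r \<odot>\<^bsub>hom_module L X\<^esub> (f \<oplus>\<^bsub>hom_module L X\<^esub> g) = r \<odot>\<^bsub>hom_module L X\<^esub> f \<oplus>\<^bsub>hom_module L X\<^esub> r \<odot>\<^bsub>hom_module L X\<^esub> g"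
      using hc[OF fg(1)] hc[OF fg(2)] r by (auto simp: hom_module_simps fun_eq_iff X.smult_r_distr restrict_def)
  next
    fix f assume f: "f \<in> carrier (hom_module L X)"
    have "(\<lambda>x\<in>carrier L. rho \<one>\<^bsub>R\<^esub> \<odot>\<^bsub>X\<^esub> f x) = (\<lambda>x\<in>carrier L. f x)"
      using hc[OF f] ring_hom_one[OF rho_hom] by (auto simp: fun_eq_iff restrict_def)
    then show "\<one>\<^bsub>R\<^esub> \<odot>\<^bsub>hom_module L X\<^esub> f = f" unfolding ext[OF f] by (simp add: hom_module_simps)
  qed
qed

text \<open>Generators of \<open>L\<close> are imposed as zeros one at a time. Evaluation at a
  further generator embeds each resulting quotient into \<open>X\<close>, of finite length over
  \<open>R\<close>; a map vanishing on all generators is zero.\<close>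

lemma hom_module_finite_length:
  assumes L: "fg_module A L" and X: "fg_module A X"
  shows "finite_length R (hom_module L X) {\<zero>\<^bsub>hom_module L X\<^esub>} (carrier (hom_module L X))"
proof -
  interpret L: left_module A L using L by (rule fg_left_module)
  interpret X: left_module A X using X by (rule fg_left_module)
  have LH: "left_module R (hom_module L X)" by (rule hom_module_left_module[OF L X])
  interpret H: left_module R "hom_module L X" by (rule LH)
  have LXR: "left_module R (restrict_scalars rho X)"
    by (rule restrict_scalars_left_module[OF ring_R rho_hom X.left_module_axioms])
  interpret XR: left_module R "restrict_scalars rho X" by (rule LXR)
  obtain S where S: "finite S" "S \<subseteq> carrier L" "\<And>H. submodule H A L \<Longrightarrow> S \<subseteq> H \<Longrightarrow> H = carrier L"
    by (rule finitely_generatedE[of A L]) (use L in \<open>auto simp: fg_module_def\<close>)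
  define Z where "Z T = {h \<in> carrier (hom_module L X). \<forall>s\<in>T. h s = \<zero>\<^bsub>X\<^esub>}" for T
  have Z: "submodule (Z T) R (hom_module L X)" if "T \<subseteq> carrier L" for T
  proof (rule H.left_submoduleI)
    have "\<zero>\<^bsub>hom_module L X\<^esub> \<in> Z T" unfolding Z_def using that H.M.zero_closed by (auto simp: hom_module_simps(2))
    then show "Z T \<noteq> {}" by blast
  next
    fix f g assume fg: "f \<in> Z T" "g \<in> Z T"
    then have "f \<oplus>\<^bsub>hom_module L X\<^esub> g \<in> carrier (hom_module L X)" by (simp add: Z_def)
    moreover have "(f \<oplus>\<^bsub>hom_module L X\<^esub> g) s = \<zero>\<^bsub>X\<^esub>" if "s \<in> T" for s
      using fg that \<open>T \<subseteq> carrier L\<close> by (simp add: Z_def hom_module_simps(3) subset_iff)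
    ultimately show "f \<oplus>\<^bsub>hom_module L X\<^esub> g \<in> Z T" by (simp add: Z_def)
  next
    fix r f assume rf: "r \<in> carrier R" "f \<in> Z T"
    then have "r \<odot>\<^bsub>hom_module L X\<^esub> f \<in> carrier (hom_module L X)" by (simp add: Z_def)
    moreover have "(r \<odot>\<^bsub>hom_module L X\<^esub> f) s = \<zero>\<^bsub>X\<^esub>" if "s \<in> T" for s
      using rf that \<open>T \<subseteq> carrier L\<close> by (simp add: Z_def hom_module_simps(4) subset_iff)
    ultimately show "r \<odot>\<^bsub>hom_module L X\<^esub> f \<in> Z T" by (simp add: Z_def)
  qed (auto simp: Z_def)
  have ev: "(\<lambda>h. h s) \<in> mod_hom R (hom_module L X) (restrict_scalars rho X)" if "s \<in> carrier L" for s
    using that by (intro mod_homI) (auto simp: hom_module_simps mod_homD(1))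
  have "finite_length R (hom_module L X) (Z S) (carrier (hom_module L X))"
    using S(1,2)
  proof (induction S rule: finite_induct)
    case empty
    have "Z {} = carrier (hom_module L X)" by (simp add: Z_def)
    then show ?case using finite_length_trivial by simp
  next
    case (insert s T)
    then have IH: "finite_length R (hom_module L X) (Z T) (carrier (hom_module L X))" and s: "s \<in> carrier L" and T: "T \<subseteq> carrier L"
      by auto
    have "finite_length R (hom_module L X) (Z (insert s T)) (Z T)"
    proof (rule rel_length_inj(1)[OF LH LXR ev[OF s] Z[OF T]])
      show "finite_length R (restrict_scalars rho X) {\<zero>\<^bsub>X\<^esub>} (carrier X)" by (rule finite_length_R[OF X])
      show "submodule {\<zero>\<^bsub>X\<^esub>} R (restrict_scalars rho X)" using XR.submodule_zero by simp
      show "submodule (carrier X) R (restrict_scalars rho X)" using XR.submodule_carrier by simp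
      show "(\<lambda>h. h s) ` Z T \<subseteq> carrier X" using mod_homD(1)[OF ev[OF s]] by (auto simp: Z_def)
    qed (auto simp: Z_def)
    then show ?case
      by (rule H.finite_length_add[OF Z[OF T] H.submodule_carrier _ _ _ IH, rotated 2]) (auto simp: Z_def)
  qed
  then show ?thesis
  proof (rule finite_length_mono)
    show "Z S \<subseteq> {\<zero>\<^bsub>hom_module L X\<^esub>}"
    proof
      fix h assume h: "h \<in> Z S"
      then have hh: "h \<in> mod_hom A L X" "h \<in> extensional (carrier L)" by (auto simp: Z_def hom_module_simps)
      have "a_kernel L X h = carrier L"
        by (rule S(3)[OF mod_hom_kernel[OF L.left_module_axioms X.left_module_axioms hh(1)]])
          (use h S(2) in \<open>auto simp: Z_def a_kernel_iff\<close>)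
      then have "h x = \<zero>\<^bsub>X\<^esub>" if "x \<in> carrier L" for x using that by (auto simp: set_eq_iff a_kernel_iff)
      then have "h = (\<lambda>x\<in>carrier L. \<zero>\<^bsub>X\<^esub>)" using hh(2) by (intro extensionalityI) auto
      then show "h \<in> {\<zero>\<^bsub>hom_module L X\<^esub>}" by (simp add: hom_module_simps)
    qed
  qed simp
qed

section \<open>Maps that become null after finitely many syzygies\<close>

definition null_at :: "nat \<Rightarrow> ('a, 'a fgcar) module \<Rightarrow> ('a, 'a fgcar) module \<Rightarrow> ('a fgcar \<Rightarrow> 'a fgcar) \<Rightarrow> bool" where
  "null_at j X Y h \<longleftrightarrow> h \<in> mod_hom A X Y \<and> null (syz j X) (syz j Y) (syz_map j X Y h)"

lemma null_at_mono:
  assumes X: "fg_module A X" and Y: "fg_module A Y" and n: "null_at j X Y h" and jk: "j \<le> k"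
  shows "null_at k X Y h"
proof -
  have "null (syz (k - j) (syz j X)) (syz (k - j) (syz j Y)) (syz_map (k - j) (syz j X) (syz j Y) (syz_map j X Y h))"
    by (rule syz_map_null[OF syz_fg[OF X] syz_fg[OF Y]]) (use n in \<open>simp add: null_at_def\<close>)
  then show ?thesis using n jk unfolding syz_map_syz_map syz_syz by (simp add: null_at_def)
qed

lemma null_at_stable_eq:
  assumes X: "fg_module A X" and Y: "fg_module A Y" and s: "stable_eq X Y f g" and n: "null_at j X Y g"
  shows "null_at j X Y f"
  using null_stable_eq[OF syz_fg[OF X] syz_fg[OF Y] syz_map_stable_eq[OF X Y s]] n stable_eq_hom[OF s] by (simp add: null_at_def)

lemma null_at_cong:
  assumes X: "fg_module A X" and Y: "fg_module A Y" and n: "null_at j X Y g" and e: "\<And>x. x \<in> carrier X \<Longrightarrow> f x = g x"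
  shows "null_at j X Y f"
  by (rule null_at_stable_eq[OF X Y stable_eq_sym[OF X Y stable_eq_cong[OF X Y _ e]] n]) (use n in \<open>simp add: null_at_def\<close>)

lemma null_at_null: "\<lbrakk>fg_module A X; fg_module A Y; null X Y f\<rbrakk> \<Longrightarrow> null_at j X Y f"
  using syz_map_null null_hom by (simp add: null_at_def)

lemma null_at_add:
  assumes X: "fg_module A X" and Y: "fg_module A Y" and f: "null_at j X Y f" and g: "null_at j X Y g"
  shows "null_at j X Y (\<lambda>x. f x \<oplus>\<^bsub>Y\<^esub> g x)"
proof -
  have fg: "f \<in> mod_hom A X Y" "g \<in> mod_hom A X Y" using f g by (auto simp: null_at_def)
  show ?thesis
    unfolding null_at_def
    using null_stable_eq[OF syz_fg[OF X] syz_fg[OF Y] syz_map_add[OF X Y fg] null_add[OF syz_fg[OF Y]]] f g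
      mod_hom_add[OF fg_left_module[OF Y] fg] by (simp add: null_at_def)
qed

lemma null_at_left:
  assumes X: "fg_module A X" and Y: "fg_module A Y" and Z: "fg_module A Z"
    and f: "null_at j X Y f" and g: "g \<in> mod_hom A Y Z"
  shows "null_at j X Z (\<lambda>x. g (f x))"
proof -
  have fh: "f \<in> mod_hom A X Y" using f by (simp add: null_at_def)
  have "null (syz j X) (syz j Z) (\<lambda>x. syz_map j Y Z g (syz_map j X Y f x))"
    by (rule null_comp_left[OF syz_fg[OF X] syz_fg[OF Y] syz_fg[OF Z] _ syz_map_hom[OF Y Z g]])
      (use f in \<open>simp add: null_at_def\<close>)
  then show ?thesis
    using null_stable_eq[OF syz_fg[OF X] syz_fg[OF Z] syz_map_comp[OF X Y Z fh g]] mod_hom_comp[OF fh g] by (simp add: null_at_def)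
qed

lemma null_at_right:
  assumes X: "fg_module A X" and Y: "fg_module A Y" and W: "fg_module A W"
    and f: "null_at j X Y f" and g: "g \<in> mod_hom A W X"
  shows "null_at j W Y (\<lambda>x. f (g x))"
proof -
  have fh: "f \<in> mod_hom A X Y" using f by (simp add: null_at_def)
  have "null (syz j W) (syz j Y) (\<lambda>x. syz_map j X Y f (syz_map j W X g x))"
    by (rule null_comp_right[OF _ syz_map_hom[OF W X g]]) (use f in \<open>simp add: null_at_def\<close>)
  then show ?thesis
    using null_stable_eq[OF syz_fg[OF W] syz_fg[OF Y] syz_map_comp[OF W X Y g fh]] mod_hom_comp[OF g fh] by (simp add: null_at_def)
qed

definition ev_null :: "('a, 'a fgcar) module \<Rightarrow> ('a, 'a fgcar) module \<Rightarrow> ('a fgcar \<Rightarrow> 'a fgcar) \<Rightarrow> bool" where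
  "ev_null X Y h \<longleftrightarrow> (\<exists>j. null_at j X Y h)"

lemma ev_null_hom: "ev_null X Y h \<Longrightarrow> h \<in> mod_hom A X Y"
  by (auto simp: ev_null_def null_at_def)

lemma ev_null_stable_eq: "\<lbrakk>fg_module A X; fg_module A Y; stable_eq X Y f g; ev_null X Y g\<rbrakk> \<Longrightarrow> ev_null X Y f"
  unfolding ev_null_def using null_at_stable_eq by blast

lemma ev_null_cong:
  "\<lbrakk>fg_module A X; fg_module A Y; ev_null X Y g; \<And>x. x \<in> carrier X \<Longrightarrow> f x = g x\<rbrakk> \<Longrightarrow> ev_null X Y f"
  unfolding ev_null_def using null_at_cong by blast

lemma ev_null_null: "\<lbrakk>fg_module A X; fg_module A Y; null X Y f\<rbrakk> \<Longrightarrow> ev_null X Y f"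
  unfolding ev_null_def using null_at_null by blast

lemma ev_null_left:
  "\<lbrakk>fg_module A X; fg_module A Y; fg_module A Z; ev_null X Y f; g \<in> mod_hom A Y Z\<rbrakk> \<Longrightarrow> ev_null X Z (\<lambda>x. g (f x))"
  unfolding ev_null_def using null_at_left by blast

lemma ev_null_right:
  "\<lbrakk>fg_module A X; fg_module A Y; fg_module A W; ev_null X Y f; g \<in> mod_hom A W X\<rbrakk> \<Longrightarrow> ev_null W Y (\<lambda>x. f (g x))"
  unfolding ev_null_def using null_at_right by blast

lemma ev_null_add:
  assumes X: "fg_module A X" and Y: "fg_module A Y" and f: "ev_null X Y f" and g: "ev_null X Y g"
  shows "ev_null X Y (\<lambda>x. f x \<oplus>\<^bsub>Y\<^esub> g x)"
proof -
  obtain i j where "null_at i X Y f" "null_at j X Y g" using f g by (auto simp: ev_null_def)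
  then have "null_at (max i j) X Y f" "null_at (max i j) X Y g" using null_at_mono[OF X Y] by auto
  then show ?thesis unfolding ev_null_def using null_at_add[OF X Y] by blast
qed

lemma null_at_submodule:
  assumes L: "fg_module A L" and X: "fg_module A X"
  shows "submodule {h \<in> carrier (hom_module L X). null_at j L X h} R (hom_module L X)"
proof -
  interpret H: left_module R "hom_module L X" by (rule hom_module_left_module[OF L X])
  show ?thesis
  proof (rule H.left_submoduleI)
    have "null_at j L X \<zero>\<^bsub>hom_module L X\<^esub>"
      by (rule null_at_cong[OF L X null_at_null[OF L X null_zero[OF X]]]) (simp add: hom_module_simps)
    then show "{h \<in> carrier (hom_module L X). null_at j L X h} \<noteq> {}" using H.M.zero_closed by blast
  next
    fix f g assume fg: "f \<in> {h \<in> carrier (hom_module L X). null_at j L X h}" "g \<in> {h \<in> carrier (hom_module L X). null_at j L X h}"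
    have "null_at j L X (f \<oplus>\<^bsub>hom_module L X\<^esub> g)"
      by (rule null_at_cong[OF L X null_at_add[OF L X, of j f g]]) (use fg in \<open>auto simp: hom_module_simps\<close>)
    then show "f \<oplus>\<^bsub>hom_module L X\<^esub> g \<in> {h \<in> carrier (hom_module L X). null_at j L X h}" using fg by simp
  next
    fix r f assume r: "r \<in> carrier R" and f: "f \<in> {h \<in> carrier (hom_module L X). null_at j L X h}"
    have "null_at j L X (r \<odot>\<^bsub>hom_module L X\<^esub> f)"
      by (rule null_at_cong[OF L X null_at_left[OF L X X _ rho_scale_hom[OF fg_left_module[OF X] r]]])
        (use f in \<open>auto simp: hom_module_simps\<close>)
    then show "r \<odot>\<^bsub>hom_module L X\<^esub> f \<in> {h \<in> carrier (hom_module L X). null_at j L X h}" using r f by simp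
  qed auto
qed

definition ev_null_homs :: "('a, 'a fgcar) module \<Rightarrow> ('a, 'a fgcar) module \<Rightarrow> ('a fgcar \<Rightarrow> 'a fgcar) set" where
  "ev_null_homs L X = {h \<in> carrier (hom_module L X). ev_null L X h}"

text \<open>The maps killed at stage \<open>j\<close> form an increasing sequence of submodules in a
  Hom module of finite length, so one stage serves all maps.\<close>

lemma null_at_stable:
  assumes L: "fg_module A L" and X: "fg_module A X"
  shows "\<exists>n. \<forall>h. ev_null L X h \<longrightarrow> null_at n L X h"
proof -
  interpret H: left_module R "hom_module L X" by (rule hom_module_left_module[OF L X])
  define C where "C j = {h \<in> carrier (hom_module L X). null_at j L X h}" for j
  have "\<exists>n. \<forall>m\<ge>n. C m = C n"
  proof (rule finite_length_inc_eventually[OF hom_module_finite_length[OF L X]], intro conjI)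
    fix i
    show "submodule (C i) R (hom_module L X)" unfolding C_def by (rule null_at_submodule[OF L X])
    then show "{\<zero>\<^bsub>hom_module L X\<^esub>} \<subseteq> C i" using H.submoduleD(2) by blast
    show "C i \<subseteq> carrier (hom_module L X)" by (auto simp: C_def)
    show "C i \<subseteq> C (Suc i)" unfolding C_def using null_at_mono[OF L X, of i _ "Suc i"] by auto
  qed
  then obtain n where n: "\<And>m. m \<ge> n \<Longrightarrow> C m = C n" by blast
  have "null_at n L X h" if h: "ev_null L X h" for h
  proof -
    obtain j where "null_at j L X h" using h by (auto simp: ev_null_def)
    then have "null_at (max j n) L X h" by (rule null_at_mono[OF L X]) simp
    then have "null_at (max j n) L X (restrict h (carrier L))" by (rule null_at_cong[OF L X]) simp
    then have "restrict h (carrier L) \<in> C (max j n)"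
      using restrict_hom[OF L ev_null_hom[OF h]] by (simp add: C_def)
    then have "restrict h (carrier L) \<in> C n" using n[of "max j n"] by simp
    then have "null_at n L X (restrict h (carrier L))" by (simp add: C_def)
    then show ?thesis by (rule null_at_cong[OF L X]) simp
  qed
  then show ?thesis by blast
qed

lemma ev_null_homs_submodule:
  assumes L: "fg_module A L" and X: "fg_module A X"
  shows "submodule (ev_null_homs L X) R (hom_module L X)"
proof -
  obtain n where "\<And>h. ev_null L X h \<Longrightarrow> null_at n L X h" using null_at_stable[OF L X] by blast
  then have "ev_null_homs L X = {h \<in> carrier (hom_module L X). null_at n L X h}"
    unfolding ev_null_homs_def by (auto simp: ev_null_def)
  then show ?thesis using null_at_submodule[OF L X] by simp
qed

text \<open>The length of \<open>Hom(L, X)\<close> modulo eventually null maps.  Dividing out all of these, and not only the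
  null ones, makes every map injective that becomes a stable isomorphism after some syzygies.\<close>

definition stable_hom_length :: "('a, 'a fgcar) module \<Rightarrow> ('a, 'a fgcar) module \<Rightarrow> nat" where
  "stable_hom_length L X = rel_length R (hom_module L X) (ev_null_homs L X) (carrier (hom_module L X))"

lemma hom_module_interval_finite:
  assumes L: "fg_module A L" and X: "fg_module A X"
  shows "submodule E R (hom_module L X) \<Longrightarrow> finite_length R (hom_module L X) E (carrier (hom_module L X))"
proof -
  interpret H: left_module R "hom_module L X" by (rule hom_module_left_module[OF L X])
  assume "submodule E R (hom_module L X)"
  then show ?thesis
    using finite_length_mono[OF hom_module_finite_length[OF L X]] H.submoduleD(2) by blast
qed

section \<open>Comparison of Hom lengths along a homomorphism\<close>

lemma post_hom:
  assumes L: "fg_module A L" and X: "fg_module A X" and Y: "fg_module A Y" and u: "u \<in> mod_hom A X Y"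
  shows "(\<lambda>h. \<lambda>x\<in>carrier L. u (h x)) \<in> mod_hom R (hom_module L X) (hom_module L Y)"
proof (rule mod_homI)
  interpret X: left_module A X using X by (rule fg_left_module)
  fix h assume h: "h \<in> carrier (hom_module L X)"
  show "(\<lambda>x\<in>carrier L. u (h x)) \<in> carrier (hom_module L Y)"
    by (rule restrict_hom[OF L mod_hom_comp[OF _ u]]) (use h in \<open>simp add: hom_module_simps\<close>)
next
  fix f g assume "f \<in> carrier (hom_module L X)" "g \<in> carrier (hom_module L X)"
  then show "(\<lambda>x\<in>carrier L. u ((f \<oplus>\<^bsub>hom_module L X\<^esub> g) x)) =
      (\<lambda>x\<in>carrier L. u (f x)) \<oplus>\<^bsub>hom_module L Y\<^esub> (\<lambda>x\<in>carrier L. u (g x))"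
    using mod_homD(2)[OF u] by (auto simp: hom_module_simps fun_eq_iff mod_homD(1))
next
  fix r f assume r: "r \<in> carrier R" and f: "f \<in> carrier (hom_module L X)"
  then show "(\<lambda>x\<in>carrier L. u ((r \<odot>\<^bsub>hom_module L X\<^esub> f) x)) = r \<odot>\<^bsub>hom_module L Y\<^esub> (\<lambda>x\<in>carrier L. u (f x))"
    using mod_homD(3)[OF u] by (auto simp: hom_module_simps fun_eq_iff mod_homD(1))
qed

lemma post_ev_null:
  assumes L: "fg_module A L" and Y: "fg_module A Y"
  shows "restrict F (carrier L) \<in> ev_null_homs L Y \<Longrightarrow> ev_null L Y F"
  unfolding ev_null_homs_def using ev_null_cong[OF L Y, of "restrict F (carrier L)" F] by simp

lemma ev_null_post:
  assumes L: "fg_module A L" and Y: "fg_module A Y" and e: "ev_null L Y F"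
  shows "restrict F (carrier L) \<in> ev_null_homs L Y"
  unfolding ev_null_homs_def using ev_null_cong[OF L Y e, of "restrict F (carrier L)"] restrict_hom[OF L ev_null_hom[OF e]] by simp

lemma stable_hom_length_inj:
  assumes L: "fg_module A L" and X: "fg_module A X" and Y: "fg_module A Y" and u: "u \<in> mod_hom A X Y"
    and inj: "\<And>h. h \<in> mod_hom A L X \<Longrightarrow> ev_null L Y (\<lambda>x. u (h x)) \<Longrightarrow> ev_null L X h"
  shows "stable_hom_length L X \<le> stable_hom_length L Y"
proof -
  have LX: "left_module R (hom_module L X)" and LY: "left_module R (hom_module L Y)"
    by (rule hom_module_left_module[OF L X], rule hom_module_left_module[OF L Y])
  interpret HX: left_module R "hom_module L X" by (rule LX)
  interpret HY: left_module R "hom_module L Y" by (rule LY)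
  let ?f = "\<lambda>h. \<lambda>x\<in>carrier L. u (h x)"
  note f = post_hom[OF L X Y u]
  show ?thesis
    unfolding stable_hom_length_def
  proof (rule rel_length_inj(2)[OF LX LY f HX.submodule_carrier ev_null_homs_submodule[OF L Y] HY.submodule_carrier])
    show "ev_null_homs L Y \<subseteq> carrier (hom_module L Y)" by (auto simp: ev_null_homs_def)
    show "?f ` carrier (hom_module L X) \<subseteq> carrier (hom_module L Y)" using mod_homD(1)[OF f] by blast
    show "finite_length R (hom_module L Y) (ev_null_homs L Y) (carrier (hom_module L Y))"
      by (rule hom_module_interval_finite[OF L Y ev_null_homs_submodule[OF L Y]])
    fix h assume h: "h \<in> carrier (hom_module L X)" "?f h \<in> ev_null_homs L Y"
    have "ev_null L X h" by (rule inj[OF _ post_ev_null[OF L Y h(2)]]) (use h(1) in \<open>simp add: hom_module_simps\<close>)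
    then show "h \<in> ev_null_homs L X" using h by (simp add: ev_null_homs_def)
  qed
qed

text \<open>An injective map between modules of equal finite length is onto. Here the image together
  with the eventually null maps already has full length, hence is everything.\<close>

lemma stable_hom_length_eq_surj:
  assumes L: "fg_module A L" and X: "fg_module A X" and Y: "fg_module A Y" and u: "u \<in> mod_hom A X Y"
    and inj: "\<And>h. h \<in> mod_hom A L X \<Longrightarrow> ev_null L Y (\<lambda>x. u (h x)) \<Longrightarrow> ev_null L X h"
    and eq: "stable_hom_length L X = stable_hom_length L Y" and h: "h \<in> mod_hom A L Y"
  shows "\<exists>g\<in>mod_hom A L X. ev_null L Y (\<lambda>x. h x \<ominus>\<^bsub>Y\<^esub> u (g x))"
proof -
  have LX: "left_module R (hom_module L X)" and LY: "left_module R (hom_module L Y)"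
    by (rule hom_module_left_module[OF L X], rule hom_module_left_module[OF L Y])
  interpret HX: left_module R "hom_module L X" by (rule LX)
  interpret HY: left_module R "hom_module L Y" by (rule LY)
  interpret Y: left_module A Y using Y by (rule fg_left_module)
  let ?f = "\<lambda>h. \<lambda>x\<in>carrier L. u (h x)" and ?C = "carrier (hom_module L Y)"
  note f = post_hom[OF L X Y u]
  note E = ev_null_homs_submodule[OF L Y]
  have im: "submodule (?f ` carrier (hom_module L X)) R (hom_module L Y)"
    by (rule mod_hom_image_submodule[OF LX LY f HX.submodule_carrier])
  define G where "G = ?f ` carrier (hom_module L X) <+>\<^bsub>hom_module L Y\<^esub> ev_null_homs L Y"
  have G: "submodule G R (hom_module L Y)" unfolding G_def by (rule HY.submodule_set_add[OF im E])
  have EG: "ev_null_homs L Y \<subseteq> G" unfolding G_def by (rule HY.set_add_upper2[OF im E])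
  have GC: "G \<subseteq> ?C" using HY.submoduleD(1)[OF G] by blast
  have fin: "finite_length R (hom_module L Y) (ev_null_homs L Y) ?C" by (rule hom_module_interval_finite[OF L Y E])
  have "stable_hom_length L X \<le> rel_length R (hom_module L Y) (ev_null_homs L Y) G"
    unfolding stable_hom_length_def
  proof (rule rel_length_inj(2)[OF LX LY f HX.submodule_carrier E G EG])
    show "?f ` carrier (hom_module L X) \<subseteq> G" unfolding G_def by (rule HY.set_add_upper1[OF im E])
    show "finite_length R (hom_module L Y) (ev_null_homs L Y) G" by (rule finite_length_mono[OF fin order_refl GC])
    fix h assume h: "h \<in> carrier (hom_module L X)" "?f h \<in> ev_null_homs L Y"
    have "ev_null L X h" by (rule inj[OF _ post_ev_null[OF L Y h(2)]]) (use h(1) in \<open>simp add: hom_module_simps\<close>)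
    then show "h \<in> ev_null_homs L X" using h by (simp add: ev_null_homs_def)
  qed
  moreover have "stable_hom_length L Y = rel_length R (hom_module L Y) (ev_null_homs L Y) G + rel_length R (hom_module L Y) G ?C"
    unfolding stable_hom_length_def by (rule HY.rel_length_add[OF G HY.submodule_carrier EG GC E fin])
  ultimately have "rel_length R (hom_module L Y) G ?C = 0" using eq by simp
  then have "G = ?C"
    using HY.rel_length_pos[OF G HY.submodule_carrier _ finite_length_mono[OF fin EG order_refl]] GC by fastforce
  then have "restrict h (carrier L) \<in> G" using restrict_hom[OF L h] by simp
  then obtain g e where g: "g \<in> carrier (hom_module L X)" and e: "e \<in> ev_null_homs L Y"
    and he: "restrict h (carrier L) = ?f g \<oplus>\<^bsub>hom_module L Y\<^esub> e"
    unfolding G_def HY.set_add_iff by blast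
  have gh: "g \<in> mod_hom A L X" using g by (simp add: hom_module_simps)
  have eh: "ev_null L Y e" using e by (simp add: ev_null_homs_def)
  have "ev_null L Y (\<lambda>x. h x \<ominus>\<^bsub>Y\<^esub> u (g x))"
  proof (rule ev_null_cong[OF L Y eh])
    fix x assume x: "x \<in> carrier L"
    have "h x = u (g x) \<oplus>\<^bsub>Y\<^esub> e x" using fun_cong[OF he, of x] x by (simp add: hom_module_simps)
    then show "h x \<ominus>\<^bsub>Y\<^esub> u (g x) = e x"
      using mod_homD(1)[OF mod_hom_comp[OF gh u] x] mod_homD(1)[OF ev_null_hom[OF eh] x]
      by (simp add: Y.M.add_diff_cancel_left)
  qed
  then show ?thesis using gh by blast
qed

lemma ev_null_cancel:
  assumes L: "fg_module A L" and X: "fg_module A X" and h: "h \<in> mod_hom A L X"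
    and s: "stable_eq X X (\<lambda>x. v (u x)) (\<lambda>x. x)" and u: "u \<in> mod_hom A X Y" and v: "v \<in> mod_hom A Y X" and Y: "fg_module A Y"
    and e: "ev_null L Y (\<lambda>x. u (h x))"
  shows "ev_null L X h"
  by (rule ev_null_stable_eq[OF L X stable_eq_sym[OF L X stable_eq_comp[OF L X X stable_eq_refl[OF L X h] s]] ev_null_left[OF L Y X e v]])

lemma stable_hom_length_stable_iso:
  assumes L: "fg_module A L" and X: "fg_module A X" and Y: "fg_module A Y" and u: "stable_iso X Y u"
  shows "stable_hom_length L X = stable_hom_length L Y"
proof -
  obtain v where v: "u \<in> mod_hom A X Y" "v \<in> mod_hom A Y X" "stable_eq X X (\<lambda>x. v (u x)) (\<lambda>x. x)"
    "stable_eq Y Y (\<lambda>x. u (v x)) (\<lambda>x. x)"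
    using u by (rule sisoE)
  show ?thesis
    by (rule antisym[OF stable_hom_length_inj[OF L X Y v(1) ev_null_cancel[OF L X _ v(3,1,2) Y]]
          stable_hom_length_inj[OF L Y X v(2) ev_null_cancel[OF L Y _ v(4,2,1) X]]])
qed

text \<open>The filtration is cut at \<open>G\<close>, the maps whose component in \<open>V\<close>
  is eventually null. The part above \<open>G\<close> is compared with \<open>V\<close> by
  \<open>q\<close> and \<open>j\<close>, the part below with \<open>U\<close> by \<open>p\<close>
  and \<open>i\<close>; each comparison is injective in both directions.\<close>

lemma stable_hom_length_add:
  assumes L: "fg_module A L" and X: "fg_module A X" and U: "fg_module A U" and V: "fg_module A V"
    and i: "i \<in> mod_hom A U X" and j: "j \<in> mod_hom A V X" and p: "p \<in> mod_hom A X U" and q: "q \<in> mod_hom A X V"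
    and pi: "stable_eq U U (\<lambda>x. p (i x)) (\<lambda>x. x)" and qj: "stable_eq V V (\<lambda>x. q (j x)) (\<lambda>x. x)"
    and qi: "null U V (\<lambda>x. q (i x))" and sum: "stable_eq X X (\<lambda>x. i (p x) \<oplus>\<^bsub>X\<^esub> j (q x)) (\<lambda>x. x)"
  shows "stable_hom_length L X = stable_hom_length L U + stable_hom_length L V"
proof -
  have LX: "left_module R (hom_module L X)" and LU: "left_module R (hom_module L U)" and LV: "left_module R (hom_module L V)"
    using hom_module_left_module L X U V by auto
  interpret HX: left_module R "hom_module L X" by (rule LX)
  interpret HU: left_module R "hom_module L U" by (rule LU)
  interpret HV: left_module R "hom_module L V" by (rule LV)
  let ?post = "\<lambda>u h. \<lambda>x\<in>carrier L. u (h x)"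
  have hom: "h \<in> mod_hom A L Y" if "h \<in> carrier (hom_module L Y)" for h Y using that by (simp add: hom_module_simps)
  define G where "G = {h \<in> carrier (hom_module L X). ?post q h \<in> ev_null_homs L V}"
  have G: "submodule G R (hom_module L X)"
    unfolding G_def by (rule mod_hom_vimage_submodule[OF LX LV post_hom[OF L X V q] ev_null_homs_submodule[OF L V]])
  have GI: "h \<in> G" if "h \<in> carrier (hom_module L X)" "ev_null L V (\<lambda>x. q (h x))" for h
    using that ev_null_post[OF L V, of "\<lambda>x. q (h x)"] by (simp add: G_def)
  have GD: "ev_null L V (\<lambda>x. q (h x))" if "h \<in> G" for h
    using that post_ev_null[OF L V, of "\<lambda>x. q (h x)"] by (simp add: G_def)
  have Gc: "G \<subseteq> carrier (hom_module L X)" by (auto simp: G_def)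
  have EG: "ev_null_homs L X \<subseteq> G" using GI ev_null_left[OF L X V _ q] by (auto simp: ev_null_homs_def)
  note fin = hom_module_interval_finite[OF L X]
  have "rel_length R (hom_module L X) G (carrier (hom_module L X)) = stable_hom_length L V"
  proof (rule antisym)
    show "rel_length R (hom_module L X) G (carrier (hom_module L X)) \<le> stable_hom_length L V"
      unfolding stable_hom_length_def
      by (rule rel_length_inj(2)[OF LX LV post_hom[OF L X V q] HX.submodule_carrier ev_null_homs_submodule[OF L V] HV.submodule_carrier])
        (use mod_homD(1)[OF post_hom[OF L X V q]] hom_module_interval_finite[OF L V ev_null_homs_submodule[OF L V]] in
          \<open>auto simp: ev_null_homs_def[of L V] G_def\<close>)
    show "stable_hom_length L V \<le> rel_length R (hom_module L X) G (carrier (hom_module L X))"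
      unfolding stable_hom_length_def
    proof (rule rel_length_inj(2)[OF LV LX post_hom[OF L V X j] HV.submodule_carrier G HX.submodule_carrier Gc _ _ fin[OF G]])
      show "?post j ` carrier (hom_module L V) \<subseteq> carrier (hom_module L X)" using mod_homD(1)[OF post_hom[OF L V X j]] by blast
      fix h assume h: "h \<in> carrier (hom_module L V)" "?post j h \<in> G"
      have "ev_null L V (\<lambda>x. q (j (h x)))"
        by (rule ev_null_cong[OF L V GD[OF h(2)]]) simp
      then have "ev_null L V h" by (rule ev_null_stable_eq[OF L V stable_eq_sym[OF L V stable_eq_comp[OF L V V stable_eq_refl[OF L V hom[OF h(1)]] qj]]])
      then show "h \<in> ev_null_homs L V" using h by (simp add: ev_null_homs_def)
    qed
  qed
  moreover have "rel_length R (hom_module L X) (ev_null_homs L X) G = stable_hom_length L U"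
  proof (rule antisym)
    show "rel_length R (hom_module L X) (ev_null_homs L X) G \<le> stable_hom_length L U"
      unfolding stable_hom_length_def
    proof (rule rel_length_inj(2)[OF LX LU post_hom[OF L X U p] G ev_null_homs_submodule[OF L U] HU.submodule_carrier])
      show "ev_null_homs L U \<subseteq> carrier (hom_module L U)" by (auto simp: ev_null_homs_def)
      show "?post p ` G \<subseteq> carrier (hom_module L U)" using mod_homD(1)[OF post_hom[OF L X U p]] Gc by blast
      show "finite_length R (hom_module L U) (ev_null_homs L U) (carrier (hom_module L U))"
        by (rule hom_module_interval_finite[OF L U ev_null_homs_submodule[OF L U]])
      fix h assume h: "h \<in> G" "?post p h \<in> ev_null_homs L U"
      have hh: "h \<in> mod_hom A L X" using h Gc hom by blast
      have "ev_null L X (\<lambda>x. i (p (h x)) \<oplus>\<^bsub>X\<^esub> j (q (h x)))"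
        by (rule ev_null_add[OF L X ev_null_left[OF L U X post_ev_null[OF L U h(2)] i] ev_null_left[OF L V X GD[OF h(1)] j]])
      then have "ev_null L X h"
        by (rule ev_null_stable_eq[OF L X stable_eq_sym[OF L X stable_eq_comp[OF L X X stable_eq_refl[OF L X hh] sum]]])
      then show "h \<in> ev_null_homs L X" using h Gc by (auto simp: ev_null_homs_def)
    qed
    show "stable_hom_length L U \<le> rel_length R (hom_module L X) (ev_null_homs L X) G"
      unfolding stable_hom_length_def
    proof (rule rel_length_inj(2)[OF LU LX post_hom[OF L U X i] HU.submodule_carrier ev_null_homs_submodule[OF L X] G EG])
      show "finite_length R (hom_module L X) (ev_null_homs L X) G"
        by (rule finite_length_mono[OF fin[OF ev_null_homs_submodule[OF L X]] order_refl Gc])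
      show "?post i ` carrier (hom_module L U) \<subseteq> G"
      proof
        fix k assume "k \<in> ?post i ` carrier (hom_module L U)"
        then obtain h where h: "h \<in> carrier (hom_module L U)" "k = ?post i h" by blast
        have "ev_null L V (\<lambda>x. q (i (h x)))"
          by (rule ev_null_null[OF L V null_comp_right[OF qi hom[OF h(1)]]])
        then have "ev_null L V (\<lambda>x. q (k x))" by (rule ev_null_cong[OF L V]) (simp add: h)
        then show "k \<in> G" using GI h mod_homD(1)[OF post_hom[OF L U X i] h(1)] by simp
      qed
      fix h assume h: "h \<in> carrier (hom_module L U)" "?post i h \<in> ev_null_homs L X"
      have "ev_null L U h" by (rule ev_null_cancel[OF L U hom[OF h(1)] pi i p X post_ev_null[OF L X h(2)]])
      then show "h \<in> ev_null_homs L U" using h by (simp add: ev_null_homs_def)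
    qed
  qed
  moreover have "stable_hom_length L X = rel_length R (hom_module L X) (ev_null_homs L X) G + rel_length R (hom_module L X) G (carrier (hom_module L X))"
    unfolding stable_hom_length_def
    by (rule HX.rel_length_add[OF G HX.submodule_carrier EG Gc ev_null_homs_submodule[OF L X] fin[OF ev_null_homs_submodule[OF L X]]])
  ultimately show ?thesis by simp
qed

text \<open>Syzygies of the inclusions and projections of a direct sum satisfy the biproduct
  identities stably, which is all that \<open>stable_hom_length_add\<close> asks for.\<close>

lemma stable_hom_length_additive:
  assumes L: "fg_module A L"
  shows "additive (\<lambda>X. stable_hom_length L (syz k X))"
  unfolding additive_def
proof (intro conjI allI impI)
  fix X Y :: "('a, 'a fgcar) module" and f assume "fg_module A X \<and> fg_module A Y \<and> f \<in> mod_iso A X Y"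
  then show "stable_hom_length L (syz k X) = stable_hom_length L (syz k Y)"
    using stable_hom_length_stable_iso[OF L syz_fg syz_fg syz_map_stable_iso[OF _ _ iso_stable_iso]] by blast
next
  fix X :: "('a, 'a fgcar) module" and U' V' assume "fg_module A X \<and> direct_decomposition A X U' V'"
  then have X: "fg_module A X" and d: "direct_decomposition A X U' V'" by auto
  have LX: "left_module A X" by (rule fg_left_module[OF X])
  have sub: "submodule U' A X" "submodule V' A X" using d by (auto simp: direct_decomposition_def)
  define U where "U = X\<lparr>carrier := U'\<rparr>"
  define V where "V = X\<lparr>carrier := V'\<rparr>"
  have U: "fg_module A U" and V: "fg_module A V" unfolding U_def V_def by (rule fg_sub[OF X sub(1)], rule fg_sub[OF X sub(2)])
  obtain p q where pq: "p \<in> mod_hom A X (X\<lparr>carrier := U'\<rparr>)" "q \<in> mod_hom A X (X\<lparr>carrier := V'\<rparr>)"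
    "\<And>x. x \<in> carrier X \<Longrightarrow> x = p x \<oplus>\<^bsub>X\<^esub> q x" "\<And>u. u \<in> U' \<Longrightarrow> p u = u" "\<And>v. v \<in> V' \<Longrightarrow> q v = v"
    "\<And>v. v \<in> V' \<Longrightarrow> p v = \<zero>\<^bsub>X\<^esub>" "\<And>u. u \<in> U' \<Longrightarrow> q u = \<zero>\<^bsub>X\<^esub>"
    by (rule direct_decomposition_maps[OF LX d], rule that)
  have p: "p \<in> mod_hom A X U" and q: "q \<in> mod_hom A X V" using pq(1,2) by (simp_all add: U_def V_def)
  have i: "(\<lambda>x. x) \<in> mod_hom A U X" and j: "(\<lambda>x. x) \<in> mod_hom A V X"
    unfolding U_def V_def by (rule mod_hom_sub_incl[OF LX sub(1) mod_hom_id], rule mod_hom_sub_incl[OF LX sub(2) mod_hom_id])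
  note s = syz_fg[OF X, of k] and sU = syz_fg[OF U, of k] and sV = syz_fg[OF V, of k]
  have 1: "stable_eq U U (\<lambda>x. p x) (\<lambda>x. x)"
    by (rule stable_eq_sym[OF U U stable_eq_cong[OF U U mod_hom_id]]) (simp add: U_def pq(4))
  have 2: "stable_eq V V (\<lambda>x. q x) (\<lambda>x. x)"
    by (rule stable_eq_sym[OF V V stable_eq_cong[OF V V mod_hom_id]]) (simp add: V_def pq(5))
  have 3: "null U V (\<lambda>x. q x)"
    by (rule null_cong[OF U null_zero[OF V]]) (simp add: U_def V_def pq(7))
  have 4: "stable_eq X X (\<lambda>x. x) (\<lambda>x. p x \<oplus>\<^bsub>X\<^esub> q x)"
    by (rule stable_eq_cong[OF X X mod_hom_id]) (simp add: pq(3)[symmetric])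
  have pX: "p \<in> mod_hom A X X" and qX: "q \<in> mod_hom A X X"
    using mod_hom_comp[OF p i] mod_hom_comp[OF q j] by simp_all
  have 5: "stable_eq (syz k X) (syz k X) (\<lambda>x. syz_map k U X (\<lambda>x. x) (syz_map k X U p x) \<oplus>\<^bsub>syz k X\<^esub> syz_map k V X (\<lambda>x. x) (syz_map k X V q x)) (\<lambda>x. x)"
    by (rule stable_eq_trans[OF s s stable_eq_sym[OF s s stable_eq_trans[OF s s syz_map_add[OF X X pX qX]
              stable_eq_add[OF s s syz_map_comp[OF X U X p i] syz_map_comp[OF X V X q j]]]]
          stable_eq_trans[OF s s syz_map_stable_eq[OF X X stable_eq_sym[OF X X 4]] syz_map_id[OF X]]])
  show "stable_hom_length L (syz k X) = stable_hom_length L (syz k (X\<lparr>carrier := U'\<rparr>)) + stable_hom_length L (syz k (X\<lparr>carrier := V'\<rparr>))"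
    unfolding U_def[symmetric] V_def[symmetric]
  proof (rule stable_hom_length_add[OF L s sU sV syz_map_hom[OF U X i] syz_map_hom[OF V X j] syz_map_hom[OF X U p] syz_map_hom[OF X V q] _ _ _ 5])
    show "stable_eq (syz k U) (syz k U) (\<lambda>x. syz_map k X U p (syz_map k U X (\<lambda>x. x) x)) (\<lambda>x. x)"
      by (rule stable_eq_trans[OF sU sU stable_eq_sym[OF sU sU syz_map_comp[OF U X U i p]] stable_eq_trans[OF sU sU syz_map_stable_eq[OF U U 1] syz_map_id[OF U]]])
    show "stable_eq (syz k V) (syz k V) (\<lambda>x. syz_map k X V q (syz_map k V X (\<lambda>x. x) x)) (\<lambda>x. x)"
      by (rule stable_eq_trans[OF sV sV stable_eq_sym[OF sV sV syz_map_comp[OF V X V j q]] stable_eq_trans[OF sV sV syz_map_stable_eq[OF V V 2] syz_map_id[OF V]]])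
    show "null (syz k U) (syz k V) (\<lambda>x. syz_map k X V q (syz_map k U X (\<lambda>x. x) x))"
      by (rule null_stable_eq[OF sU sV stable_eq_sym[OF sU sV syz_map_comp[OF U X V i q]] syz_map_null[OF U V 3]])
  qed
qed

section \<open>A uniform bound of Igusa and Todorov\<close>

text \<open>There are finitely many pairs from \<open>Ns\<close>, each with its own bound. The
  maximum works for all \<open>X\<close> and \<open>Y\<close> in the closure, since expanding both
  identities writes \<open>h\<close> as a sum of maps that contain an eventually null map between
  two members of \<open>Ns\<close>.\<close>

lemma null_at_uniform:
  assumes Ns: "finite Ns" "\<And>N. N \<in> Ns \<Longrightarrow> fg_module A N"
  shows "\<exists>n. \<forall>X Y h. fg_module A X \<and> fg_module A Y \<and> thru Ns X X (\<lambda>x. x) \<and> thru Ns Y Y (\<lambda>x. x) \<and> ev_null X Y h \<longrightarrow>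
    null_at n X Y h"
proof -
  define n where "n N N' = (SOME n. \<forall>h. ev_null N N' h \<longrightarrow> null_at n N N' h)" for N N'
  have n: "null_at (n N N') N N' h" if "N \<in> Ns" "N' \<in> Ns" "ev_null N N' h" for N N' h
    using someI_ex[OF null_at_stable[OF Ns(2)[OF that(1)] Ns(2)[OF that(2)]]] that(3) unfolding n_def by blast
  \<comment> \<open>The added 0 keeps the maximum meaningful for empty \<open>Ns\<close>.\<close>
  define m where "m = Max ((\<lambda>(N, N'). n N N') ` (Ns \<times> Ns) \<union> {0})"
  have m: "null_at m N N' h" if "N \<in> Ns" "N' \<in> Ns" "ev_null N N' h" for N N' h
  proof (rule null_at_mono[OF Ns(2)[OF that(1)] Ns(2)[OF that(2)] n[OF that]])
    show "n N N' \<le> m" unfolding m_def using Ns(1) that by (intro Max_ge) force+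
  qed
  show ?thesis
  proof (intro exI[of _ m] allI impI, elim conjE)
    fix X Y h assume X: "fg_module A X" and Y: "fg_module A Y" and tX: "thru Ns X X (\<lambda>x. x)" and tY: "thru Ns Y Y (\<lambda>x. x)"
      and h: "ev_null X Y h"
    have hh: "h \<in> mod_hom A X Y" by (rule ev_null_hom[OF h])
    \<comment> \<open>The identity of the target is expanded first, with a member of
      \<open>Ns\<close> as the source; the general source follows.\<close>
    have 1: "null_at m N Y f" if N: "N \<in> Ns" and f: "ev_null N Y f" for N f
    proof -
      have fN: "fg_module A N" by (rule Ns(2)[OF N])
      have fh: "f \<in> mod_hom A N Y" by (rule ev_null_hom[OF f])
      have "null_at m N Y (\<lambda>x. g (f x))" if "thru Ns Y Y g" for g
        using that
      proof induction
        case (thru_zero h)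
        show ?case
          by (rule null_at_cong[OF fN Y null_at_null[OF fN Y null_zero[OF Y]]]) (use thru_zero mod_homD(1)[OF fh] in simp)
      next
        case (thru_step g N' a b h)
        have fN': "fg_module A N'" by (rule Ns(2)[OF thru_step(2)])
        have "null_at m N Y (\<lambda>x. b (a (f x)))"
          by (rule null_at_left[OF fN fN' Y m[OF N thru_step(2) ev_null_left[OF fN Y fN' f thru_step(3)]] thru_step(4)])
        then have "null_at m N Y (\<lambda>x. g (f x) \<oplus>\<^bsub>Y\<^esub> b (a (f x)))" by (rule null_at_add[OF fN Y thru_step.IH])
        then show ?case by (rule null_at_cong[OF fN Y]) (use thru_step(5) mod_homD(1)[OF fh] in simp)
      qed
      from this[OF tY] show ?thesis .
    qed
    have "null_at m X Y (\<lambda>x. h (g x))" if "thru Ns X X g" for g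
      using that
    proof induction
      case (thru_zero g)
      show ?case
        by (rule null_at_cong[OF X Y null_at_null[OF X Y null_zero[OF Y]]])
          (use thru_zero mod_hom_zero[OF fg_left_module[OF X] fg_left_module[OF Y] hh] in simp)
    next
      case (thru_step f N a b g)
      have fN: "fg_module A N" by (rule Ns(2)[OF thru_step(2)])
      have "null_at m X Y (\<lambda>x. h (b (a x)))"
        by (rule null_at_right[OF fN Y X 1[OF thru_step(2) ev_null_right[OF X Y fN h thru_step(4)]] thru_step(3)])
      then have "null_at m X Y (\<lambda>x. h (f x) \<oplus>\<^bsub>Y\<^esub> h (b (a x)))" by (rule null_at_add[OF X Y thru_step.IH])
      then show ?case
        by (rule null_at_cong[OF X Y])
          (use thru_step(5) mod_homD(2)[OF hh] mod_homD(1)[OF thru_hom[OF thru_step(1) X X]]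
              mod_homD(1)[OF mod_hom_comp[OF thru_step(3,4)]] in simp)
    qed
    from this[OF tX] show "null_at m X Y h" .
  qed
qed

text \<open>At a sufficiently late stage the composite is null and \<open>u\<close> is a stable
  isomorphism at the same time, so \<open>u\<close> can be cancelled there.\<close>

lemma ev_stable_iso_inj:
  assumes L: "fg_module A L" and X: "fg_module A X" and Y: "fg_module A Y" and u: "u \<in> mod_hom A X Y"
    and s: "stable_iso (syz m X) (syz m Y) (syz_map m X Y u)" and h: "h \<in> mod_hom A L X" and e: "ev_null L Y (\<lambda>x. u (h x))"
  shows "ev_null L X h"
proof -
  obtain j where "null_at j L Y (\<lambda>x. u (h x))" using e by (auto simp: ev_null_def)
  then have n: "null_at (j + m) L Y (\<lambda>x. u (h x))" by (rule null_at_mono[OF L Y]) simp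
  let ?J = "j + m"
  note sL = syz_fg[OF L, of ?J] and sX = syz_fg[OF X, of ?J] and sY = syz_fg[OF Y, of ?J]
  have "stable_iso (syz ?J X) (syz ?J Y) (syz_map ?J X Y u)"
    using syz_map_stable_iso[OF syz_fg[OF X] syz_fg[OF Y] s, of j] unfolding syz_map_syz_map syz_syz .
  then obtain v where v: "syz_map ?J X Y u \<in> mod_hom A (syz ?J X) (syz ?J Y)" "v \<in> mod_hom A (syz ?J Y) (syz ?J X)"
    "stable_eq (syz ?J X) (syz ?J X) (\<lambda>x. v (syz_map ?J X Y u x)) (\<lambda>x. x)"
    by (rule sisoE)
  have hJ: "syz_map ?J L X h \<in> mod_hom A (syz ?J L) (syz ?J X)" by (rule syz_map_hom[OF L X h])
  have "null (syz ?J L) (syz ?J Y) (\<lambda>x. syz_map ?J X Y u (syz_map ?J L X h x))"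
    by (rule null_stable_eq[OF sL sY stable_eq_sym[OF sL sY syz_map_comp[OF L X Y h u]]]) (use n in \<open>simp add: null_at_def\<close>)
  then have "null (syz ?J L) (syz ?J X) (\<lambda>x. v (syz_map ?J X Y u (syz_map ?J L X h x)))"
    by (rule null_comp_left[OF sL sY sX _ v(2)])
  then have "null (syz ?J L) (syz ?J X) (syz_map ?J L X h)"
    by (rule null_stable_eq[OF sL sX stable_eq_sym[OF sL sX stable_eq_comp[OF sL sX sX stable_eq_refl[OF sL sX hJ] v(3)]]])
  then show ?thesis using h unfolding ev_null_def null_at_def by blast
qed

lemma null_at_sub_stable_eq:
  assumes X: "fg_module A X" and f: "f \<in> mod_hom A X X" and n: "null_at j X X (\<lambda>x. x \<ominus>\<^bsub>X\<^esub> f x)"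
  shows "stable_eq (syz j X) (syz j X) (syz_map j X X f) (\<lambda>x. x)"
proof -
  note s = syz_fg[OF X, of j]
  have "null (syz j X) (syz j X) (\<lambda>x. syz_map j X X (\<lambda>x. x) x \<ominus>\<^bsub>syz j X\<^esub> syz_map j X X f x)"
    by (rule null_stable_eq[OF s s stable_eq_sym[OF s s syz_map_sub[OF X X mod_hom_id f]]]) (use n in \<open>simp add: null_at_def\<close>)
  then have "stable_eq (syz j X) (syz j X) (syz_map j X X (\<lambda>x. x)) (syz_map j X X f)"
    using syz_map_hom[OF X X f] syz_map_hom[OF X X mod_hom_id] by (simp add: stable_eq_def)
  then show ?thesis using stable_eq_trans[OF s s stable_eq_sym[OF s s] syz_map_id[OF X]] by blast
qed

text \<open>The bound is \<open>n + e\<close>: at stage \<open>e\<close> the Hom lengths of both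
  sides agree for all test modules from \<open>Ns\<close>, and \<open>n\<close> further syzygies
  kill every eventually null map between modules of the resulting closure.\<close>

lemma igusa_todorov:
  assumes Ns: "finite Ns" "\<And>N. N \<in> Ns \<Longrightarrow> fg_module A N"
  shows "\<exists>b. \<forall>X Y u m. fg_module A X \<and> fg_module A Y \<and> thru Ns X X (\<lambda>x. x) \<and> thru Ns Y Y (\<lambda>x. x) \<and>
      u \<in> mod_hom A X Y \<and> stable_iso (syz m X) (syz m Y) (syz_map m X Y u) \<longrightarrow>
    stable_iso (syz b X) (syz b Y) (syz_map b X Y u)"
proof -
  define Bf where "Bf N = (SOME Bs. finite Bs \<and> (\<forall>B\<in>Bs. fg_module A B \<and> indec B) \<and> thru Bs N N (\<lambda>x. x))" for N
  have Bf: "finite (Bf N) \<and> (\<forall>B\<in>Bf N. fg_module A B \<and> indec B) \<and> thru (Bf N) N N (\<lambda>x. x)" if "N \<in> Ns" for N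
    unfolding Bf_def by (rule someI_ex[OF indec_summands_ex[OF Ns(2)[OF that]]])
  define Bs where "Bs = (\<Union>N\<in>Ns. Bf N)"
  have Bs: "finite Bs" "\<And>B. B \<in> Bs \<Longrightarrow> fg_module A B \<and> indec B" using Bf Ns(1) by (auto simp: Bs_def)
  have toBs: "thru Bs X X (\<lambda>x. x)" if X: "fg_module A X" and t: "thru Ns X X (\<lambda>x. x)" for X
  proof (rule thru_subst[OF X X _ t])
    fix N assume N: "N \<in> Ns"
    have "thru Bs N N (\<lambda>x. x)" by (rule thru_mono[of "Bf N"]) (use N Bf in \<open>auto simp: Bs_def\<close>)
    then show "fg_module A N \<and> thru Bs N N (\<lambda>x. x)" using Ns(2)[OF N] by simp
  qed
  define w where "w N k B = int (stable_hom_length (syz k N) (syz k B))" for N k B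
  \<comment> \<open>From stage \<open>\<eta> N\<close> on, a vector that is eventually orthogonal to
    the length vectors \<open>w N k\<close> is orthogonal to them. It will be applied to the
    difference of the multiplicities of \<open>X\<close> and \<open>Y\<close>.\<close>
  define \<eta> where "\<eta> N = (SOME n. \<forall>v. (\<exists>m. \<forall>k\<ge>m. (\<Sum>b\<in>Bs. v b * w N k b) = 0) \<longrightarrow> (\<forall>k\<ge>n. (\<Sum>b\<in>Bs. v b * w N k b) = 0))" for N
  have \<eta>: "(\<Sum>b\<in>Bs. v b * w N k b) = 0" if "k \<ge> \<eta> N" "\<forall>k\<ge>m. (\<Sum>b\<in>Bs. v b * w N k b) = 0" for v k m N
    using someI_ex[OF eventually_orthogonal_uniform[OF Bs(1), of "w N"]] that unfolding \<eta>_def by blast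
  define e where "e = Max (\<eta> ` Ns \<union> {0})"
  have e: "\<eta> N \<le> e" if "N \<in> Ns" for N unfolding e_def using Ns(1) that by (intro Max_ge) auto
  \<comment> \<open>Generators of a closure that contains the \<open>e\<close>-th syzygies of all
    admissible \<open>X\<close> and \<open>Y\<close>.\<close>
  let ?Ns = "insert (free_one A) (syz e ` Ns)"
  have Ns': "finite ?Ns" "\<And>N. N \<in> ?Ns \<Longrightarrow> fg_module A N" using Ns free_one_fg syz_fg by auto
  obtain n where n: "\<And>X Y h. \<lbrakk>fg_module A X; fg_module A Y; thru ?Ns X X (\<lambda>x. x); thru ?Ns Y Y (\<lambda>x. x); ev_null X Y h\<rbrakk> \<Longrightarrow>
    null_at n X Y h"
    using null_at_uniform[OF Ns'] by blast
  show ?thesis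
  proof (intro exI[of _ "n + e"] allI impI, elim conjE)
    fix X Y u m
    assume X: "fg_module A X" and Y: "fg_module A Y" and tX: "thru Ns X X (\<lambda>x. x)" and tY: "thru Ns Y Y (\<lambda>x. x)"
      and u: "u \<in> mod_hom A X Y" and s: "stable_iso (syz m X) (syz m Y) (syz_map m X Y u)"
    obtain cX where cX: "\<And>\<phi>. additive \<phi> \<Longrightarrow> \<phi> X = (\<Sum>B\<in>Bs. cX B * \<phi> B)"
      using additive_combination[OF Bs X toBs[OF X tX]] by blast
    obtain cY where cY: "\<And>\<phi>. additive \<phi> \<Longrightarrow> \<phi> Y = (\<Sum>B\<in>Bs. cY B * \<phi> B)"
      using additive_combination[OF Bs Y toBs[OF Y tY]] by blast
    have diff: "int (stable_hom_length (syz k N) (syz k X)) - int (stable_hom_length (syz k N) (syz k Y)) = (\<Sum>b\<in>Bs. (int (cX b) - int (cY b)) * w N k b)"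
      if N: "N \<in> Ns" for k N
      using cX[OF stable_hom_length_additive[OF syz_fg[OF Ns(2)[OF N]], of k k]] cY[OF stable_hom_length_additive[OF syz_fg[OF Ns(2)[OF N]], of k k]]
      by (simp add: w_def left_diff_distrib sum_subtractf)
    have later: "stable_iso (syz k X) (syz k Y) (syz_map k X Y u)" if "k \<ge> m" for k
      using syz_map_stable_iso[OF syz_fg[OF X] syz_fg[OF Y] s, of "k - m"] that unfolding syz_map_syz_map syz_syz by simp
    \<comment> \<open>From stage \<open>m\<close> on, which depends on \<open>u\<close>, the lengths
      agree because \<open>u\<close> has become a stable isomorphism. The choice of \<open>e\<close>
      moves this agreement to a stage independent of \<open>u\<close>.\<close>
    have eq: "stable_hom_length (syz e N) (syz e X) = stable_hom_length (syz e N) (syz e Y)" if N: "N \<in> Ns" for N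
    proof -
      have "\<forall>k\<ge>m. (\<Sum>b\<in>Bs. (int (cX b) - int (cY b)) * w N k b) = 0"
        using stable_hom_length_stable_iso[OF syz_fg[OF Ns(2)[OF N]] syz_fg[OF X] syz_fg[OF Y] later] by (simp add: diff[OF N, symmetric])
      from \<eta>[OF e[OF N] this] show ?thesis using diff[OF N, of e] by simp
    qed
    let ?X = "syz e X" and ?Y = "syz e Y" and ?u = "syz_map e X Y u"
    have fX: "fg_module A ?X" and fY: "fg_module A ?Y" by (rule syz_fg[OF X], rule syz_fg[OF Y])
    have uh: "?u \<in> mod_hom A ?X ?Y" by (rule syz_map_hom[OF X Y u])
    have su: "stable_iso (syz m ?X) (syz m ?Y) (syz_map m ?X ?Y ?u)" unfolding syz_map_syz_map syz_syz by (rule later) simp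
    have tX': "thru ?Ns ?X ?X (\<lambda>x. x)"
      by (rule thru_stable_eq[OF fX fX thru_syz_map[OF X X Ns(2) tX] syz_map_id[OF X]]) simp_all
    have tY': "thru ?Ns ?Y ?Y (\<lambda>x. x)"
      by (rule thru_stable_eq[OF fY fY thru_syz_map[OF Y Y Ns(2) tY] syz_map_id[OF Y]]) simp_all
    interpret Y: left_module A ?Y by (rule fg_left_module[OF fY])
    interpret X: left_module A ?X by (rule fg_left_module[OF fX])
    \<comment> \<open>Maps from test modules lift along \<open>?u\<close> up to eventually null
      maps: from the free module every map is null and zero is a lift, from the others equality of
      lengths makes composition with \<open>?u\<close> onto.\<close>
    have surj: "\<exists>g\<in>mod_hom A N ?X. ev_null N ?Y (\<lambda>x. h x \<ominus>\<^bsub>?Y\<^esub> ?u (g x))" if N: "N \<in> ?Ns" and h: "h \<in> mod_hom A N ?Y" for N h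
    proof (cases "N = free_one A")
      case True
      have fN: "fg_module A N" by (rule Ns'(2)[OF N])
      have "null N ?Y h"
        using null_factor[OF fY free_one_projective mod_hom_id, of h] h by (simp add: True)
      then have "ev_null N ?Y (\<lambda>x. h x \<ominus>\<^bsub>?Y\<^esub> ?u \<zero>\<^bsub>?X\<^esub>)"
        by (intro ev_null_cong[OF fN fY ev_null_null[OF fN fY]])
          (use mod_hom_zero[OF fg_left_module[OF fX] fg_left_module[OF fY] uh] mod_homD(1)[OF h] in \<open>simp_all add: Y.M.diff_zero\<close>)
      then show ?thesis
        by (rule bexI[of _ "\<lambda>_. \<zero>\<^bsub>?X\<^esub>"]) (rule mod_hom_const_zero[OF fg_left_module[OF fX]])
    next
      case False
      then obtain N0 where N0: "N0 \<in> Ns" "N = syz e N0" using N by blast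
      have fN: "fg_module A N" by (rule Ns'(2)[OF N])
      show ?thesis
        by (rule stable_hom_length_eq_surj[OF fN fX fY uh ev_stable_iso_inj[OF fN fX fY uh su] _ h]) (use eq[OF N0(1)] N0(2) in simp_all)
    qed
    \<comment> \<open>Lifting the summands of the identity of \<open>?Y\<close> one by one produces
      a right inverse of \<open>?u\<close> up to eventually null maps.\<close>
    have "\<exists>g\<in>mod_hom A ?Y ?X. ev_null ?Y ?Y (\<lambda>x. h x \<ominus>\<^bsub>?Y\<^esub> ?u (g x))" if "thru ?Ns ?Y ?Y h" for h
      using that
    proof induction
      case (thru_zero h)
      have "ev_null ?Y ?Y (\<lambda>x. h x \<ominus>\<^bsub>?Y\<^esub> ?u \<zero>\<^bsub>?X\<^esub>)"
        by (rule ev_null_cong[OF fY fY ev_null_null[OF fY fY null_zero[OF fY]]])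
          (use mod_hom_zero[OF fg_left_module[OF fX] fg_left_module[OF fY] uh] thru_zero in \<open>simp add: Y.M.diff_zero\<close>)
      then show ?case
        by (rule bexI[of _ "\<lambda>_. \<zero>\<^bsub>?X\<^esub>"]) (rule mod_hom_const_zero[OF fg_left_module[OF fX]])
    next
      case (thru_step f N a b h)
      have fN: "fg_module A N" by (rule Ns'(2)[OF thru_step(2)])
      obtain g where g: "g \<in> mod_hom A ?Y ?X" "ev_null ?Y ?Y (\<lambda>x. f x \<ominus>\<^bsub>?Y\<^esub> ?u (g x))" using thru_step.IH by blast
      obtain k where k: "k \<in> mod_hom A N ?X" "ev_null N ?Y (\<lambda>x. b x \<ominus>\<^bsub>?Y\<^esub> ?u (k x))"
        using surj[OF thru_step(2,4)] by blast
      have ka: "(\<lambda>x. k (a x)) \<in> mod_hom A ?Y ?X" by (rule mod_hom_comp[OF thru_step(3) k(1)])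
      have "ev_null ?Y ?Y (\<lambda>x. b (a x) \<ominus>\<^bsub>?Y\<^esub> ?u (k (a x)))"
        by (rule ev_null_right[OF fN fY fY k(2) thru_step(3)])
      then have "ev_null ?Y ?Y (\<lambda>x. (f x \<ominus>\<^bsub>?Y\<^esub> ?u (g x)) \<oplus>\<^bsub>?Y\<^esub> (b (a x) \<ominus>\<^bsub>?Y\<^esub> ?u (k (a x))))"
        by (rule ev_null_add[OF fY fY g(2)])
      then have "ev_null ?Y ?Y (\<lambda>x. h x \<ominus>\<^bsub>?Y\<^esub> ?u (g x \<oplus>\<^bsub>?X\<^esub> k (a x)))"
      proof (rule ev_null_cong[OF fY fY])
        fix x assume x: "x \<in> carrier ?Y"
        have c: "g x \<in> carrier ?X" "k (a x) \<in> carrier ?X" "f x \<in> carrier ?Y" "b (a x) \<in> carrier ?Y"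
          using mod_homD(1)[OF g(1) x] mod_homD(1)[OF ka x] mod_homD(1)[OF thru_hom[OF thru_step(1) fY fY] x]
            mod_homD(1)[OF mod_hom_comp[OF thru_step(3,4)] x] by auto
        have c': "?u (g x) \<in> carrier ?Y" "?u (k (a x)) \<in> carrier ?Y" using mod_homD(1)[OF uh] c by auto
        have hx: "h x = f x \<oplus>\<^bsub>?Y\<^esub> b (a x)" using thru_step(5) x by blast
        show "h x \<ominus>\<^bsub>?Y\<^esub> ?u (g x \<oplus>\<^bsub>?X\<^esub> k (a x)) = (f x \<ominus>\<^bsub>?Y\<^esub> ?u (g x)) \<oplus>\<^bsub>?Y\<^esub> (b (a x) \<ominus>\<^bsub>?Y\<^esub> ?u (k (a x)))"
          unfolding mod_homD(2)[OF uh c(1,2)] hx using c(3,4) c'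
          by (simp add: Y.M.minus_eq Y.M.minus_add Y.M.a_ac)
      qed
      then show ?case
        by (rule bexI[of _ "\<lambda>x. g x \<oplus>\<^bsub>?X\<^esub> k (a x)"]) (rule mod_hom_add[OF fg_left_module[OF fX] g(1) ka])
    qed
    from this[OF tY'] obtain g where g: "g \<in> mod_hom A ?Y ?X" "ev_null ?Y ?Y (\<lambda>x. x \<ominus>\<^bsub>?Y\<^esub> ?u (g x))" by blast
    note ug = mod_hom_comp[OF g(1) uh] and gu = mod_hom_comp[OF uh g(1)]
    \<comment> \<open>The right inverse is also a left inverse:
      \<open>u (1 - g u) = (1 - u g) u\<close> is eventually null, and \<open>u\<close> may be
      cancelled on the left.\<close>
    have "ev_null ?X ?Y (\<lambda>x. ?u x \<ominus>\<^bsub>?Y\<^esub> ?u (g (?u x)))" by (rule ev_null_right[OF fY fY fX g(2) uh])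
    then have "ev_null ?X ?Y (\<lambda>x. ?u (x \<ominus>\<^bsub>?X\<^esub> g (?u x)))"
      by (rule ev_null_cong[OF fX fY])
        (rule mod_hom_diff[OF fg_left_module[OF fX] fg_left_module[OF fY] uh _ mod_homD(1)[OF gu]])
    then have g2: "ev_null ?X ?X (\<lambda>x. x \<ominus>\<^bsub>?X\<^esub> g (?u x))"
      by (rule ev_stable_iso_inj[OF fX fX fY uh su mod_hom_sub[OF fg_left_module[OF fX] mod_hom_id gu]])
    note sX = syz_fg[OF fX, of n] and sY = syz_fg[OF fY, of n]
    have "stable_eq (syz n ?Y) (syz n ?Y) (syz_map n ?Y ?Y (\<lambda>x. ?u (g x))) (\<lambda>x. x)"
      by (rule null_at_sub_stable_eq[OF fY ug n[OF fY fY tY' tY' g(2)]])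
    then have 1: "stable_eq (syz n ?Y) (syz n ?Y) (\<lambda>x. syz_map n ?X ?Y ?u (syz_map n ?Y ?X g x)) (\<lambda>x. x)"
      by (rule stable_eq_trans[OF sY sY stable_eq_sym[OF sY sY syz_map_comp[OF fY fX fY g(1) uh]]])
    have "stable_eq (syz n ?X) (syz n ?X) (syz_map n ?X ?X (\<lambda>x. g (?u x))) (\<lambda>x. x)"
      by (rule null_at_sub_stable_eq[OF fX gu n[OF fX fX tX' tX' g2]])
    then have 2: "stable_eq (syz n ?X) (syz n ?X) (\<lambda>x. syz_map n ?Y ?X g (syz_map n ?X ?Y ?u x)) (\<lambda>x. x)"
      by (rule stable_eq_trans[OF sX sX stable_eq_sym[OF sX sX syz_map_comp[OF fX fY fX uh g(1)]]])
    have "stable_iso (syz n ?X) (syz n ?Y) (syz_map n ?X ?Y ?u)"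
      by (rule sisoI[OF syz_map_hom[OF fX fY uh] syz_map_hom[OF fY fX g(1)] 2 1])
    then show "stable_iso (syz (n + e) X) (syz (n + e) Y) (syz_map (n + e) X Y u)" unfolding syz_map_syz_map syz_syz .
  qed
qed

end

section \<open>Rotating short exact sequences\<close>

context artin_algebra
begin

definition short_exact :: "('a, 'a fgcar) module \<Rightarrow> ('a fgcar \<Rightarrow> 'a fgcar) \<Rightarrow> ('a, 'a fgcar) module \<Rightarrow>
    ('a fgcar \<Rightarrow> 'a fgcar) \<Rightarrow> ('a, 'a fgcar) module \<Rightarrow> bool" where
  "short_exact X f Y z Z \<longleftrightarrow> fg_module A X \<and> fg_module A Y \<and> fg_module A Z \<and> f \<in> mod_hom A X Y \<and>
     inj_on f (carrier X) \<and> z \<in> mod_epi A Y Z \<and> f ` carrier X = a_kernel Y Z z"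

lemma short_exactD:
  assumes "short_exact X f Y z Z"
  shows "fg_module A X" "fg_module A Y" "fg_module A Z" "f \<in> mod_hom A X Y" "inj_on f (carrier X)"
    "z \<in> mod_epi A Y Z" "z \<in> mod_hom A Y Z" "f ` carrier X = a_kernel Y Z z"
  using assms by (auto simp: short_exact_def mod_epi_def)

lemma factor_through_mono:
  assumes W: "left_module A W" and s: "short_exact X f Y z Z" and h: "h \<in> mod_hom A W Y"
    and zh: "\<And>w. w \<in> carrier W \<Longrightarrow> z (h w) = \<zero>\<^bsub>Z\<^esub>"
  obtains g where "g \<in> mod_hom A W X" "\<And>w. w \<in> carrier W \<Longrightarrow> f (g w) = h w"
proof -
  note e = short_exactD[OF s]
  interpret X: left_module A X by (rule fg_left_module[OF e(1)])
  define g where "g w = inv_into (carrier X) f (h w)" for w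
  have im: "h w \<in> f ` carrier X" if "w \<in> carrier W" for w
    unfolding e(8) using zh[OF that] mod_homD(1)[OF h that] by (simp add: a_kernel_iff)
  have gX: "g w \<in> carrier X" and fg: "f (g w) = h w" if "w \<in> carrier W" for w
    unfolding g_def using im[OF that] by (rule inv_into_into, rule f_inv_into_f)
  interpret W: left_module A W by fact
  show thesis
  proof (rule that[OF _ fg])
    show "g \<in> mod_hom A W X"
    proof (rule mod_homI)
      fix x y assume xy: "x \<in> carrier W" "y \<in> carrier W"
      have "f (g (x \<oplus>\<^bsub>W\<^esub> y)) = f (g x \<oplus>\<^bsub>X\<^esub> g y)"
        using xy fg gX mod_homD(2)[OF h] mod_homD(2)[OF e(4)] by simp
      then show "g (x \<oplus>\<^bsub>W\<^esub> y) = g x \<oplus>\<^bsub>X\<^esub> g y" using inj_onD[OF e(5)] gX xy by simp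
    next
      fix a x assume ax: "a \<in> carrier A" "x \<in> carrier W"
      have "f (g (a \<odot>\<^bsub>W\<^esub> x)) = f (a \<odot>\<^bsub>X\<^esub> g x)"
        using ax fg gX mod_homD(3)[OF h] mod_homD(3)[OF e(4)] by simp
      then show "g (a \<odot>\<^bsub>W\<^esub> x) = a \<odot>\<^bsub>X\<^esub> g x" using inj_onD[OF e(5)] gX ax by simp
    qed (rule gX)
  qed
qed

text \<open>\<open>K\<close> is the kernel of the composite from the cover of \<open>Y\<close> to
  \<open>Z\<close>, hence a syzygy of \<open>Z\<close>. On \<open>K\<close> the cover takes values
  in the image of \<open>f\<close>, which defines \<open>q\<close>; its kernel is that of the cover,
  the syzygy of \<open>Y\<close>.\<close>

lemma rotate:
  assumes s: "short_exact X f Y z Z"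
  obtains K q where "short_exact (syzygy A Y) (\<lambda>x. x) K q X" "pres K Z (proj_cover Y) (\<lambda>x. z (cover_map Y x))"
    "\<And>p. p \<in> carrier K \<Longrightarrow> f (q p) = cover_map Y p"
proof -
  note e = short_exactD[OF s]
  let ?P = "proj_cover Y" and ?e = "\<lambda>x. z (cover_map Y x)"
  have LX: "left_module A X" and LY: "left_module A Y" and LZ: "left_module A Z"
    using e(1,2,3) by (auto intro: fg_left_module)
  define K where "K = ?P\<lparr>carrier := a_kernel ?P Z ?e\<rparr>"
  have epi: "?e \<in> mod_epi A ?P Z"
  proof -
    have "cover_map Y ` carrier ?P = carrier Y" "z ` carrier Y = carrier Z" using cover_map_epi[OF e(2)] e(6) by (auto simp: mod_epi_def)
    then have "?e ` carrier ?P = carrier Z" by (simp add: image_image[symmetric])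
    then show ?thesis using mod_hom_comp[OF cover_map_hom[OF e(2)] e(7)] by (simp add: mod_epi_def)
  qed
  have K: "pres K Z ?P ?e" using proj_cover_projective[OF e(2)] e(3) epi by (simp add: pres_def K_def)
  note k = presD[OF K]
  have LK: "left_module A K" by (rule fg_left_module[OF k(8)])
  have pi: "cover_map Y \<in> mod_hom A K Y" using mod_hom_comp[OF pres_incl[OF K] cover_map_hom[OF e(2)]] .
  obtain q where q: "q \<in> mod_hom A K X" "\<And>p. p \<in> carrier K \<Longrightarrow> f (q p) = cover_map Y p"
    by (rule factor_through_mono[OF LK s pi]) (use k(9) in auto)
  have f0: "f \<zero>\<^bsub>X\<^esub> = \<zero>\<^bsub>Y\<^esub>" by (rule mod_hom_zero[OF LX LY e(4)])
  have z0: "z \<zero>\<^bsub>Y\<^esub> = \<zero>\<^bsub>Z\<^esub>" by (rule mod_hom_zero[OF LY LZ e(7)])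
  interpret X: left_module A X by (rule LX)
  have q0: "q p = \<zero>\<^bsub>X\<^esub> \<longleftrightarrow> cover_map Y p = \<zero>\<^bsub>Y\<^esub>" if p: "p \<in> carrier K" for p
    using q(2)[OF p] f0 inj_onD[OF e(5), of "q p" "\<zero>\<^bsub>X\<^esub>"] mod_homD(1)[OF q(1) p] by auto
  have sK: "x \<in> carrier (syzygy A Y) \<longleftrightarrow> x \<in> carrier K \<and> q x = \<zero>\<^bsub>X\<^esub>" for x
    unfolding presD(9)[OF syzygy_pres[OF e(2)]] using k(9) q0 z0 by metis
  have "short_exact (syzygy A Y) (\<lambda>x. x) K q X"
    unfolding short_exact_def
  proof (intro conjI syzygy_fg e(1,2) k(8))
    show "(\<lambda>x. x) \<in> mod_hom A (syzygy A Y) K"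
      by (rule pres_into[OF K pres_incl[OF syzygy_pres[OF e(2)]]]) (use sK k(9) in blast)
    show "q \<in> mod_epi A K X"
    proof -
      have "x \<in> q ` carrier K" if x: "x \<in> carrier X" for x
      proof -
        have fx: "f x \<in> carrier Y" "z (f x) = \<zero>\<^bsub>Z\<^esub>" using imageI[OF x, of f] unfolding e(8) by (auto simp: a_kernel_iff)
        obtain p where p: "p \<in> carrier ?P" "cover_map Y p = f x" using mod_epi_surj[OF cover_map_epi[OF e(2)] fx(1)] by blast
        then have pK: "p \<in> carrier K" using fx(2) k(9) by simp
        have "q p = x" using q(2)[OF pK] p(2) inj_onD[OF e(5) _ mod_homD(1)[OF q(1) pK] x] by simp
        then show ?thesis using pK by blast
      qed
      then have "q ` carrier K = carrier X" using mod_homD(1)[OF q(1)] by blast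
      then show ?thesis using q(1) by (simp add: mod_epi_def)
    qed
    show "(\<lambda>x. x) ` carrier (syzygy A Y) = a_kernel K X q"
      using sK by (auto simp: a_kernel_iff)
  qed simp
  then show thesis using K q(2) by (rule that)
qed

text \<open>Schanuel's lemma in stable form, with the comparison map kept as a lift of the
  identity.\<close>

lemma pres_stable_iso:
  assumes K: "pres K M P p" and L: "pres L M Q q"
  obtains s where "is_lift P p Q q (\<lambda>x. x) s" "stable_iso K L s"
proof -
  obtain s where s: "is_lift P p Q q (\<lambda>x. x) s" using lift_ex[OF K L mod_hom_id] by blast
  show thesis by (rule that[OF s lift_stable_iso[OF K L stable_iso_id[OF presD(3)[OF K]] s]])
qed

text \<open>The comparison of \<open>K\<close> with the syzygy of \<open>Z\<close> lifts the
  identity of \<open>Z\<close> from the composite presentation, and so lifts \<open>z\<close> from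
  the cover of \<open>Y\<close>. Hence the inclusion represents the syzygy of
  \<open>z\<close>.\<close>

lemma rotate_epi:
  assumes s: "short_exact X f Y z Z" and K: "pres K Z (proj_cover Y) (\<lambda>x. z (cover_map Y x))"
    and i: "(\<lambda>x. x) \<in> mod_hom A (syzygy A Y) K"
  shows "arrow_eq (syzygy A Y) K (\<lambda>x. x) (syzygy A Y) (syzygy A Z) (syzygy_map Y Z z)"
proof -
  note e = short_exactD[OF s]
  note sY = syzygy_fg[OF e(2)] and sZ = syzygy_fg[OF e(3)]
  obtain t where t: "is_lift (proj_cover Y) (\<lambda>x. z (cover_map Y x)) (proj_cover Z) (cover_map Z) (\<lambda>x. x) t" "stable_iso K (syzygy A Z) t"
    by (rule pres_stable_iso[OF K syzygy_pres[OF e(3)]])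
  have "is_lift (proj_cover Y) (cover_map Y) (proj_cover Z) (cover_map Z) z t" using t(1) by (simp add: is_lift_def)
  then have "stable_eq (syzygy A Y) (syzygy A Z) (syzygy_map Y Z z) t"
    by (rule syzygy_map_unique[OF e(2,3) stable_eq_refl[OF e(2,3,7)]])
  then have "stable_eq (syzygy A Y) (syzygy A Z) (\<lambda>x. t x) (\<lambda>x. syzygy_map Y Z z x)" by (rule stable_eq_sym[OF sY sZ])
  then show ?thesis
    by (intro arrow_eqI[OF i syzygy_map_hom[OF e(2,3,7)] stable_iso_id[OF sY] t(2)])
qed

text \<open>Rotating twice turns \<open>f\<close> into a representative of its syzygy.\<close>

lemma rotate_mono:
  assumes s: "short_exact X f Y z Z" and K: "pres K Z (proj_cover Y) (\<lambda>x. z (cover_map Y x))"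
    and s1: "short_exact (syzygy A Y) (\<lambda>x. x) K q X" and q: "\<And>p. p \<in> carrier K \<Longrightarrow> f (q p) = cover_map Y p"
    and L: "pres L X (proj_cover K) (\<lambda>x. q (cover_map K x))"
    and s2: "short_exact (syzygy A K) (\<lambda>x. x) L r (syzygy A Y)" and r: "\<And>p. p \<in> carrier L \<Longrightarrow> r p = cover_map K p"
  shows "arrow_eq (syzygy A X) (syzygy A Y) (syzygy_map X Y f) L (syzygy A Y) r"
proof -
  note e = short_exactD[OF s] and e1 = short_exactD[OF s1] and e2 = short_exactD[OF s2]
  note sX = syzygy_fg[OF e(1)] and sY = syzygy_fg[OF e(2)]
  obtain t where t: "is_lift (proj_cover X) (cover_map X) (proj_cover K) (\<lambda>x. q (cover_map K x)) (\<lambda>x. x) t" "stable_iso (syzygy A X) L t"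
    by (rule pres_stable_iso[OF syzygy_pres[OF e(1)] L])
  have th: "t \<in> mod_hom A (proj_cover X) (proj_cover K)" "\<And>x. x \<in> carrier (proj_cover X) \<Longrightarrow> q (cover_map K (t x)) = cover_map X x"
    using t(1) by (auto simp: is_lift_def)
  \<comment> \<open>Since \<open>f q\<close> is the cover of \<open>Y\<close> on \<open>K\<close>,
    this map lifts \<open>f\<close> between the covers of \<open>X\<close> and \<open>Y\<close>; on
    the syzygy of \<open>X\<close> it equals \<open>r t\<close>.\<close>
  let ?G = "\<lambda>x. cover_map K (t x)"
  have G: "?G \<in> mod_hom A (proj_cover X) K" by (rule mod_hom_comp[OF th(1) cover_map_hom[OF e1(2)]])
  have "is_lift (proj_cover X) (cover_map X) (proj_cover Y) (cover_map Y) f ?G"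
    unfolding is_lift_def
  proof (intro conjI ballI)
    show "?G \<in> mod_hom A (proj_cover X) (proj_cover Y)" by (rule pres_out[OF K G])
    fix x assume x: "x \<in> carrier (proj_cover X)"
    show "cover_map Y (?G x) = f (cover_map X x)" using q[OF mod_homD(1)[OF G x]] th(2)[OF x] by simp
  qed
  then have 1: "stable_eq (syzygy A X) (syzygy A Y) (syzygy_map X Y f) ?G"
    by (rule syzygy_map_unique[OF e(1,2) stable_eq_refl[OF e(1,2,4)]])
  have 2: "stable_eq (syzygy A X) (syzygy A Y) ?G (\<lambda>x. r (t x))"
    by (rule stable_eq_cong[OF sX sY stable_eq_hom(2)[OF 1]]) (rule r[OF mod_homD(1)[OF stable_iso_hom[OF t(2)]]])
  have "stable_eq (syzygy A X) (syzygy A Y) (\<lambda>x. syzygy_map X Y f x) (\<lambda>x. r (t x))"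
    using stable_eq_trans[OF sX sY 1 2] .
  then show ?thesis
    by (intro arrow_eqI[OF syzygy_map_hom[OF e(1,2,4)] e2(7) t(2) stable_iso_id[OF sY]])
qed

text \<open>The third rotation is \<Omega>L, N, \<Omega>K, where \<open>L\<close> and
  \<open>K\<close> are first syzygies of \<open>X\<close> and \<open>Z\<close>, and \<open>N\<close>
  is a first syzygy of \<Omega>Y. All three terms are thus second syzygies, in the original
  order.\<close>

lemma rotate_thrice:
  assumes s: "short_exact X f Y z Z"
  obtains X' f' Y' z' Z' \<gamma> where "short_exact X' f' Y' z' Z'"
    "arrow_eq (syz 2 X) (syz 2 Y) (syz_map 2 X Y f) X' Y' f'" "stable_iso Z' (syz 2 Z) \<gamma>"
proof -
  note e = short_exactD[OF s]
  obtain K q where K: "short_exact (syzygy A Y) (\<lambda>x. x) K q X" "pres K Z (proj_cover Y) (\<lambda>x. z (cover_map Y x))"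
    "\<And>p. p \<in> carrier K \<Longrightarrow> f (q p) = cover_map Y p"
    by (rule rotate[OF s], rule that)
  note eK = short_exactD[OF K(1)]
  obtain L r where L: "short_exact (syzygy A K) (\<lambda>x. x) L r (syzygy A Y)" "pres L X (proj_cover K) (\<lambda>x. q (cover_map K x))"
    "\<And>p. p \<in> carrier L \<Longrightarrow> r p = cover_map K p"
    by (rule rotate[OF K(1)], rule that)
  note eL = short_exactD[OF L(1)]
  obtain N t where N: "short_exact (syzygy A L) (\<lambda>x. x) N t (syzygy A K)" "pres N (syzygy A Y) (proj_cover L) (\<lambda>x. r (cover_map L x))"
    "\<And>p. p \<in> carrier N \<Longrightarrow> t p = cover_map L p"
    by (rule rotate[OF L(1)], rule that)
  note eN = short_exactD[OF N(1)]
  note fg = syzygy_fg[OF eL(2)] eN(2) syzygy_fg[OF eL(3)]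
  have 1: "arrow_eq (syzygy A X) (syzygy A Y) (syzygy_map X Y f) L (syzygy A Y) r"
    by (rule rotate_mono[OF s K(2) K(1) K(3) L(2) L(1) L(3)])
  note s1 = syzygy_fg[OF e(1)] syzygy_fg[OF e(2)]
  have 2: "arrow_eq (syz 2 X) (syz 2 Y) (syz_map 2 X Y f) (syzygy A L) (syzygy A (syzygy A Y)) (syzygy_map L (syzygy A Y) r)"
    using arrow_eq_syz_map[OF s1 eL(2) s1(2) 1, of 1] by (simp add: numeral_2_eq_2)
  have 3: "arrow_eq (syzygy A L) N (\<lambda>x. x) (syzygy A L) (syzygy A (syzygy A Y)) (syzygy_map L (syzygy A Y) r)"
    by (rule rotate_epi[OF L(1) N(2) eN(4)])
  have 4: "arrow_eq (syz 2 X) (syz 2 Y) (syz_map 2 X Y f) (syzygy A L) N (\<lambda>x. x)"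
    by (rule arrow_eq_trans[OF syz_fg[OF e(1)] syz_fg[OF e(2)] fg(1) fg(3) fg(1,2) 2
          arrow_eq_sym[OF fg(1,2,1,3) 3]])
  obtain u where u: "stable_iso K (syzygy A Z) u" by (rule pres_stable_iso[OF K(2) syzygy_pres[OF e(3)]])
  have "stable_iso (syzygy A K) (syz 2 Z) (syz_map 1 K (syzygy A Z) u)"
    using syz_map_stable_iso[OF eK(2) syzygy_fg[OF e(3)] u, of 1] by (simp add: numeral_2_eq_2)
  then show thesis by (rule that[OF N(1) 4])
qed

text \<open>Every even syzygy of \<open>f\<close> is realised, up to stable isomorphism, by a map in
  a genuine short exact sequence, where kernel and cokernel are available.\<close>

lemma rotate_iterate:
  assumes s: "short_exact X f Y z Z"
  shows "\<exists>X' f' Y' z' Z' \<gamma>. short_exact X' f' Y' z' Z' \<and>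
    arrow_eq (syz (2 * k) X) (syz (2 * k) Y) (syz_map (2 * k) X Y f) X' Y' f' \<and> stable_iso Z' (syz (2 * k) Z) \<gamma>"
proof (induction k)
  case 0
  note e = short_exactD[OF s]
  have "arrow_eq X Y f X Y f"
    by (rule arrow_eqI[OF e(4,4) stable_iso_id[OF e(1)] stable_iso_id[OF e(2)] stable_eq_refl[OF e(1,2,4)]])
  then show ?case using s stable_iso_id[OF e(3)] by (simp, blast)
next
  case (Suc k)
  note e = short_exactD[OF s]
  obtain X' f' Y' z' Z' \<gamma> where 1: "short_exact X' f' Y' z' Z'"
    "arrow_eq (syz (2 * k) X) (syz (2 * k) Y) (syz_map (2 * k) X Y f) X' Y' f'" "stable_iso Z' (syz (2 * k) Z) \<gamma>"
    using Suc by blast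
  note e1 = short_exactD[OF 1(1)]
  obtain X'' f'' Y'' z'' Z'' \<delta> where 2: "short_exact X'' f'' Y'' z'' Z''"
    "arrow_eq (syz 2 X') (syz 2 Y') (syz_map 2 X' Y' f') X'' Y'' f''" "stable_iso Z'' (syz 2 Z') \<delta>"
    by (rule rotate_thrice[OF 1(1)], rule that)
  note e2 = short_exactD[OF 2(1)]
  have k2: "2 + 2 * k = 2 * Suc k" by simp
  have "arrow_eq (syz 2 (syz (2 * k) X)) (syz 2 (syz (2 * k) Y)) (syz_map 2 (syz (2 * k) X) (syz (2 * k) Y) (syz_map (2 * k) X Y f))
    (syz 2 X') (syz 2 Y') (syz_map 2 X' Y' f')"
    by (rule arrow_eq_syz_map[OF syz_fg[OF e(1)] syz_fg[OF e(2)] e1(1,2) 1(2)])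
  then have "arrow_eq (syz (2 * Suc k) X) (syz (2 * Suc k) Y) (syz_map (2 * Suc k) X Y f) (syz 2 X') (syz 2 Y') (syz_map 2 X' Y' f')"
    unfolding syz_map_syz_map syz_syz k2 .
  from arrow_eq_trans[OF syz_fg[OF e(1)] syz_fg[OF e(2)] syz_fg[OF e1(1)] syz_fg[OF e1(2)] e2(1,2) this 2(2)]
  have 3: "arrow_eq (syz (2 * Suc k) X) (syz (2 * Suc k) Y) (syz_map (2 * Suc k) X Y f) X'' Y'' f''" .
  have "stable_iso (syz 2 Z') (syz 2 (syz (2 * k) Z)) (syz_map 2 Z' (syz (2 * k) Z) \<gamma>)"
    by (rule syz_map_stable_iso[OF e1(3) syz_fg[OF e(3)] 1(3)])
  from stable_iso_comp[OF e2(3) syz_fg[OF e1(3)] syz_fg[OF syz_fg[OF e(3)]] 2(3) this]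
  have "\<exists>\<gamma>. stable_iso Z'' (syz (2 * Suc k) Z) \<gamma>" unfolding syz_syz k2 by blast
  then show ?case using 2(1) 3 by blast
qed

section \<open>Stable isomorphisms and projective cokernels\<close>

lemma projective_syz_mono:
  assumes M: "fg_module A M" and p: "projective_module A (syz m M)" and mn: "m \<le> n"
  shows "projective_module A (syz n M)"
proof -
  have f: "fg_module A (syz m M)" by (rule syz_fg[OF M])
  have "null (syz m M) (syz m M) (\<lambda>x. x)" using p by (simp add: null_id_iff_projective[OF f])
  from syz_map_null[OF f f this, of "n - m"]
  have "null (syz (n - m) (syz m M)) (syz (n - m) (syz m M)) (syz_map (n - m) (syz m M) (syz m M) (\<lambda>x. x))" .
  from null_stable_eq[OF syz_fg[OF f] syz_fg[OF f] stable_eq_sym[OF syz_fg[OF f] syz_fg[OF f] syz_map_id[OF f]] this]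
  have "projective_module A (syz (n - m) (syz m M))" by (simp add: null_id_iff_projective[OF syz_fg[OF f]])
  then show ?thesis using mn unfolding syz_syz by simp
qed

lemma projective_stable_iso:
  assumes X: "fg_module A X" and Y: "fg_module A Y" and f: "stable_iso X Y f" and p: "projective_module A X"
  shows "projective_module A Y"
  using null_id_stable_iso[OF X Y f] p by (simp add: null_id_iff_projective X Y)

text \<open>The sequence splits. With a section \<open>t\<close> of \<open>z\<close>, the map
  \<open>y - t (z y)\<close> factors over \<open>f\<close> and gives the inverse, and the error
  \<open>t z\<close> passes through the projective \<open>Z\<close>.\<close>

lemma split_stable_iso:
  assumes s: "short_exact X f Y z Z" and Z: "projective_module A Z"
  shows "stable_iso X Y f"
proof -
  note e = short_exactD[OF s]
  have LX: "left_module A X" and LY: "left_module A Y" and LZ: "left_module A Z"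
    using e(1,2,3) by (auto intro: fg_left_module)
  interpret X: left_module A X by (rule LX)
  interpret Y: left_module A Y by (rule LY)
  interpret Z: left_module A Z by (rule LZ)
  obtain t where t: "t \<in> mod_hom A Z Y" "\<And>x. x \<in> carrier Z \<Longrightarrow> z (t x) = x"
    by (rule projective_lift[OF Z e(2,3,6) mod_hom_id], rule that)
  have tz: "(\<lambda>y. t (z y)) \<in> mod_hom A Y Y" by (rule mod_hom_comp[OF e(7) t(1)])
  let ?h = "\<lambda>y. y \<ominus>\<^bsub>Y\<^esub> t (z y)"
  have h: "?h \<in> mod_hom A Y Y" by (rule mod_hom_sub[OF LY mod_hom_id tz])
  have zc: "z y \<in> carrier Z" "t (z y) \<in> carrier Y" if "y \<in> carrier Y" for y
    using mod_homD(1)[OF e(7) that] mod_homD(1)[OF tz that] by auto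
  have zh: "z (?h y) = \<zero>\<^bsub>Z\<^esub>" if y: "y \<in> carrier Y" for y
    using mod_hom_diff[OF LY LZ e(7) y zc(2)[OF y]] t(2)[OF zc(1)[OF y]] zc(1)[OF y]
    by (simp add: Z.M.minus_eq Z.M.r_neg)
  obtain g where g: "g \<in> mod_hom A Y X" "\<And>y. y \<in> carrier Y \<Longrightarrow> f (g y) = ?h y"
    by (rule factor_through_mono[OF LY s h zh], assumption, rule that)
  have "stable_eq X X (\<lambda>x. x) (\<lambda>x. g (f x))"
  proof (rule stable_eq_cong[OF e(1,1) mod_hom_id])
    fix x assume x: "x \<in> carrier X"
    have fx: "f x \<in> carrier Y" "z (f x) = \<zero>\<^bsub>Z\<^esub>" using imageI[OF x, of f] unfolding e(8) by (auto simp: a_kernel_iff)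
    have "f (g (f x)) = f x"
      using g(2)[OF fx(1)] fx mod_hom_zero[OF LZ LY t(1)] by (simp add: Y.M.diff_zero)
    then show "g (f x) = x" using inj_onD[OF e(5) _ mod_homD(1)[OF g(1) fx(1)] x] by simp
  qed
  moreover have "null Y Y (\<lambda>y. f (g y) \<ominus>\<^bsub>Y\<^esub> y)"
  proof (rule null_cong[OF e(2) null_neg[OF e(2,2) null_factor[OF e(2) Z e(7) t(1)]]])
    fix y assume y: "y \<in> carrier Y"
    have "f (g y) = y \<oplus>\<^bsub>Y\<^esub> \<ominus>\<^bsub>Y\<^esub> t (z y)" using g(2)[OF y] by (simp add: Y.M.minus_eq)
    then show "f (g y) \<ominus>\<^bsub>Y\<^esub> y = \<ominus>\<^bsub>Y\<^esub> t (z y)"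
      using Y.M.add_diff_cancel_left[OF y Y.M.a_inv_closed[OF zc(2)[OF y]]] by simp
  qed
  then have "stable_eq Y Y (\<lambda>y. f (g y)) (\<lambda>y. y)"
    using mod_hom_comp[OF g(1) e(4)] mod_hom_id[of A Y] by (simp add: stable_eq_def)
  ultimately show ?thesis by (intro sisoI[OF e(4) g(1) stable_eq_sym[OF e(1,1)]])
qed

text \<open>If \<open>f\<close> is a stable isomorphism, both outer maps of \<open>\<Omega>Y \<rightarrow> K \<rightarrow> X\<close> are null, hence so is the
  identity of \<open>K\<close>, a syzygy of \<open>Z\<close>.\<close>

lemma stable_iso_cokernel:
  assumes s: "short_exact X f Y z Z" and f: "stable_iso X Y f"
  shows "projective_module A (syzygy A Z)"
proof -
  note e = short_exactD[OF s]
  have LX: "left_module A X" and LY: "left_module A Y" and LZ: "left_module A Z"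
    using e(1,2,3) by (auto intro: fg_left_module)
  obtain g where g: "g \<in> mod_hom A Y X" "stable_eq X X (\<lambda>x. g (f x)) (\<lambda>x. x)" "stable_eq Y Y (\<lambda>x. f (g x)) (\<lambda>x. x)"
    using f by (rule sisoE)
  obtain K q where K: "short_exact (syzygy A Y) (\<lambda>x. x) K q X" "pres K Z (proj_cover Y) (\<lambda>x. z (cover_map Y x))"
    "\<And>p. p \<in> carrier K \<Longrightarrow> f (q p) = cover_map Y p"
    by (rule rotate[OF s], rule that)
  note eK = short_exactD[OF K(1)] and k = presD[OF K(2)]
  note fK = eK(2) and fP = k(2) and fY' = eK(1)
  have LK: "left_module A K" and LP: "left_module A (proj_cover Y)" using fK fP by (auto intro: fg_left_module)
  interpret X: left_module A X by (rule LX)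
  interpret Y: left_module A Y by (rule LY)
  interpret Z: left_module A Z by (rule LZ)
  interpret K: left_module A K by (rule LK)
  interpret P: left_module A "proj_cover Y" by (rule LP)
  \<comment> \<open>The composite \<open>f q\<close> is the cover of \<open>Y\<close> restricted to
    \<open>K\<close> and so passes through a projective. Cancelling the stable isomorphism
    \<open>f\<close> makes \<open>q\<close> null.\<close>
  have "null K Y (\<lambda>x. cover_map Y x)"
    by (rule null_factor[OF e(2) k(1) pres_incl[OF K(2)] cover_map_hom[OF e(2)]])
  then have "null K Y (\<lambda>x. f (q x))" by (rule null_cong[OF fK]) (rule K(3))
  then have "null K X (\<lambda>x. g (f (q x)))" by (rule null_comp_left[OF fK e(2,1) _ g(1)])
  then have nq: "null K X q"
    by (rule null_stable_eq[OF fK e(1) stable_eq_sym[OF fK e(1) stable_eq_comp[OF fK e(1,1) stable_eq_refl[OF fK e(1) eK(7)] g(2)]]])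
  obtain t where t: "t \<in> mod_hom A K (proj_cover X)" "\<And>x. x \<in> carrier K \<Longrightarrow> cover_map X (t x) = q x"
    using nq by (auto simp: null_def)
  obtain \<sigma> where \<sigma>: "\<sigma> \<in> mod_hom A (proj_cover X) K" "\<And>x. x \<in> carrier (proj_cover X) \<Longrightarrow> q (\<sigma> x) = cover_map X x"
    by (rule projective_lift[OF proj_cover_projective[OF e(1)] fK e(1) eK(6) cover_map_hom[OF e(1)]], rule that)
  have st: "(\<lambda>x. \<sigma> (t x)) \<in> mod_hom A K K" by (rule mod_hom_comp[OF t(1) \<sigma>(1)])
  \<comment> \<open>The null map \<open>q\<close> lifts by \<open>t\<close> to the cover of
    \<open>X\<close>, and \<sigma> lifts that cover to \<open>K\<close>. Hence \<open>q\<close>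
    kills the difference from the identity, which then factors through the syzygy of
    \<open>Y\<close>.\<close>
  let ?D = "\<lambda>x. x \<ominus>\<^bsub>K\<^esub> \<sigma> (t x)"
  have D: "?D \<in> mod_hom A K K" by (rule mod_hom_sub[OF LK mod_hom_id st])
  obtain D' where D': "D' \<in> mod_hom A K (syzygy A Y)" "\<And>x. x \<in> carrier K \<Longrightarrow> D' x = ?D x"
  proof (rule factor_through_mono[OF LK K(1) D])
    fix x assume x: "x \<in> carrier K"
    have "q (?D x) = q x \<ominus>\<^bsub>X\<^esub> q (\<sigma> (t x))" by (rule mod_hom_diff[OF LK LX eK(7) x mod_homD(1)[OF st x]])
    also have "q (\<sigma> (t x)) = q x" using \<sigma>(2)[OF mod_homD(1)[OF t(1) x]] t(2)[OF x] by simp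
    finally show "q (?D x) = \<zero>\<^bsub>X\<^esub>" using mod_homD(1)[OF eK(7) x] by (simp add: X.M.minus_eq X.M.r_neg)
  qed (rule that)
  \<comment> \<open>Stably \<open>z\<close> equals \<open>z f g\<close>, and \<open>z f\<close> is
    zero.\<close>
  have "stable_eq Y Z (\<lambda>y. z (f (g y))) z"
    by (rule stable_eq_comp[OF e(2,2,3) g(3) stable_eq_refl[OF e(2,3,7)]])
  moreover have "null Y Z (\<lambda>y. z (f (g y)))"
  proof (rule null_cong[OF e(2) null_zero[OF e(3)]])
    fix y assume "y \<in> carrier Y"
    then have "f (g y) \<in> a_kernel Y Z z" unfolding e(8)[symmetric] using mod_homD(1)[OF g(1)] by blast
    then show "z (f (g y)) = \<zero>\<^bsub>Z\<^esub>" by (simp add: a_kernel_iff)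
  qed
  ultimately have "null Y Z z" using null_stable_eq[OF e(2,3) stable_eq_sym[OF e(2,3)]] by blast
  then obtain h where h: "h \<in> mod_hom A Y (proj_cover Y)" "\<And>y. y \<in> carrier Y \<Longrightarrow> z (cover_map Y (h y)) = z y"
    using null_lift[OF e(3) _ fP k(4)] by blast
  have hp: "(\<lambda>x. h (cover_map Y x)) \<in> mod_hom A (proj_cover Y) (proj_cover Y)" by (rule mod_hom_comp[OF cover_map_hom[OF e(2)] h(1)])
  \<comment> \<open>A lift \<open>h\<close> of the null map \<open>z\<close> corrects the identity
    of the cover so that it lands in \<open>K\<close>. On the syzygy of \<open>Y\<close> the
    correction vanishes, so the inclusion into \<open>K\<close> extends to a projective and is
    null.\<close>
  let ?H = "\<lambda>x. x \<ominus>\<^bsub>proj_cover Y\<^esub> h (cover_map Y x)"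
  have H: "?H \<in> mod_hom A (proj_cover Y) K"
  proof (rule pres_into[OF K(2) mod_hom_sub[OF LP mod_hom_id hp]])
    fix x assume x: "x \<in> carrier (proj_cover Y)"
    have "z (cover_map Y (?H x)) = z (cover_map Y x) \<ominus>\<^bsub>Z\<^esub> z (cover_map Y (h (cover_map Y x)))"
      by (rule mod_hom_diff[OF LP LZ k(5) x mod_homD(1)[OF hp x]])
    also have "\<dots> = \<zero>\<^bsub>Z\<^esub>" using h(2) mod_homD(1)[OF cover_map_hom[OF e(2)] x] mod_homD(1)[OF k(5) x]
      by (simp add: Z.M.minus_eq Z.M.r_neg)
    finally show "z (cover_map Y (?H x)) = \<zero>\<^bsub>Z\<^esub>" .
  qed
  have "null (syzygy A Y) K ?H"
    by (rule null_factor[OF fK k(1) pres_incl[OF syzygy_pres[OF e(2)]] H])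
  then have "null (syzygy A Y) K (\<lambda>x. x)"
  proof (rule null_cong[OF fY'])
    fix x assume "x \<in> carrier (syzygy A Y)"
    then have x: "x \<in> carrier (proj_cover Y)" "cover_map Y x = \<zero>\<^bsub>Y\<^esub>" using presD(9)[OF syzygy_pres[OF e(2)]] by auto
    show "x = ?H x" unfolding x(2) mod_hom_zero[OF LY LP h(1)] using P.M.diff_zero[OF x(1)] by simp
  qed
  from null_comp_right[OF this D'(1)] have "null K K (\<lambda>x. D' x)" .
  then have "null K K ?D" by (rule null_cong[OF fK]) (simp add: D'(2))
  \<comment> \<open>The identity of \<open>K\<close> is the sum of a map through the null inclusion
    and a map through the cover of \<open>X\<close>.\<close>
  then have "null K K (\<lambda>x. ?D x \<oplus>\<^bsub>K\<^esub> \<sigma> (t x))"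
    by (rule null_add[OF fK _ null_factor[OF fK proj_cover_projective[OF e(1)] t(1) \<sigma>(1)]])
  then have "null K K (\<lambda>x. x)"
    by (rule null_cong[OF fK]) (simp add: K.M.diff_add_cancel mod_homD(1)[OF st])
  then have "projective_module A K" by (simp add: null_id_iff_projective[OF fK])
  moreover obtain u where u: "stable_iso K (syzygy A Z) u" by (rule pres_stable_iso[OF K(2) syzygy_pres[OF e(3)]])
  ultimately show ?thesis using projective_stable_iso[OF fK syzygy_fg[OF e(3)]] by blast
qed

text \<open>At stage \<open>2 * m\<close> the map sits in a short exact sequence with projective
  cokernel, and such a sequence splits.\<close>

lemma projective_syz_imp_stable_iso:
  assumes s: "short_exact X f Y z Z" and p: "projective_module A (syz m Z)"
  shows "stable_iso (syz (2 * m) X) (syz (2 * m) Y) (syz_map (2 * m) X Y f)"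
proof -
  note e = short_exactD[OF s]
  obtain X' f' Y' z' Z' \<gamma> where r: "short_exact X' f' Y' z' Z'"
    "arrow_eq (syz (2 * m) X) (syz (2 * m) Y) (syz_map (2 * m) X Y f) X' Y' f'" "stable_iso Z' (syz (2 * m) Z) \<gamma>"
    using rotate_iterate[OF s] by blast
  note er = short_exactD[OF r(1)] and sZ = syz_fg[OF e(3), of "2 * m"]
  obtain \<delta> where d: "stable_iso (syz (2 * m) Z) Z' \<delta>" using r(3) by (rule sisoE)
  have "projective_module A (syz (2 * m) Z)" by (rule projective_syz_mono[OF e(3) p]) simp
  then have "projective_module A Z'" by (rule projective_stable_iso[OF sZ er(3) d])
  then have "stable_iso X' Y' f'" by (rule split_stable_iso[OF r(1)])
  then show ?thesis
    by (rule arrow_eq_stable_iso[OF er(1,2) syz_fg[OF e(1)] syz_fg[OF e(2)]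
          arrow_eq_sym[OF syz_fg[OF e(1)] syz_fg[OF e(2)] er(1,2) r(2)]])
qed

text \<open>Stage \<open>b\<close> is raised to the even stage \<open>2 * b\<close>, where a short
  exact sequence is available; the additional syzygy comes from
  \<open>stable_iso_cokernel\<close>.\<close>

lemma stable_iso_imp_projective_syz:
  assumes s: "short_exact X f Y z Z" and i: "stable_iso (syz b X) (syz b Y) (syz_map b X Y f)"
  shows "projective_module A (syz (Suc (2 * b)) Z)"
proof -
  note e = short_exactD[OF s]
  obtain X' f' Y' z' Z' \<gamma> where r: "short_exact X' f' Y' z' Z'"
    "arrow_eq (syz (2 * b) X) (syz (2 * b) Y) (syz_map (2 * b) X Y f) X' Y' f'" "stable_iso Z' (syz (2 * b) Z) \<gamma>"
    using rotate_iterate[OF s] by blast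
  note er = short_exactD[OF r(1)] and sZ = syz_fg[OF e(3), of "2 * b"]
  have "stable_iso (syz (2 * b) X) (syz (2 * b) Y) (syz_map (2 * b) X Y f)"
    using syz_map_stable_iso[OF syz_fg[OF e(1)] syz_fg[OF e(2)] i, of b] unfolding syz_map_syz_map syz_syz by (simp add: mult_2)
  then have "stable_iso X' Y' f'"
    by (rule arrow_eq_stable_iso[OF syz_fg[OF e(1)] syz_fg[OF e(2)] er(1,2) r(2)])
  then have "projective_module A (syzygy A Z')" by (rule stable_iso_cokernel[OF r(1)])
  moreover have "stable_iso (syzygy A Z') (syz (Suc (2 * b)) Z) (syz_map 1 Z' (syz (2 * b) Z) \<gamma>)"
    using syz_map_stable_iso[OF er(3) sZ r(3), of 1] by simp
  ultimately show ?thesis using projective_stable_iso[OF syzygy_fg[OF er(3)] syz_fg[OF e(3)]] by blast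
qed

section \<open>Projective dimension and syzygies\<close>

text \<open>Over the zero module the kernel of the cover is everything, so the zero submodule
  supplements it and must be everything by minimality.\<close>

lemma proj_cover_zero:
  assumes X: "fg_module A X" and z: "carrier X = {\<zero>\<^bsub>X\<^esub>}"
  shows "carrier (proj_cover X) = {\<zero>\<^bsub>proj_cover X\<^esub>}"
proof -
  interpret P: left_module A "proj_cover X" by (rule fg_left_module[OF proj_cover_fg[OF X]])
  have ker: "a_kernel (proj_cover X) X (cover_map X) = carrier (proj_cover X)"
    using mod_homD(1)[OF cover_map_hom[OF X]] z by (auto simp: a_kernel_iff)
  have "{\<zero>\<^bsub>proj_cover X\<^esub>} <+>\<^bsub>proj_cover X\<^esub> a_kernel (proj_cover X) X (cover_map X) = carrier (proj_cover X)"
    unfolding ker by (auto simp: P.set_add_iff)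
  then show ?thesis using cover[OF X] P.submodule_zero unfolding projective_cover_def by metis
qed

text \<open>The cover splits, and the image of the section supplements the kernel. Minimality of the
  cover makes the section onto, so the kernel is zero.\<close>

lemma syzygy_projective_zero:
  assumes Q: "projective_module A Q"
  shows "carrier (syzygy A Q) = {\<zero>\<^bsub>syzygy A Q\<^esub>}"
proof -
  have fQ: "fg_module A Q" by (rule projective_fg[OF Q])
  note fP = proj_cover_fg[OF fQ] and pr = syzygy_pres[OF fQ]
  have LQ: "left_module A Q" and LP: "left_module A (proj_cover Q)" using fQ fP by (auto intro: fg_left_module)
  interpret P: left_module A "proj_cover Q" by (rule LP)
  interpret Q: left_module A Q by (rule LQ)
  obtain s where s: "s \<in> mod_hom A Q (proj_cover Q)" "\<And>x. x \<in> carrier Q \<Longrightarrow> cover_map Q (s x) = x"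
    by (rule projective_lift[OF Q fP fQ cover_map_epi[OF fQ] mod_hom_id], rule that)
  have im: "submodule (s ` carrier Q) A (proj_cover Q)"
    by (rule mod_hom_image_submodule[OF LQ LP s(1) Q.submodule_carrier])
  have "x \<in> s ` carrier Q <+>\<^bsub>proj_cover Q\<^esub> a_kernel (proj_cover Q) Q (cover_map Q)" if x: "x \<in> carrier (proj_cover Q)" for x
  proof -
    have px: "cover_map Q x \<in> carrier Q" by (rule mod_homD(1)[OF cover_map_hom[OF fQ] x])
    have sx: "s (cover_map Q x) \<in> carrier (proj_cover Q)" by (rule mod_homD(1)[OF s(1) px])
    have "cover_map Q (x \<ominus>\<^bsub>proj_cover Q\<^esub> s (cover_map Q x)) = \<zero>\<^bsub>Q\<^esub>"
      using mod_hom_diff[OF LP LQ cover_map_hom[OF fQ] x sx] s(2)[OF px] px by (simp add: Q.M.minus_eq Q.M.r_neg)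
    then have "x \<ominus>\<^bsub>proj_cover Q\<^esub> s (cover_map Q x) \<in> a_kernel (proj_cover Q) Q (cover_map Q)" using x sx by (simp add: a_kernel_iff P.M.minus_closed)
    moreover have "x = s (cover_map Q x) \<oplus>\<^bsub>proj_cover Q\<^esub> (x \<ominus>\<^bsub>proj_cover Q\<^esub> s (cover_map Q x))"
      using P.M.diff_add_cancel[OF x sx] x sx by (simp add: P.M.a_comm P.M.minus_closed)
    ultimately show ?thesis unfolding P.set_add_iff using px by blast
  qed
  moreover have "s ` carrier Q <+>\<^bsub>proj_cover Q\<^esub> a_kernel (proj_cover Q) Q (cover_map Q) \<subseteq> carrier (proj_cover Q)"
    by (rule P.set_add_least[OF P.submodule_carrier]) (use P.submoduleD(1)[OF im] in \<open>auto simp: a_kernel_iff\<close>)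
  ultimately have "s ` carrier Q <+>\<^bsub>proj_cover Q\<^esub> a_kernel (proj_cover Q) Q (cover_map Q) = carrier (proj_cover Q)" by blast
  then have sP: "s ` carrier Q = carrier (proj_cover Q)" using cover[OF fQ] im unfolding projective_cover_def by blast
  have "x = \<zero>\<^bsub>proj_cover Q\<^esub>" if x: "x \<in> carrier (syzygy A Q)" for x
  proof -
    have x': "x \<in> carrier (proj_cover Q)" "cover_map Q x = \<zero>\<^bsub>Q\<^esub>" using x presD(9)[OF pr] by auto
    then obtain y where y: "y \<in> carrier Q" "x = s y" using sP by blast
    then have "y = \<zero>\<^bsub>Q\<^esub>" using s(2) x'(2) by simp
    then show ?thesis using y(2) mod_hom_zero[OF LQ LP s(1)] by simp
  qed
  moreover interpret S: left_module A "syzygy A Q" by (rule fg_left_module[OF syzygy_fg[OF fQ]])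
  have "\<zero>\<^bsub>syzygy A Q\<^esub> = \<zero>\<^bsub>proj_cover Q\<^esub>" by (simp add: syzygy_eq)
  ultimately show ?thesis using S.M.zero_closed by auto
qed

text \<open>The covers of the successive syzygies form a resolution. All syzygies after a projective
  one vanish, and so do their covers.\<close>

lemma projective_dimension_le:
  assumes M: "fg_module A M" and p: "projective_module A (syz m M)"
  shows "projective_dimension A M \<le> enat m"
proof -
  define P where "P i = proj_cover (syz i M)" for i
  define d where "d i = cover_map (syz (Suc i) M)" for i
  note fs = syz_fg[OF M]
  have sc: "carrier (syz (Suc i) M) = a_kernel (P i) (syz i M) (cover_map (syz i M))" for i
    by (simp add: P_def syzygy_eq)
  have sz: "\<zero>\<^bsub>syz (Suc i) M\<^esub> = \<zero>\<^bsub>P i\<^esub>" for i by (simp add: P_def syzygy_eq)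
  have dim: "d i ` carrier (P (Suc i)) = carrier (syz (Suc i) M)" for i
    using cover_map_epi[OF fs[of "Suc i"]] unfolding mod_epi_def d_def P_def by blast
  have zero: "carrier (syz i M) = {\<zero>\<^bsub>syz i M\<^esub>}" if "m < i" for i
    using that
  proof (induction i)
    case (Suc i)
    have "projective_module A (syz i M)" by (rule projective_syz_mono[OF M p]) (use Suc.prems in simp)
    from syzygy_projective_zero[OF this] show ?case by simp
  qed simp
  have "projective_resolution A M P d (cover_map M)"
    unfolding projective_resolution_def
  proof (intro conjI allI)
    show "projective_module A (P i)" for i unfolding P_def by (rule proj_cover_projective[OF fs])
    show "cover_map M \<in> mod_epi A (P 0) M" unfolding P_def using cover_map_epi[OF M] by simp
    show "d i \<in> mod_hom A (P (Suc i)) (P i)" for i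
      unfolding d_def P_def
      by (rule pres_out[OF syzygy_pres[OF fs[of i]]]) (use cover_map_hom[OF fs[of "Suc i"]] in simp)
    show "d 0 ` carrier (P 1) = a_kernel (P 0) M (cover_map M)"
      using dim[of 0] sc[of 0] by simp
    show "d (Suc i) ` carrier (P (Suc (Suc i))) = a_kernel (P (Suc i)) (P i) (d i)" for i
      unfolding dim sc[of "Suc i"] by (auto simp: a_kernel_iff d_def sz simp del: funpow.simps)
  qed
  moreover have "\<forall>i>m. carrier (P i) = {\<zero>\<^bsub>P i\<^esub>}" unfolding P_def using proj_cover_zero[OF fs zero] by blast
  ultimately show ?thesis unfolding projective_dimension_def by (intro Inf_lower) blast
qed

text \<open>Along any resolution the kernels are stably the syzygies of \<open>M\<close>; beyond the
  end of a finite resolution they are zero, hence projective.\<close>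

lemma finite_projective_dimension:
  assumes M: "fg_module A M" and fin: "projective_dimension A M < \<infinity>"
  shows "\<exists>m. projective_module A (syz m M)"
proof -
  let ?S = "{enat n | n. \<exists>P d e. projective_resolution A M P d e \<and> (\<forall>i>n. carrier (P i) = {\<zero>\<^bsub>P i\<^esub>})}"
  \<comment> \<open>The infimum of the empty set is \<infinity>, which finiteness excludes.\<close>
  have "?S \<noteq> {}"
  proof
    assume "?S = {}"
    moreover have "projective_dimension A M = Inf ?S" by (simp only: projective_dimension_def)
    ultimately have "projective_dimension A M = Inf {}" by (simp only:)
    then show False using fin by (simp add: top_enat_def)
  qed
  then obtain n P d e where res: "projective_resolution A M P d e" and z: "\<And>i. i > n \<Longrightarrow> carrier (P i) = {\<zero>\<^bsub>P i\<^esub>}"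
    by blast
  have P: "projective_module A (P i)" and epi: "e \<in> mod_epi A (P 0) M"
    and d: "d i \<in> mod_hom A (P (Suc i)) (P i)" and d0: "d 0 ` carrier (P 1) = a_kernel (P 0) M e"
    and dS: "d (Suc i) ` carrier (P (Suc (Suc i))) = a_kernel (P (Suc i)) (P i) (d i)" for i
    using res unfolding projective_resolution_def by auto
  \<comment> \<open>The kernel at place \<open>i\<close> is a syzygy of order \<open>Suc i\<close>,
    because the augmentation already accounts for one.\<close>
  define K where "K i = (case i of 0 \<Rightarrow> (P 0)\<lparr>carrier := a_kernel (P 0) M e\<rparr>
    | Suc j \<Rightarrow> (P i)\<lparr>carrier := a_kernel (P i) (P j) (d j)\<rparr>)" for i
  have K0: "pres (K 0) M (P 0) e" using P[of 0] epi M by (simp add: pres_def K_def)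
  have Kz: "\<zero>\<^bsub>K i\<^esub> = \<zero>\<^bsub>P i\<^esub>" for i by (cases i) (auto simp: K_def)
  have dK: "d i ` carrier (P (Suc i)) = carrier (K i)" for i
    by (cases i) (use d0 dS in \<open>auto simp: K_def\<close>)
  have KP: "K i = (P i)\<lparr>carrier := carrier (K i)\<rparr>" for i by (cases i) (auto simp: K_def)
  have ks: "a_kernel (P (Suc i)) (K i) (d i) = a_kernel (P (Suc i)) (P i) (d i)" for i
    by (auto simp: a_kernel_iff Kz)
  have KS: "pres (K (Suc i)) (K i) (P (Suc i)) (d i)" if "fg_module A (K i)" for i
  proof -
    have "d i \<in> mod_hom A (P (Suc i)) (K i)"
      by (subst KP) (rule mod_hom_into_sub[OF d], use dK[of i] in blast)
    then have "d i \<in> mod_epi A (P (Suc i)) (K i)" using dK by (simp add: mod_epi_def)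
    then show ?thesis unfolding pres_def ks using P[of "Suc i"] that by (simp add: K_def)
  qed
  have main: "fg_module A (K i) \<and> (\<exists>\<gamma>. stable_iso (K i) (syz (Suc i) M) \<gamma>)" for i
  proof (induction i)
    case 0
    obtain \<gamma> where "stable_iso (K 0) (syzygy A M) \<gamma>" by (rule pres_stable_iso[OF K0 syzygy_pres[OF M]])
    then show ?case using presD(8)[OF K0] by auto
  next
    case (Suc i)
    then obtain \<gamma> where g: "stable_iso (K i) (syz (Suc i) M) \<gamma>" and fg: "fg_module A (K i)" by blast
    note pr = KS[OF fg] and pr' = syzygy_pres[OF syz_fg[OF M, of "Suc i"]]
    obtain F where F: "is_lift (P (Suc i)) (d i) (proj_cover (syz (Suc i) M)) (cover_map (syz (Suc i) M)) \<gamma> F"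
      using lift_ex[OF pr pr' stable_iso_hom[OF g]] by blast
    have "stable_iso (K (Suc i)) (syzygy A (syz (Suc i) M)) F" by (rule lift_stable_iso[OF pr pr' g F])
    then show ?case using presD(8)[OF pr] by auto
  qed
  obtain \<gamma> where fK: "fg_module A (K (Suc n))" and g: "stable_iso (K (Suc n)) (syz (Suc (Suc n)) M) \<gamma>"
    using main[of "Suc n"] by blast
  have "carrier (K (Suc n)) \<subseteq> {\<zero>\<^bsub>K (Suc n)\<^esub>}"
    using z[of "Suc n"] Kz[of "Suc n"] by (auto simp: K_def a_kernel_iff)
  then have zero: "x = \<zero>\<^bsub>K (Suc n)\<^esub>" if "x \<in> carrier (K (Suc n))" for x using that by (rule subsetD[THEN singletonD])
  have "null (K (Suc n)) (K (Suc n)) (\<lambda>x. x)"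
    by (rule null_cong[OF fK null_zero[OF fK] zero])
  then have "projective_module A (K (Suc n))" by (simp add: null_id_iff_projective[OF fK])
  then show ?thesis using projective_stable_iso[OF fK syz_fg[OF M] g] by blast
qed

end

section \<open>Quotient modules and modules over quotient rings\<close>

lemma epi_fg:
  assumes M: "fg_module A M" and Q: "left_module A Q" and q: "q \<in> mod_epi A M Q"
  shows "fg_module A Q"
proof -
  have LM: "left_module A M" by (rule fg_left_module[OF M])
  interpret M: left_module A M by (rule LM)
  interpret Q: left_module A Q by (rule Q)
  have qh: "q \<in> mod_hom A M Q" and qs: "q ` carrier M = carrier Q" using q by (auto simp: mod_epi_def)
  obtain S where S: "finite S" "S \<subseteq> carrier M" "\<And>H. submodule H A M \<Longrightarrow> S \<subseteq> H \<Longrightarrow> H = carrier M"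
    by (rule finitely_generatedE[of A M]) (use M in \<open>auto simp: fg_module_def\<close>)
  have "H = carrier Q" if H: "submodule H A Q" "q ` S \<subseteq> H" for H
  proof -
    have "{x \<in> carrier M. q x \<in> H} = carrier M"
      by (rule S(3)[OF mod_hom_vimage_submodule[OF LM Q qh H(1)]]) (use H(2) S(2) in auto)
    then have "q ` carrier M \<subseteq> H" by blast
    then show ?thesis using qs Q.submoduleD(1)[OF H(1)] by blast
  qed
  moreover have "q ` S \<subseteq> carrier Q" using S(2) mod_homD(1)[OF qh] by blast
  ultimately have "finitely_generated A Q"
    unfolding finitely_generated_def using S(1) by (intro exI[of _ "q ` S"]) auto
  then show ?thesis using Q by (simp add: fg_module_def)
qed

text \<open>A system of representatives realises the quotient on the carrier type of \<open>M\<close>.\<close>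

lemma quotient_ex:
  fixes M :: "('a, 'x) module"
  assumes M: "fg_module A M" and U: "submodule U A M"
  obtains Q :: "('a, 'x) module" and q where "fg_module A Q" "q \<in> mod_epi A M Q" "a_kernel M Q q = U"
proof -
  have LM: "left_module A M" by (rule fg_left_module[OF M])
  interpret M: left_module A M by (rule LM)
  note Uc = M.submoduleD(1)[OF U] and Udiff = M.submodule_diff[OF U]
  define rep where "rep x = (SOME y. y \<in> carrier M \<and> y \<ominus>\<^bsub>M\<^esub> x \<in> U)" for x
  have rep: "rep x \<in> carrier M" "rep x \<ominus>\<^bsub>M\<^esub> x \<in> U" if "x \<in> carrier M" for x
  proof -
    have "x \<ominus>\<^bsub>M\<^esub> x \<in> U" using that M.submoduleD(2)[OF U] by (simp add: M.M.minus_eq M.M.r_neg)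
    then have "\<exists>y. y \<in> carrier M \<and> y \<ominus>\<^bsub>M\<^esub> x \<in> U" using that by blast
    from someI_ex[OF this] show "rep x \<in> carrier M" "rep x \<ominus>\<^bsub>M\<^esub> x \<in> U" by (auto simp: rep_def)
  qed
  have tr: "x \<ominus>\<^bsub>M\<^esub> z \<in> U" if "x \<ominus>\<^bsub>M\<^esub> y \<in> U" "y \<ominus>\<^bsub>M\<^esub> z \<in> U" "x \<in> carrier M" "y \<in> carrier M" "z \<in> carrier M" for x y z
  proof -
    have "(x \<ominus>\<^bsub>M\<^esub> y) \<oplus>\<^bsub>M\<^esub> (y \<ominus>\<^bsub>M\<^esub> z) = ((x \<ominus>\<^bsub>M\<^esub> y) \<oplus>\<^bsub>M\<^esub> y) \<ominus>\<^bsub>M\<^esub> z"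
      using that by (simp add: M.M.minus_eq M.M.a_assoc)
    then show ?thesis using M.submoduleD(3)[OF U that(1,2)] that by (simp add: M.M.diff_add_cancel)
  qed
  have sy: "y \<ominus>\<^bsub>M\<^esub> x \<in> U" if "x \<ominus>\<^bsub>M\<^esub> y \<in> U" "x \<in> carrier M" "y \<in> carrier M" for x y
    using M.submodule_minus[OF U that(1)] that(2,3) by (simp add: M.M.minus_eq M.M.minus_add M.M.a_comm)
  \<comment> \<open>Congruent elements satisfy the same predicate under \<open>SOME\<close>, so
    their representatives are literally equal.\<close>
  have eqI: "rep x = rep y" if "x \<ominus>\<^bsub>M\<^esub> y \<in> U" "x \<in> carrier M" "y \<in> carrier M" for x y
  proof -
    have "(z \<in> carrier M \<and> z \<ominus>\<^bsub>M\<^esub> x \<in> U) = (z \<in> carrier M \<and> z \<ominus>\<^bsub>M\<^esub> y \<in> U)" for z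
      using tr[of z x y] tr[of z y x] sy[OF that] that by blast
    then show ?thesis unfolding rep_def by simp
  qed
  define Q where "Q = \<lparr>carrier = rep ` carrier M, mult = (\<lambda>x y. x), one = rep \<zero>\<^bsub>M\<^esub>, zero = rep \<zero>\<^bsub>M\<^esub>,
    add = (\<lambda>x y. rep (x \<oplus>\<^bsub>M\<^esub> y)), smult = (\<lambda>a x. rep (a \<odot>\<^bsub>M\<^esub> x))\<rparr>"
  have radd: "rep (rep x \<oplus>\<^bsub>M\<^esub> rep y) = rep (x \<oplus>\<^bsub>M\<^esub> y)" if xy: "x \<in> carrier M" "y \<in> carrier M" for x y
  proof (rule eqI)
    have "(rep x \<oplus>\<^bsub>M\<^esub> rep y) \<ominus>\<^bsub>M\<^esub> (x \<oplus>\<^bsub>M\<^esub> y) = (rep x \<ominus>\<^bsub>M\<^esub> x) \<oplus>\<^bsub>M\<^esub> (rep y \<ominus>\<^bsub>M\<^esub> y)"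
      using xy rep by (simp add: M.M.minus_eq M.M.minus_add M.M.a_ac)
    then show "(rep x \<oplus>\<^bsub>M\<^esub> rep y) \<ominus>\<^bsub>M\<^esub> (x \<oplus>\<^bsub>M\<^esub> y) \<in> U" using rep xy M.submoduleD(3)[OF U] by simp
  qed (use xy rep in auto)
  have rsm: "rep (a \<odot>\<^bsub>M\<^esub> rep x) = rep (a \<odot>\<^bsub>M\<^esub> x)" if ax: "a \<in> carrier A" "x \<in> carrier M" for a x
  proof (rule eqI)
    have "a \<odot>\<^bsub>M\<^esub> rep x \<ominus>\<^bsub>M\<^esub> a \<odot>\<^bsub>M\<^esub> x = a \<odot>\<^bsub>M\<^esub> (rep x \<ominus>\<^bsub>M\<^esub> x)"
      using ax rep by (simp add: M.M.minus_eq M.smult_r_distr M.smult_r_minus)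
    then show "a \<odot>\<^bsub>M\<^esub> rep x \<ominus>\<^bsub>M\<^esub> a \<odot>\<^bsub>M\<^esub> x \<in> U" using rep ax M.submoduleD(4)[OF U] by simp
  qed (use ax rep in auto)
  have Q: "carrier Q = rep ` carrier M" "\<zero>\<^bsub>Q\<^esub> = rep \<zero>\<^bsub>M\<^esub>"
    "x \<oplus>\<^bsub>Q\<^esub> y = rep (x \<oplus>\<^bsub>M\<^esub> y)" "a \<odot>\<^bsub>Q\<^esub> x = rep (a \<odot>\<^bsub>M\<^esub> x)" for x y a
    by (simp_all add: Q_def)
  have Qadd: "rep x \<oplus>\<^bsub>Q\<^esub> rep y = rep (x \<oplus>\<^bsub>M\<^esub> y)" if "x \<in> carrier M" "y \<in> carrier M" for x y
    using radd that by (simp add: Q)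
  have Qsm: "a \<odot>\<^bsub>Q\<^esub> rep x = rep (a \<odot>\<^bsub>M\<^esub> x)" if "a \<in> carrier A" "x \<in> carrier M" for x a
    using rsm that by (simp add: Q)
  have grp: "abelian_group Q"
  proof (rule abelian_groupI)
    fix x y assume "x \<in> carrier Q" "y \<in> carrier Q"
    then obtain x' y' where xy: "x' \<in> carrier M" "y' \<in> carrier M" "x = rep x'" "y = rep y'" unfolding Q by blast
    show "x \<oplus>\<^bsub>Q\<^esub> y \<in> carrier Q" using xy Qadd Q(1) by auto
    show "x \<oplus>\<^bsub>Q\<^esub> y = y \<oplus>\<^bsub>Q\<^esub> x" using xy Qadd M.M.a_comm by simp
  next
    fix x y w assume "x \<in> carrier Q" "y \<in> carrier Q" "w \<in> carrier Q"
    then obtain x' y' w' where xy: "x' \<in> carrier M" "y' \<in> carrier M" "w' \<in> carrier M" "x = rep x'" "y = rep y'" "w = rep w'"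
      unfolding Q by blast
    then show "x \<oplus>\<^bsub>Q\<^esub> y \<oplus>\<^bsub>Q\<^esub> w = x \<oplus>\<^bsub>Q\<^esub> (y \<oplus>\<^bsub>Q\<^esub> w)" using Qadd M.M.a_assoc by simp
  next
    show "\<zero>\<^bsub>Q\<^esub> \<in> carrier Q" unfolding Q(1,2) by (rule imageI) simp
  next
    fix x assume "x \<in> carrier Q"
    then obtain x' where x: "x' \<in> carrier M" "x = rep x'" unfolding Q by blast
    show "\<zero>\<^bsub>Q\<^esub> \<oplus>\<^bsub>Q\<^esub> x = x" using x Qadd[of "\<zero>\<^bsub>M\<^esub>" x'] by (simp add: Q(2))
    have "rep (\<ominus>\<^bsub>M\<^esub> x') \<oplus>\<^bsub>Q\<^esub> x = \<zero>\<^bsub>Q\<^esub>" using x Qadd[of "\<ominus>\<^bsub>M\<^esub> x'" x'] by (simp add: Q(2) M.M.l_neg)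
    moreover have "rep (\<ominus>\<^bsub>M\<^esub> x') \<in> carrier Q" unfolding Q(1) by (rule imageI) (use x in simp)
    ultimately show "\<exists>y\<in>carrier Q. y \<oplus>\<^bsub>Q\<^esub> x = \<zero>\<^bsub>Q\<^esub>" by blast
  qed
  have LQ: "left_module A Q"
  proof (intro left_module.intro left_module_axioms.intro grp M.A.ring_axioms)
    fix a x assume a: "a \<in> carrier A" and "x \<in> carrier Q"
    then obtain x' where x: "x' \<in> carrier M" "x = rep x'" unfolding Q by blast
    show "a \<odot>\<^bsub>Q\<^esub> x \<in> carrier Q" unfolding x(2) Qsm[OF a x(1)] Q(1) by (rule imageI) (use a x in simp)
  next
    fix a b x assume ab: "a \<in> carrier A" "b \<in> carrier A" and "x \<in> carrier Q"
    then obtain x' where x: "x' \<in> carrier M" "x = rep x'" unfolding Q by blast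
    show "(a \<oplus>\<^bsub>A\<^esub> b) \<odot>\<^bsub>Q\<^esub> x = a \<odot>\<^bsub>Q\<^esub> x \<oplus>\<^bsub>Q\<^esub> b \<odot>\<^bsub>Q\<^esub> x"
      using ab x by (simp add: Qsm Qadd M.smult_l_distr)
    show "(a \<otimes>\<^bsub>A\<^esub> b) \<odot>\<^bsub>Q\<^esub> x = a \<odot>\<^bsub>Q\<^esub> (b \<odot>\<^bsub>Q\<^esub> x)"
      using ab x by (simp add: Qsm M.smult_assoc1)
  next
    fix a x y assume a: "a \<in> carrier A" and "x \<in> carrier Q" "y \<in> carrier Q"
    then obtain x' y' where xy: "x' \<in> carrier M" "y' \<in> carrier M" "x = rep x'" "y = rep y'" unfolding Q by blast
    show "a \<odot>\<^bsub>Q\<^esub> (x \<oplus>\<^bsub>Q\<^esub> y) = a \<odot>\<^bsub>Q\<^esub> x \<oplus>\<^bsub>Q\<^esub> a \<odot>\<^bsub>Q\<^esub> y"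
      using a xy by (simp add: Qsm Qadd M.smult_r_distr)
  next
    fix x assume "x \<in> carrier Q"
    then obtain x' where x: "x' \<in> carrier M" "x = rep x'" unfolding Q by blast
    then show "\<one>\<^bsub>A\<^esub> \<odot>\<^bsub>Q\<^esub> x = x" by (simp add: Qsm)
  qed
  have epi: "rep \<in> mod_epi A M Q"
    unfolding mod_epi_def mem_Collect_eq
  proof (intro conjI mod_homI)
    show "rep ` carrier M = carrier Q" by (simp only: Q)
    fix x assume "x \<in> carrier M" then show "rep x \<in> carrier Q" by (simp add: Q)
  qed (simp_all add: Qadd Qsm)
  have "a_kernel M Q rep = U"
  proof (rule subset_antisym; rule subsetI)
    fix x assume "x \<in> a_kernel M Q rep"
    then have x: "x \<in> carrier M" "rep x = rep \<zero>\<^bsub>M\<^esub>" by (simp_all add: a_kernel_iff Q)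
    have "rep \<zero>\<^bsub>M\<^esub> \<in> U" using rep[of "\<zero>\<^bsub>M\<^esub>"] by (simp add: M.M.diff_zero)
    moreover have "x \<ominus>\<^bsub>M\<^esub> rep x \<in> U" by (rule sy[OF rep(2)[OF x(1)] rep(1)[OF x(1)] x(1)])
    ultimately have "(x \<ominus>\<^bsub>M\<^esub> rep x) \<oplus>\<^bsub>M\<^esub> rep x \<in> U" using M.submoduleD(3)[OF U] x(2) by simp
    then show "x \<in> U" using x(1) rep(1)[OF x(1)] by (simp add: M.M.diff_add_cancel)
  next
    fix x assume x: "x \<in> U"
    then have "rep x = rep \<zero>\<^bsub>M\<^esub>" using Uc[OF x] by (intro eqI) (simp_all add: M.M.diff_zero)
    then show "x \<in> a_kernel M Q rep" using Uc[OF x] by (simp add: a_kernel_iff Q)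
  qed
  then show thesis using epi_fg[OF M LQ epi] epi by (intro that[of Q rep])
qed

text \<open>A coset acts through a chosen representative; any two differ by an element of
  \<open>I\<close>, which acts as zero.\<close>

lemma module_over_quotient:
  fixes M :: "('a, 'x) module"
  assumes M: "fg_module A M" and I: "ideal I A"
    and ann: "\<And>i x. i \<in> I \<Longrightarrow> x \<in> carrier M \<Longrightarrow> i \<odot>\<^bsub>M\<^esub> x = \<zero>\<^bsub>M\<^esub>"
  obtains X :: "('a set, 'x) module" where "fg_module (A Quot I) X"
    "(\<lambda>x. x) \<in> mod_iso A M (restrict_scalars (\<lambda>a. I +>\<^bsub>A\<^esub> a) X)"
proof -
  have LM: "left_module A M" by (rule fg_left_module[OF M])
  interpret M: left_module A M by (rule LM)
  interpret I: ideal I A by (rule I)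
  let ?f = "\<lambda>a. I +>\<^bsub>A\<^esub> a"
  have f: "?f \<in> ring_hom A (A Quot I)" by (rule I.rcos_ring_hom)
  have surj: "carrier (A Quot I) = ?f ` carrier A"
    by (auto simp: FactRing_def A_RCOSETS_def RCOSETS_def a_r_coset_def)
  define X where "X = \<lparr>carrier = carrier M, mult = mult M, one = one M, zero = zero M, add = add M,
    smult = (\<lambda>c x. (SOME a. a \<in> carrier A \<and> c = ?f a) \<odot>\<^bsub>M\<^esub> x)\<rparr>"
  have X: "carrier X = carrier M" "zero X = zero M" "add X = add M" by (simp_all add: X_def)
  have sm: "?f a \<odot>\<^bsub>X\<^esub> x = a \<odot>\<^bsub>M\<^esub> x" if a: "a \<in> carrier A" and x: "x \<in> carrier M" for a x
  proof -
    define b where "b = (SOME b. b \<in> carrier A \<and> ?f a = ?f b)"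
    have b: "b \<in> carrier A" "?f a = ?f b"
      using someI_ex[of "\<lambda>b. b \<in> carrier A \<and> ?f a = ?f b"] a unfolding b_def by blast+
    have "b \<in> ?f b" by (rule I.a_rcos_self[OF b(1)])
    then have "b \<in> ?f a" using b(2) by simp
    then obtain i where i: "i \<in> I" "b = i \<oplus>\<^bsub>A\<^esub> a" unfolding a_r_coset_def' by blast
    have "b \<odot>\<^bsub>M\<^esub> x = i \<odot>\<^bsub>M\<^esub> x \<oplus>\<^bsub>M\<^esub> a \<odot>\<^bsub>M\<^esub> x"
      unfolding i(2) using i(1) a x I.Icarr by (simp add: M.smult_l_distr)
    then have "b \<odot>\<^bsub>M\<^esub> x = a \<odot>\<^bsub>M\<^esub> x" using ann[OF i(1) x] a x by simp
    then show ?thesis by (simp add: X_def b_def)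
  qed
  have grp: "abelian_group X"
  proof (rule abelian_groupI)
    fix x assume "x \<in> carrier X"
    then show "\<exists>y\<in>carrier X. y \<oplus>\<^bsub>X\<^esub> x = \<zero>\<^bsub>X\<^esub>"
      unfolding X by (intro bexI[of _ "\<ominus>\<^bsub>M\<^esub> x"]) (simp_all add: M.M.l_neg)
  qed (simp_all add: X M.M.a_ac)
  have LX: "left_module (A Quot I) X"
  proof (intro left_module.intro left_module_axioms.intro grp I.quotient_is_ring)
    fix c x assume "c \<in> carrier (A Quot I)" "x \<in> carrier X"
    then obtain a where "a \<in> carrier A" "c = ?f a" "x \<in> carrier M" unfolding surj X by blast
    then show "c \<odot>\<^bsub>X\<^esub> x \<in> carrier X" by (simp add: sm X)
  next
    fix c d x assume "c \<in> carrier (A Quot I)" "d \<in> carrier (A Quot I)" "x \<in> carrier X"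
    then obtain a b where ab: "a \<in> carrier A" "b \<in> carrier A" "c = ?f a" "d = ?f b" "x \<in> carrier M"
      unfolding surj X by blast
    have "c \<oplus>\<^bsub>A Quot I\<^esub> d = ?f (a \<oplus>\<^bsub>A\<^esub> b)" "c \<otimes>\<^bsub>A Quot I\<^esub> d = ?f (a \<otimes>\<^bsub>A\<^esub> b)"
      using ring_hom_add[OF f] ring_hom_mult[OF f] ab by simp_all
    then show "(c \<oplus>\<^bsub>A Quot I\<^esub> d) \<odot>\<^bsub>X\<^esub> x = c \<odot>\<^bsub>X\<^esub> x \<oplus>\<^bsub>X\<^esub> d \<odot>\<^bsub>X\<^esub> x"
      "(c \<otimes>\<^bsub>A Quot I\<^esub> d) \<odot>\<^bsub>X\<^esub> x = c \<odot>\<^bsub>X\<^esub> (d \<odot>\<^bsub>X\<^esub> x)"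
      using ab by (simp_all add: sm X M.smult_l_distr M.smult_assoc1)
  next
    fix c x y assume "c \<in> carrier (A Quot I)" "x \<in> carrier X" "y \<in> carrier X"
    then obtain a where "a \<in> carrier A" "c = ?f a" "x \<in> carrier M" "y \<in> carrier M" unfolding surj X by blast
    then show "c \<odot>\<^bsub>X\<^esub> (x \<oplus>\<^bsub>X\<^esub> y) = c \<odot>\<^bsub>X\<^esub> x \<oplus>\<^bsub>X\<^esub> c \<odot>\<^bsub>X\<^esub> y" by (simp add: sm X M.smult_r_distr)
  next
    fix x assume "x \<in> carrier X"
    then show "\<one>\<^bsub>A Quot I\<^esub> \<odot>\<^bsub>X\<^esub> x = x" using sm[of "\<one>\<^bsub>A\<^esub>" x] ring_hom_one[OF f] by (simp add: X)
  qed
  interpret X: left_module "A Quot I" X by (rule LX)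
  obtain S where S: "finite S" "S \<subseteq> carrier M" "\<And>H. submodule H A M \<Longrightarrow> S \<subseteq> H \<Longrightarrow> H = carrier M"
    by (rule finitely_generatedE[of A M]) (use M in \<open>auto simp: fg_module_def\<close>)
  have "H = carrier X" if H: "submodule H (A Quot I) X" "S \<subseteq> H" for H
  proof -
    have "submodule H A M"
    proof (rule M.left_submoduleI)
      show "H \<subseteq> carrier M" using X.submoduleD(1)[OF H(1)] by (auto simp: X)
      show "H \<noteq> {}" using X.submoduleD(2)[OF H(1)] by blast
      show "x \<oplus>\<^bsub>M\<^esub> y \<in> H" if "x \<in> H" "y \<in> H" for x y using X.submoduleD(3)[OF H(1) that] by (simp add: X)
      show "a \<odot>\<^bsub>M\<^esub> x \<in> H" if "a \<in> carrier A" "x \<in> H" for a x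
        using X.submoduleD(4)[OF H(1), of "?f a" x] X.submoduleD(1)[OF H(1) that(2)] that sm by (simp add: surj X)
    qed
    then show ?thesis using S(3) H(2) by (simp add: X)
  qed
  then have "finitely_generated (A Quot I) X"
    unfolding finitely_generated_def using S(1,2) by (intro exI[of _ S]) (auto simp: X)
  then have "fg_module (A Quot I) X" using LX by (simp add: fg_module_def)
  moreover have "(\<lambda>x. x) \<in> mod_iso A M (restrict_scalars ?f X)"
    unfolding mod_iso_def mem_Collect_eq
    by (intro conjI mod_homI) (simp_all add: X sm bij_betw_def)
  ultimately show thesis by (rule that)
qed

section \<open>Syzygy-finiteness expressed by maps through modules\<close>

context artin_algebra
begin

text \<open>The identity of a summand of a power passes through the power by inclusion and
  projection.\<close>

lemma add_closure_thru:
  assumes N: "fg_module A N" and Y: "Y \<in> add_closure A N"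
  shows "thru {N} Y Y (\<lambda>x. x)"
proof -
  obtain m U \<phi> where fY: "fg_module A Y" and U: "direct_summand A U (mod_power N m)"
    and \<phi>: "\<phi> \<in> mod_iso A Y ((mod_power N m)\<lparr>carrier := U\<rparr>)"
    using Y unfolding add_closure_def by blast
  let ?P = "mod_power N m" and ?U = "(mod_power N m)\<lparr>carrier := U\<rparr>"
  have LY: "left_module A Y" by (rule fg_left_module[OF fY])
  have LP: "left_module A ?P" by (rule mod_power_left_module[OF fg_left_module[OF N]])
  obtain V where d: "direct_decomposition A ?P U V"
    using U unfolding direct_summand_def direct_decomposition_def by blast
  have sub: "submodule U A ?P" using d by (simp add: direct_decomposition_def)
  obtain p q where pq: "p \<in> mod_hom A ?P (?P\<lparr>carrier := U\<rparr>)" "q \<in> mod_hom A ?P (?P\<lparr>carrier := V\<rparr>)"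
    "\<And>x. x \<in> carrier ?P \<Longrightarrow> x = p x \<oplus>\<^bsub>?P\<^esub> q x" "\<And>u. u \<in> U \<Longrightarrow> p u = u" "\<And>v. v \<in> V \<Longrightarrow> q v = v"
    "\<And>v. v \<in> V \<Longrightarrow> p v = \<zero>\<^bsub>?P\<^esub>" "\<And>u. u \<in> U \<Longrightarrow> q u = \<zero>\<^bsub>?P\<^esub>"
    by (rule direct_decomposition_maps[OF LP d], rule that)
  have fh: "\<phi> \<in> mod_hom A Y ?U" and b: "bij_betw \<phi> (carrier Y) (carrier ?U)" using \<phi> by (auto simp: mod_iso_def)
  have fP: "\<phi> \<in> mod_hom A Y ?P" by (rule mod_hom_out_of_sub[OF LP sub fh])
  have "thru {N} Y Y (\<lambda>x. inv_into (carrier Y) \<phi> (p (\<phi> x)))"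
    by (rule thru_power[OF fY fY N fP mod_hom_comp[OF pq(1) mod_hom_inv[OF LY fh b]]])
  then show ?thesis
  proof (rule thru_cong, intro ballI)
    fix x assume x: "x \<in> carrier Y"
    have "\<phi> x \<in> U" using mod_homD(1)[OF fh x] by simp
    then show "x = inv_into (carrier Y) \<phi> (p (\<phi> x))" using pq(4) bij_betw_inv_into_left[OF b x] by simp
  qed
qed

text \<open>Conjugation by \<open>f\<close> returns the identity of \<open>Y\<close> up to a null
  map, which \<open>free_one A\<close> absorbs.\<close>

lemma thru_stable_iso:
  assumes X: "fg_module A X" and Y: "fg_module A Y" and f: "stable_iso X Y f"
    and t: "thru Ns X X (\<lambda>x. x)" and free: "free_one A \<in> Ns"
  shows "thru Ns Y Y (\<lambda>x. x)"
proof -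
  obtain g where g: "f \<in> mod_hom A X Y" "g \<in> mod_hom A Y X" "stable_eq Y Y (\<lambda>x. f (g x)) (\<lambda>x. x)"
    using f by (rule sisoE)
  show ?thesis by (rule thru_stable_eq[OF Y Y thru_post[OF Y X Y thru_pre[OF t g(2)] g(1)] g(3) free])
qed

lemma thru_syz:
  assumes X: "fg_module A X" and Ns: "\<And>N. N \<in> Ns \<Longrightarrow> fg_module A N" and t: "thru Ns X X (\<lambda>x. x)"
  shows "thru (insert (free_one A) (syz k ` Ns)) (syz k X) (syz k X) (\<lambda>x. x)"
  by (rule thru_stable_eq[OF syz_fg[OF X] syz_fg[OF X] thru_syz_map[OF X X Ns t] syz_map_id[OF X]]) simp_all

text \<open>A module killed by \<open>I\<close> is isomorphic to the restriction of a module over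
  the quotient. The chosen syzygies of the two are only stably isomorphic, which brings in the free
  module.\<close>

lemma syzygy_finite_quotient:
  assumes I: "ideal I A" and sf: "syzygy_finite A (A Quot I) (\<lambda>a. I +>\<^bsub>A\<^esub> a)"
  shows "\<exists>n N. fg_module A N \<and> (\<forall>X. fg_module A X \<and> (\<forall>i\<in>I. \<forall>x\<in>carrier X. i \<odot>\<^bsub>X\<^esub> x = \<zero>\<^bsub>X\<^esub>) \<longrightarrow>
    thru {free_one A, N} (syz n X) (syz n X) (\<lambda>x. x))"
proof -
  obtain n and N :: "('a, 'a fgcar) module" where N: "fg_module A N"
    and sy: "\<And>X :: ('a set, 'a fgcar) module. fg_module (A Quot I) X \<Longrightarrow>
      syz n (restrict_scalars (\<lambda>a. I +>\<^bsub>A\<^esub> a) X) \<in> add_closure A N"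
    using sf unfolding syzygy_finite_def by blast
  interpret I: ideal I A by (rule I)
  show ?thesis
  proof (intro exI[of _ n] exI[of _ N] conjI N allI impI, elim conjE)
    fix X :: "('a, 'a fgcar) module"
    assume X: "fg_module A X" and ann': "\<forall>i\<in>I. \<forall>x\<in>carrier X. i \<odot>\<^bsub>X\<^esub> x = \<zero>\<^bsub>X\<^esub>"
    have ann: "i \<odot>\<^bsub>X\<^esub> x = \<zero>\<^bsub>X\<^esub>" if "i \<in> I" "x \<in> carrier X" for i x using ann' that by blast
    obtain X' :: "('a set, 'a fgcar) module" where X': "fg_module (A Quot I) X'"
      "(\<lambda>x. x) \<in> mod_iso A X (restrict_scalars (\<lambda>a. I +>\<^bsub>A\<^esub> a) X')"
      by (rule module_over_quotient[OF X I ann])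
    let ?X = "restrict_scalars (\<lambda>a. I +>\<^bsub>A\<^esub> a) X'"
    have LX: "left_module A ?X"
      by (rule restrict_scalars_left_module[OF ring_A I.rcos_ring_hom fg_left_module[OF X'(1)]])
    have "(\<lambda>x. x) \<in> mod_epi A X ?X" using X'(2) by (auto simp: mod_iso_def mod_epi_def bij_betw_def)
    then have fX: "fg_module A ?X" by (rule epi_fg[OF X LX])
    obtain g where g: "stable_iso ?X X g" using iso_stable_iso[OF X fX X'(2)] by (rule sisoE)
    have "thru {free_one A, N} (syz n ?X) (syz n ?X) (\<lambda>x. x)"
      by (rule thru_mono[OF add_closure_thru[OF N sy[OF X'(1)]]]) simp
    then show "thru {free_one A, N} (syz n X) (syz n X) (\<lambda>x. x)"
      by (rule thru_stable_iso[OF syz_fg[OF fX] syz_fg[OF X] syz_map_stable_iso[OF fX X g]]) simp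
  qed
qed

section \<open>First syzygies and the radical\<close>

text \<open>Suppose \<open>a w = r\<close> avoided a maximal left ideal \<open>L\<close>. Then L +
  Ar = A, so the preimage of \<open>L\<close> together with the multiples of \<open>w\<close> fills
  the cover. As \<open>w\<close> lies in the kernel of the cover, minimality makes the preimage
  everything, and \<open>r\<close> lies in \<open>L\<close> after all.\<close>

lemma superfluous_radical:
  assumes M: "fg_module A M" and w: "w \<in> carrier (syzygy A M)" and a: "a \<in> mod_hom A (proj_cover M) (free_one A)"
  shows "\<exists>r\<in>jacobson_radical A. a w = {\<lambda>_. r}"
proof -
  let ?P = "proj_cover M" and ?F = "free_one A" and ?g = "\<lambda>b. {\<lambda>_. b} :: 'a fgcar"
  have LP: "left_module A ?P" by (rule fg_left_module[OF proj_cover_fg[OF M]])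
  have LF: "left_module A ?F" by (rule fg_left_module[OF free_one_fg])
  have LR: "left_module A (regular_module A)" by (rule regular_left_module[OF ring_A])
  interpret P: left_module A ?P by (rule LP)
  interpret F: left_module A ?F by (rule LF)
  interpret Rg: left_module A "regular_module A" by (rule LR)
  have g: "?g \<in> mod_hom A (regular_module A) ?F" using free_one_iso by (simp add: mod_iso_def)
  have wP: "w \<in> carrier ?P" and wker: "w \<in> a_kernel ?P M (cover_map M)"
    using w by (auto simp: syzygy_eq a_kernel_iff)
  have "a w \<in> carrier ?F" by (rule mod_homD(1)[OF a wP])
  then obtain r where r: "r \<in> carrier A" "a w = ?g r" by auto
  have "r \<in> L" if L: "maximal_left_ideal L A" for L
  proof (rule ccontr)
    assume rL: "r \<notin> L"
    have Ls: "submodule L A (regular_module A)" using L by (simp add: maximal_left_ideal_def left_ideal_def)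
    have gL: "submodule (?g ` L) A ?F" by (rule mod_hom_image_submodule[OF LR LF g Ls])
    define V where "V = {x \<in> carrier ?P. a x \<in> ?g ` L}"
    have V: "submodule V A ?P" unfolding V_def by (rule mod_hom_vimage_submodule[OF LP LF a gL])
    let ?S = "(\<lambda>c. c \<otimes>\<^bsub>A\<^esub> r) ` carrier A"
    have "(\<lambda>c. c \<odot>\<^bsub>regular_module A\<^esub> r) \<in> mod_hom A (regular_module A) (regular_module A)"
      by (rule regular_mod_hom[OF LR]) (use r in simp)
    from mod_hom_image_submodule[OF LR LR this Rg.submodule_carrier]
    have S: "submodule ?S A (regular_module A)" by simp
    let ?T = "L <+>\<^bsub>regular_module A\<^esub> ?S"
    have T: "submodule ?T A (regular_module A)" by (rule Rg.submodule_set_add[OF Ls S])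
    have "r \<in> ?S" using r(1) by (intro image_eqI[of _ _ "\<one>\<^bsub>A\<^esub>"]) auto
    then have "r \<in> ?T" using Rg.set_add_upper2[OF Ls S] by blast
    moreover have LT: "L \<subseteq> ?T" by (rule Rg.set_add_upper1[OF Ls S])
    ultimately have TA: "?T = carrier A"
      using L T rL unfolding maximal_left_ideal_def left_ideal_def by blast
    have "x \<in> V <+>\<^bsub>?P\<^esub> a_kernel ?P M (cover_map M)" if x: "x \<in> carrier ?P" for x
    proof -
      have "a x \<in> carrier ?F" by (rule mod_homD(1)[OF a x])
      then obtain s where s: "s \<in> carrier A" "a x = ?g s" by auto
      then have "s \<in> ?T" using TA by simp
      then obtain l c where lc: "l \<in> L" "c \<in> carrier A" "s = l \<oplus>\<^bsub>A\<^esub> c \<otimes>\<^bsub>A\<^esub> r" by (auto simp: Rg.set_add_iff)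
      have lA: "l \<in> carrier A" using Rg.submoduleD(1)[OF Ls lc(1)] by simp
      have cw: "c \<odot>\<^bsub>?P\<^esub> w \<in> carrier ?P" using lc wP by simp
      have cr: "c \<otimes>\<^bsub>A\<^esub> r \<in> carrier A" using lc r by simp
      have acw: "a (c \<odot>\<^bsub>?P\<^esub> w) = ?g (c \<otimes>\<^bsub>A\<^esub> r)" using mod_homD(3)[OF a lc(2) wP] r lc(2) by simp
      have "a x = ?g l \<oplus>\<^bsub>?F\<^esub> ?g (c \<otimes>\<^bsub>A\<^esub> r)" using mod_homD(2)[OF g, of l "c \<otimes>\<^bsub>A\<^esub> r"] lA cr s(2) lc(3) by simp
      then have "a (x \<ominus>\<^bsub>?P\<^esub> c \<odot>\<^bsub>?P\<^esub> w) = ?g l"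
        using mod_hom_diff[OF LP LF a x cw] acw mod_homD(1)[OF g, of l] mod_homD(1)[OF g, of "c \<otimes>\<^bsub>A\<^esub> r"] lA cr
        by (simp add: F.M.add_diff_cancel_right)
      then have "x \<ominus>\<^bsub>?P\<^esub> c \<odot>\<^bsub>?P\<^esub> w \<in> V" unfolding V_def using lc(1) x cw by (auto simp: P.M.minus_closed)
      moreover have "c \<odot>\<^bsub>?P\<^esub> w \<in> a_kernel ?P M (cover_map M)"
        by (rule P.submoduleD(4)[OF presD(7)[OF syzygy_pres[OF M]] lc(2) wker])
      moreover have "x = (x \<ominus>\<^bsub>?P\<^esub> c \<odot>\<^bsub>?P\<^esub> w) \<oplus>\<^bsub>?P\<^esub> c \<odot>\<^bsub>?P\<^esub> w" using P.M.diff_add_cancel[OF x cw] by simp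
      ultimately show ?thesis unfolding P.set_add_iff by blast
    qed
    moreover have "V <+>\<^bsub>?P\<^esub> a_kernel ?P M (cover_map M) \<subseteq> carrier ?P"
      by (rule P.set_add_least[OF P.submodule_carrier]) (auto simp: V_def a_kernel_iff)
    ultimately have "V <+>\<^bsub>?P\<^esub> a_kernel ?P M (cover_map M) = carrier ?P" by blast
    then have "V = carrier ?P" using cover[OF M] V unfolding projective_cover_def by blast
    then have "a w \<in> ?g ` L" using wP by (auto simp: V_def)
    then obtain l where "l \<in> L" "?g r = ?g l" using r(2) by auto
    then show False using rL by (simp add: fun_eq_iff)
  qed
  then have "r \<in> jacobson_radical A" using r(1) by (simp add: jacobson_radical_def)
  then show ?thesis using r(2) by blast
qed

lemma ideals_annihilate_syzygy:
  assumes M: "fg_module A M" and I: "ideal I A" and J: "ideal J A"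
    and IJK: "I \<cdot>\<^bsub>A\<^esub> J \<cdot>\<^bsub>A\<^esub> K = {\<zero>\<^bsub>A\<^esub>}" and rad: "jacobson_radical A \<subseteq> K"
    and w: "w \<in> carrier (syzygy A M)" and i: "i \<in> I" and j: "j \<in> J"
  shows "i \<odot>\<^bsub>syzygy A M\<^esub> (j \<odot>\<^bsub>syzygy A M\<^esub> w) = \<zero>\<^bsub>syzygy A M\<^esub>"
proof -
  let ?P = "proj_cover M"
  have LP: "left_module A ?P" by (rule fg_left_module[OF proj_cover_fg[OF M]])
  have LF: "left_module A (free_one A)" by (rule fg_left_module[OF free_one_fg])
  interpret P: left_module A ?P by (rule LP)
  have iA: "i \<in> carrier A" and jA: "j \<in> carrier A" using ideal.Icarr[OF I i] ideal.Icarr[OF J j] by auto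
  have wP: "w \<in> carrier ?P" using w by (simp add: syzygy_eq a_kernel_iff)
  have ijr: "(i \<otimes>\<^bsub>A\<^esub> j) \<otimes>\<^bsub>A\<^esub> r = \<zero>\<^bsub>A\<^esub>" if "r \<in> jacobson_radical A" for r
  proof -
    have "(i \<otimes>\<^bsub>A\<^esub> j) \<otimes>\<^bsub>A\<^esub> r \<in> I \<cdot>\<^bsub>A\<^esub> J \<cdot>\<^bsub>A\<^esub> K"
      using that rad i j by (intro ideal_prod.prod) auto
    then show ?thesis using IJK by simp
  qed
  have "(i \<otimes>\<^bsub>A\<^esub> j) \<odot>\<^bsub>?P\<^esub> h w = \<zero>\<^bsub>?P\<^esub>" if "thru {free_one A} ?P ?P h" for h
    using that
  proof induction
    case (thru_zero h)
    then show ?case using wP iA jA by simp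
  next
    case (thru_step f N a b h)
    have a: "a \<in> mod_hom A ?P (free_one A)" and b: "b \<in> mod_hom A (free_one A) ?P" using thru_step(2-4) by auto
    obtain r where r: "r \<in> jacobson_radical A" "a w = {\<lambda>_. r}" using superfluous_radical[OF M w a] by blast
    have rA: "r \<in> carrier A" using r(1) by (simp add: jacobson_radical_def)
    have "{\<lambda>_. \<one>\<^bsub>A\<^esub>} \<in> carrier (free_one A)" by simp
    then have b1: "b {\<lambda>_. \<one>\<^bsub>A\<^esub>} \<in> carrier ?P" by (rule mod_homD(1)[OF b])
    have "(i \<otimes>\<^bsub>A\<^esub> j) \<odot>\<^bsub>?P\<^esub> b (a w) = ((i \<otimes>\<^bsub>A\<^esub> j) \<otimes>\<^bsub>A\<^esub> r) \<odot>\<^bsub>?P\<^esub> b {\<lambda>_. \<one>\<^bsub>A\<^esub>}"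
      unfolding r(2) free_one_hom_eq[OF b rA] using iA jA rA b1 by (simp only: P.smult_assoc1 m_closed)
    also have "\<dots> = \<zero>\<^bsub>?P\<^esub>" unfolding ijr[OF r(1)] using b1 by simp
    finally have 1: "(i \<otimes>\<^bsub>A\<^esub> j) \<odot>\<^bsub>?P\<^esub> b (a w) = \<zero>\<^bsub>?P\<^esub>" .
    have fw: "f w \<in> carrier ?P" by (rule mod_homD(1)[OF thru_hom[OF thru_step(1) proj_cover_fg[OF M] proj_cover_fg[OF M]] wP])
    have bw: "b (a w) \<in> carrier ?P" by (rule mod_homD(1)[OF mod_hom_comp[OF a b] wP])
    have "h w = f w \<oplus>\<^bsub>?P\<^esub> b (a w)" using thru_step(5) wP by blast
    then show ?case using fw bw iA jA 1 thru_step.IH by (simp add: P.smult_r_distr)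
  qed
  from this[OF projective_thru[OF proj_cover_projective[OF M]]]
  have "(i \<otimes>\<^bsub>A\<^esub> j) \<odot>\<^bsub>?P\<^esub> w = \<zero>\<^bsub>?P\<^esub>" .
  then show ?thesis using iA jA wP by (simp add: syzygy_eq P.smult_assoc1)
qed

section \<open>Finiteness of the finitistic dimension\<close>

text \<open>The submodule is the annihilator of \<open>I\<close> in \<open>W\<close>. It contains
  JW, so \<open>J\<close> acts as zero on the quotient.\<close>

lemma ideal_filtration:
  assumes W: "fg_module A W" and I: "ideal I A" and J: "ideal J A"
    and IJ: "\<And>i j w. i \<in> I \<Longrightarrow> j \<in> J \<Longrightarrow> w \<in> carrier W \<Longrightarrow> i \<odot>\<^bsub>W\<^esub> (j \<odot>\<^bsub>W\<^esub> w) = \<zero>\<^bsub>W\<^esub>"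
  obtains X f z Z where "short_exact X f W z Z"
    "\<And>i x. i \<in> I \<Longrightarrow> x \<in> carrier X \<Longrightarrow> i \<odot>\<^bsub>X\<^esub> x = \<zero>\<^bsub>X\<^esub>"
    "\<And>j x. j \<in> J \<Longrightarrow> x \<in> carrier Z \<Longrightarrow> j \<odot>\<^bsub>Z\<^esub> x = \<zero>\<^bsub>Z\<^esub>"
proof -
  have LW: "left_module A W" by (rule fg_left_module[OF W])
  interpret W: left_module A W by (rule LW)
  define T where "T = {x \<in> carrier W. \<forall>i\<in>I. i \<odot>\<^bsub>W\<^esub> x = \<zero>\<^bsub>W\<^esub>}"
  have IA: "i \<in> carrier A" if "i \<in> I" for i by (rule ideal.Icarr[OF I that])
  have JA: "j \<in> carrier A" if "j \<in> J" for j by (rule ideal.Icarr[OF J that])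
  have T: "submodule T A W"
  proof (rule W.left_submoduleI)
    show "T \<subseteq> carrier W" by (auto simp: T_def)
    have "\<zero>\<^bsub>W\<^esub> \<in> T" using IA by (simp add: T_def)
    then show "T \<noteq> {}" by blast
    show "x \<oplus>\<^bsub>W\<^esub> y \<in> T" if "x \<in> T" "y \<in> T" for x y using that IA by (simp add: T_def W.smult_r_distr)
    show "a \<odot>\<^bsub>W\<^esub> x \<in> T" if ax: "a \<in> carrier A" "x \<in> T" for a x
    proof -
      have "i \<odot>\<^bsub>W\<^esub> (a \<odot>\<^bsub>W\<^esub> x) = \<zero>\<^bsub>W\<^esub>" if i: "i \<in> I" for i
      proof -
        have "i \<otimes>\<^bsub>A\<^esub> a \<in> I" by (rule ideal.I_r_closed[OF I i ax(1)])
        then have "(i \<otimes>\<^bsub>A\<^esub> a) \<odot>\<^bsub>W\<^esub> x = \<zero>\<^bsub>W\<^esub>" using ax(2) by (simp add: T_def)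
        then show ?thesis using W.smult_assoc1[OF IA[OF i] ax(1), of x] ax(2) by (simp add: T_def)
      qed
      then show ?thesis using ax by (simp add: T_def)
    qed
  qed
  have JT: "j \<odot>\<^bsub>W\<^esub> w \<in> T" if "j \<in> J" "w \<in> carrier W" for j w
    using that JA IJ by (simp add: T_def)
  let ?X = "W\<lparr>carrier := T\<rparr>"
  obtain Z :: "('a, 'a fgcar) module" and z where Z: "fg_module A Z" "z \<in> mod_epi A W Z" "a_kernel W Z z = T"
    by (rule quotient_ex[OF W T])
  have zh: "z \<in> mod_hom A W Z" by (rule mod_epi_hom[OF Z(2)])
  show thesis
  proof (rule that)
    show "short_exact ?X (\<lambda>x. x) W z Z"
      unfolding short_exact_def
      using fg_sub[OF W T] W Z mod_hom_sub_incl[OF LW T mod_hom_id] by simp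
    show "i \<odot>\<^bsub>?X\<^esub> x = \<zero>\<^bsub>?X\<^esub>" if "i \<in> I" "x \<in> carrier ?X" for i x
      using that by (simp add: T_def)
    show "j \<odot>\<^bsub>Z\<^esub> x = \<zero>\<^bsub>Z\<^esub>" if j: "j \<in> J" and x: "x \<in> carrier Z" for j x
    proof -
      obtain w where w: "w \<in> carrier W" "z w = x" using mod_epi_surj[OF Z(2) x] by blast
      have "j \<odot>\<^bsub>W\<^esub> w \<in> a_kernel W Z z" unfolding Z(3) by (rule JT[OF j w(1)])
      then show ?thesis using mod_homD(3)[OF zh JA[OF j] w(1)] w(2) by (simp add: a_kernel_iff)
    qed
  qed
qed

lemma finitistic_dimension_finite:
  assumes I: "ideal I A" and J: "ideal J A"
    and IJK: "I \<cdot>\<^bsub>A\<^esub> J \<cdot>\<^bsub>A\<^esub> K = {\<zero>\<^bsub>A\<^esub>}" and rad: "jacobson_radical A \<subseteq> K"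
    and sfI: "syzygy_finite A (A Quot I) (\<lambda>a. I +>\<^bsub>A\<^esub> a)"
    and sfJ: "syzygy_finite A (A Quot J) (\<lambda>a. J +>\<^bsub>A\<^esub> a)"
  shows "finitistic_dimension A < \<infinity>"
proof -
  let ?F = "free_one A"
  obtain n1 and N1 :: "('a, 'a fgcar) module" where N1: "fg_module A N1"
    and t1: "\<And>X. \<lbrakk>fg_module A X; \<And>i x. i \<in> I \<Longrightarrow> x \<in> carrier X \<Longrightarrow> i \<odot>\<^bsub>X\<^esub> x = \<zero>\<^bsub>X\<^esub>\<rbrakk> \<Longrightarrow>
      thru {?F, N1} (syz n1 X) (syz n1 X) (\<lambda>x. x)"
    using syzygy_finite_quotient[OF I sfI] by metis
  obtain n2 and N2 :: "('a, 'a fgcar) module" where N2: "fg_module A N2"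
    and t2: "\<And>X. \<lbrakk>fg_module A X; \<And>i x. i \<in> J \<Longrightarrow> x \<in> carrier X \<Longrightarrow> i \<odot>\<^bsub>X\<^esub> x = \<zero>\<^bsub>X\<^esub>\<rbrakk> \<Longrightarrow>
      thru {?F, N2} (syz n2 X) (syz n2 X) (\<lambda>x. x)"
    using syzygy_finite_quotient[OF J sfJ] by metis
  define n where "n = n1 + n2"
  \<comment> \<open>Exponents are matched so that one \<open>n\<close> serves both ends. Since
    \<open>L\<close> is stably \<Omega>X, \<open>syz n L\<close> is the syzygy of order
    \<open>n1 + n2 + 1\<close> of \<open>X\<close>; since \<open>K\<close> is stably \<Omega>Z, the
    other end is the one of order \<open>n1 + n2 + 2\<close> of \<open>Z\<close>.\<close>
  define Ns1 where "Ns1 = insert ?F (syz (Suc n2) ` {?F, N1})"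
  define Ns2 where "Ns2 = insert ?F (syz (Suc (Suc n1)) ` {?F, N2})"
  have Ns: "finite (Ns1 \<union> Ns2)" "\<And>N. N \<in> Ns1 \<union> Ns2 \<Longrightarrow> fg_module A N"
    using free_one_fg N1 N2 syz_fg by (auto simp: Ns1_def Ns2_def simp del: funpow.simps)
  obtain b where b: "\<And>X Y u m. \<lbrakk>fg_module A X; fg_module A Y; thru (Ns1 \<union> Ns2) X X (\<lambda>x. x);
      thru (Ns1 \<union> Ns2) Y Y (\<lambda>x. x); u \<in> mod_hom A X Y; stable_iso (syz m X) (syz m Y) (syz_map m X Y u)\<rbrakk> \<Longrightarrow>
    stable_iso (syz b X) (syz b Y) (syz_map b X Y u)"
    using igusa_todorov[OF Ns] by blast
  \<comment> \<open>\<open>Suc (2 * (b + n))\<close> bounds the syzygies needed for the cokernel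
    \<Omega>W, and 2 more lead from \<open>M\<close> to \<Omega>W.\<close>
  define B where "B = Suc (2 * (b + n)) + 2"
  have bound: "projective_dimension A M \<le> enat B"
    if M: "fg_module A M" and fin: "projective_dimension A M < \<infinity>" for M :: "('a, 'a fgcar) module"
  proof -
    obtain m where m: "projective_module A (syz m M)" using finite_projective_dimension[OF M fin] by blast
    let ?W = "syzygy A M"
    have W: "fg_module A ?W" by (rule syzygy_fg[OF M])
    obtain X f z Z where s: "short_exact X f ?W z Z"
      and X: "\<And>i x. i \<in> I \<Longrightarrow> x \<in> carrier X \<Longrightarrow> i \<odot>\<^bsub>X\<^esub> x = \<zero>\<^bsub>X\<^esub>"
      and Z: "\<And>j x. j \<in> J \<Longrightarrow> x \<in> carrier Z \<Longrightarrow> j \<odot>\<^bsub>Z\<^esub> x = \<zero>\<^bsub>Z\<^esub>"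
      by (rule ideal_filtration[OF W I J ideals_annihilate_syzygy[OF M I J IJK rad]], assumption+, rule that)
    note e = short_exactD[OF s]
    obtain K q where K: "short_exact (syzygy A ?W) (\<lambda>x. x) K q X" "pres K Z (proj_cover ?W) (\<lambda>x. z (cover_map ?W x))"
      by (rule rotate[OF s])
    note eK = short_exactD[OF K(1)]
    \<comment> \<open>The inclusion of \<open>syzygy A K\<close> into \<open>L\<close> is the map
      \<open>u\<close> of the overview, and \<Omega>W is its cokernel.\<close>
    obtain L r where L: "short_exact (syzygy A K) (\<lambda>x. x) L r (syzygy A ?W)" "pres L X (proj_cover K) (\<lambda>x. q (cover_map K x))"
      by (rule rotate[OF K(1)])
    note eL = short_exactD[OF L(1)]
    let ?u = "syz_map n (syzygy A K) L (\<lambda>x. x)"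
    have tL: "thru (Ns1 \<union> Ns2) (syz n L) (syz n L) (\<lambda>x. x)"
    proof -
      obtain v where v: "stable_iso L (syzygy A X) v" by (rule pres_stable_iso[OF L(2) syzygy_pres[OF e(1)]])
      obtain v' where v': "stable_iso (syzygy A X) L v'" using v by (rule sisoE)
      have "thru Ns1 (syz (Suc n2) (syz n1 X)) (syz (Suc n2) (syz n1 X)) (\<lambda>x. x)"
        unfolding Ns1_def by (rule thru_syz[OF syz_fg[OF e(1)] _ t1[OF e(1) X]]) (use free_one_fg N1 in auto)
      moreover have "syz (Suc n2) (syz n1 X) = syz n (syzygy A X)"
        by (simp add: n_def funpow_swap1[symmetric] funpow_add add.commute[of n1])
      ultimately have "thru Ns1 (syz n (syzygy A X)) (syz n (syzygy A X)) (\<lambda>x. x)" by simp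
      then have "thru Ns1 (syz n L) (syz n L) (\<lambda>x. x)"
        by (rule thru_stable_iso[OF syz_fg[OF syzygy_fg[OF e(1)]] syz_fg[OF eL(2)] syz_map_stable_iso[OF syzygy_fg[OF e(1)] eL(2) v']])
          (simp add: Ns1_def)
      then show ?thesis by (rule thru_mono) simp
    qed
    have tK: "thru (Ns1 \<union> Ns2) (syz n (syzygy A K)) (syz n (syzygy A K)) (\<lambda>x. x)"
    proof -
      obtain v where v: "stable_iso K (syzygy A Z) v" by (rule pres_stable_iso[OF K(2) syzygy_pres[OF e(3)]])
      obtain v' where v': "stable_iso (syzygy A Z) K v'" using v by (rule sisoE)
      have sw: "syz n (syzygy A Y) = syz (Suc n) Y" for Y by (simp add: funpow_swap1)
      have "thru Ns2 (syz (Suc (Suc n1)) (syz n2 Z)) (syz (Suc (Suc n1)) (syz n2 Z)) (\<lambda>x. x)"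
        unfolding Ns2_def by (rule thru_syz[OF syz_fg[OF e(3)] _ t2[OF e(3) Z]]) (use free_one_fg N2 in auto)
      moreover have "syz (Suc (Suc n1)) (syz n2 Z) = syz (Suc n) (syzygy A Z)"
        by (simp add: n_def funpow_swap1[symmetric] funpow_add)
      ultimately have "thru Ns2 (syz (Suc n) (syzygy A Z)) (syz (Suc n) (syzygy A Z)) (\<lambda>x. x)" by simp
      then have "thru Ns2 (syz (Suc n) K) (syz (Suc n) K) (\<lambda>x. x)"
        by (rule thru_stable_iso[OF syz_fg[OF syzygy_fg[OF e(3)]] syz_fg[OF eK(2)] syz_map_stable_iso[OF syzygy_fg[OF e(3)] eK(2) v']])
          (simp add: Ns2_def)
      then show ?thesis unfolding sw by (rule thru_mono) simp
    qed
    have WM: "syz k (syzygy A ?W) = syz (k + 2) M" for k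
      by (simp add: funpow_swap1 numeral_2_eq_2)
    have "projective_module A (syz m (syzygy A ?W))"
      unfolding WM by (rule projective_syz_mono[OF M m]) simp
    from projective_syz_imp_stable_iso[OF L(1) this]
    have "stable_iso (syz (2 * m) (syzygy A K)) (syz (2 * m) L) (syz_map (2 * m) (syzygy A K) L (\<lambda>x. x))" .
    \<comment> \<open>Exchanging the order of the two syzygy counts turns the stable isomorphism at
      stage \<open>2 * m\<close> of the inclusion into one at stage \<open>2 * m\<close> of its
      \<open>n\<close>-th syzygy, to which the uniform bound applies.\<close>
    from syz_map_stable_iso[OF syz_fg[OF eL(1)] syz_fg[OF eL(2)] this, of n]
    have "stable_iso (syz (2 * m) (syz n (syzygy A K))) (syz (2 * m) (syz n L)) (syz_map (2 * m) (syz n (syzygy A K)) (syz n L) ?u)"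
      unfolding syz_map_syz_map syz_syz by (simp only: add.commute)
    from b[OF syz_fg[OF eL(1)] syz_fg[OF eL(2)] tK tL syz_map_hom[OF eL(1,2,4)] this]
    have "stable_iso (syz (b + n) (syzygy A K)) (syz (b + n) L) (syz_map (b + n) (syzygy A K) L (\<lambda>x. x))"
      unfolding syz_map_syz_map syz_syz .
    from stable_iso_imp_projective_syz[OF L(1) this]
    have "projective_module A (syz B M)" unfolding WM B_def .
    then show ?thesis by (rule projective_dimension_le[OF M])
  qed
  have "finitistic_dimension A \<le> enat B"
    unfolding finitistic_dimension_def by (rule Sup_least) (use bound in blast)
  then show ?thesis by (rule order_le_less_trans) simp
qed

end

theorem theorem1p2:
  fixes R :: "('r, 'k) ring_scheme"
    and A :: "('r, 'a, 'l) module_scheme"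
    and I J K :: "'a set"
  assumes "artin_algebra R A"
    and "ideal I A" and "ideal J A" and "ideal K A"
    and "I \<cdot>\<^bsub>A\<^esub> J \<cdot>\<^bsub>A\<^esub> K = {\<zero>\<^bsub>A\<^esub>}"
    and "jacobson_radical A \<subseteq> K"
    and "syzygy_finite A (A Quot I) (\<lambda>a. I +>\<^bsub>A\<^esub> a)"
    and "syzygy_finite A (A Quot J) (\<lambda>a. J +>\<^bsub>A\<^esub> a)"
  shows "finitistic_dimension A < \<infinity>"
  by (rule artin_algebra.finitistic_dimension_finite[OF assms(1-3,5-8)])

end
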